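(* Let $\mu\in\mathbb{Z}_{\ge 0}^n$ and $z\in S_n$, let $E^z_\mu$ be the relative (permuted basement) Macdonald polynomial, and let $\vec u_\mu$ be a reduced word for $u_\mu$. Let $\mathrm{AW}^z_\mu$ be the set of alcove walks of type $(z,\vec u_\mu)$ and let $\mathrm{NAF}^z_\mu$ be the set of nonattacking fillings for $(z,\mu)$. Then: (a) (Alcove walk formula) $\displaystyle E^z_\mu=\sum_{p\in \mathrm{AW}^z_\mu}\mathrm{wt}(p)$. (b) (Nonattacking fillings formula) $\displaystyle E^z_\mu=\sum_{T\in \mathrm{NAF}^z_\mu}\mathrm{wt}(T)$.
   Context: **Parameters and polynomials.** Fix $n\in\mathbb{Z}_{>0}$, $q\in\mathbb{C}^\times$, $t^{1/2}\in\mathbb{C}^\times$, $t=(t^{1/2})^2$, with $1\notin\{q^at^b\mid a,b\in\mathbb{Z},\ (a,b)\neq(0,0)\}$. $S_n$ is the group of bijections of $\{1,\dots,n\}$ (product = composition), $s_i=(i\ i{+}1)$, $\ell(w)$ is the number of inversions of $w\in S_n$. For $\mu\in\mathbb{Z}^n$, $x^\mu=x_1^{\mu_1}\cdots x_n^{\mu_n}$. $S_n$ acts on $\mathbb{C}[x_1^{\pm1},\dots,x_n^{\pm1}]$ by $w x_i=x_{w(i)}$ and on $\mathbb{Z}^n$ by permuting positions so that $w x^\mu=x^{w\mu}$. Operators on $\mathbb{C}[x_1^{\pm1},\dots,x_n^{\pm1}]$: $(T_{q^{-1},x_n}h)(x_1,\dots,x_n)=h(x_1,\dots,x_{n-1},q^{-1}x_n)$,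 $$T_i=t^{-1/2}\Big(t-\frac{tx_i-x_{i+1}}{x_i-x_{i+1}}(1-s_i)\Big)\ (1\le i\le n-1),\qquad g=s_1s_2\cdots s_{n-1}T_{q^{-1},x_n},$$ $$Y_1=gT_{n-1}\cdots T_1,\qquad Y_{i+1}=T_i^{-1}Y_iT_i^{-1}\ (1\le i\le n-1).$$ For $w\in S_n$ with reduced word $w=s_{i_1}\cdots s_{i_\ell}$ put $T_w=T_{i_1}\cdots T_{i_\ell}$. **Macdonald polynomials.** For $\mu\in\mathbb{Z}^n$ let $v_\mu\in S_n$ be the minimal length permutation such that $v_\mu\mu$ is weakly increasing; explicitly $v_\mu(i)=1+\#\{i'<i\mid \mu_{i'}\le\mu_i\}+\#\{i'>i\mid\mu_{i'}<\mu_i\}$. $E_\mu$ is the unique element of $\mathbb{C}[x_1^{\pm1},\dots,x_n^{\pm1}]$ with $Y_iE_\mu=q^{-\mu_i}t^{-(v_\mu(i)-1)+\frac12(n-1)}E_\mu$ for all $i\in\{1,\dots,n\}$ and with coefficient of $x^\mu$ equal to $1$. For $z\in S_n$, $E^z_\mu=t^{-\frac12(\ell(zv_\mu^{-1})-\ell(v_\mu^{-1}))}T_zE_\mu$. **Affine Weyl group.** $W$ is the group of bijections $w:\mathbb{Z}\to\mathbb{Z}$ with $w(i+n)=w(i)+n$; $S_n\subseteq W$ by periodic extension; $\pi\in W$ is $\pi(i)=i+1$. Length: $\ell(w)=\#\{(j,k)\mid j\in\{1,\dots,n\},\ k\in\mathbb{Z},\ j<k,\ w(j)>w(k)\}$.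 The homomorphism $W\to S_n$, $w\mapsto\overline{w}$, is given by $\overline{w}(i)\equiv w(i)\bmod n$. $W$ acts on $\mathbb{Z}^n$ by $\pi(\mu_1,\dots,\mu_n)=(\mu_n+1,\mu_1,\dots,\mu_{n-1})$ and with $s_i$ ($1\le i\le n-1$) swapping the $i$th and $(i+1)$st entries. $u_\mu$ is the minimal length element of $W$ with $u_\mu(0,\dots,0)=\mu$. Put $s_\pi=\pi$. A reduced word for $u_\mu$ is an expression $\vec u_\mu=s_{i_1}\cdots s_{i_r}$ of $u_\mu$ with $i_1,\dots,i_r\in\{1,\dots,n-1,\pi\}$ in which the number of $k$ with $i_k\neq\pi$ is $\ell(u_\mu)$. **Affine coroots.** $W$ acts $\mathbb{Z}$-linearly on the free abelian group with basis $\varepsilon_1^\vee,\dots,\varepsilon_n^\vee,K$, fixing $K$, by $\pi^{-1}\varepsilon_1^\vee=\varepsilon_n^\vee+K$, $\pi^{-1}\varepsilon_i^\vee=\varepsilon_{i-1}^\vee$ for $2\le i\le n$, and $s_i$ ($1\le i\le n-1$) swapping $\varepsilon_i^\vee$ and $\varepsilon_{i+1}^\vee$ and fixing the other $\varepsilon_j^\vee$. Set $\alpha_i^\vee=\varepsilon_i^\vee-\varepsilon_{i+1}^\vee$, $\mathrm{sh}(\varepsilon_i^\vee-\varepsilon_j^\vee-mK)=m$ and $\mathrm{ht}(\varepsilon_i^\vee-\varepsilon_j^\vee-mK)=j-i$. For $k$ with $i_k\ne\pi$ let $\beta_k^\vee=s_{i_r}^{-1}s_{i_{r-1}}^{-1}\cdots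 s_{i_{k+1}}^{-1}\alpha_{i_k}^\vee$. **Alcove walks.** An alcove walk of type $(z,\vec u_\mu)$ is a sequence $p=(p_0,\dots,p_r)$ in $W$ with $p_0=z$; $p_k=p_{k-1}\pi$ if $s_{i_k}=\pi$; and $p_k\in\{p_{k-1},p_{k-1}s_{i_k}\}$ if $s_{i_k}\ne\pi$. Put $z_k=\overline{p_k}\in S_n$ and $\mu^{(k-1)}=s_{i_k}s_{i_{k+1}}\cdots s_{i_r}(0,\dots,0)\in\mathbb{Z}^n_{\geq 0}$. For $k$ with $p_k=p_{k-1}$ let $$\mathrm{norm}(p_k)=\tfrac12\big(\ell(z_{k-1}s_{i_k}v_{\mu^{(k-1)}}^{-1})-\ell(z_{k-1}v_{\mu^{(k-1)}}^{-1})-1\big),\qquad d_k=q^{\mathrm{sh}(-\beta_k^\vee)}t^{\mathrm{ht}(-\beta_k^\vee)}.$$ The weight of step $k$ is $$\mathrm{wt}_p(k)=\begin{cases}\frac{1-t}{1-d_k}\,t^{\mathrm{norm}(p_k)},&p_k=p_{k-1},\ \ell(z_{k-1}s_{i_k})>\ell(z_{k-1}),\\[2pt] \frac{(1-t)d_k}{1-d_k}\,t^{\mathrm{norm}(p_k)},&p_k=p_{k-1},\ \ell(z_{k-1}s_{i_k})<\ell(z_{k-1}),\\[2pt] 1,&p_k=p_{k-1}s_{i_k}\text{ with } i_k\neq\pi,\\ x_{z_{k-1}(1)},&p_k=p_{k-1}\pi\text{ with } i_k=\pi,\end{cases}$$ and $\mathrm{wt}(p)=\prod_{k=1}^r\mathrm{wt}_p(k)$.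 **Boxes and nonattacking fillings.** Boxes are elements $(i,j)\in\{1,\dots,n\}\times\mathbb{Z}_{\ge0}$, and $(i,j)$ is identified with the integer $i+nj$ (its cylindrical coordinate). $dg(\mu)=\{(i,j)\mid 1\le i\le n,\ 1\le j\le\mu_i\}$ and $\widehat{dg}(\mu)=\{(i,j)\mid 1\le i\le n,\ 0\le j\le\mu_i\}$. For $b\in dg(\mu)$ let $\mathrm{attack}_\mu(b)=\{b-1,\dots,b-n+1\}\cap\widehat{dg}(\mu)$. For $b\in\widehat{dg}(\mu)$ let $\mathrm{Nleg}_\mu(b)=(b+n\mathbb{Z}_{>0})\cap dg(\mu)$. For $b\in dg(\mu)$ let $\mathrm{Narm}_\mu(b)=\{a\in\mathrm{attack}_\mu(b)\mid \#\mathrm{Nleg}_\mu(a)\le\#\mathrm{Nleg}_\mu(b)\}$. A nonattacking filling for $(z,\mu)$ is a map $T:\widehat{dg}(\mu)\to\{1,\dots,n\}$ with $T(i,0)=z(i)$ for $1\le i\le n$ and $T(a)\ne T(b)$ whenever $b\in dg(\mu)$ and $a\in\mathrm{attack}_\mu(b)$. Let $\mathrm{bwn}_T(b)=\{a\in\mathrm{Narm}_\mu(b)\mid T(a)\text{ is strictly between }T(b-n)\text{ and }T(b)\}$ and $D_b=q^{\#\mathrm{Nleg}_\mu(b)+1}t^{\#\mathrm{Narm}_\mu(b)+1}$. Then $$\mathrm{wt}_T(b)=\begin{cases}\frac{1-t}{1-D_b}\,t^{\#\mathrm{bwn}_T(b)}\,x_{T(b)},&T(b-n)>T(b),\\[2pt]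 \frac{(1-t)D_b}{1-D_b}\,t^{-1-\#\mathrm{bwn}_T(b)}\,x_{T(b)},&T(b-n)<T(b),\\[2pt] x_{T(b)},&T(b-n)=T(b),\end{cases}$$ and $\mathrm{wt}(T)=\prod_{b\in dg(\mu)}\mathrm{wt}_T(b)$. *)

theory Defs
  imports Complex_Main "HOL-Library.Poly_Mapping" "HOL-Library.FuncSet"
    "HOL-Combinatorics.Permutations"
begin

abbreviation coef :: "('a \<Rightarrow>\<^sub>0 'b::zero) \<Rightarrow> 'a \<Rightarrow> 'b"
  where "coef \<equiv> Poly_Mapping.lookup"

abbreviation supp :: "('a \<Rightarrow>\<^sub>0 'b::zero) \<Rightarrow> 'a set"
  where "supp \<equiv> Poly_Mapping.keys"

text \<open>
  Positions, variables and rows are indexed by the integers \<open>1..n\<close>.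
  \<open>expo\<close> contains \<open>\<int>\<^sup>n\<close> as the functions supported in \<open>{1..n}\<close>.
  \<open>laurent\<close> is the monoid algebra of \<open>expo\<close>, i.e. Laurent polynomials in variables
  \<open>x\<^sub>i\<close> for all integers \<open>i\<close>; \<open>Laurent n\<close> is \<open>\<complex>[x\<^sub>1\<^sup>\<plusminus>\<^sup>1,\<dots>,x\<^sub>n\<^sup>\<plusminus>\<^sup>1]\<close>.
  The operators below are defined on all of \<open>laurent\<close> and preserve \<open>Laurent n\<close>.
\<close>

type_synonym expo = "int \<Rightarrow>\<^sub>0 int"
type_synonym laurent = "expo \<Rightarrow>\<^sub>0 complex"

definition Zn :: "int \<Rightarrow> expo set"
  where "Zn n = {\<mu>. supp \<mu> \<subseteq> {1..n}}"

definition Laurent :: "int \<Rightarrow> laurent set"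
  where "Laurent n = {h. supp h \<subseteq> Zn n}"

definition Const :: "complex \<Rightarrow> laurent"
  where "Const c = Poly_Mapping.single 0 c"

definition xvar :: "int \<Rightarrow> laurent"
  where "xvar i = Poly_Mapping.single (Poly_Mapping.single i 1) 1"


section \<open>The symmetric group\<close>

text \<open>\<open>S\<^sub>n\<close> is the set of \<open>w\<close> with \<open>w permutes {1..n}\<close>; the product is \<open>\<circ>\<close>.\<close>

definition sref :: "int \<Rightarrow> int \<Rightarrow> int"
  where "sref i = transpose i (i + 1)"

definition perm_len :: "int \<Rightarrow> (int \<Rightarrow> int) \<Rightarrow> nat"
  where "perm_len n w = card {(i, j). 1 \<le> i \<and> i < j \<and> j \<le> n \<and> w j < w i}"

definition perm_word :: "int list \<Rightarrow> int \<Rightarrow> int"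
  where "perm_word ws = foldr (\<lambda>i f. sref i \<circ> f) ws id"

definition perm_reduced_word :: "int \<Rightarrow> int list \<Rightarrow> (int \<Rightarrow> int) \<Rightarrow> bool"
  where "perm_reduced_word n ws w \<longleftrightarrow>
    set ws \<subseteq> {1..n - 1} \<and> perm_word ws = w \<and> length ws = perm_len n w"

text \<open>\<open>(w \<mu>)\<^bsub>w(i)\<^esub> = \<mu>\<^sub>i\<close>, so that \<open>w x\<^sup>\<mu> = x\<^sup>w\<^sup>\<mu>\<close>.\<close>

definition perm_expo :: "(int \<Rightarrow> int) \<Rightarrow> expo \<Rightarrow> expo"
  where "perm_expo w \<mu> = Poly_Mapping.map_key (inv w) \<mu>"

definition perm_laurent :: "(int \<Rightarrow> int) \<Rightarrow> laurent \<Rightarrow> laurent"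
  where "perm_laurent w h = (\<Sum>\<nu>\<in>supp h. Poly_Mapping.single (perm_expo w \<nu>) (coef h \<nu>))"

lemma coef_perm_expo:
  assumes "bij w"
  shows "coef (perm_expo w \<mu>) (w i) = coef \<mu> i"
  using assms by (simp add: perm_expo_def map_key.rep_eq bij_imp_bij_inv bij_is_inj)

lemma perm_laurent_xvar:
  assumes "bij w"
  shows "perm_laurent w (xvar i) = xvar (w i)"
proof -
  have "perm_expo w (Poly_Mapping.single i 1) = Poly_Mapping.single (w i) 1"
    unfolding perm_expo_def
    using map_key_single[of "inv w" "w i" 1] assms
    by (simp add: bij_imp_bij_inv bij_is_inj)
  then show ?thesis by (simp add: perm_laurent_def xvar_def)
qed

text \<open>\<open>v\<^sub>\<mu>\<close>, the permutation of minimal length for which \<open>v\<^sub>\<mu> \<mu>\<close> is weakly increasing (it is unique).\<close>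

definition vperm :: "int \<Rightarrow> expo \<Rightarrow> int \<Rightarrow> int"
  where "vperm n \<mu> = (ARG_MIN (perm_len n) w. w permutes {1..n} \<and>
    (\<forall>i j. 1 \<le> i \<and> i \<le> j \<and> j \<le> n \<longrightarrow> coef (perm_expo w \<mu>) i \<le> coef (perm_expo w \<mu>) j))"


section \<open>Demazure-Lusztig and Cherednik operators, Macdonald polynomials\<close>

text \<open>The parameter \<open>th\<close> is \<open>t\<^sup>1\<^sup>/\<^sup>2\<close>.\<close>

definition generic :: "complex \<Rightarrow> complex \<Rightarrow> bool"
  where "generic q th \<longleftrightarrow> q \<noteq> 0 \<and> th \<noteq> 0 \<and>
    (\<forall>a b :: int. (a, b) \<noteq> (0, 0) \<longrightarrow> q powi a * (th ^ 2) powi b \<noteq> 1)"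

text \<open>The quotient \<open>(h - s\<^sub>i h) / (x\<^sub>i - x\<^sub>i\<^sub>+\<^sub>1)\<close>, which is again a Laurent polynomial.\<close>

definition divdiff :: "int \<Rightarrow> laurent \<Rightarrow> laurent"
  where "divdiff i h = (THE f. (xvar i - xvar (i + 1)) * f = h - perm_laurent (sref i) h)"

definition T_op :: "complex \<Rightarrow> int \<Rightarrow> laurent \<Rightarrow> laurent"
  where "T_op th i h = Const (inverse th) *
    (Const (th ^ 2) * h - (Const (th ^ 2) * xvar i - xvar (i + 1)) * divdiff i h)"

text \<open>\<open>q_shift q n\<close> is the operator that replaces \<open>x\<^sub>n\<close> by \<open>q\<^sup>-\<^sup>1 x\<^sub>n\<close>.\<close>

definition q_shift :: "complex \<Rightarrow> int \<Rightarrow> laurent \<Rightarrow> laurent"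
  where "q_shift q n h =
    (\<Sum>\<nu>\<in>supp h. Poly_Mapping.single \<nu> (coef h \<nu> * (inverse q) powi (coef \<nu> n)))"

definition g_op :: "int \<Rightarrow> complex \<Rightarrow> laurent \<Rightarrow> laurent"
  where "g_op n q = foldr (\<lambda>i f. perm_laurent (sref i) \<circ> f) [1..n - 1] (q_shift q n)"

definition T_word :: "complex \<Rightarrow> int list \<Rightarrow> laurent \<Rightarrow> laurent"
  where "T_word th ws = foldr (\<lambda>i f. T_op th i \<circ> f) ws id"

primrec Y_aux :: "int \<Rightarrow> complex \<Rightarrow> complex \<Rightarrow> nat \<Rightarrow> laurent \<Rightarrow> laurent"
  where
    "Y_aux n q th 0 = g_op n q \<circ> T_word th (rev [1..n - 1])"
  | "Y_aux n q th (Suc k) =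
      inv (T_op th (int k + 1)) \<circ> Y_aux n q th k \<circ> inv (T_op th (int k + 1))"

definition Y_op :: "int \<Rightarrow> complex \<Rightarrow> complex \<Rightarrow> int \<Rightarrow> laurent \<Rightarrow> laurent"
  where "Y_op n q th i = Y_aux n q th (nat (i - 1))"

text \<open>By the braid relations \<open>T_perm n th w\<close> does not depend on the chosen reduced word.\<close>

definition T_perm :: "int \<Rightarrow> complex \<Rightarrow> (int \<Rightarrow> int) \<Rightarrow> laurent \<Rightarrow> laurent"
  where "T_perm n th w = T_word th (SOME ws. perm_reduced_word n ws w)"

text \<open>The eigenvalue is \<open>q\<^bsup>-\<mu>\<^sub>i\<^esup> t\<^bsup>-(v\<^sub>\<mu>(i)-1) + (n-1)/2\<^esup>\<close>, with \<open>t = th\<^sup>2\<close>.\<close>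

definition E_mac :: "int \<Rightarrow> complex \<Rightarrow> complex \<Rightarrow> expo \<Rightarrow> laurent"
  where "E_mac n q th \<mu> = (THE f. f \<in> Laurent n \<and>
    (\<forall>i\<in>{1..n}. Y_op n q th i f =
      Const (q powi (- coef \<mu> i) * th powi (- 2 * (vperm n \<mu> i - 1) + (n - 1))) * f) \<and>
    coef f \<mu> = 1)"

definition E_rel :: "int \<Rightarrow> complex \<Rightarrow> complex \<Rightarrow> (int \<Rightarrow> int) \<Rightarrow> expo \<Rightarrow> laurent"
  where "E_rel n q th z \<mu> =
    Const (th powi (- (int (perm_len n (z \<circ> inv (vperm n \<mu>))) - int (perm_len n (inv (vperm n \<mu>))))))
    * T_perm n th z (E_mac n q th \<mu>)"


section \<open>The affine Weyl group\<close>

definition affW :: "int \<Rightarrow> (int \<Rightarrow> int) set"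
  where "affW n = {w. bij w \<and> (\<forall>i. w (i + n) = w i + n)}"

text \<open>The representative of \<open>k\<close> modulo \<open>n\<close> in \<open>{1..n}\<close>.\<close>

definition rep :: "int \<Rightarrow> int \<Rightarrow> int"
  where "rep n k = (k - 1) mod n + 1"

definition periodic :: "int \<Rightarrow> (int \<Rightarrow> int) \<Rightarrow> int \<Rightarrow> int"
  where "periodic n w k = w (rep n k) + n * ((k - 1) div n)"

definition overline :: "int \<Rightarrow> (int \<Rightarrow> int) \<Rightarrow> int \<Rightarrow> int"
  where "overline n w i = (if i \<in> {1..n} then rep n (w i) else i)"

definition aff_len :: "int \<Rightarrow> (int \<Rightarrow> int) \<Rightarrow> nat"
  where "aff_len n w = card {(j, k). 1 \<le> j \<and> j \<le> n \<and> j < k \<and> w k < w j}"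

datatype letter = Ref int | Rot

fun gen :: "int \<Rightarrow> letter \<Rightarrow> int \<Rightarrow> int"
  where
    "gen n (Ref i) = periodic n (sref i)"
  | "gen n Rot = (\<lambda>k. k + 1)"

definition aff_word :: "int \<Rightarrow> letter list \<Rightarrow> int \<Rightarrow> int"
  where "aff_word n ws = foldr (\<lambda>a f. gen n a \<circ> f) ws id"

text \<open>
  The action of \<open>W\<close> on \<open>\<int>\<^sup>n\<close>: extend \<open>\<mu>\<close> to all integers by \<open>\<mu>\<^bsub>i+n\<^esub> = \<mu>\<^sub>i - 1\<close>;
  then \<open>(w \<mu>)\<^bsub>w(i)\<^esub> = \<mu>\<^sub>i\<close>. The lemmas \<open>aff_act_comp\<close>, \<open>aff_act_Rot\<close> and \<open>aff_act_Ref\<close> show that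
  this is the group action that is given on generators by
  \<open>\<pi>(\<mu>\<^sub>1,\<dots>,\<mu>\<^sub>n) = (\<mu>\<^sub>n+1,\<mu>\<^sub>1,\<dots>,\<mu>\<^bsub>n-1\<^esub>)\<close> and by \<open>s\<^sub>i\<close> swapping entries \<open>i\<close> and \<open>i+1\<close>.
\<close>

definition expo_ext :: "int \<Rightarrow> expo \<Rightarrow> int \<Rightarrow> int"
  where "expo_ext n \<mu> k = coef \<mu> (rep n k) - (k - 1) div n"

definition aff_act :: "int \<Rightarrow> (int \<Rightarrow> int) \<Rightarrow> expo \<Rightarrow> expo"
  where "aff_act n w \<mu> =
    Abs_poly_mapping (\<lambda>i. if i \<in> {1..n} then expo_ext n \<mu> (inv w i) else 0)"

lemma coef_aff_act:
  "coef (aff_act n w \<mu>) i = (if i \<in> {1..n} then expo_ext n \<mu> (inv w i) else 0)"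
proof -
  have "finite {i. (if i \<in> {1..n} then expo_ext n \<mu> (inv w i) else 0) \<noteq> 0}"
    by (rule finite_subset[of _ "{1..n}"]) auto
  then show ?thesis
    unfolding aff_act_def by (subst lookup_Abs_poly_mapping) auto
qed

lemma rep_in: "0 < n \<Longrightarrow> rep n k \<in> {1..n}"
  by (simp add: rep_def add1_zle_eq)

lemma rep_eq: "k \<in> {1..n} \<Longrightarrow> rep n k = k"
  by (simp add: rep_def)

lemma rep_decomp: "k = rep n k + ((k - 1) div n) * n"
  by (simp add: rep_def)

lemma expo_ext_add:
  assumes "0 < n"
  shows "expo_ext n \<mu> (k + m * n) = expo_ext n \<mu> k - m"
proof -
  have "k + m * n - 1 = (k - 1) + m * n" by simp
  then have "(k + m * n - 1) div n = (k - 1) div n + m" "(k + m * n - 1) mod n = (k - 1) mod n"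
    using assms by (metis div_mult_self1 add.commute less_irrefl, metis mod_mult_self1)
  then show ?thesis by (simp add: expo_ext_def rep_def)
qed

lemma affW_add:
  assumes "w \<in> affW n"
  shows "w (i + m * n) = w i + m * n"
proof (induction m rule: int_induct[where k = 0])
  case (step1 m)
  have "w (i + (m + 1) * n) = w ((i + m * n) + n)" by (simp add: algebra_simps)
  also have "\<dots> = w (i + m * n) + n" using assms by (simp only: affW_def mem_Collect_eq)
  finally show ?case using step1 by (simp add: algebra_simps)
next
  case (step2 m)
  have "w (i + m * n) = w ((i + (m - 1) * n) + n)" by (simp add: algebra_simps)
  also have "\<dots> = w (i + (m - 1) * n) + n" using assms by (simp only: affW_def mem_Collect_eq)
  finally show ?case using step2 by (simp add: algebra_simps)
qed simp

lemma affW_inv: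
  assumes "w \<in> affW n"
  shows "inv w \<in> affW n"
proof -
  have b: "bij w" using assms by (simp add: affW_def)
  have "inv w (i + n) = inv w i + n" for i
  proof -
    have "w (inv w i + n) = i + n"
      using assms b by (simp add: affW_def bij_is_surj surj_f_inv_f)
    then show ?thesis using b by (metis bij_inv_eq_iff)
  qed
  then show ?thesis using b by (simp add: affW_def bij_imp_bij_inv)
qed

lemma expo_ext_aff_act:
  assumes "0 < n" "w \<in> affW n"
  shows "expo_ext n (aff_act n w \<mu>) k = expo_ext n \<mu> (inv w k)"
proof -
  let ?m = "(k - 1) div n"
  have "expo_ext n (aff_act n w \<mu>) k = expo_ext n \<mu> (inv w (rep n k)) - ?m"
    using rep_in[OF assms(1), of k] by (simp add: expo_ext_def[of n "aff_act n w \<mu>"] coef_aff_act)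
  also have "\<dots> = expo_ext n \<mu> (inv w (rep n k) + ?m * n)"
    using assms(1) by (simp add: expo_ext_add)
  also have "\<dots> = expo_ext n \<mu> (inv w (rep n k + ?m * n))"
    using affW_add[OF affW_inv[OF assms(2)]] by simp
  finally show ?thesis by (simp add: rep_decomp[symmetric])
qed

lemma aff_act_comp:
  assumes "0 < n" "v \<in> affW n" "w \<in> affW n"
  shows "aff_act n (v \<circ> w) \<mu> = aff_act n v (aff_act n w \<mu>)"
  using assms by (intro poly_mapping_eqI)
    (simp add: coef_aff_act expo_ext_aff_act o_inv_distrib affW_def)

lemma aff_act_id: "\<mu> \<in> Zn n \<Longrightarrow> aff_act n id \<mu> = \<mu>"
  by (intro poly_mapping_eqI)
    (auto simp: coef_aff_act expo_ext_def rep_eq Zn_def in_keys_iff div_pos_pos_trivial)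

lemma aff_act_Rot:
  assumes "0 < n" "i \<in> {1..n}"
  shows "coef (aff_act n (gen n Rot) \<mu>) i = (if i = 1 then coef \<mu> n + 1 else coef \<mu> (i - 1))"
proof -
  have "inv (\<lambda>k::int. k + 1) = (\<lambda>k. k - 1)"
    by (rule inv_equality) auto
  moreover have "expo_ext n \<mu> 0 = coef \<mu> n + 1"
    using expo_ext_add[OF assms(1), of \<mu> n "-1"] assms(1)
    by (simp add: expo_ext_def rep_eq)
  moreover have "expo_ext n \<mu> (i - 1) = coef \<mu> (i - 1)" if "i \<noteq> 1"
    using assms that by (simp add: expo_ext_def rep_eq)
  ultimately show ?thesis using assms by (auto simp: coef_aff_act)
qed

lemma sref_sref [simp]: "sref i (sref i k) = k"
  by (simp add: sref_def)

lemma sref_in: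
  assumes "i \<in> {1..n - 1}" "k \<in> {1..n}"
  shows "sref i k \<in> {1..n}"
  using assms by (auto simp: sref_def transpose_def)

lemma periodic_s_involution:
  assumes "i \<in> {1..n - 1}"
  shows "periodic n (sref i) (periodic n (sref i) k) = k"
proof -
  have n: "0 < n" using assms by simp
  define a where "a = sref i (rep n k)"
  define m where "m = (k - 1) div n"
  have a: "a \<in> {1..n}" unfolding a_def using sref_in[OF assms rep_in[OF n]] .
  have eq: "a + n * m - 1 = (a - 1) + n * m" by simp
  have "rep n (a + n * m) = a" "(a + n * m - 1) div n = m"
    unfolding rep_def eq using a n by (simp_all add: div_pos_pos_trivial)
  moreover have "periodic n (sref i) k = a + n * m"
    by (simp add: periodic_def a_def m_def)
  ultimately have "periodic n (sref i) (periodic n (sref i) k) = sref i a + n * m"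
    by (simp add: periodic_def[of n "sref i" "a + n * m"])
  also have "\<dots> = k" using rep_decomp[of k n] by (simp add: a_def m_def mult.commute)
  finally show ?thesis .
qed

lemma aff_act_Ref:
  assumes "i \<in> {1..n - 1}" "j \<in> {1..n}"
  shows "coef (aff_act n (gen n (Ref i)) \<mu>) j = coef \<mu> (sref i j)"
proof -
  have "inv (periodic n (sref i)) = periodic n (sref i)"
    using periodic_s_involution[OF assms(1)] by (intro inv_equality)
  moreover have "periodic n (sref i) j = sref i j"
    using assms by (simp add: periodic_def rep_eq)
  ultimately show ?thesis
    using assms sref_in[OF assms] by (auto simp: coef_aff_act expo_ext_def rep_eq)
qed

text \<open>The minimal length element \<open>u\<^sub>\<mu>\<close> is unique, since \<open>S\<^sub>n\<close> is the stabiliser of \<open>0\<close>.\<close>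

definition u_min :: "int \<Rightarrow> expo \<Rightarrow> int \<Rightarrow> int"
  where "u_min n \<mu> = (ARG_MIN (aff_len n) w. w \<in> affW n \<and> aff_act n w 0 = \<mu>)"

text \<open>Only the reflections are counted, since \<open>\<pi>\<close> has length \<open>0\<close>.\<close>

definition reduced_word :: "int \<Rightarrow> letter list \<Rightarrow> (int \<Rightarrow> int) \<Rightarrow> bool"
  where "reduced_word n ws w \<longleftrightarrow>
    set ws \<subseteq> insert Rot (Ref ` {1..n - 1}) \<and> aff_word n ws = w \<and>
    length (filter (\<lambda>a. a \<noteq> Rot) ws) = aff_len n w"


section \<open>Affine coroots\<close>

text \<open>The basis elements \<open>\<epsilon>\<^sub>i\<^sup>\<or>\<close> and \<open>K\<close>; only those \<open>Eps i\<close> with \<open>1 \<le> i \<le> n\<close> occur.\<close>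

datatype cobasis = Eps int | Kel

type_synonym coweight = "cobasis \<Rightarrow>\<^sub>0 int"

definition alpha :: "int \<Rightarrow> coweight"
  where "alpha i = frag_of (Eps i) - frag_of (Eps (i + 1))"

text \<open>The action of the inverses of the generators.\<close>

fun inv_gen_basis :: "int \<Rightarrow> letter \<Rightarrow> cobasis \<Rightarrow> coweight"
  where
    "inv_gen_basis n a Kel = frag_of Kel"
  | "inv_gen_basis n (Ref i) (Eps j) = frag_of (Eps (sref i j))"
  | "inv_gen_basis n Rot (Eps j) =
      (if j = 1 then frag_of (Eps n) + frag_of Kel else frag_of (Eps (j - 1)))"

definition inv_gen_act :: "int \<Rightarrow> letter \<Rightarrow> coweight \<Rightarrow> coweight"
  where "inv_gen_act n a = frag_extend (inv_gen_basis n a)"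

text \<open>
  \<open>sh\<close> and \<open>ht n\<close> are linear forms; \<open>sh_coroot\<close> and \<open>ht_coroot\<close> give their values
  on \<open>\<epsilon>\<^sub>i\<^sup>\<or> - \<epsilon>\<^sub>j\<^sup>\<or> - m K\<close>.
\<close>

definition sh :: "coweight \<Rightarrow> int"
  where "sh \<beta> = - coef \<beta> Kel"

definition ht :: "int \<Rightarrow> coweight \<Rightarrow> int"
  where "ht n \<beta> = - (\<Sum>i\<in>{1..n}. i * coef \<beta> (Eps i))"

lemma sh_coroot:
  "sh (frag_of (Eps i) - frag_of (Eps j) - frag_cmul m (frag_of Kel)) = m"
  by (simp add: sh_def lookup_minus)

lemma ht_coroot:
  assumes "i \<in> {1..n}" "j \<in> {1..n}"
  shows "ht n (frag_of (Eps i) - frag_of (Eps j) - frag_cmul m (frag_of Kel)) = j - i"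
proof -
  have "(\<Sum>k\<in>{1..n}. k * coef (frag_of (Eps l)) (Eps k)) = l" if "l \<in> {1..n}" for l
  proof -
    have "(\<Sum>k\<in>{1..n}. k * coef (frag_of (Eps l)) (Eps k)) =
        (\<Sum>k\<in>{1..n}. if k = l then k else 0)"
      by (intro sum.cong) auto
    then show ?thesis using that by simp
  qed
  then show ?thesis using assms
    by (simp add: ht_def lookup_minus right_diff_distrib sum_subtractf)
qed

text \<open>
  For a word \<open>ws = [s\<^bsub>i\<^sub>1\<^esub>, \<dots>, s\<^bsub>i\<^sub>r\<^esub>]\<close> the steps are numbered \<open>k = 1, \<dots>, r\<close>, so that
  \<open>s\<^bsub>i\<^sub>k\<^esub>\<close> is \<open>ws ! (k - 1)\<close>. \<open>beta n ws k i\<close> is \<open>\<beta>\<^sub>k\<^sup>\<or>\<close> if \<open>s\<^bsub>i\<^sub>k\<^esub> = Ref i\<close>.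
\<close>

definition beta :: "int \<Rightarrow> letter list \<Rightarrow> nat \<Rightarrow> int \<Rightarrow> coweight"
  where "beta n ws k i = fold (inv_gen_act n) (drop k ws) (alpha i)"


section \<open>Alcove walks\<close>

definition AW :: "int \<Rightarrow> (int \<Rightarrow> int) \<Rightarrow> letter list \<Rightarrow> (int \<Rightarrow> int) list set"
  where "AW n z ws = {p. length p = length ws + 1 \<and> p ! 0 = periodic n z \<and>
    (\<forall>k\<in>{1..length ws}.
      (case ws ! (k - 1) of
        Rot \<Rightarrow> p ! k = p ! (k - 1) \<circ> gen n Rot
      | Ref i \<Rightarrow> p ! k \<in> {p ! (k - 1), p ! (k - 1) \<circ> gen n (Ref i)}))}"

text \<open>\<open>mu_at n ws k\<close> is \<open>\<mu>\<^bsup>(k-1)\<^esup> = s\<^bsub>i\<^sub>k\<^esub> \<cdots> s\<^bsub>i\<^sub>r\<^esub>(0,\<dots>,0)\<close>.\<close>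

definition mu_at :: "int \<Rightarrow> letter list \<Rightarrow> nat \<Rightarrow> expo"
  where "mu_at n ws k = aff_act n (aff_word n (drop (k - 1) ws)) 0"

definition d_step :: "int \<Rightarrow> complex \<Rightarrow> complex \<Rightarrow> letter list \<Rightarrow> nat \<Rightarrow> int \<Rightarrow> complex"
  where "d_step n q th ws k i = q powi sh (- beta n ws k i) * (th ^ 2) powi ht n (- beta n ws k i)"

text \<open>\<open>twice_norm\<close> is \<open>2 norm(p\<^sub>k)\<close>, so that \<open>t\<^bsup>norm(p\<^sub>k)\<^esup> = th\<^bsup>2 norm(p\<^sub>k)\<^esup>\<close>.\<close>

definition twice_norm :: "int \<Rightarrow> letter list \<Rightarrow> (int \<Rightarrow> int) list \<Rightarrow> nat \<Rightarrow> int \<Rightarrow> int"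
  where "twice_norm n ws p k i =
    (let z = overline n (p ! (k - 1)); v = vperm n (mu_at n ws k)
     in int (perm_len n (z \<circ> sref i \<circ> inv v)) - int (perm_len n (z \<circ> inv v)) - 1)"

definition wt_step ::
  "int \<Rightarrow> complex \<Rightarrow> complex \<Rightarrow> letter list \<Rightarrow> (int \<Rightarrow> int) list \<Rightarrow> nat \<Rightarrow> laurent"
  where "wt_step n q th ws p k =
    (let z = overline n (p ! (k - 1)) in
     case ws ! (k - 1) of
       Rot \<Rightarrow> xvar (z 1)
     | Ref i \<Rightarrow>
         if p ! k = p ! (k - 1) then
           if perm_len n (z \<circ> sref i) > perm_len n z
           then Const ((1 - th ^ 2) / (1 - d_step n q th ws k i) * th powi twice_norm n ws p k i)
           else Const ((1 - th ^ 2) * d_step n q th ws k i / (1 - d_step n q th ws k i)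
             * th powi twice_norm n ws p k i)
         else 1)"

definition wt_walk ::
  "int \<Rightarrow> complex \<Rightarrow> complex \<Rightarrow> letter list \<Rightarrow> (int \<Rightarrow> int) list \<Rightarrow> laurent"
  where "wt_walk n q th ws p = (\<Prod>k\<in>{1..length ws}. wt_step n q th ws p k)"


section \<open>Nonattacking fillings\<close>

text \<open>Boxes \<open>(i, j)\<close> are represented by their cylindrical coordinates \<open>i + n j\<close>.\<close>

definition dg :: "int \<Rightarrow> expo \<Rightarrow> int set"
  where "dg n \<mu> = {i + n * j | i j. i \<in> {1..n} \<and> 1 \<le> j \<and> j \<le> coef \<mu> i}"

definition dg_hat :: "int \<Rightarrow> expo \<Rightarrow> int set"
  where "dg_hat n \<mu> = {i + n * j | i j. i \<in> {1..n} \<and> 0 \<le> j \<and> j \<le> coef \<mu> i}"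

definition attack :: "int \<Rightarrow> expo \<Rightarrow> int \<Rightarrow> int set"
  where "attack n \<mu> b = {b - n + 1..b - 1} \<inter> dg_hat n \<mu>"

definition Nleg :: "int \<Rightarrow> expo \<Rightarrow> int \<Rightarrow> int set"
  where "Nleg n \<mu> b = {b + n * m | m. 0 < m} \<inter> dg n \<mu>"

definition Narm :: "int \<Rightarrow> expo \<Rightarrow> int \<Rightarrow> int set"
  where "Narm n \<mu> b = {a \<in> attack n \<mu> b. card (Nleg n \<mu> a) \<le> card (Nleg n \<mu> b)}"

definition NAF :: "int \<Rightarrow> (int \<Rightarrow> int) \<Rightarrow> expo \<Rightarrow> (int \<Rightarrow> int) set"
  where "NAF n z \<mu> = {F \<in> dg_hat n \<mu> \<rightarrow>\<^sub>E {1..n}.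
    (\<forall>i\<in>{1..n}. F i = z i) \<and>
    (\<forall>b\<in>dg n \<mu>. \<forall>a\<in>attack n \<mu> b. F a \<noteq> F b)}"

definition bwn :: "int \<Rightarrow> expo \<Rightarrow> (int \<Rightarrow> int) \<Rightarrow> int \<Rightarrow> int set"
  where "bwn n \<mu> F b = {a \<in> Narm n \<mu> b.
    F (b - n) < F a \<and> F a < F b \<or> F b < F a \<and> F a < F (b - n)}"

definition D_box :: "int \<Rightarrow> complex \<Rightarrow> complex \<Rightarrow> expo \<Rightarrow> int \<Rightarrow> complex"
  where "D_box n q th \<mu> b = q ^ (card (Nleg n \<mu> b) + 1) * (th ^ 2) ^ (card (Narm n \<mu> b) + 1)"

definition wt_box ::
  "int \<Rightarrow> complex \<Rightarrow> complex \<Rightarrow> expo \<Rightarrow> (int \<Rightarrow> int) \<Rightarrow> int \<Rightarrow> laurent"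
  where "wt_box n q th \<mu> F b =
    (if F (b - n) > F b then
       Const ((1 - th ^ 2) / (1 - D_box n q th \<mu> b) * (th ^ 2) ^ card (bwn n \<mu> F b)) * xvar (F b)
     else if F (b - n) < F b then
       Const ((1 - th ^ 2) * D_box n q th \<mu> b / (1 - D_box n q th \<mu> b)
         * (th ^ 2) powi (- 1 - int (card (bwn n \<mu> F b)))) * xvar (F b)
     else xvar (F b))"

definition wt_filling ::
  "int \<Rightarrow> complex \<Rightarrow> complex \<Rightarrow> expo \<Rightarrow> (int \<Rightarrow> int) \<Rightarrow> laurent"
  where "wt_filling n q th \<mu> F = (\<Prod>b\<in>dg n \<mu>. wt_box n q th \<mu> F b)"

end

theory Submission
  imports Defs
begin

text \<open>
  Both formulas are obtained by unrolling recursions for the relative polynomials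
  \<open>E\<^sup>z\<^sub>\<mu>\<close>. They build \<open>\<mu>\<close> from \<open>0\<close> by the generator \<open>\<pi>\<close> and by simple reflections.

  The recursions come from the joint eigenvectors. Order the monomials by the square norm of the
  exponent and then by \<open>\<Sum>i. i * \<mu>\<^sub>i\<close>. Each \<open>Y\<^sub>i\<close> is triangular for this order (\<open>Y_xpow\<close>), and
  by genericity its diagonal entries determine the exponent (\<open>ev_inject\<close>). Therefore a joint eigenvector
  has a unique top monomial and is determined by its eigenvalues up to a factor
  (\<open>joint_eigenvector_top\<close>, \<open>is_E_unique\<close>). The operator \<open>x\<^sub>1 g\<close> shifts the eigenvalues
  cyclically and takes \<open>E\<^sub>\<nu>\<close> to a multiple of \<open>E\<^bsub>\<pi>\<nu>\<^esub>\<close> (\<open>is_E_raise\<close>). If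
  \<open>\<nu>\<^sub>i > \<nu>\<^bsub>i+1\<^esub>\<close>, then \<open>T\<^sub>i + a\<close> with a suitable constant \<open>a\<close> swaps two eigenvalues
  and takes \<open>E\<^sub>\<nu>\<close> to a multiple of \<open>E\<close> for the exponent \<open>s\<^sub>i\<nu>\<close> (\<open>intertwiner\<close>, \<open>is_E_T\<close>).
  Application of \<open>T\<^sub>z\<close> yields \<open>E\<^sup>z = x\<^bsub>z(1)\<^esub> E\<^bsup>zc\<^esup>\<close>, with exponent \<open>\<pi>\<nu>\<close> on the left, \<open>\<nu>\<close> on
  the right and the cycle \<open>c = s\<^sub>1 \<cdots> s\<^bsub>n-1\<^esub>\<close> (\<open>E_rel_piact\<close>), and \<open>E\<^sup>z = E\<^bsup>zs\<^sub>i\<^esup> + C E\<^sup>z\<close> with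
  exponent \<open>s\<^sub>i\<nu>\<close> on the left and \<open>\<nu>\<close> on the right (\<open>E_rel_sact\<close>).

  For the alcove walks, minimality of \<open>u\<^sub>\<mu>\<close> implies that along a reduced word every reflection is applied
  to an exponent with strictly decreasing entries (\<open>reduced_word_ascending\<close>), so the recursion applies at
  every letter. The two terms at a reflection are the walks that cross and the walks that fold, which
  gives the formula (\<open>walk_sum\<close>). The constants agree because \<open>u\<^sub>\<nu>\<^sup>-\<^sup>1\<close> maps \<open>i\<close> to
  \<open>v\<^sub>\<nu>(i) - n \<nu>\<^sub>i\<close>, and this computes the coroots (\<open>rep_start\<close>, \<open>d_step_eq\<close>).

  For the fillings, let \<open>k\<close> be the first nonzero column of \<open>\<mu>\<close>, and let \<open>\<nu>\<close> arise by removal of the first box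
  of this column and moving the rest of it to the end. Then \<open>\<mu> = s\<^bsub>k-1\<^esub> \<cdots> s\<^sub>1 \<pi> \<nu>\<close>, and the recursion
  expresses \<open>E\<^sup>z\<^sub>\<mu>\<close> by \<open>2\<^bsup>k-1\<^esup>\<close> terms. They collapse to \<open>k\<close> terms (\<open>remove_first_box\<close>): the
  polynomial \<open>E\<^sup>y\<^sub>\<nu>\<close> depends only on the values of \<open>y\<close> at the positions \<open>\<ge> k\<close>, since \<open>\<nu>\<close>
  vanishes at the others (\<open>E_rel_agree\<close>), and the coefficients of equal polynomials are added by the
  identity \<open>wgt_merge\<close>. The \<open>k\<close> terms are indexed by the possible entries \<open>z(1), \<dots>, z(k)\<close> of the removed
  box. Removal of this box is also a bijection of fillings that preserves the weights of all other boxes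
  (\<open>filling_recursion\<close>), because it moves them monotonically in cylindrical coordinates. Induction on the
  number of boxes finishes the proof (\<open>filling_formula\<close>).
\<close>

section \<open>Laurent polynomials and their linear operators\<close>

definition xpow :: "expo \<Rightarrow> laurent"
  where "xpow \<nu> = Poly_Mapping.single \<nu> 1"

lemma xpow_0 [simp]: "xpow 0 = 1"
  by (simp add: xpow_def)

lemma xpow_add: "xpow (\<mu> + \<nu>) = xpow \<mu> * xpow \<nu>"
  by (simp add: xpow_def mult_single)

lemma xpow_neq_0 [simp]: "xpow \<nu> \<noteq> 0"
proof
  assume "xpow \<nu> = 0"
  then have "coef (xpow \<nu>) \<nu> = 0" by simp
  then show False by (simp add: xpow_def)
qed

lemma xvar_eq_xpow: "xvar i = xpow (Poly_Mapping.single i 1)"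
  by (simp add: xvar_def xpow_def)

lemma Const_0 [simp]: "Const 0 = 0" and Const_1 [simp]: "Const 1 = 1"
  by (simp_all add: Const_def)

lemma Const_add: "Const (a + b) = Const a + Const b"
  and Const_diff: "Const (a - b) = Const a - Const b"
  and Const_mult: "Const (a * b) = Const a * Const b"
  and Const_minus: "Const (- a) = - Const a"
  by (simp_all add: Const_def single_add single_diff mult_single single_uminus)

lemma Const_power: "Const (a ^ k) = Const a ^ k"
  by (induction k) (simp_all add: Const_mult)

lemma Const_mult_single: "Const c * Poly_Mapping.single \<nu> a = Poly_Mapping.single \<nu> (c * a)"
  by (simp add: Const_def mult_single)

lemma single_eq_Const_xpow: "Poly_Mapping.single \<nu> a = Const a * xpow \<nu>"
  by (simp add: xpow_def Const_mult_single)

lemma coef_xpow: "coef (xpow \<mu>) \<nu> = (if \<mu> = \<nu> then 1 else 0)"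
  by (simp add: xpow_def lookup_single when_def)

lemma supp_xpow [simp]: "supp (xpow \<mu>) = {\<mu>}"
  by (simp add: xpow_def)

lemma laurent_induct [case_names monomial add]:
  assumes "\<And>c \<nu>. P (Const c * xpow \<nu>)" and "\<And>f g. P f \<Longrightarrow> P g \<Longrightarrow> P (f + g)"
  shows "P (h :: laurent)"
proof (induction h rule: update_induct)
  case const
  then show ?case using assms(1)[of 0] by simp
next
  case (update f a b)
  have "Poly_Mapping.update a b f = f + Const b * xpow a"
    using update(1) unfolding single_eq_Const_xpow[symmetric]
    by (intro poly_mapping_eqI)
      (auto simp: lookup_update lookup_add lookup_single when_def in_keys_iff)
  then show ?case using assms update by auto
qed

lemma coef_Const_mult [simp]: "coef (Const c * f) \<nu> = c * coef f \<nu>"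
proof (induction f rule: laurent_induct)
  case (monomial a \<mu>)
  show ?case
    by (simp add: single_eq_Const_xpow[symmetric] Const_mult_single)
      (simp add: lookup_single when_def)
qed (simp add: lookup_add algebra_simps)

lemma coef_xpow_mult: "coef (xpow \<mu> * f) \<nu> = coef f (\<nu> - \<mu>)"
proof (induction f rule: laurent_induct)
  case (monomial a \<kappa>)
  have "xpow \<mu> * (Const a * xpow \<kappa>) = Const a * xpow (\<mu> + \<kappa>)"
    by (simp add: xpow_add mult.left_commute)
  moreover have "\<mu> + \<kappa> = \<nu> \<longleftrightarrow> \<kappa> = \<nu> - \<mu>" by (auto simp: algebra_simps)
  ultimately show ?case by (simp only: coef_Const_mult coef_xpow)
qed (simp add: lookup_add algebra_simps)

lemma laurent_expansion: "h = (\<Sum>\<nu>\<in>supp h. Const (coef h \<nu>) * xpow \<nu>)"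
  by (rule poly_mapping_eqI)
    (simp add: lookup_sum coef_xpow if_distrib[of "(*) _"] in_keys_iff cong: if_cong)

definition lin :: "(laurent \<Rightarrow> laurent) \<Rightarrow> bool"
  where "lin A \<longleftrightarrow> (\<forall>f g. A (f + g) = A f + A g) \<and> (\<forall>c f. A (Const c * f) = Const c * A f)"

lemma lin_add: "lin A \<Longrightarrow> A (f + g) = A f + A g"
  and lin_Const: "lin A \<Longrightarrow> A (Const c * f) = Const c * A f"
  by (simp_all add: lin_def)

lemma lin_0: "lin A \<Longrightarrow> A 0 = 0"
  using lin_Const[of A 0 0] by simp

lemma lin_minus: "lin A \<Longrightarrow> A (- f) = - A f"
  using lin_Const[of A "-1" f] by (simp add: Const_minus)

lemma lin_diff: "lin A \<Longrightarrow> A (f - g) = A f - A g"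
  using lin_add[of A f "- g"] by (simp add: lin_minus)

lemma lin_sum: "lin A \<Longrightarrow> A (\<Sum>i\<in>S. f i) = (\<Sum>i\<in>S. A (f i))"
  by (induction S rule: infinite_finite_induct) (simp_all add: lin_0 lin_add)

lemma lin_id: "lin id" and lin_mult: "lin ((*) f)"
  and lin_comp: "lin A \<Longrightarrow> lin B \<Longrightarrow> lin (A \<circ> B)"
  and lin_op_diff: "lin A \<Longrightarrow> lin B \<Longrightarrow> lin (\<lambda>h. A h - B h)"
  by (simp_all add: lin_def algebra_simps)

lemma lin_expansion: "lin A \<Longrightarrow> A h = (\<Sum>\<nu>\<in>supp h. Const (coef h \<nu>) * A (xpow \<nu>))"
  by (subst laurent_expansion[of h]) (simp add: lin_sum lin_Const)

lemma lin_eqI: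
  assumes "lin A" "lin B" "\<And>\<nu>. A (xpow \<nu>) = B (xpow \<nu>)"
  shows "A h = B h"
  by (simp add: lin_expansion[OF assms(1), of h] lin_expansion[OF assms(2), of h] assms(3))

text \<open>
  For fixed \<open>g\<close> the claim equates two linear operators in \<open>f\<close> and can be tested on monomials; the same
  argument then applies to \<open>g\<close>.
\<close>

lemma lin_multiplicative:
  assumes "lin A" "\<And>\<mu> \<nu>. A (xpow \<mu> * xpow \<nu>) = A (xpow \<mu>) * A (xpow \<nu>)"
  shows "A (f * g) = A f * A g"
proof -
  have 1: "A (xpow \<mu> * g) = A (xpow \<mu>) * A g" for \<mu>
    using lin_eqI[OF lin_comp[OF assms(1) lin_mult[of "xpow \<mu>"]]
        lin_comp[OF lin_mult[of "A (xpow \<mu>)"] assms(1)], of g] assms(2)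
    by simp
  have "(A \<circ> (*) g) f = ((*) (A g) \<circ> A) f"
    by (rule lin_eqI[OF lin_comp[OF assms(1) lin_mult] lin_comp[OF lin_mult assms(1)]])
      (simp add: 1 mult.commute[of g] mult.commute[of "A g"])
  then show ?thesis by (simp add: mult.commute)
qed

text \<open>
  The permutations of variables and the \<open>q\<close>-shift are both of this form, so that linearity and
  multiplicativity can be treated at once.
\<close>

definition monop :: "(expo \<Rightarrow> expo) \<Rightarrow> (expo \<Rightarrow> complex) \<Rightarrow> laurent \<Rightarrow> laurent"
  where "monop \<phi> c h = (\<Sum>\<nu>\<in>supp h. Poly_Mapping.single (\<phi> \<nu>) (coef h \<nu> * c \<nu>))"

lemma monop_superset:
  "finite S \<Longrightarrow> supp h \<subseteq> S \<Longrightarrow>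
    monop \<phi> c h = (\<Sum>\<nu>\<in>S. Poly_Mapping.single (\<phi> \<nu>) (coef h \<nu> * c \<nu>))"
  unfolding monop_def by (rule sum.mono_neutral_left) (auto simp: in_keys_iff)

lemma monop_xpow [simp]: "monop \<phi> c (xpow \<nu>) = Const (c \<nu>) * xpow (\<phi> \<nu>)"
  by (simp add: monop_def coef_xpow single_eq_Const_xpow)

lemma lin_monop: "lin (monop \<phi> c)"
  unfolding lin_def
proof (intro conjI allI)
  fix f g :: laurent
  let ?S = "supp f \<union> supp g"
  show "monop \<phi> c (f + g) = monop \<phi> c f + monop \<phi> c g"
    by (simp add: monop_superset[of ?S "f + g"] monop_superset[of ?S f] monop_superset[of ?S g]
        keys_add lookup_add algebra_simps single_add sum.distrib)
next
  fix a f
  have "supp (Const a * f) \<subseteq> supp f" by (auto simp: in_keys_iff)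
  then show "monop \<phi> c (Const a * f) = Const a * monop \<phi> c f"
    by (simp add: monop_superset[of "supp f"] sum_distrib_left Const_mult_single mult.assoc)
qed

lemma monop_mult:
  assumes "\<And>\<mu> \<nu>. \<phi> (\<mu> + \<nu>) = \<phi> \<mu> + \<phi> \<nu>" "\<And>\<mu> \<nu>. c (\<mu> + \<nu>) = c \<mu> * c \<nu>"
  shows "monop \<phi> c (f * g) = monop \<phi> c f * monop \<phi> c g"
  by (rule lin_multiplicative[OF lin_monop])
    (simp add: xpow_add[symmetric] assms, simp add: xpow_add Const_mult)

lemma monop_comp: "monop \<phi> c (monop \<psi> d h) = monop (\<phi> \<circ> \<psi>) (\<lambda>\<nu>. c (\<psi> \<nu>) * d \<nu>) h"
proof -
  have "(monop \<phi> c \<circ> monop \<psi> d) h = monop (\<phi> \<circ> \<psi>) (\<lambda>\<nu>. c (\<psi> \<nu>) * d \<nu>) h"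
    by (rule lin_eqI[OF lin_comp[OF lin_monop lin_monop] lin_monop])
      (simp add: lin_Const[OF lin_monop] Const_mult)
  then show ?thesis by simp
qed

lemma coef_monop: "inj \<phi> \<Longrightarrow> coef (monop \<phi> c h) (\<phi> \<nu>) = c \<nu> * coef h \<nu>"
  by (simp add: monop_def lookup_sum lookup_single when_def inj_eq in_keys_iff cong: if_cong)

lemma perm_laurent_eq_monop: "perm_laurent w = monop (perm_expo w) (\<lambda>_. 1)"
  by (simp add: fun_eq_iff perm_laurent_def monop_def)

lemma q_shift_eq_monop: "q_shift q n = monop id (\<lambda>\<nu>. inverse q powi coef \<nu> n)"
  by (simp add: fun_eq_iff q_shift_def monop_def)

lemma coef_perm_expo': "bij w \<Longrightarrow> coef (perm_expo w \<mu>) j = coef \<mu> (inv w j)"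
  by (metis coef_perm_expo bij_inv_eq_iff)

lemma perm_expo_add: "bij w \<Longrightarrow> perm_expo w (\<mu> + \<nu>) = perm_expo w \<mu> + perm_expo w \<nu>"
  by (rule poly_mapping_eqI) (simp add: coef_perm_expo' lookup_add)

lemma perm_expo_comp: "bij v \<Longrightarrow> bij w \<Longrightarrow> perm_expo (v \<circ> w) \<mu> = perm_expo v (perm_expo w \<mu>)"
  by (rule poly_mapping_eqI) (simp add: coef_perm_expo' bij_comp o_inv_distrib)

lemma perm_expo_id [simp]: "perm_expo id \<mu> = \<mu>"
  by (rule poly_mapping_eqI) (simp add: coef_perm_expo')

lemma inj_perm_expo: "bij w \<Longrightarrow> inj (perm_expo w)"
  by (rule inj_on_inverseI[of _ "perm_expo (inv w)"])
    (simp add: perm_expo_comp[symmetric] bij_imp_bij_inv bij_is_inj)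

lemma lin_perm_laurent: "lin (perm_laurent w)"
  by (simp add: perm_laurent_eq_monop lin_monop)

lemma perm_laurent_mult: "bij w \<Longrightarrow> perm_laurent w (f * g) = perm_laurent w f * perm_laurent w g"
  by (simp add: perm_laurent_eq_monop monop_mult perm_expo_add)

lemma perm_laurent_xpow [simp]: "perm_laurent w (xpow \<nu>) = xpow (perm_expo w \<nu>)"
  by (simp add: perm_laurent_eq_monop)

lemma perm_laurent_1: "bij w \<Longrightarrow> perm_laurent w 1 = 1"
  using perm_laurent_mult[of w 1 1] perm_laurent_xpow[of w 0]
  by (metis mult_cancel_left2 mult_1 xpow_neq_0 xpow_0)

lemma perm_laurent_Const: "bij w \<Longrightarrow> perm_laurent w (Const c) = Const c"
  using lin_Const[OF lin_perm_laurent, of w c 1] by (simp add: perm_laurent_1)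

lemma perm_laurent_comp:
  "bij v \<Longrightarrow> bij w \<Longrightarrow> perm_laurent v (perm_laurent w h) = perm_laurent (v \<circ> w) h"
proof -
  assume "bij v" "bij w"
  then have "perm_expo v \<circ> perm_expo w = perm_expo (v \<circ> w)"
    by (simp add: fun_eq_iff perm_expo_comp)
  then show ?thesis by (simp add: perm_laurent_eq_monop monop_comp)
qed

lemma bij_sref [simp]: "bij (sref i)"
  by (simp add: sref_def)

lemma sref_o_sref [simp]: "sref i \<circ> sref i = id"
  by (simp add: fun_eq_iff)

lemma inv_sref [simp]: "inv (sref i) = sref i"
  by (simp add: inv_unique_comp)

lemma xvar_neq: "i \<noteq> j \<Longrightarrow> xvar i \<noteq> xvar j"
proof
  assume ij: "i \<noteq> j" and "xvar i = xvar j"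
  then have "coef (xvar i) (Poly_Mapping.single j 1) = 1"
    by (simp add: xvar_def)
  then have "Poly_Mapping.single i (1::int) = Poly_Mapping.single j 1"
    by (simp add: xvar_eq_xpow coef_xpow split: if_splits)
  then have "coef (Poly_Mapping.single i (1::int)) i = coef (Poly_Mapping.single j 1) i" by simp
  then show False using ij by (simp add: lookup_single when_def)
qed

lemma Laurent_expansion_closed:
  assumes "h \<in> Laurent n" "lin A" "\<And>\<nu>. \<nu> \<in> Zn n \<Longrightarrow> A (xpow \<nu>) \<in> Laurent n"
  shows "A h \<in> Laurent n"
proof -
  have "supp (Const (coef h \<nu>) * A (xpow \<nu>)) \<subseteq> Zn n" if "\<nu> \<in> supp h" for \<nu>
    using assms(1) assms(3)[of \<nu>] that by (auto simp: Laurent_def in_keys_iff subset_iff)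
  then show ?thesis
    unfolding lin_expansion[OF assms(2), of h] Laurent_def
    using keys_sum[of "\<lambda>\<nu>. Const (coef h \<nu>) * A (xpow \<nu>)" "supp h"] by blast
qed

lemma Laurent_add: "f \<in> Laurent n \<Longrightarrow> g \<in> Laurent n \<Longrightarrow> f + g \<in> Laurent n"
  unfolding Laurent_def using keys_add[of f g] by auto

lemma Laurent_Const_mult: "f \<in> Laurent n \<Longrightarrow> Const c * f \<in> Laurent n"
  unfolding Laurent_def by (auto simp: in_keys_iff subset_iff)

lemma Laurent_diff: "f \<in> Laurent n \<Longrightarrow> g \<in> Laurent n \<Longrightarrow> f - g \<in> Laurent n"
  using Laurent_add[of f n "Const (-1) * g"] Laurent_Const_mult[of g n "-1"]
  by (simp add: Const_minus)

lemma Laurent_xpow [simp]: "xpow \<nu> \<in> Laurent n \<longleftrightarrow> \<nu> \<in> Zn n"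
  by (simp add: Laurent_def)

lemma Zn_coef: "\<nu> \<in> Zn n \<longleftrightarrow> (\<forall>i. i \<notin> {1..n} \<longrightarrow> coef \<nu> i = 0)"
  by (auto simp: Zn_def in_keys_iff)

lemma Zn_0 [simp]: "0 \<in> Zn n"
  by (simp add: Zn_coef)

section \<open>Demazure-Lusztig operators\<close>

abbreviation sig :: "int \<Rightarrow> laurent \<Rightarrow> laurent"
  where "sig i \<equiv> perm_laurent (sref i)"

abbreviation root :: "int \<Rightarrow> expo"
  where "root i \<equiv> Poly_Mapping.single i 1 - Poly_Mapping.single (i + 1) 1"

abbreviation sact :: "int \<Rightarrow> expo \<Rightarrow> expo"
  where "sact i \<equiv> perm_expo (sref i)"

lemma sig_mult: "sig i (f * g) = sig i f * sig i g"
  by (simp add: perm_laurent_mult)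

lemma sig_add: "sig i (f + g) = sig i f + sig i g"
  and sig_diff: "sig i (f - g) = sig i f - sig i g"
  and sig_Const: "sig i (Const c) = Const c"
  and sig_xvar: "sig i (xvar j) = xvar (sref i j)"
  by (simp_all add: lin_add[OF lin_perm_laurent] lin_diff[OF lin_perm_laurent]
      perm_laurent_Const perm_laurent_xvar)

lemma perm_laurent_id: "perm_laurent id h = h"
  using lin_eqI[OF lin_perm_laurent[of id] lin_id, of h] by simp

lemma sig_sig [simp]: "sig i (sig i h) = h"
  by (simp add: perm_laurent_comp perm_laurent_id)

lemmas sig_simps = sig_mult sig_add sig_diff sig_Const sig_xvar sig_sig

lemma sref_simps [simp]: "sref i i = i + 1" "sref i (i + 1) = i"
  by (simp_all add: sref_def)

lemma sref_other: "j \<noteq> i \<Longrightarrow> j \<noteq> i + 1 \<Longrightarrow> sref i j = j"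
  by (simp add: sref_def)

lemma coef_sact: "coef (sact i \<nu>) j = coef \<nu> (sref i j)"
  by (simp add: coef_perm_expo')

lemma xvar_diff_neq_0 [simp]: "xvar i - xvar (i + 1) \<noteq> 0"
  using xvar_neq[of i "i + 1"] by simp

lemma sact_eq: "sact i \<nu> = \<nu> - frag_cmul (coef \<nu> i - coef \<nu> (i + 1)) (root i)"
  by (rule poly_mapping_eqI, subst coef_sact)
    (auto simp: lookup_minus lookup_single when_def sref_def transpose_def)

text \<open>
  Neighbouring exponents in the string from \<open>\<nu>\<close> to \<open>s\<^sub>i \<nu>\<close> differ by the factor \<open>x\<^bsub>i+1\<^esub> / x\<^sub>i\<close>, so a
  sum over the string telescopes after multiplication by \<open>x\<^sub>i - x\<^bsub>i+1\<^esub>\<close>. These sums are the divided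
  differences of monomials.
\<close>

lemma root_string_step:
  "xvar i * xpow (\<nu> - frag_cmul (k + 1) (root i)) = xvar (i + 1) * xpow (\<nu> - frag_cmul k (root i))"
proof -
  have "Poly_Mapping.single i 1 + (\<nu> - frag_cmul (k + 1) (root i)) =
    Poly_Mapping.single (i + 1) 1 + (\<nu> - frag_cmul k (root i))"
    by (rule poly_mapping_eqI) (simp add: lookup_add lookup_minus algebra_simps)
  then show ?thesis by (simp only: xvar_eq_xpow xpow_add[symmetric])
qed

lemma root_string_telescope:
  "(xvar i - xvar (i + 1)) * (\<Sum>k = 1..<int d + 1. xpow (\<nu> - frag_cmul k (root i))) =
   xvar (i + 1) * (xpow \<nu> - xpow (\<nu> - frag_cmul (int d) (root i)))"
proof (induction d)
  case (Suc d)
  let ?P = "\<lambda>k. xpow (\<nu> - frag_cmul k (root i))"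
  have "{1..<int (Suc d) + 1} = insert (int d + 1) {1..<int d + 1}" by auto
  then have "(\<Sum>k = 1..<int (Suc d) + 1. ?P k) = ?P (int d + 1) + (\<Sum>k = 1..<int d + 1. ?P k)"
    by simp
  then show ?case using Suc root_string_step[of i \<nu> "int d"]
    by (simp only: distrib_left) (simp add: algebra_simps)
qed simp

text \<open>
  On a monomial with \<open>\<nu>\<^sub>i > \<nu>\<^bsub>i+1\<^esub>\<close> the quotient is \<open>x\<^sub>i\<^sup>-\<^sup>1\<close> times the sum over the string from \<open>\<nu>\<close>
  to \<open>s\<^sub>i \<nu>\<close> without its last member. Quotients are unique, as there are no zero divisors, and therefore
  \<open>divdiff\<close> is this quotient.
\<close>

lemma xvar_diff_dvd: "(xvar i - xvar (i + 1)) dvd h - sig i h"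
proof (induction h rule: laurent_induct)
  case (monomial c \<nu>)
  have *: "(xvar i - xvar (i + 1)) dvd xpow \<nu> - xpow (sact i \<nu>)"
    if d: "coef \<nu> i - coef \<nu> (i + 1) = int d" for \<nu> d
  proof (cases d)
    case 0
    then show ?thesis using d by (simp add: sact_eq)
  next
    case (Suc e)
    let ?P = "\<lambda>k. xpow (\<nu> - frag_cmul k (root i))"
    have 1: "(xvar i - xvar (i + 1)) * (\<Sum>k = 1..<int e + 1. ?P k) = xvar (i + 1) * (xpow \<nu> - ?P (int e))"
      by (rule root_string_telescope)
    have 2: "xvar i * ?P (int e + 1) = xvar (i + 1) * ?P (int e)"
      by (rule root_string_step)
    have s: "xpow (sact i \<nu>) = ?P (int e + 1)" using Suc d by (simp add: sact_eq add.commute)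
    have "xvar i * (xpow \<nu> - xpow (sact i \<nu>)) =
      (xvar i - xvar (i + 1)) * (xpow \<nu> + (\<Sum>k = 1..<int e + 1. ?P k))"
      using 1 2 unfolding s by (simp add: algebra_simps)
    then have "xpow (- Poly_Mapping.single i 1) * (xvar i * (xpow \<nu> - xpow (sact i \<nu>))) =
      (xvar i - xvar (i + 1)) * (xpow (- Poly_Mapping.single i 1) * (xpow \<nu> + (\<Sum>k = 1..<int e + 1. ?P k)))"
      by (simp add: mult.left_commute)
    moreover have "xpow (- Poly_Mapping.single i 1) * xvar i = 1"
      by (simp add: xvar_eq_xpow xpow_add[symmetric])
    ultimately show ?thesis by (simp add: mult.assoc[symmetric])
  qed
  have "(xvar i - xvar (i + 1)) dvd xpow \<nu> - xpow (sact i \<nu>)"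
  proof (cases "coef \<nu> (i + 1) \<le> coef \<nu> i")
    case True
    then show ?thesis using *[of \<nu> "nat (coef \<nu> i - coef \<nu> (i + 1))"] by simp
  next
    case False
    then have "(xvar i - xvar (i + 1)) dvd xpow (sact i \<nu>) - xpow (sact i (sact i \<nu>))"
      using *[of "sact i \<nu>" "nat (coef \<nu> (i + 1) - coef \<nu> i)"] by (simp add: coef_sact)
    moreover have "sact i (sact i \<nu>) = \<nu>"
      by (simp add: perm_expo_comp[symmetric])
    ultimately show ?thesis by (metis dvd_minus_iff minus_diff_eq)
  qed
  moreover have "Const c * xpow \<nu> - sig i (Const c * xpow \<nu>) = Const c * (xpow \<nu> - xpow (sact i \<nu>))"
    by (simp add: sig_simps algebra_simps)
  ultimately show ?case by simp
next
  case (add f g)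
  have "f + g - sig i (f + g) = (f - sig i f) + (g - sig i g)" by (simp add: sig_simps)
  then show ?case using add by (metis dvd_add)
qed

lemma divdiff_mult: "(xvar i - xvar (i + 1)) * divdiff i h = h - sig i h"
proof -
  obtain f where f: "h - sig i h = (xvar i - xvar (i + 1)) * f"
    using xvar_diff_dvd by (auto simp: dvd_def)
  show ?thesis unfolding divdiff_def
    by (rule theI[of _ f]) (use f xvar_diff_neq_0[of i] in \<open>auto simp: \<close>)
qed

locale hecke =
  fixes th :: complex
  assumes th: "th \<noteq> 0"
begin

abbreviation T :: "int \<Rightarrow> laurent \<Rightarrow> laurent" where "T i \<equiv> T_op th i"
abbreviation u :: laurent where "u \<equiv> Const th"
abbreviation u' :: laurent where "u' \<equiv> Const (inverse th)"

lemma u_u': "u * u' = 1"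
  using th by (simp add: Const_mult[symmetric])

text \<open>
  Multiplication by the denominator characterises \<open>T\<^sub>i\<close> without divided differences. Identities between
  the operators thereby become polynomial identities.
\<close>

lemma T_char:
  "(xvar i - xvar (i + 1)) * T i h =
    (u' - u) * xvar (i + 1) * h + (u * xvar i - u' * xvar (i + 1)) * sig i h"
  using divdiff_mult[of i h] u_u'
  unfolding T_op_def Const_power by algebra

lemma T_eqI:
  assumes "(xvar i - xvar (i + 1)) * f =
    (u' - u) * xvar (i + 1) * h + (u * xvar i - u' * xvar (i + 1)) * sig i h"
  shows "T i h = f"
  using assms T_char[of i h] xvar_diff_neq_0[of i] by (metis mult_left_cancel)

lemma T_add: "T i (f + g) = T i f + T i g"
  by (rule T_eqI) (use T_char[of i f] T_char[of i g] in \<open>simp only: sig_add, algebra\<close>)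

lemma T_mult_invariant: "sig i f = f \<Longrightarrow> T i (f * h) = f * T i h"
  by (rule T_eqI) (simp add: mult.left_commute T_char sig_simps, simp add: algebra_simps)

lemma T_Const: "T i (Const c * h) = Const c * T i h"
  by (simp add: T_mult_invariant sig_simps)

lemma lin_T: "lin (T i)"
  by (simp add: lin_def T_add T_Const)

lemmas T_diff = lin_diff[OF lin_T]

lemma T_1: "T i 1 = u"
  by (rule T_eqI) (simp add: perm_laurent_1 algebra_simps)

lemma T_invariant: "sig i f = f \<Longrightarrow> T i f = u * f"
  using T_mult_invariant[of i f 1] by (simp add: T_1 mult.commute)

lemma sig_T:
  "(xvar i - xvar (i + 1)) * sig i (T i h) =
    - ((u' - u) * xvar i * sig i h + (u * xvar (i + 1) - u' * xvar i) * h)"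
proof -
  have "sig i ((xvar i - xvar (i + 1)) * T i h) =
    sig i ((u' - u) * xvar (i + 1) * h + (u * xvar i - u' * xvar (i + 1)) * sig i h)"
    by (simp only: T_char)
  then have "(xvar (i + 1) - xvar i) * sig i (T i h) =
    (u' - u) * xvar i * sig i h + (u * xvar (i + 1) - u' * xvar i) * h"
    by (simp only: sig_simps sref_simps)
  then show ?thesis by algebra
qed

text \<open>
  The quadratic relation \<open>(T\<^sub>i - t\<^bsup>1/2\<^esup>)(T\<^sub>i + t\<^bsup>-1/2\<^esup>) = 0\<close>, which makes \<open>T\<^sub>i\<close> invertible.
\<close>

lemma T_T: "T i (T i h) = (u - u') * T i h + h"
proof (rule T_eqI)
  let ?x = "xvar i" and ?y = "xvar (i + 1)"
  have "(?x - ?y) * ((?x - ?y) * ((u - u') * T i h + h)) =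
    (?x - ?y) * ((u' - u) * ?y * T i h + (u * ?x - u' * ?y) * sig i (T i h))"
    using T_char[of i h] sig_T[of i h] u_u' by algebra
  then show "(?x - ?y) * ((u - u') * T i h + h) =
      (u' - u) * ?y * T i h + (u * ?x - u' * ?y) * sig i (T i h)"
    by (rule mult_left_cancel[OF xvar_diff_neq_0, THEN iffD1])
qed

definition Ti :: "int \<Rightarrow> laurent \<Rightarrow> laurent"
  where "Ti i h = T i h - (u - u') * h"

lemma T_u_diff: "T i ((u - u') * h) = (u - u') * T i h"
  using T_Const[of i "th - inverse th" h] by (simp add: Const_diff)

lemma T_Ti [simp]: "T i (Ti i h) = h" and Ti_T [simp]: "Ti i (T i h) = h"
  unfolding Ti_def T_diff T_u_diff T_T by simp_all

lemma inv_T: "inv (T i) = Ti i"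
  by (rule inv_unique_comp) (simp_all add: fun_eq_iff)

lemma lin_Ti: "lin (Ti i)"
  using lin_T[of i] by (simp add: lin_def Ti_def algebra_simps)

lemma T_eq_Ti: "T i h = Ti i h + (u - u') * h"
  by (simp add: Ti_def)

lemma T_inject: "T i f = T i g \<Longrightarrow> f = g"
  by (metis Ti_T)

text \<open>
  The cross relations of the affine Hecke algebra between \<open>T\<^sub>i\<close> and multiplication by variables.
\<close>

lemma T_X: "T i (xvar i * h) = xvar (i + 1) * Ti i h"
  by (rule T_eqI)
    (use T_char[of i h] in \<open>simp add: Ti_def sig_simps, algebra\<close>)

lemma Ti_X: "Ti i (xvar (i + 1) * h) = xvar i * T i h"
  by (rule T_inject[of i]) (simp add: T_X)

lemma T_X_Suc: "T i (xvar (i + 1) * h) = xvar i * T i h + (u - u') * (xvar (i + 1) * h)"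
  by (simp add: T_eq_Ti[of i "xvar (i + 1) * h"] Ti_X)

lemma T_X_other: "j \<noteq> i \<Longrightarrow> j \<noteq> i + 1 \<Longrightarrow> T i (xvar j * h) = xvar j * T i h"
  by (rule T_mult_invariant) (simp add: sig_xvar sref_other)

lemma sig_T_far:
  assumes "j \<noteq> i" "j \<noteq> i + 1" "i \<noteq> j + 1"
  shows "sig i (T j h) = T j (sig i h)"
proof (rule T_eqI[symmetric])
  have *: "sref i j = j" "sref i (j + 1) = j + 1" using assms by (auto simp: sref_other)
  have c: "sref i \<circ> sref j = sref j \<circ> sref i"
    using assms by (auto simp: fun_eq_iff sref_def transpose_def)
  have "sig i ((xvar j - xvar (j + 1)) * T j h) =
    sig i ((u' - u) * xvar (j + 1) * h + (u * xvar j - u' * xvar (j + 1)) * sig j h)"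
    by (simp only: T_char)
  then show "(xvar j - xvar (j + 1)) * sig i (T j h) =
    (u' - u) * xvar (j + 1) * sig i h + (u * xvar j - u' * xvar (j + 1)) * sig j (sig i h)"
    by (simp add: sig_simps * perm_laurent_comp c)
qed

text \<open>
  The difference \<open>B\<close> of the two sides of the braid relation commutes with multiplication by
  variables up to renaming the variables. As it vanishes at 1, it vanishes everywhere.
\<close>

lemma braid_defect_X:
  defines "B \<equiv> \<lambda>i h. T i (T (i + 1) (T i h)) - T (i + 1) (T i (T (i + 1) h))"
  shows "B i (xvar i * h) = xvar (i + 2) * B i h"
    and "B i (xvar (i + 2) * h) = xvar i * B i h"
    and "B i (xvar (i + 1) * h) = xvar (i + 1) * B i h"
    and "j \<notin> {i, i + 1, i + 2} \<Longrightarrow> B i (xvar j * h) = xvar j * B i h"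
proof -
  let ?T = "T i" and ?S = "T (i + 1)" and ?x = "xvar i" and ?y = "xvar (i + 1)" and ?z = "xvar (i + 2)"
  have "i + 1 + 1 = i + 2" by simp
  have S_X: "?S (?y * h) = ?z * Ti (i + 1) h"
    and S_X_Suc: "?S (?z * h) = ?y * ?S h + (u - u') * (?z * h)" for h
    using T_X[of "i + 1" h] T_X_Suc[of "i + 1" h] by (simp_all only: \<open>i + 1 + 1 = i + 2\<close>)
  have Tz: "?T (?z * h) = ?z * ?T h" for h by (rule T_X_other) auto
  have Sx: "?S (?x * h) = ?x * ?S h" for h by (rule T_X_other) auto
  have Tx: "?T (?x * h) = ?y * ?T h - (u - u') * (?y * h)" for h
    by (simp only: T_X Ti_def) algebra
  have Sy: "?S (?y * h) = ?z * ?S h - (u - u') * (?z * h)" for h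
    by (simp only: S_X Ti_def) algebra
  have TT: "?T (?T h) = (u - u') * ?T h + h" and SS: "?S (?S h) = (u - u') * ?S h + h" for h
    by (rule T_T)+
  note Tu = T_u_diff
  show 1: "B i (?x * h) = ?z * B i h"
    unfolding B_def
    by (simp only: Tx Sy Sx Tz T_diff Tu TT SS T_add) algebra
  have Sz: "?S (?z * h) = ?y * ?S h + (u - u') * (?z * h)" for h
    using S_X_Suc by simp
  show 3: "B i (?z * h) = ?x * B i h"
    unfolding B_def
    by (simp only: Tz Sz T_X_Suc[of i] Sx T_add Tu TT SS Tx Sy T_diff) algebra
  \<comment> \<open>The middle variable is obtained from the outer two, since both operators commute with
    multiplication by the symmetric sum of the three variables.\<close>
  have s: "sig i (?x + ?y + ?z) = ?x + ?y + ?z" "sig (i + 1) (?x + ?y + ?z) = ?x + ?y + ?z"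
    by (simp_all add: sig_simps sref_other) (simp_all add: sref_def transpose_def add.commute)
  have "B i ((?x + ?y + ?z) * h) = (?x + ?y + ?z) * B i h"
    unfolding B_def by (simp only: T_mult_invariant s right_diff_distrib)
  moreover have "B i ((?x + ?y + ?z) * h) = B i (?x * h) + B i (?y * h) + B i (?z * h)"
    unfolding B_def by (simp add: distrib_right T_add)
  ultimately show "B i (?y * h) = ?y * B i h" using 1 3 by algebra
  show "B i (xvar j * h) = xvar j * B i h" if "j \<notin> {i, i + 1, i + 2}"
    unfolding B_def using that by (simp add: T_X_other right_diff_distrib)
qed

text \<open>
  Cancellation of a variable replaces multiplication by its inverse, so negative exponents need no
  operator identity of their own.
\<close>

lemma xpow_generate [case_names one var inverse]:
  assumes "P 1" "\<And>j h. P h \<Longrightarrow> P (xvar j * h)" "\<And>j h. P (xvar j * h) \<Longrightarrow> P h"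
  shows "P (xpow \<nu>)"
proof -
  have 1: "P h \<Longrightarrow> P (xpow (Poly_Mapping.single j k) * h)" for j k h
  proof (induction k rule: int_induct[where k = 0])
    case (step1 m)
    have "xpow (Poly_Mapping.single j (m + 1)) * h = xvar j * (xpow (Poly_Mapping.single j m) * h)"
      by (simp add: xvar_eq_xpow single_add xpow_add)
    then show ?case using step1 assms(2) by metis
  next
    case (step2 m)
    have "xpow (Poly_Mapping.single j m) * h = xvar j * (xpow (Poly_Mapping.single j (m - 1)) * h)"
      by (simp add: xvar_eq_xpow xpow_add[symmetric] mult.assoc[symmetric] single_add[symmetric])
    then show ?case using step2 assms(3) by metis
  qed simp
  show ?thesis
  proof (induction \<nu> rule: update_induct)
    case (update f a b)
    have "Poly_Mapping.update a b f = Poly_Mapping.single a b + f"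
      using update(1)
      by (intro poly_mapping_eqI)
        (auto simp: lookup_update lookup_add lookup_single when_def in_keys_iff)
    then show ?case using 1 update by (simp add: xpow_add)
  qed (simp add: assms(1))
qed

lemma T_braid: "T i (T (i + 1) (T i h)) = T (i + 1) (T i (T (i + 1) h))"
proof -
  define B where "B h = T i (T (i + 1) (T i h)) - T (i + 1) (T i (T (i + 1) h))" for h
  have X: "B (xvar j * h) = xvar (if j = i then i + 2 else if j = i + 2 then i else j) * B h" for j h
    using braid_defect_X(1,2,3)[of i h] braid_defect_X(4)[of j i h]
    by (cases "j = i + 1") (auto simp: B_def)
  have nz: "xvar j \<noteq> 0" for j by (simp add: xvar_eq_xpow)
  have "lin B"
    unfolding B_def using lin_op_diff[OF lin_comp[OF lin_T lin_comp[OF lin_T lin_T]]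
        lin_comp[OF lin_T lin_comp[OF lin_T lin_T]], of i "i + 1" i "i + 1" i "i + 1"]
    by simp
  moreover have "B 1 = 0"
    using T_Const[of _ th 1] T_Const[of _ th u] by (simp add: B_def T_1)
  then have "B (xpow \<nu>) = 0" for \<nu>
    by (induction \<nu> rule: xpow_generate) (auto simp: X nz)
  ultimately have "B h = 0"
    using lin_expansion[of B h] by simp
  then show ?thesis by (simp add: B_def)
qed

lemma T_commute:
  assumes "j \<noteq> i" "j \<noteq> i + 1" "i \<noteq> j + 1"
  shows "T i (T j h) = T j (T i h)"
proof (rule T_eqI)
  have *: "sref j i = i" "sref j (i + 1) = i + 1" using assms by (auto simp: sref_other)
  have "T j ((xvar i - xvar (i + 1)) * T i h) =
    T j ((u' - u) * xvar (i + 1) * h + (u * xvar i - u' * xvar (i + 1)) * sig i h)"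
    by (simp only: T_char)
  then show "(xvar i - xvar (i + 1)) * T j (T i h) =
    (u' - u) * xvar (i + 1) * T j h + (u * xvar i - u' * xvar (i + 1)) * sig i (T j h)"
    by (simp add: T_add T_mult_invariant sig_simps * sig_T_far assms)
qed

end

section \<open>Lengths and reduced words in the symmetric group\<close>

definition invs :: "int \<Rightarrow> (int \<Rightarrow> int) \<Rightarrow> (int \<times> int) set"
  where "invs n w = {(i, j). 1 \<le> i \<and> i < j \<and> j \<le> n \<and> w j < w i}"

lemma perm_len_eq: "perm_len n w = card (invs n w)"
  by (simp add: perm_len_def invs_def)

lemma finite_invs [simp]: "finite (invs n w)"
  by (rule finite_subset[of _ "{1..n} \<times> {1..n}"]) (auto simp: invs_def)

lemma perm_len_sum:
  "int (perm_len n w) = (\<Sum>i\<in>{1..n}. \<Sum>j\<in>{1..n}. of_bool (i < j \<and> w j < w i))"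
proof -
  have "invs n w = (SIGMA i:{1..n}. {1..n} \<inter> {j. i < j \<and> w j < w i})"
    by (auto simp: invs_def)
  then have "int (perm_len n w) = (\<Sum>i\<in>{1..n}. int (card ({1..n} \<inter> {j. i < j \<and> w j < w i})))"
    by (simp add: perm_len_eq)
  then show ?thesis by (simp only: sum_of_bool_eq finite_atLeastAtMost_int)
qed

lemma sum_two_off:
  assumes "finite A" "p \<in> A" "r \<in> A" "p \<noteq> r"
  shows "(\<Sum>i\<in>A. f i) = f p + f r + (\<Sum>i\<in>A - {p, r}. f i :: 'a::comm_monoid_add)"
proof -
  have "A - {p} - {r} = A - {p, r}" by auto
  then show ?thesis
    using assms by (simp add: sum.remove[of A p] sum.remove[of "A - {p}" r] add.assoc)
qed

text \<open>
  Only pairs that contain \<open>P\<close> or \<open>Q\<close> matter. A position between \<open>P\<close> and \<open>Q\<close> whose value lies between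
  \<open>w P\<close> and \<open>w Q\<close> becomes inverted with both of them; any other position keeps its total number
  of inversions with the two.
\<close>

lemma perm_len_transpose:
  assumes "P \<in> {1..n}" "Q \<in> {1..n}" "P < Q" "w P < w Q" "inj_on w {1..n}"
  shows "perm_len n (w \<circ> transpose P Q) =
    perm_len n w + 1 + 2 * card {m. P < m \<and> m < Q \<and> w P < w m \<and> w m < w Q}"
proof -
  let ?A = "{1..n}" and ?B = "{1..n} - {P, Q}" and ?w = "w \<circ> transpose P Q"
  define f :: "(int \<Rightarrow> int) \<Rightarrow> int \<Rightarrow> int \<Rightarrow> int" where "f w i j = of_bool (i < j \<and> w j < w i)" for w i j
  have len: "int (perm_len n w) = (\<Sum>i\<in>?A. \<Sum>j\<in>?A. f w i j)" for w
    unfolding f_def by (rule perm_len_sum)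
  have split: "(\<Sum>i\<in>?A. \<Sum>j\<in>?A. f w i j) =
    f w P P + f w P Q + f w Q P + f w Q Q +
    (\<Sum>m\<in>?B. f w P m + f w m P + f w Q m + f w m Q) + (\<Sum>i\<in>?B. \<Sum>j\<in>?B. f w i j)" for w
  proof -
    have off: "(\<Sum>i\<in>?A. g i) = g P + g Q + (\<Sum>i\<in>?B. g i)" for g :: "int \<Rightarrow> int"
      using assms(1-3) by (intro sum_two_off) auto
    show ?thesis unfolding off sum.distrib by simp
  qed
  have id: "?w m = w m" if "m \<in> ?B" for m using that by (simp add: transpose_def)
  have PQ: "?w P = w Q" "?w Q = w P" by simp_all
  have BB: "(\<Sum>i\<in>?B. \<Sum>j\<in>?B. f ?w i j) = (\<Sum>i\<in>?B. \<Sum>j\<in>?B. f w i j)"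
    by (rule sum.cong[OF refl], rule sum.cong[OF refl]) (simp only: f_def id)
  let ?M = "{m. P < m \<and> m < Q \<and> w P < w m \<and> w m < w Q}"
  have neq: "w m \<noteq> w P" "w m \<noteq> w Q" if "m \<in> ?B" for m
    using inj_on_eq_iff[OF assms(5)] assms(1,2) that by auto
  have "(\<Sum>m\<in>?B. f ?w P m + f ?w m P + f ?w Q m + f ?w m Q) =
    (\<Sum>m\<in>?B. f w P m + f w m P + f w Q m + f w m Q + 2 * of_bool (m \<in> ?M))"
  proof (rule sum.cong[OF refl])
    fix m assume m: "m \<in> ?B"
    show "f ?w P m + f ?w m P + f ?w Q m + f ?w m Q =
      f w P m + f w m P + f w Q m + f w m Q + 2 * of_bool (m \<in> ?M)"
    proof -
      have "m < P \<or> P < m \<and> m < Q \<or> Q < m" "w m < w P \<or> w P < w m \<and> w m < w Q \<or> w Q < w m"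
        using neq[OF m] m by auto
      then show ?thesis
        unfolding f_def PQ id[OF m] using assms(3,4) by (elim disjE conjE) simp_all
    qed
  qed
  also have "\<dots> = (\<Sum>m\<in>?B. f w P m + f w m P + f w Q m + f w m Q) + 2 * int (card ?M)"
  proof -
    have "?B \<inter> {m. m \<in> ?M} = ?M" using assms by auto
    then have "(\<Sum>m\<in>?B. of_bool (m \<in> ?M)) = int (card ?M)"
      by (simp only: sum_of_bool_eq finite_Diff finite_atLeastAtMost_int)
    then show ?thesis by (simp only: sum.distrib sum_distrib_left[symmetric])
  qed
  finally have cross: "(\<Sum>m\<in>?B. f ?w P m + f ?w m P + f ?w Q m + f ?w m Q) =
    (\<Sum>m\<in>?B. f w P m + f w m P + f w Q m + f w m Q) + 2 * int (card ?M)" .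
  have "f ?w P P + f ?w P Q + f ?w Q P + f ?w Q Q = 1" "f w P P + f w P Q + f w Q P + f w Q Q = 0"
    unfolding f_def PQ using assms(3,4) by simp_all
  then have "int (perm_len n ?w) = int (perm_len n w) + 1 + 2 * int (card ?M)"
    unfolding len split BB cross by linarith
  then show ?thesis by linarith
qed

lemma perm_len_sref:
  assumes "i \<in> {1..n - 1}" "w permutes {1..n}" "w i < w (i + 1)"
  shows "perm_len n (w \<circ> sref i) = perm_len n w + 1"
proof -
  have e: "{m. i < m \<and> m < i + 1 \<and> w i < w m \<and> w m < w (i + 1)} = {}" by auto
  have "perm_len n (w \<circ> transpose i (i + 1)) = perm_len n w + 1 +
      2 * card {m. i < m \<and> m < i + 1 \<and> w i < w m \<and> w m < w (i + 1)}"
    by (rule perm_len_transpose) (use assms in \<open>auto simp: permutes_inj_on\<close>)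
  then show ?thesis unfolding e by (simp add: sref_def)
qed

lemma sref_permutes: "i \<in> {1..n - 1} \<Longrightarrow> sref i permutes {1..n}"
  unfolding sref_def by (rule permutes_swap_id) auto

lemma perm_len_sref_less:
  assumes "i \<in> {1..n - 1}" "w permutes {1..n}" "w (i + 1) < w i"
  shows "perm_len n w = perm_len n (w \<circ> sref i) + 1"
proof -
  have "perm_len n ((w \<circ> sref i) \<circ> sref i) = perm_len n (w \<circ> sref i) + 1"
    using assms permutes_compose[OF sref_permutes[OF assms(1)] assms(2)]
    by (intro perm_len_sref) simp_all
  then show ?thesis by (simp add: comp_assoc)
qed

lemma perm_len_inv: assumes "w permutes {1..n}" shows "perm_len n (inv w) = perm_len n w"
proof -
  have maps: "(w j, w i) \<in> invs n (inv w)" if "(i, j) \<in> invs n w" "w permutes {1..n}" for i j w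
  proof -
    have "i \<in> {1..n}" "j \<in> {1..n}" using that(1) by (auto simp: invs_def)
    then have "w i \<in> {1..n}" "w j \<in> {1..n}" using permutes_in_image[OF that(2)] by blast+
    then show ?thesis using that by (simp add: invs_def permutes_inverses)
  qed
  have "bij_betw (\<lambda>(i, j). (w j, w i)) (invs n w) (invs n (inv w))"
  proof (rule bij_betw_byWitness[where f' = "\<lambda>(i, j). (inv w j, inv w i)"])
    show "(\<lambda>(i, j). (w j, w i)) ` invs n w \<subseteq> invs n (inv w)"
      using maps[OF _ assms] by auto
    show "(\<lambda>(i, j). (inv w j, inv w i)) ` invs n (inv w) \<subseteq> invs n w"
      using maps[OF _ permutes_inv[OF assms]] permutes_bij[OF assms] by (auto simp: inv_inv_eq)
  qed (use assms in \<open>auto simp: permutes_inverses\<close>)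
  then show ?thesis by (simp add: perm_len_eq bij_betw_same_card)
qed

lemma inv_sref_comp:
  assumes "w permutes {1..n}" shows "inv (sref i \<circ> w) = inv w \<circ> sref i"
  using assms by (simp add: o_inv_distrib permutes_bij sref_def)

lemma perm_len_sref_left:
  assumes "i \<in> {1..n - 1}" "w permutes {1..n}" "inv w i < inv w (i + 1)"
  shows "perm_len n (sref i \<circ> w) = perm_len n w + 1"
proof -
  have "perm_len n (inv w \<circ> sref i) = perm_len n (inv w) + 1"
    by (rule perm_len_sref) (use assms permutes_inv in auto)
  then show ?thesis
    using perm_len_inv[OF permutes_compose[OF assms(2) sref_permutes[OF assms(1)]]]
      perm_len_inv[OF assms(2)]
    by (simp add: inv_sref_comp[OF assms(2)])
qed

lemma perm_len_sref_left_less: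
  assumes "i \<in> {1..n - 1}" "w permutes {1..n}" "inv w (i + 1) < inv w i"
  shows "perm_len n w = perm_len n (sref i \<circ> w) + 1"
proof -
  have "perm_len n (sref i \<circ> (sref i \<circ> w)) = perm_len n (sref i \<circ> w) + 1"
    using assms permutes_compose[OF assms(2) sref_permutes[OF assms(1)]]
    by (intro perm_len_sref_left) (simp_all add: inv_sref_comp)
  then show ?thesis by (simp add: comp_assoc[symmetric])
qed

lemma perm_len_id [simp]: "perm_len n id = 0" 
  unfolding perm_len_eq invs_def by (subst card_eq_0_iff) auto

lemma perm_inv_neq:
  assumes "w permutes {1..n::int}" shows "inv w i \<noteq> inv w (i + 1)"
  using permutes_inj[OF permutes_inv[OF assms]] by (simp add: inj_eq)

lemma strict_increasing_permutation_id:
  assumes "w permutes {1..n::int}" "\<And>i. i \<in> {1..n - 1} \<Longrightarrow> w i < w (i + 1)"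
  shows "w = id"
proof -
  have 1: "int k < n \<Longrightarrow> int k + 1 \<le> w (int k + 1)" for k
  proof (induction k)
    case 0
    then show ?case using permutes_in_image[OF assms(1), of 1] by simp
  next
    case (Suc k)
    then show ?case using assms(2)[of "int k + 1"] by (simp add: add.commute)
  qed
  have 2: "int k < n \<Longrightarrow> w (n - int k) \<le> n - int k" for k
  proof (induction k)
    case 0
    then show ?case using permutes_in_image[OF assms(1), of n] by simp
  next
    case (Suc k)
    then show ?case using assms(2)[of "n - int k - 1"] by (simp add: algebra_simps)
  qed
  have "w i = i" if "i \<in> {1..n}" for i
    using 1[of "nat (i - 1)"] 2[of "nat (n - i)"] that by simp
  then show ?thesis using permutes_not_in[OF assms(1)] by (metis eq_id_iff)
qed

lemma perm_reduced_word_Nil [simp]: "perm_reduced_word n [] w \<longleftrightarrow> w = id"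
  by (auto simp: perm_reduced_word_def perm_word_def)

lemma perm_word_Nil [simp]: "perm_word [] = id"
  by (simp add: perm_word_def)

lemma perm_word_Cons [simp]: "perm_word (i # ws) = sref i \<circ> perm_word ws"
  by (simp add: perm_word_def)

lemma perm_word_permutes: "set ws \<subseteq> {1..n - 1} \<Longrightarrow> perm_word ws permutes {1..n}"
proof (induction ws)
  case Nil
  show ?case unfolding perm_word_Nil by (rule permutes_id)
next
  case (Cons i ws)
  then have "perm_word ws permutes {1..n}" "sref i permutes {1..n}"
    by (simp_all add: sref_permutes)
  then show ?case unfolding perm_word_Cons by (rule permutes_compose)
qed

lemma perm_reduced_word_permutes: "perm_reduced_word n ws w \<Longrightarrow> w permutes {1..n}"
  using perm_word_permutes by (auto simp: perm_reduced_word_def)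

lemma perm_len_sref_left_cases:
  assumes "i \<in> {1..n - 1}" "w permutes {1..n}"
  shows "perm_len n w \<le> perm_len n (sref i \<circ> w) + 1"
  using perm_len_sref_left[OF assms] perm_len_sref_left_less[OF assms] perm_inv_neq[OF assms(2), of i]
  by (cases "inv w i < inv w (i + 1)") auto

lemma perm_len_word_le: "set ws \<subseteq> {1..n - 1} \<Longrightarrow> perm_len n (perm_word ws) \<le> length ws"
proof (induction ws)
  case Nil
  then show ?case unfolding perm_word_Nil perm_len_id by simp
next
  case (Cons i ws)
  have "perm_len n (sref i \<circ> perm_word ws) \<le> perm_len n (sref i \<circ> (sref i \<circ> perm_word ws)) + 1"
    using Cons.prems by (intro perm_len_sref_left_cases permutes_compose[OF perm_word_permutes] sref_permutes) auto
  then have "perm_len n (sref i \<circ> perm_word ws) \<le> length (i # ws)"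
    using Cons by (simp add: comp_assoc[symmetric])
  then show ?case by (simp only: perm_word_Cons)
qed

lemma perm_reduced_word_Cons:
  "perm_reduced_word n (i # ws) w \<longleftrightarrow>
    i \<in> {1..n - 1} \<and> w permutes {1..n} \<and> inv w (i + 1) < inv w i \<and> perm_reduced_word n ws (sref i \<circ> w)"
  (is "?L \<longleftrightarrow> ?R")
proof
  assume L: ?L
  then have w: "w permutes {1..n}" and i: "i \<in> {1..n - 1}" and ws: "set ws \<subseteq> {1..n - 1}"
    and eq: "w = sref i \<circ> perm_word ws" and len: "length ws + 1 = perm_len n w"
    using perm_reduced_word_permutes[OF L] by (auto simp: perm_reduced_word_def)
  have s: "sref i \<circ> w = perm_word ws" by (simp add: eq fun_eq_iff)
  have "perm_len n (sref i \<circ> w) < perm_len n w"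
    using perm_len_word_le[OF ws] len s by simp
  then have lt: "inv w (i + 1) < inv w i"
    using perm_len_sref_left[OF i w] perm_inv_neq[OF w, of i] by (cases "inv w i < inv w (i + 1)") auto
  then show ?R
    using perm_len_sref_left_less[OF i w lt] i w ws s len by (simp add: perm_reduced_word_def)
next
  assume R: ?R
  then have "perm_len n w = perm_len n (sref i \<circ> w) + 1"
    by (intro perm_len_sref_left_less) auto
  moreover have "sref i \<circ> (sref i \<circ> w) = w" by (simp add: fun_eq_iff)
  ultimately show ?L using R by (auto simp: perm_reduced_word_def)
qed

lemma perm_reduced_word_exists:
  assumes "w permutes {1..n}" shows "\<exists>ws. perm_reduced_word n ws w"
  using assms
proof (induction "perm_len n w" arbitrary: w rule: less_induct)
  case less
  show ?case
  proof (cases "w = id")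
    case False
    then have "inv w \<noteq> id" using less.prems by (metis inv_id inv_inv_eq permutes_bij)
    then obtain i where i: "i \<in> {1..n - 1}" "inv w (i + 1) < inv w i"
      using strict_increasing_permutation_id[OF permutes_inv[OF less.prems]]
        perm_inv_neq[OF less.prems] by (metis linorder_neqE)
    have "perm_len n (sref i \<circ> w) < perm_len n w"
      using perm_len_sref_left_less[OF i(1) less.prems i(2)] by simp
    then obtain ws where "perm_reduced_word n ws (sref i \<circ> w)"
      using less.hyps permutes_compose[OF less.prems sref_permutes[OF i(1)]] by blast
    then have "perm_reduced_word n (i # ws) w"
      using i less.prems by (simp add: perm_reduced_word_Cons)
    then show ?thesis ..
  qed (metis perm_reduced_word_Nil)
qed

section \<open>The operators of permutations\<close>

context hecke begin

lemma T_word_Nil [simp]: "T_word th [] h = h"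
  and T_word_Cons [simp]: "T_word th (i # ws) h = T i (T_word th ws h)"
  by (simp_all add: T_word_def)

lemma T_word_append: "T_word th (ws @ ws') h = T_word th ws (T_word th ws' h)"
  by (induction ws) simp_all

lemma lin_T_word: "lin (T_word th ws)"
proof (induction ws)
  case Nil
  then show ?case by (simp add: lin_def)
next
  case (Cons i ws)
  then show ?case using lin_T[of i] by (simp add: lin_def)
qed

text \<open>
  Matsumoto's theorem for the operators, by induction on the length. If two reduced words of \<open>w\<close> start
  with different letters \<open>i\<close> and \<open>j\<close>, then \<open>w\<close> also has reduced words that start with either of the two
  sides of the braid or commutation relation of \<open>s\<^sub>i\<close> and \<open>s\<^sub>j\<close>. The induction hypothesis
  compares the given words with these, and the relation compares these with each other.
\<close>

lemma T_word_unique: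
  assumes "perm_reduced_word n ws w" "perm_reduced_word n ws' w"
  shows "T_word th ws h = T_word th ws' h"
  using assms
proof (induction "length ws" arbitrary: ws ws' w h rule: less_induct)
  case less
  have w: "w permutes {1..n}" using perm_reduced_word_permutes less.prems by blast
  have len: "length ws = length ws'" using less.prems by (simp add: perm_reduced_word_def)
  show ?case
  proof (cases ws)
    case Nil
    then show ?thesis using len by simp
  next
    case (Cons i a)
    then obtain j b where ws': "ws' = j # b" using len by (cases ws') auto
    have i: "i \<in> {1..n - 1}" "inv w (i + 1) < inv w i" and a: "perm_reduced_word n a (sref i \<circ> w)"
      using less.prems(1) by (simp_all add: Cons perm_reduced_word_Cons)
    have j: "j \<in> {1..n - 1}" "inv w (j + 1) < inv w j" and b: "perm_reduced_word n b (sref j \<circ> w)"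
      using less.prems(2) by (simp_all add: ws' perm_reduced_word_Cons)
    have la: "length a < length ws" "length b < length ws" using len Cons ws' by simp_all
    have IH: "T_word th c h = T_word th d h"
      if "perm_reduced_word n c v" "perm_reduced_word n d v" "c \<in> {a, b}" for c d v h
      using less.hyps[of c v d h] that la by auto
    note perm = w permutes_compose sref_permutes[OF i(1)] sref_permutes[OF j(1)]
    have inv1: "inv (sref k \<circ> v) = inv v \<circ> sref k" if "v permutes {1..n}" for k v
      using that by (rule inv_sref_comp)
    have adjacent: "T_word th ws h = T_word th ws' h"
      if "ws = i # a" "ws' = i' # b" "i' = i + 1" "perm_reduced_word n a (sref i \<circ> w)"
        "perm_reduced_word n b (sref i' \<circ> w)" "i \<in> {1..n - 1}" "i' \<in> {1..n - 1}"
        "inv w (i + 1) < inv w i" "inv w (i' + 1) < inv w i'"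
        "\<And>c d v h. perm_reduced_word n c v \<Longrightarrow> perm_reduced_word n d v \<Longrightarrow> c \<in> {a, b} \<Longrightarrow>
          T_word th c h = T_word th d h"
      for i i' a b ws ws'
    proof -
      note s = sref_permutes[OF that(6)] sref_permutes[OF that(7)]
      have p: "sref i \<circ> w permutes {1..n}" "sref i' \<circ> w permutes {1..n}"
        "sref i' \<circ> (sref i \<circ> w) permutes {1..n}" "sref i \<circ> (sref i' \<circ> w) permutes {1..n}"
        "sref i \<circ> (sref i' \<circ> (sref i \<circ> w)) permutes {1..n}"
        by (intro permutes_compose s w)+
      obtain c where c: "perm_reduced_word n c (sref i \<circ> (sref i' \<circ> (sref i \<circ> w)))"
        using perm_reduced_word_exists[OF p(5)] by blast
      have braid: "sref i \<circ> (sref i' \<circ> (sref i \<circ> w)) = sref i' \<circ> (sref i \<circ> (sref i' \<circ> w))"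
        using that(3) by (auto simp: fun_eq_iff sref_def transpose_def)
      have v: "sref i (i + 2) = i + 2" "sref (i + 1) i = i" "sref (i + 1) (i + 1) = i + 2"
        "sref (i + 1) (i + 2) = i + 1"
        by (auto simp: sref_def transpose_def)
      have lt: "inv w (i + 1) < inv w i" "inv w (i + 2) < inv w (i + 1)" "inv w (i + 2) < inv w i"
        using that(3,8,9) by (simp_all add: add.assoc)
      have Suc: "i' + 1 = i + 2" using that(3) by simp
      have invs: "inv (sref i \<circ> w) = inv w \<circ> sref i" "inv (sref i' \<circ> w) = inv w \<circ> sref i'"
        "inv (sref i' \<circ> (sref i \<circ> w)) = inv w \<circ> sref i \<circ> sref i'"
        "inv (sref i \<circ> (sref i' \<circ> w)) = inv w \<circ> sref i' \<circ> sref i"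
        using inv_sref_comp[OF p(1), of i'] inv_sref_comp[OF p(2), of i] inv_sref_comp[OF w] by simp_all
      have v': "i + 1 + 1 = i + 2" by simp
      have "inv (sref i \<circ> w) (i' + 1) < inv (sref i \<circ> w) i'"
        "inv (sref i' \<circ> (sref i \<circ> w)) (i + 1) < inv (sref i' \<circ> (sref i \<circ> w)) i"
        "inv (sref i' \<circ> w) (i + 1) < inv (sref i' \<circ> w) i"
        "inv (sref i \<circ> (sref i' \<circ> w)) (i' + 1) < inv (sref i \<circ> (sref i' \<circ> w)) i'"
        unfolding invs comp_apply using lt by (simp_all only: that(3) v' v sref_simps)
      then have "perm_reduced_word n (i' # i # c) (sref i \<circ> w)"
        "perm_reduced_word n (i # i' # c) (sref i' \<circ> w)"
        using that(6,7) p c c[unfolded braid] by (simp_all only: perm_reduced_word_Cons)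
      then have "T_word th a g = T_word th (i' # i # c) g" "T_word th b g = T_word th (i # i' # c) g" for g
        using that(4,5,10) by blast+
      then show ?thesis using T_braid[of i] that(3) by (simp add: that(1,2))
    qed
    consider "i = j" | "j = i + 1" | "i = j + 1" | "j \<noteq> i" "j \<noteq> i + 1" "i \<noteq> j + 1" by blast
    then show ?thesis
    proof cases
      case 1
      have "T_word th a h = T_word th b h" for h
        using IH[OF a _, of b] b 1 by blast
      then show ?thesis by (simp only: Cons ws' 1 T_word_Cons)
    next
      case 2
      show ?thesis
        by (rule adjacent[OF Cons ws' 2 a b i(1) j(1) i(2) j(2)]) (rule IH; assumption)
    next
      case 3
      have "T_word th ws' h = T_word th ws h"
        by (rule adjacent[OF ws' Cons 3 b a j(1) i(1) j(2) i(2)]) (rule IH, assumption, assumption, blast)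
      then show ?thesis ..
    next
      case 4
      have p: "sref i \<circ> w permutes {1..n}" "sref j \<circ> w permutes {1..n}"
        "sref j \<circ> (sref i \<circ> w) permutes {1..n}"
        by (intro permutes_compose perm)+
      obtain c where c: "perm_reduced_word n c (sref j \<circ> (sref i \<circ> w))"
        using perm_reduced_word_exists[OF p(3)] by blast
      have comm: "sref j \<circ> (sref i \<circ> w) = sref i \<circ> (sref j \<circ> w)"
        using 4 by (auto simp: fun_eq_iff sref_def transpose_def)
      have v: "sref i j = j" "sref i (j + 1) = j + 1" "sref j i = i" "sref j (i + 1) = i + 1"
        using 4 by (auto simp: sref_other)
      have "perm_reduced_word n (j # c) (sref i \<circ> w)" "perm_reduced_word n (i # c) (sref j \<circ> w)"
        using c i j p comm by (simp_all add: perm_reduced_word_Cons inv1 w v)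
      then have "T_word th a g = T_word th (j # c) g" "T_word th b g = T_word th (i # c) g" for g
        using a b IH by blast+
      then show ?thesis using T_commute[OF 4] by (simp add: Cons ws')
    qed
  qed
qed

lemma T_perm_eq: "perm_reduced_word n ws w \<Longrightarrow> T_perm n th w h = T_word th ws h"
  unfolding T_perm_def by (rule T_word_unique[OF someI])

lemma lin_T_perm: "lin (T_perm n th w)"
  unfolding T_perm_def by (rule lin_T_word)

lemma T_perm_id [simp]: "T_perm n th id h = h"
  using T_perm_eq[of n "[]" id h] by simp

lemma T_perm_left:
  assumes "i \<in> {1..n - 1}" "w permutes {1..n}" "inv w i < inv w (i + 1)"
  shows "T_perm n th (sref i \<circ> w) h = T i (T_perm n th w h)"
proof -
  obtain ws where ws: "perm_reduced_word n ws w"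
    using perm_reduced_word_exists[OF assms(2)] by blast
  have "perm_reduced_word n (i # ws) (sref i \<circ> w)"
    using ws assms permutes_compose[OF assms(2) sref_permutes[OF assms(1)]]
    by (simp add: perm_reduced_word_Cons inv_sref_comp comp_assoc[symmetric])
  then show ?thesis using ws by (simp add: T_perm_eq)
qed

lemma perm_word_append: "perm_word (ws @ ws') = perm_word ws \<circ> perm_word ws'"
  by (induction ws) (simp_all add: comp_assoc)

lemma T_perm_right:
  assumes "i \<in> {1..n - 1}" "w permutes {1..n}" "w i < w (i + 1)"
  shows "T_perm n th (w \<circ> sref i) h = T_perm n th w (T i h)"
proof -
  obtain ws where ws: "perm_reduced_word n ws w"
    using perm_reduced_word_exists[OF assms(2)] by blast
  have "perm_reduced_word n (ws @ [i]) (w \<circ> sref i)"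
    using ws assms perm_len_sref[OF assms]
    by (auto simp: perm_reduced_word_def perm_word_append)
  then show ?thesis using ws by (simp add: T_perm_eq T_word_append)
qed

lemma T_perm_right_less:
  assumes "i \<in> {1..n - 1}" "w permutes {1..n}" "w (i + 1) < w i"
  shows "T_perm n th w (Ti i h) = T_perm n th (w \<circ> sref i) h"
proof -
  have "T_perm n th ((w \<circ> sref i) \<circ> sref i) (Ti i h) = T_perm n th (w \<circ> sref i) (T i (Ti i h))"
    using assms by (intro T_perm_right permutes_compose[OF sref_permutes]) simp_all
  then show ?thesis by (simp add: comp_assoc)
qed

lemma T_word_one: "T_word th ws 1 = Const (th ^ length ws)"
  by (induction ws) (simp_all add: T_invariant sig_Const Const_mult)

lemma T_perm_one: "w permutes {1..n} \<Longrightarrow> T_perm n th w 1 = Const (th ^ perm_len n w)"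
  using perm_reduced_word_exists[of w n] T_perm_eq[of n _ w 1]
  by (auto simp: T_word_one perm_reduced_word_def)

end

text \<open>
  The cycle \<open>s\<^sub>k \<cdots> s\<^bsub>n-1\<^esub>\<close> and its inverse. The image of \<open>\<pi>\<close> in the symmetric group is \<open>rot 1 n\<close>.
\<close>

definition rot :: "int \<Rightarrow> int \<Rightarrow> int \<Rightarrow> int"
  where "rot k n i = (if k \<le> i \<and> i < n then i + 1 else if i = n then k else i)"

definition unrot :: "int \<Rightarrow> int \<Rightarrow> int \<Rightarrow> int"
  where "unrot k n i = (if k < i \<and> i \<le> n then i - 1 else if i = k then n else i)"

lemma unrot_rot [simp]: "k \<le> n \<Longrightarrow> unrot k n (rot k n i) = i"
  and rot_unrot [simp]: "k \<le> n \<Longrightarrow> rot k n (unrot k n i) = i"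
  by (auto simp: rot_def unrot_def)

lemma bij_rot: "k \<le> n \<Longrightarrow> bij (rot k n)"
  by (rule bij_betw_byWitness[where f' = "unrot k n"]) auto

lemma inv_rot: "k \<le> n \<Longrightarrow> inv (rot k n) = unrot k n"
  by (rule inv_unique_comp) (auto simp: fun_eq_iff)

lemma rot_permutes: "1 \<le> k \<Longrightarrow> k \<le> n \<Longrightarrow> rot k n permutes {1..n}"
  by (rule bij_imp_permutes)
    (auto intro!: bij_betw_byWitness[where f' = "unrot k n"] simp: rot_def unrot_def)

lemma sref_rot: "k < n \<Longrightarrow> sref k \<circ> rot (k + 1) n = rot k n"
  by (auto simp: fun_eq_iff rot_def sref_def transpose_def)

lemma rot_n: "rot n n = id"
  by (auto simp: fun_eq_iff rot_def)

lemma perm_reduced_word_rot: "1 \<le> k \<Longrightarrow> k \<le> n \<Longrightarrow> perm_reduced_word n [k..n - 1] (rot k n)"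
proof (induction "nat (n - k)" arbitrary: k)
  case 0
  then have "k = n" by simp
  then have "[k..n - 1] = []" "rot k n = id" by (simp_all only: rot_n) simp
  then show ?case by (simp only: perm_reduced_word_Nil)
next
  case (Suc d)
  have "[k..n - 1] = k # [k + 1..n - 1]" using Suc.hyps(2) by (intro upto_rec1) simp
  moreover have "sref k \<circ> rot k n = rot (k + 1) n"
    using sref_rot[of k n, symmetric] Suc.hyps(2) by (simp add: comp_assoc[symmetric])
  moreover have "perm_reduced_word n [k + 1..n - 1] (rot (k + 1) n)"
    using Suc by (intro Suc.hyps(1)) auto
  ultimately show ?case
    using Suc rot_permutes[of k n] by (simp add: perm_reduced_word_Cons inv_rot unrot_def)
qed

context hecke begin

text \<open>
  Induction on a reduced word of \<open>z\<close>. Each generator either commutes with the current variable, or turns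
  it into the next one while becoming an inverse, which cancels against the following \<open>T\<^sub>y\<^sub>c\<close>.
\<close>

lemma T_perm_X_rot:
  assumes "0 < n" "z permutes {1..n}"
  shows "T_perm n th z (xvar 1 * T_perm n th (rot 1 n) h) = xvar (z 1) * T_perm n th (z \<circ> rot 1 n) h"
proof -
  obtain ws where "perm_reduced_word n ws z"
    using perm_reduced_word_exists[OF assms(2)] by blast
  then show ?thesis
  proof (induction ws arbitrary: z)
    case Nil
    then have "z = id" by (simp only: perm_reduced_word_Nil)
    then show ?case by (simp only: T_perm_id id_comp) (simp only: id_apply)
  next
    case (Cons i ws)
    define y where "y = sref i \<circ> z"
    have i: "i \<in> {1..n - 1}" and z: "z permutes {1..n}" and lt: "inv z (i + 1) < inv z i"
      and ws: "perm_reduced_word n ws y"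
      using Cons.prems by (simp_all add: perm_reduced_word_Cons y_def)
    have y: "y permutes {1..n}" using perm_reduced_word_permutes[OF ws] .
    have z_eq: "z = sref i \<circ> y" by (simp add: y_def fun_eq_iff)
    have lty: "inv y i < inv y (i + 1)"
      using lt z unfolding y_def by (simp add: inv_sref_comp)
    have yin: "inv y i \<in> {1..n}" "inv y (i + 1) \<in> {1..n}"
      using i permutes_in_image[OF permutes_inv[OF y]] by auto
    let ?c = "rot 1 n"
    have c: "?c permutes {1..n}" using assms(1) by (intro rot_permutes) auto
    have yc: "y \<circ> ?c permutes {1..n}" by (rule permutes_compose[OF c y])
    have inv_yc: "inv (y \<circ> ?c) k = unrot 1 n (inv y k)" for k
      using assms(1) y c by (simp add: o_inv_distrib permutes_bij inv_rot)
    have "T_perm n th z (xvar 1 * T_perm n th ?c h) = T i (T_perm n th y (xvar 1 * T_perm n th ?c h))"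
      unfolding z_eq using lty by (intro T_perm_left i y)
    also have "\<dots> = T i (xvar (y 1) * T_perm n th (y \<circ> ?c) h)"
      by (simp only: Cons.IH[OF ws])
    also have "\<dots> = xvar (z 1) * T_perm n th (z \<circ> ?c) h"
    proof (cases "y 1 = i")
      case True
      then have 1: "inv y i = 1" using permutes_inverses(2)[OF y, of 1] by simp
      have "inv (y \<circ> ?c) (i + 1) < inv (y \<circ> ?c) i"
        unfolding inv_yc 1 using yin lty by (simp add: unrot_def)
      then have "T_perm n th (sref i \<circ> (sref i \<circ> (y \<circ> ?c))) h = T i (T_perm n th (sref i \<circ> (y \<circ> ?c)) h)"
        by (intro T_perm_left i permutes_compose[OF yc] sref_permutes) (simp add: inv_sref_comp[OF yc])
      then have "T_perm n th (y \<circ> ?c) h = T i (T_perm n th (z \<circ> ?c) h)"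
        by (simp add: comp_assoc[symmetric] z_eq)
      then show ?thesis by (simp add: True T_X z_eq)
    next
      case False
      have "y 1 \<noteq> i + 1"
      proof
        assume "y 1 = i + 1"
        then have "inv y (i + 1) = 1" using permutes_inverses(2)[OF y, of 1] by simp
        then show False using lty yin by simp
      qed
      moreover have "inv y i \<noteq> 1" using False permutes_inverses(1)[OF y, of i] by auto
      then have "inv (y \<circ> ?c) i < inv (y \<circ> ?c) (i + 1)"
        unfolding inv_yc using lty yin by (simp add: unrot_def)
      then have "T_perm n th (sref i \<circ> (y \<circ> ?c)) h = T i (T_perm n th (y \<circ> ?c) h)"
        by (intro T_perm_left i yc)
      ultimately show ?thesis
        using False by (simp add: T_X_other z_eq sref_other comp_assoc)
    qed
    finally show ?case .
  qed
qed

end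

section \<open>Cherednik operators\<close>

locale macdonald = hecke th for th :: complex +
  fixes n :: int and q :: complex
  assumes n: "0 < n" and generic: "generic q th"
begin

lemma q: "q \<noteq> 0"
  using generic by (simp add: generic_def)

abbreviation c :: "int \<Rightarrow> int" where "c \<equiv> rot 1 n"
abbreviation g :: "laurent \<Rightarrow> laurent" where "g \<equiv> g_op n q"

lemma c_permutes: "c permutes {1..n}"
  using n by (intro rot_permutes) auto

lemma bij_c: "bij c"
  using n by (intro bij_rot) auto

lemma c_simps: "c n = 1" "i \<in> {1..n - 1} \<Longrightarrow> c i = i + 1"
  by (auto simp: rot_def)

text \<open>
  All factors of \<open>g\<close> act on monomials, so \<open>g\<close> is multiplicative and its commutation relations follow
  from its action on exponents.
\<close>

lemma g_eq_monop: "g = monop (perm_expo c) (\<lambda>\<nu>. inverse q powi coef \<nu> n)"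
proof -
  have "foldr (\<lambda>i f. perm_laurent (sref i) \<circ> f) ws A h = perm_laurent (perm_word ws) (A h)" for ws A h
  proof (induction ws)
    case Nil
    show ?case by (simp only: perm_word_Nil perm_laurent_id) simp
  next
    case (Cons i ws)
    have "bij (perm_word ws)"
    proof (induction ws)
      case Nil
      show ?case by (simp only: perm_word_Nil bij_id)
    next
      case (Cons i ws)
      then show ?case by (simp only: perm_word_Cons bij_comp bij_sref)
    qed
    have "foldr (\<lambda>i f. perm_laurent (sref i) \<circ> f) (i # ws) A h = sig i (perm_laurent (perm_word ws) (A h))"
      by (simp only: foldr.simps comp_apply Cons.IH)
    then show ?case
      by (simp only: perm_word_Cons perm_laurent_comp[OF bij_sref \<open>bij (perm_word ws)\<close>])
  qed
  note F = this
  have P: "perm_word [1..n - 1] = c"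
    using perm_reduced_word_rot[of 1 n] n by (simp add: perm_reduced_word_def)
  have "g h = perm_laurent c (q_shift q n h)" for h
    unfolding g_op_def F P ..
  then show ?thesis
    by (simp add: fun_eq_iff perm_laurent_eq_monop q_shift_eq_monop monop_comp)
qed

lemma lin_g: "lin g"
  by (simp add: g_eq_monop lin_monop)

lemma g_mult: "g (f * h) = g f * g h"
  unfolding g_eq_monop
  by (rule monop_mult) (simp_all add: perm_expo_add bij_c lookup_add power_int_add q)

lemma g_xpow: "g (xpow \<nu>) = Const (inverse q powi coef \<nu> n) * xpow (perm_expo c \<nu>)"
  by (simp add: g_eq_monop)

lemma g_Const: "g (Const a) = Const a"
proof -
  have "perm_expo c 0 = 0"
    by (rule poly_mapping_eqI) (simp add: coef_perm_expo' bij_c)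
  then show ?thesis using lin_Const[OF lin_g, of a 1] g_xpow[of 0] by simp
qed

lemma perm_expo_single: "bij w \<Longrightarrow> perm_expo w (Poly_Mapping.single i a) = Poly_Mapping.single (w i) a"
  by (rule poly_mapping_eqI) (auto simp: coef_perm_expo' lookup_single when_def bij_inv_eq_iff)

lemma g_xvar: "i \<in> {1..n - 1} \<Longrightarrow> g (xvar i) = xvar (i + 1)"
  and g_xvar_n: "g (xvar n) = Const (inverse q) * xvar 1"
  by (simp_all add: xvar_eq_xpow g_xpow perm_expo_single bij_c c_simps lookup_single)

lemma g_sig:
  assumes "i \<in> {1..n - 2}"
  shows "g (sig i h) = sig (i + 1) (g h)"
proof -
  have "c \<circ> sref i = sref (i + 1) \<circ> c"
    using assms by (auto simp: fun_eq_iff rot_def sref_def transpose_def)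
  then have 1: "perm_expo c (sact i \<nu>) = sact (i + 1) (perm_expo c \<nu>)" for \<nu>
    by (simp only: perm_expo_comp[OF bij_c bij_sref, symmetric] perm_expo_comp[OF bij_sref bij_c, symmetric])
  have 2: "coef (sact i \<nu>) n = coef \<nu> n" for \<nu>
    using assms by (subst coef_sact, subst sref_other) auto
  have "(g \<circ> sig i) h = (sig (i + 1) \<circ> g) h"
  proof (rule lin_eqI[of "g \<circ> sig i" "sig (i + 1) \<circ> g"])
    fix \<nu>
    show "(g \<circ> sig i) (xpow \<nu>) = (sig (i + 1) \<circ> g) (xpow \<nu>)"
      by (simp only: comp_apply perm_laurent_xpow g_xpow 1 2 sig_mult sig_Const)
  qed (intro lin_comp lin_g lin_perm_laurent)+
  then show ?thesis by simp
qed

lemma g_T: "i \<in> {1..n - 2} \<Longrightarrow> g (T i h) = T (i + 1) (g h)"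
proof (rule T_eqI[symmetric])
  assume i: "i \<in> {1..n - 2}"
  then have x: "g (xvar i) = xvar (i + 1)" "g (xvar (i + 1)) = xvar (i + 1 + 1)"
    using g_xvar[of i] g_xvar[of "i + 1"] by simp_all
  have "g ((xvar i - xvar (i + 1)) * T i h) =
    g ((u' - u) * xvar (i + 1) * h + (u * xvar i - u' * xvar (i + 1)) * sig i h)"
    by (simp only: T_char)
  then show "(xvar (i + 1) - xvar (i + 1 + 1)) * g (T i h) =
    (u' - u) * xvar (i + 1 + 1) * g h + (u * xvar (i + 1) - u' * xvar (i + 1 + 1)) * sig (i + 1) (g h)"
    by (simp only: lin_add[OF lin_g] lin_diff[OF lin_g] g_mult g_Const x g_sig[OF i])
qed

abbreviation Y :: "int \<Rightarrow> laurent \<Rightarrow> laurent" where "Y \<equiv> Y_op n q th"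

definition Ti_word :: "int list \<Rightarrow> laurent \<Rightarrow> laurent"
  where "Ti_word ws = foldr (\<lambda>i f. Ti i \<circ> f) ws id"

lemma Ti_word_Nil [simp]: "Ti_word [] h = h"
  and Ti_word_Cons [simp]: "Ti_word (i # ws) h = Ti i (Ti_word ws h)"
  by (simp_all add: Ti_word_def)

lemma Ti_word_append: "Ti_word (ws @ ws') h = Ti_word ws (Ti_word ws' h)"
  by (induction ws) simp_all

lemma T_word_rev_Ti_word: "T_word th (rev ws) (Ti_word ws h) = h"
  by (induction ws) (simp_all add: T_word_append)

lemma Y_1: "Y 1 h = g (T_word th (rev [1..n - 1]) h)"
  by (simp add: Y_op_def)

lemma Y_Suc: "1 \<le> i \<Longrightarrow> Y (i + 1) h = Ti i (Y i (Ti i h))"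
proof -
  assume "1 \<le> i"
  then have "nat i = Suc (nat (i - 1))" "int (nat (i - 1)) + 1 = i" by simp_all
  then show ?thesis by (simp add: Y_op_def inv_T)
qed

lemma T_Y: "1 \<le> i \<Longrightarrow> T i (Y (i + 1) h) = Y i (Ti i h)"
  by (simp add: Y_Suc)

text \<open>
  Of the inverses in the recursion for \<open>Y\<^sub>i\<close>, those on the right cancel against \<open>T\<^bsub>i-1\<^esub> \<cdots> T\<^sub>1\<close> in
  \<open>Y\<^sub>1\<close>. Each generator remains exactly once, which makes the triangularity of \<open>Y\<^sub>i\<close> visible.
\<close>

lemma Y_explicit:
  assumes "i \<in> {1..n}"
  shows "Y i h = Ti_word (rev [1..i - 1]) (g (T_word th (rev [i..n - 1]) h))"
  using assms
proof (induction "nat (i - 1)" arbitrary: i h)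
  case 0
  then show ?case by (simp add: Y_1)
next
  case (Suc d)
  define j where "j = i - 1"
  have j: "j \<in> {1..n}" "d = nat (j - 1)" "i = j + 1" "j \<le> n - 1" using Suc by (auto simp: j_def)
  have 1: "[1..j + 1 - 1] = [1..j - 1] @ [j]" using j by (simp add: upto_rec2)
  have 2: "[j..n - 1] = j # [j + 1..n - 1]" using j by (intro upto_rec1) simp
  show ?case
    using Suc.hyps(1)[OF j(2,1), of "Ti j h"] j(1)
    unfolding j(3) 1 by (simp add: Y_Suc 2 T_word_append)
qed

lemma lin_Y: "i \<in> {1..n} \<Longrightarrow> lin (Y i)"
proof -
  assume i: "i \<in> {1..n}"
  have "lin (Ti_word ws)" for ws
  proof (induction ws)
    case Nil
    then show ?case by (simp add: lin_def)
  next
    case (Cons i ws)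
    then show ?case using lin_Ti[of i] by (simp add: lin_def)
  qed
  then have "lin (Ti_word (rev [1..i - 1]) \<circ> (g \<circ> T_word th (rev [i..n - 1])))"
    by (intro lin_comp lin_g lin_T_word)
  moreover have "Y i = Ti_word (rev [1..i - 1]) \<circ> (g \<circ> T_word th (rev [i..n - 1]))"
    using Y_explicit[OF i] by (simp add: fun_eq_iff)
  ultimately show ?thesis by simp
qed

text \<open>
  On joint eigenvectors this agrees with \<open>x\<^sub>1 g\<close> up to a factor (\<open>raise_Y_n\<close>). In this form the operator
  can be moved past \<open>T\<^sub>z\<close> by \<open>T_perm_X_rot\<close>.
\<close>

definition raise :: "laurent \<Rightarrow> laurent"
  where "raise h = xvar 1 * T_word th [1..n - 1] h"

lemma T_word_commute:
  "\<forall>j\<in>set ws. j \<noteq> i \<and> j \<noteq> i + 1 \<and> i \<noteq> j + 1 \<Longrightarrow> T i (T_word th ws h) = T_word th ws (T i h)"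
  by (induction ws) (auto simp: T_commute)

text \<open>
  The factor \<open>T\<^bsub>i+1\<^esub>\<close> commutes with the generators below \<open>i\<close>, turns into \<open>T\<^sub>i\<close> by the braid relation, and
  commutes with the remaining generators.
\<close>

lemma T_word_shift:
  assumes "k \<le> i" "i < m"
  shows "T (i + 1) (T_word th [k..m] h) = T_word th [k..m] (T i h)"
proof -
  have 1: "[k..m] = [k..i - 1] @ i # (i + 1) # [i + 2..m]"
  proof -
    have "[k..m] = [k..i - 1] @ [i..m]"
      using assms upto_split1[of k i m] by simp
    also have "[i..m] = i # (i + 1) # [i + 1 + 1..m]"
      using assms by (simp add: upto_rec1)
    finally show ?thesis by (simp add: add.assoc)
  qed
  have "T (i + 1) (T_word th [k..i - 1] f) = T_word th [k..i - 1] (T (i + 1) f)" for f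
    by (rule T_word_commute) auto
  moreover have "T_word th [i + 2..m] (T i f) = T i (T_word th [i + 2..m] f)" for f
    by (rule T_word_commute[symmetric]) auto
  ultimately show ?thesis
    by (simp add: 1 T_word_append T_braid)
qed

lemma T_raise: "i \<in> {1..n - 2} \<Longrightarrow> T (i + 1) (raise h) = raise (T i h)"
  unfolding raise_def by (subst T_X_other) (auto simp: T_word_shift)

lemma T_word_rev_shift:
  assumes "k \<le> i" "i < m"
  shows "T_word th (rev [k..m]) (T (i + 1) h) = T i (T_word th (rev [k..m]) h)"
proof -
  have 1: "[k..m] = [k..i - 1] @ i # (i + 1) # [i + 2..m]"
  proof -
    have "[k..m] = [k..i - 1] @ [i..m]"
      using assms upto_split1[of k i m] by simp
    also have "[i..m] = i # (i + 1) # [i + 1 + 1..m]"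
      using assms by (simp add: upto_rec1)
    finally show ?thesis by (simp add: add.assoc)
  qed
  have "T_word th (rev [k..i - 1]) (T (i + 1) f) = T (i + 1) (T_word th (rev [k..i - 1]) f)" for f
    by (rule T_word_commute[symmetric]) auto
  moreover have "T_word th (rev [i + 2..m]) (T i f) = T i (T_word th (rev [i + 2..m]) f)" for f
    by (rule T_word_commute[symmetric]) auto
  ultimately show ?thesis
    by (simp add: 1 T_word_append T_braid[symmetric])
qed

lemma T_Y_1: "i \<in> {2..n - 1} \<Longrightarrow> T i (Y 1 h) = Y 1 (T i h)"
proof -
  assume i: "i \<in> {2..n - 1}"
  have "T_word th (rev [1..n - 1]) (T (i - 1 + 1) h) = T (i - 1) (T_word th (rev [1..n - 1]) h)"
    using i by (intro T_word_rev_shift) auto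
  then show ?thesis using g_T[of "i - 1" "T_word th (rev [1..n - 1]) h"] i by (simp add: Y_1)
qed

lemma commute_Ti:
  assumes "\<And>h. T i (A h) = A (T i h)" shows "Ti i (A h) = A (Ti i h)"
  by (metis assms T_Ti Ti_T)

text \<open>
  Induction on \<open>j\<close> by \<open>Y\<^sub>j = T\<^bsub>j-1\<^esub>\<^sup>-\<^sup>1 Y\<^bsub>j-1\<^esub> T\<^bsub>j-1\<^esub>\<^sup>-\<^sup>1\<close>. Only \<open>i = j - 2\<close> needs more than commuting
  generators: there \<open>Y\<^sub>j\<close> is expanded down to \<open>Y\<^sub>i\<close>, and the braid relation turns \<open>T\<^sub>i\<close> into \<open>T\<^bsub>i+1\<^esub>\<close>
  on one side of \<open>Y\<^sub>i\<close> and back on the other.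
\<close>

lemma T_Y_commute:
  assumes "j \<in> {1..n}" "i \<in> {1..n - 1}" "j \<noteq> i" "j \<noteq> i + 1"
  shows "T i (Y j h) = Y j (T i h)"
  using assms
proof (induction "nat (j - 1)" arbitrary: i j h rule: less_induct)
  case less
  show ?case
  proof (cases "j = 1")
    case True
    then show ?thesis using less.prems by (simp add: T_Y_1)
  next
    case False
    define k where "k = j - 1"
    have k: "k \<in> {1..n}" "j = k + 1" "nat (k - 1) < nat (j - 1)" using less.prems False by (auto simp: k_def)
    have Yj: "Y j f = Ti k (Y k (Ti k f))" for f using k by (simp add: Y_Suc)
    show ?thesis
    proof (cases "k = i + 1")
      case False
      then have "T i (Y k f) = Y k (T i f)" for f
        using less.hyps[OF k(3,1), of i f] less.prems k(2) by auto
      moreover have "T i (Ti k f) = Ti k (T i f)" for f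
        using less.prems k(2) False by (intro commute_Ti[where A = "T i", symmetric] T_commute) auto
      ultimately show ?thesis by (simp add: Yj)
    next
      case k_eq: True
      have l: "nat (i - 1) < nat (j - 1)" "i \<in> {1..n}" using k k_eq less.prems by auto
      have Yk: "Y k f = Ti i (Y i (Ti i f))" for f using k_eq less.prems by (simp add: Y_Suc)
      have com: "Ti k (Y i f) = Y i (Ti k f)" "T k (Y i f) = Y i (T k f)" for f
        using less.hyps[OF l, of k] less.prems k k_eq
        by (auto intro!: commute_Ti[where A = "Y i"])
      have braid: "T i (Ti k (Ti i f)) = Ti k (Ti i (T k f))" for f
      proof -
        have "T k (T i (T k (Ti k (Ti i f)))) = T i (T k (T i (Ti k (Ti i f))))"
          unfolding k_eq by (rule T_braid[symmetric])
        then have "T k f = T i (T k (T i (Ti k (Ti i f))))" by simp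
        then show ?thesis by (metis Ti_T)
      qed
      have braid': "Ti i (Ti k (T i f)) = T k (Ti i (Ti k f))" for f
      proof -
        have "T i (T k (T i (Ti i (Ti k f)))) = T k (T i (T k (Ti i (Ti k f))))"
          unfolding k_eq by (rule T_braid)
        then have "T i f = T k (T i (T k (Ti i (Ti k f))))" by simp
        then show ?thesis by (metis Ti_T)
      qed
      show ?thesis by (simp add: Yj Yk braid braid' com)
    qed
  qed
qed

text \<open>
  Each generator turns the variable into the next one and becomes an inverse that cancels.
\<close>

lemma T_word_X:
  assumes "1 \<le> k" "k \<le> m + 1"
  shows "T_word th (rev [k..m]) (xvar k * T_word th [k..m] h) = xvar (m + 1) * h"
  using assms
proof (induction "nat (m + 1 - k)" arbitrary: k h)
  case 0
  then show ?case by simp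
next
  case (Suc d)
  have "[k..m] = k # [k + 1..m]" using Suc by (intro upto_rec1) simp
  then show ?case using Suc.hyps(1)[of "k + 1"] Suc.prems Suc.hyps(2)
    by (simp add: T_word_append T_X)
qed

lemma Y_1_raise: "Y 1 (raise h) = Const (inverse q) * (xvar 1 * g h)"
  unfolding Y_1 raise_def using T_word_X[of 1 "n - 1" h] n
  by (simp add: g_mult g_xvar_n mult.assoc)

lemma T_word_Ti_word: "T_word th ws (Ti_word (rev ws) h) = h"
  using T_word_rev_Ti_word[of "rev ws" h] by simp

lemma raise_Y_n: "raise (Y n h) = xvar 1 * g h"
  unfolding raise_def using n by (simp add: Y_explicit T_word_Ti_word)

text \<open>
  For \<open>i > 1\<close> the claim is reduced to \<open>i - 1\<close>, because \<open>T\<^sub>i\<close> passes through \<open>raise\<close> as \<open>T\<^bsub>i-1\<^esub>\<close>. For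
  \<open>i = 1\<close> the generators \<open>T\<^bsub>n-1\<^esub> \<cdots> T\<^sub>2\<close> of \<open>Y\<^sub>2\<close> pass through those of \<open>raise\<close> as
  \<open>T\<^bsub>n-2\<^esub> \<cdots> T\<^sub>1\<close>, and \<open>g\<close> restores the indices of the generators that it passes.
\<close>

lemma Y_raise: "i \<in> {1..n - 1} \<Longrightarrow> Y (i + 1) (raise h) = raise (Y i h)"
proof (induction "nat (i - 1)" arbitrary: i h)
  case 0
  then have i: "i = 1" and n1: "1 \<le> n - 1" by auto
  define a where "a = [2..n - 1]"
  have up: "[1..n - 1] = 1 # a" unfolding a_def using n1 by (simp add: upto_rec1)
  have com: "T_word th (rev a) (xvar 1 * f) = xvar 1 * T_word th (rev a) f" for f
  proof -
    have "\<forall>j\<in>set ws. 2 \<le> j \<Longrightarrow> T_word th ws (xvar 1 * f) = xvar 1 * T_word th ws f" for ws f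
      by (induction ws) (auto simp: T_X_other)
    then show ?thesis by (simp add: a_def)
  qed
  have key: "T_word th (rev a) (T_word th [1..n - 1] f) = T_word th [1..n - 2] (T_word th (rev [1..n - 1]) f)" for f
  proof -
    have "T_word th (rev [2..m]) (T_word th [1..n - 1] f) = T_word th [1..n - 1] (T_word th (rev [1..m - 1]) f)"
      if "1 \<le> m" "m \<le> n - 1" for m f
      using that
    proof (induction "nat (m - 1)" arbitrary: m f)
      case 0
      then show ?case by simp
    next
      case (Suc d)
      have e: "[2..m] = [2..m - 1] @ [m]" "[1..m - 1] = [1..m - 1 - 1] @ [m - 1]"
        using Suc by (simp_all add: upto_rec2)
      have "T m (T_word th (rev [2..m - 1]) (T_word th [1..n - 1] f)) =
        T m (T_word th [1..n - 1] (T_word th (rev [1..m - 1 - 1]) f))"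
        using Suc.hyps(1)[of "m - 1" f] Suc.prems Suc.hyps(2) by simp
      also have "\<dots> = T_word th [1..n - 1] (T (m - 1) (T_word th (rev [1..m - 1 - 1]) f))"
        using T_word_shift[of 1 "m - 1" "n - 1"] Suc.prems Suc.hyps(2) by simp
      finally show ?case unfolding e by (simp add: T_word_append)
    qed
    from this[of "n - 1" f] have "T_word th (rev a) (T_word th [1..n - 1] f) =
        T_word th [1..n - 1] (T_word th (rev [1..n - 2]) f)"
      using n1 by (simp add: a_def)
    also have "[1..n - 1] = [1..n - 2] @ [n - 1]"
      using n1 by (simp add: upto_rec2)
    finally show ?thesis by (simp add: T_word_append \<open>[1..n - 1] = [1..n - 2] @ [n - 1]\<close>)
  qed
  have gT: "g (T_word th [1..n - 2] f) = T_word th [2..n - 1] (g f)" for f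
  proof -
    have "set ws \<subseteq> {1..n - 2} \<Longrightarrow> g (T_word th ws f) = T_word th (map (\<lambda>i. i + 1) ws) (g f)" for ws
      by (induction ws) (auto simp: g_T)
    moreover have "map (\<lambda>i. i + 1) [1..m] = [2..m + 1]" for m
    proof -
      have "map (\<lambda>i. i + 1) [k..m] = [k + 1..m + 1]" for k
        by (induction k m rule: upto.induct) (simp add: upto.simps)
      from this[of 1] show ?thesis by simp
    qed
    from this[of "n - 2"] have "map (\<lambda>i. i + 1) [1..n - 2] = [2..n - 1]" by simp
    ultimately show ?thesis by (metis set_upto order_refl)
  qed
  have "Y 2 (raise h) = Ti 1 (Y 1 (Ti 1 (raise h)))"
    using Y_Suc[of 1] by simp
  also have "\<dots> = Ti 1 (g (T_word th (rev a) (raise h)))"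
    by (simp add: Y_1 up T_word_append)
  also have "\<dots> = Ti 1 (g (xvar 1 * T_word th [1..n - 2] (T_word th (rev [1..n - 1]) h)))"
    by (simp add: raise_def com key)
  also have "\<dots> = Ti 1 (xvar 2 * T_word th [2..n - 1] (Y 1 h))"
    using n1 by (simp add: g_mult g_xvar gT Y_1)
  also have "\<dots> = raise (Y 1 h)"
    using Ti_X[of 1] by (simp add: raise_def up a_def)
  finally show ?case by (simp add: i)
next
  case (Suc d)
  define j where "j = i - 1"
  have j: "j \<in> {1..n - 1}" "i = j + 1" "d = nat (j - 1)" "j \<in> {1..n - 2}" using Suc by (auto simp: j_def)
  have TiR: "Ti (j + 1) (raise f) = raise (Ti j f)" for f
    using T_raise[OF j(4), of "Ti j f"] by (metis T_Ti Ti_T)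
  have "Y (i + 1) (raise h) = Ti i (Y i (Ti i (raise h)))"
    using Suc.prems by (simp add: Y_Suc)
  also have "\<dots> = raise (Ti j (Y j (Ti j h)))"
    using Suc.hyps(1)[OF j(3,1)] by (simp add: j(2) TiR)
  also have "\<dots> = raise (Y i h)" using j by (simp add: Y_Suc)
  finally show ?case .
qed

end

section \<open>The sorting permutation\<close>

text \<open>
  Sorting by \<open>v\<^sub>\<mu>\<close> is stable: equal entries keep their order, by minimality of the length.
\<close>

definition vless :: "expo \<Rightarrow> int \<Rightarrow> int \<Rightarrow> bool"
  where "vless \<mu> i j \<longleftrightarrow> coef \<mu> i < coef \<mu> j \<or> coef \<mu> i = coef \<mu> j \<and> i < j"

lemma finite_positions [simp]: "finite {k :: int. 1 \<le> k \<and> k \<le> n \<and> P k}"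
  by (rule finite_subset[of _ "{1..n}"]) auto

definition vrank :: "int \<Rightarrow> expo \<Rightarrow> int \<Rightarrow> int"
  where "vrank n \<mu> i = (if i \<in> {1..n} then 1 + int (card {k \<in> {1..n}. vless \<mu> k i}) else i)"

lemma vless_trans: "vless \<mu> i j \<Longrightarrow> vless \<mu> j k \<Longrightarrow> vless \<mu> i k"
  and vless_irrefl [simp]: "\<not> vless \<mu> i i"
  and vless_linear: "i \<noteq> j \<Longrightarrow> vless \<mu> i j \<or> vless \<mu> j i"
  and vless_asym: "vless \<mu> i j \<Longrightarrow> \<not> vless \<mu> j i"
  by (auto simp: vless_def)

lemma vrank_less:
  assumes "i \<in> {1..n}" "j \<in> {1..n}"
  shows "vrank n \<mu> i < vrank n \<mu> j \<longleftrightarrow> vless \<mu> i j"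
proof -
  have less: "vrank n \<mu> i < vrank n \<mu> j" if "vless \<mu> i j" "i \<in> {1..n}" "j \<in> {1..n}" for i j
  proof -
    have "{k \<in> {1..n}. vless \<mu> k i} \<subset> {k \<in> {1..n}. vless \<mu> k j}"
      using that vless_trans[of \<mu> _ i j] vless_irrefl[of \<mu> i] by blast
    then have "card {k \<in> {1..n}. vless \<mu> k i} < card {k \<in> {1..n}. vless \<mu> k j}"
      by (intro psubset_card_mono) auto
    then show ?thesis using that(2,3) by (simp add: vrank_def)
  qed
  show ?thesis
    using less[of i j] less[of j i] vless_linear[of i j \<mu>] vless_asym[of \<mu> i j] assms
    by (cases "i = j") auto
qed

lemma vrank_permutes: "vrank n \<mu> permutes {1..n}"
proof (rule bij_imp_permutes)
  have inj: "inj_on (vrank n \<mu>) {1..n}"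
  proof (rule inj_onI)
    fix i j assume ij: "i \<in> {1..n}" "j \<in> {1..n}" "vrank n \<mu> i = vrank n \<mu> j"
    then have "\<not> vless \<mu> i j" "\<not> vless \<mu> j i"
      using vrank_less[OF ij(1,2), of \<mu>] vrank_less[OF ij(2,1), of \<mu>] by auto
    then show "i = j" using vless_linear by blast
  qed
  have "vrank n \<mu> i \<in> {1..n}" if i: "i \<in> {1..n}" for i
  proof -
    have "{k \<in> {1..n}. vless \<mu> k i} \<subset> {1..n}" using i vless_irrefl[of \<mu> i] by blast
    then have "card {k \<in> {1..n}. vless \<mu> k i} < card {1..n}" by (intro psubset_card_mono) auto
    then show ?thesis using i by (simp add: vrank_def)
  qed
  then show "bij_betw (vrank n \<mu>) {1..n} {1..n}"
    using inj by (simp add: bij_betw_def endo_inj_surj image_subset_iff)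
qed (simp only: vrank_def if_False)

lemma permutation_eqI_order:
  assumes "w permutes {1..n::int}" "w' permutes {1..n}"
    and "\<And>i j. i \<in> {1..n} \<Longrightarrow> j \<in> {1..n} \<Longrightarrow> w i < w j \<longleftrightarrow> w' i < w' j"
  shows "w = w'"
proof -
  have "w \<circ> inv w' = id"
  proof (rule strict_increasing_permutation_id)
    show "w \<circ> inv w' permutes {1..n}"
      by (rule permutes_compose[OF permutes_inv[OF assms(2)] assms(1)])
    fix i assume i: "i \<in> {1..n - 1}"
    then have "inv w' i \<in> {1..n}" "inv w' (i + 1) \<in> {1..n}"
      using permutes_in_image[OF permutes_inv[OF assms(2)]] by auto
    then show "(w \<circ> inv w') i < (w \<circ> inv w') (i + 1)"
      using assms(3) by (simp add: permutes_inverses[OF assms(2)])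
  qed
  then have "w \<circ> inv w' \<circ> w' = w'" by simp
  then show ?thesis by (simp add: comp_assoc permutes_inv_o[OF assms(2)])
qed

lemma invs_determine_permutation:
  assumes "w permutes {1..n::int}" "w' permutes {1..n}" "invs n w = invs n w'"
  shows "w = w'"
proof (rule permutation_eqI_order[OF assms(1,2)])
  fix i j assume ij: "i \<in> {1..n}" "j \<in> {1..n}"
  have *: "w b < w a \<longleftrightarrow> w' b < w' a" if "a < b" "a \<in> {1..n}" "b \<in> {1..n}" for a b
    using assms(3) that by (auto simp: invs_def set_eq_iff)
  have neq: "w i \<noteq> w j" "w' i \<noteq> w' j" if "i \<noteq> j"
    using that permutes_inj[OF assms(1)] permutes_inj[OF assms(2)] by (auto simp: inj_eq)
  show "w i < w j \<longleftrightarrow> w' i < w' j"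
    using *[of i j] *[of j i] ij neq by (cases i j rule: linorder_cases) auto
qed

text \<open>
  Every permutation that sorts \<open>\<mu>\<close> inverts all pairs that \<open>vrank\<close> inverts. A sorting permutation of minimal
  length therefore has the same inversions as \<open>vrank\<close>, and the inversions determine a permutation.
\<close>

lemma vperm_eq_vrank: "vperm n \<mu> = vrank n \<mu>"
proof -
  define sorts where "sorts w \<longleftrightarrow> w permutes {1..n} \<and>
    (\<forall>i j. 1 \<le> i \<and> i \<le> j \<and> j \<le> n \<longrightarrow> coef (perm_expo w \<mu>) i \<le> coef (perm_expo w \<mu>) j)" for w
  have "sorts (vrank n \<mu>)"
    unfolding sorts_def
  proof (intro conjI allI impI)
    fix i j assume ij: "1 \<le> i \<and> i \<le> j \<and> j \<le> n"
    define a b where "a = inv (vrank n \<mu>) i" and "b = inv (vrank n \<mu>) j"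
    have "a \<in> {1..n}" "b \<in> {1..n}" "vrank n \<mu> a = i" "vrank n \<mu> b = j"
      using ij permutes_in_image[OF permutes_inv[OF vrank_permutes[of n \<mu>]]]
      by (auto simp: a_def b_def permutes_inverses[OF vrank_permutes])
    then have "\<not> vless \<mu> b a" using vrank_less[of b n a \<mu>] ij by auto
    then show "coef (perm_expo (vrank n \<mu>) \<mu>) i \<le> coef (perm_expo (vrank n \<mu>) \<mu>) j"
      by (simp add: coef_perm_expo' permutes_bij[OF vrank_permutes] a_def b_def vless_def)
  qed (rule vrank_permutes)
  moreover have vperm: "vperm n \<mu> = arg_min (perm_len n) sorts"
    by (simp add: vperm_def sorts_def[abs_def])
  ultimately have v: "sorts (vperm n \<mu>)" "perm_len n (vperm n \<mu>) \<le> perm_len n (vrank n \<mu>)"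
    using arg_min_nat_lemma[where P = sorts and m = "perm_len n" and k = "vrank n \<mu>"] by auto
  have "invs n (vrank n \<mu>) \<subseteq> invs n (vperm n \<mu>)"
  proof (clarify)
    fix i j assume "(i, j) \<in> invs n (vrank n \<mu>)"
    then have ij: "1 \<le> i" "i < j" "j \<le> n" "vless \<mu> j i"
      using vrank_less[of j n i \<mu>] by (auto simp: invs_def)
    then have lt: "coef \<mu> j < coef \<mu> i" by (auto simp: vless_def)
    let ?w = "vperm n \<mu>"
    have p: "?w permutes {1..n}" using v(1) by (simp add: sorts_def)
    have "\<not> ?w i \<le> ?w j"
    proof
      assume "?w i \<le> ?w j"
      then have "coef (perm_expo ?w \<mu>) (?w i) \<le> coef (perm_expo ?w \<mu>) (?w j)"
        using v(1) permutes_in_image[OF p, of i] permutes_in_image[OF p, of j] ij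
        by (simp add: sorts_def)
      then show False using lt by (simp add: coef_perm_expo permutes_bij[OF p])
    qed
    then show "(i, j) \<in> invs n ?w" using ij by (simp add: invs_def)
  qed
  then have "invs n (vrank n \<mu>) = invs n (vperm n \<mu>)"
    using v(2) by (intro card_seteq) (simp_all add: perm_len_eq)
  then have "vrank n \<mu> = vperm n \<mu>"
    using v(1) by (intro invs_determine_permutation) (simp_all add: sorts_def vrank_permutes)
  then show ?thesis ..
qed

lemma vperm_permutes: "vperm n \<mu> permutes {1..n}"
  unfolding vperm_eq_vrank by (rule vrank_permutes)

lemma vperm_less:
  "i \<in> {1..n} \<Longrightarrow> j \<in> {1..n} \<Longrightarrow> vperm n \<mu> i < vperm n \<mu> j \<longleftrightarrow> vless \<mu> i j"
  unfolding vperm_eq_vrank by (rule vrank_less)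

lemma vperm_count: "i \<in> {1..n} \<Longrightarrow> vperm n \<mu> i = 1 + int (card {k \<in> {1..n}. vless \<mu> k i})"
  by (simp add: vperm_eq_vrank vrank_def)

lemma vperm_eqI:
  assumes "w permutes {1..n}"
    and "\<And>i j. i \<in> {1..n} \<Longrightarrow> j \<in> {1..n} \<Longrightarrow> w i < w j \<longleftrightarrow> vless \<mu> i j"
  shows "vperm n \<mu> = w"
  by (rule permutation_eqI_order[OF vperm_permutes assms(1)]) (simp add: vperm_less assms(2))

lemma vperm_zero: "vperm n 0 = id"
  by (rule vperm_eqI[OF permutes_id]) (simp add: vless_def)

lemma vperm_sact:
  assumes "i \<in> {1..n - 1}" "coef \<nu> i \<noteq> coef \<nu> (i + 1)"
  shows "vperm n (sact i \<nu>) = vperm n \<nu> \<circ> sref i"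
proof (rule vperm_eqI)
  show "vperm n \<nu> \<circ> sref i permutes {1..n}"
    by (rule permutes_compose[OF sref_permutes[OF assms(1)] vperm_permutes])
  fix a b assume ab: "a \<in> {1..n}" "b \<in> {1..n}"
  have "vless \<nu> (sref i a) (sref i b) \<longleftrightarrow> vless (sact i \<nu>) a b"
    unfolding vless_def coef_sact
    using assms(2) by (auto simp: sref_def transpose_def)
  then show "(vperm n \<nu> \<circ> sref i) a < (vperm n \<nu> \<circ> sref i) b \<longleftrightarrow> vless (sact i \<nu>) a b"
    using vperm_less[OF sref_in[OF assms(1) ab(1)] sref_in[OF assms(1) ab(2)], of \<nu>] by simp
qed

text \<open>
  The action of \<open>\<pi>\<close>, written in the way in which \<open>x\<^sub>1 g\<close> transforms exponents.
\<close>

definition piact :: "int \<Rightarrow> expo \<Rightarrow> expo"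
  where "piact n \<nu> = perm_expo (rot 1 n) \<nu> + Poly_Mapping.single 1 1"

lemma coef_piact:
  "0 < n \<Longrightarrow> coef (piact n \<nu>) i = coef \<nu> (unrot 1 n i) + (if i = 1 then 1 else 0)"
  by (simp add: piact_def lookup_add coef_perm_expo' bij_rot inv_rot lookup_single when_def)

lemma unrot_permutes: "1 \<le> k \<Longrightarrow> k \<le> n \<Longrightarrow> unrot k n permutes {1..n}"
  using permutes_inv[OF rot_permutes[of k n]] inv_rot[of k n] by simp

lemma vperm_piact:
  assumes "0 < n"
  shows "vperm n (piact n \<nu>) = vperm n \<nu> \<circ> unrot 1 n"
proof (rule vperm_eqI)
  have p: "unrot 1 n permutes {1..n}" using assms by (intro unrot_permutes) auto
  show "vperm n \<nu> \<circ> unrot 1 n permutes {1..n}"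
    by (rule permutes_compose[OF p vperm_permutes])
  fix a b assume ab: "a \<in> {1..n}" "b \<in> {1..n}"
  then have ab': "unrot 1 n a \<in> {1..n}" "unrot 1 n b \<in> {1..n}"
    using permutes_in_image[OF p] by blast+
  have "vless \<nu> (unrot 1 n a) (unrot 1 n b) \<longleftrightarrow> vless (piact n \<nu>) a b"
    unfolding vless_def coef_piact[OF assms] using ab by (auto simp: unrot_def)
  then show "(vperm n \<nu> \<circ> unrot 1 n) a < (vperm n \<nu> \<circ> unrot 1 n) b \<longleftrightarrow> vless (piact n \<nu>) a b"
    using vperm_less[OF ab', of \<nu>] by simp
qed

lemma vperm_Suc_eq:
  assumes "i \<in> {1..n - 1}" "coef \<nu> i = coef \<nu> (i + 1)"
  shows "vperm n \<nu> (i + 1) = vperm n \<nu> i + 1"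
proof -
  have "{k \<in> {1..n}. vless \<nu> k (i + 1)} = insert i {k \<in> {1..n}. vless \<nu> k i}"
    using assms by (auto simp: vless_def)
  moreover have "i \<notin> {k \<in> {1..n}. vless \<nu> k i}" "finite {k \<in> {1..n}. vless \<nu> k i}" by simp_all
  ultimately have "card {k \<in> {1..n}. vless \<nu> k (i + 1)} = Suc (card {k \<in> {1..n}. vless \<nu> k i})"
    by (metis card_insert_disjoint)
  then show ?thesis using assms(1) vperm_count[of i n \<nu>] vperm_count[of "i + 1" n \<nu>] by simp
qed

text \<open>
  Moving the last letter of \<open>w\<close> to the front removes the \<open>n - w n\<close> inversions with larger letters and
  creates \<open>w n - 1\<close> inversions with smaller ones.
\<close>

lemma perm_len_unrot:
  assumes "0 < n" "w permutes {1..n}"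
  shows "int (perm_len n (w \<circ> unrot 1 n)) = int (perm_len n w) + 2 * w n - n - 1"
proof -
  let ?w = "w \<circ> unrot 1 n"
  have wn: "w n \<in> {1..n}" using assms permutes_in_image[OF assms(2), of n] by simp
  have inj: "inj w" using permutes_inj[OF assms(2)] .
  have img: "w ` ({1..n} - {n}) = {1..n} - {w n}"
    unfolding image_set_diff[OF inj] permutes_image[OF assms(2)] by simp
  have greater: "int (card {i \<in> {1..n} - {n}. w n < w i}) = n - w n"
  proof -
    have "w ` {i \<in> {1..n} - {n}. w n < w i} = {y \<in> w ` ({1..n} - {n}). w n < y}" by blast
    also have "\<dots> = {w n + 1..n}" unfolding img using wn by auto
    finally have "w ` {i \<in> {1..n} - {n}. w n < w i} = {w n + 1..n}" .
    then have "card {i \<in> {1..n} - {n}. w n < w i} = card {w n + 1..n}"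
      using card_image[OF inj_on_subset[OF inj subset_UNIV]] by metis
    then show ?thesis using wn by simp
  qed
  have smaller: "int (card {i \<in> {1..n} - {n}. w i < w n}) = w n - 1"
  proof -
    have "w ` {i \<in> {1..n} - {n}. w i < w n} = {y \<in> w ` ({1..n} - {n}). y < w n}" by blast
    also have "\<dots> = {1..w n - 1}" unfolding img using wn by auto
    finally have "w ` {i \<in> {1..n} - {n}. w i < w n} = {1..w n - 1}" .
    then have "card {i \<in> {1..n} - {n}. w i < w n} = card {1..w n - 1}"
      using card_image[OF inj_on_subset[OF inj subset_UNIV]] by metis
    then show ?thesis using wn by simp
  qed
  have "invs n w = invs (n - 1) w \<union> (\<lambda>i. (i, n)) ` {i \<in> {1..n} - {n}. w n < w i}"
  proof (intro set_eqI)
    fix p :: "int \<times> int"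
    obtain i j where p: "p = (i, j)" by fastforce
    show "p \<in> invs n w \<longleftrightarrow> p \<in> invs (n - 1) w \<union> (\<lambda>i. (i, n)) ` {i \<in> {1..n} - {n}. w n < w i}"
      unfolding p by (cases "j = n") (auto simp: invs_def)
  qed
  moreover have "invs (n - 1) w \<inter> (\<lambda>i. (i, n)) ` {i \<in> {1..n} - {n}. w n < w i} = {}"
    by (auto simp: invs_def)
  ultimately have 1: "perm_len n w = perm_len (n - 1) w + card {i \<in> {1..n} - {n}. w n < w i}"
    by (simp add: perm_len_eq card_Un_disjoint card_image inj_on_def)
  have u: "unrot 1 n 1 = n" "\<And>i. 1 < i \<Longrightarrow> i \<le> n \<Longrightarrow> unrot 1 n i = i - 1"
    by (auto simp: unrot_def)
  have "invs n ?w = (\<lambda>(i, j). (i + 1, j + 1)) ` invs (n - 1) w \<union>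
    (\<lambda>i. (1, i + 1)) ` {i \<in> {1..n} - {n}. w i < w n}" (is "?L = ?R")
  proof (intro equalityI subsetI)
    fix p assume "p \<in> ?L"
    then obtain i j where p: "p = (i, j)" and ij: "1 \<le> i" "i < j" "j \<le> n" "?w j < ?w i"
      by (auto simp: invs_def)
    show "p \<in> ?R"
    proof (cases "i = 1")
      case True
      then have "j - 1 \<in> {i \<in> {1..n} - {n}. w i < w n}" using ij u by auto
      then have "(1::int, j - 1 + 1) \<in> (\<lambda>i. (1, i + 1)) ` {i \<in> {1..n} - {n}. w i < w n}" by (rule imageI)
      moreover have "(1::int, j - 1 + 1) = p" using True p by simp
      ultimately have "p \<in> (\<lambda>i. (1::int, i + 1)) ` {i \<in> {1..n} - {n}. w i < w n}" by (simp only:)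
      then show ?thesis by (rule UnI2)
    next
      case False
      then have "(i - 1, j - 1) \<in> invs (n - 1) w" using ij u by (auto simp: invs_def)
      then have "(case (i - 1, j - 1) of (i, j) \<Rightarrow> (i + 1, j + 1)) \<in> (\<lambda>(i, j). (i + 1, j + 1)) ` invs (n - 1) w"
        by (rule imageI)
      then show ?thesis using p by simp
    qed
  next
    fix p assume "p \<in> ?R"
    then show "p \<in> ?L" using u by (auto simp: invs_def)
  qed
  moreover have disjoint: "(\<lambda>(i, j). (i + 1, j + 1)) ` invs (n - 1) w \<inter>
    (\<lambda>i. (1, i + 1)) ` {i \<in> {1..n} - {n}. w i < w n} = {}"
    by (auto simp: invs_def)
  moreover have "card ((\<lambda>(i, j). (i + 1, j + 1)) ` invs (n - 1) w) = card (invs (n - 1) w)"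
    by (intro card_image) (auto simp: inj_on_def)
  moreover have "card ((\<lambda>i. (1 :: int, i + 1)) ` {i \<in> {1..n} - {n}. w i < w n}) =
      card {i \<in> {1..n} - {n}. w i < w n}"
    by (intro card_image) (auto simp: inj_on_def)
  moreover have "finite {i \<in> {1..n} - {n}. w i < w n}" by simp
  ultimately have 2: "perm_len n ?w = perm_len (n - 1) w + card {i \<in> {1..n} - {n}. w i < w n}"
    unfolding perm_len_eq by (simp only: card_Un_disjoint finite_imageI finite_invs finite_Diff finite_atLeastAtMost_int finite_Collect_conjI Collect_mem_eq simp_thms)
  show ?thesis using 1 2 greater smaller by linarith
qed

section \<open>Triangularity of the Cherednik operators\<close>

definition sqn :: "int \<Rightarrow> expo \<Rightarrow> int"
  where "sqn n \<nu> = (\<Sum>i\<in>{1..n}. (coef \<nu> i)\<^sup>2)"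

definition wsum :: "int \<Rightarrow> expo \<Rightarrow> int"
  where "wsum n \<nu> = (\<Sum>i\<in>{1..n}. i * coef \<nu> i)"

text \<open>
  The exponents of \<open>T\<^sub>i x\<^sup>\<nu>\<close> lie on the string between \<open>\<nu>\<close> and \<open>s\<^sub>i \<nu>\<close>. Those in the interior have
  smaller norm by convexity, and the weighted sum separates the two ends.
\<close>

definition lower :: "int \<Rightarrow> expo \<Rightarrow> expo \<Rightarrow> bool"
  where "lower n \<kappa> \<nu> \<longleftrightarrow> sqn n \<kappa> < sqn n \<nu> \<or> sqn n \<kappa> = sqn n \<nu> \<and> wsum n \<kappa> < wsum n \<nu>"

lemma lower_trans: "lower n \<kappa> \<mu> \<Longrightarrow> lower n \<mu> \<nu> \<Longrightarrow> lower n \<kappa> \<nu>"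
  and lower_irrefl [simp]: "\<not> lower n \<nu> \<nu>"
  by (auto simp: lower_def)

lemma sqn_perm: "w permutes {1..n} \<Longrightarrow> sqn n (perm_expo w \<nu>) = sqn n \<nu>"
  unfolding sqn_def
  by (subst sum.permute[of w]) (simp_all add: coef_perm_expo permutes_bij comp_def)

lemma Zn_perm: "w permutes {1..n} \<Longrightarrow> \<nu> \<in> Zn n \<Longrightarrow> perm_expo w \<nu> \<in> Zn n"
  unfolding Zn_coef using permutes_in_image[OF permutes_inv, of w "{1..n}"]
  by (metis coef_perm_expo' permutes_bij)

lemma perm_expo_inv [simp]:
  "bij w \<Longrightarrow> perm_expo (inv w) (perm_expo w \<nu>) = \<nu>"
  "bij w \<Longrightarrow> perm_expo w (perm_expo (inv w) \<nu>) = \<nu>"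
  by (rule poly_mapping_eqI, simp add: coef_perm_expo' bij_imp_bij_inv inv_inv_eq bij_is_inj bij_is_surj surj_f_inv_f)+

lemma wsum_transpose:
  assumes "p \<in> {1..n}" "r \<in> {1..n}" "p < r" "coef \<kappa> p < coef \<kappa> r"
  shows "wsum n (perm_expo (transpose p r) \<kappa>) < wsum n \<kappa>"
proof -
  have c: "coef (perm_expo (transpose p r) \<kappa>) i = coef \<kappa> (transpose p r i)" for i
    by (simp add: coef_perm_expo')
  have "wsum n (perm_expo (transpose p r) \<kappa>) =
    p * coef \<kappa> r + r * coef \<kappa> p + (\<Sum>i\<in>{1..n} - {p, r}. i * coef \<kappa> (transpose p r i))"
    unfolding wsum_def c using assms by (subst sum_two_off[of _ p r]) auto
  moreover have "wsum n \<kappa> = p * coef \<kappa> p + r * coef \<kappa> r + (\<Sum>i\<in>{1..n} - {p, r}. i * coef \<kappa> i)"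
    unfolding wsum_def using assms by (subst sum_two_off[of _ p r]) auto
  moreover have "(\<Sum>i\<in>{1..n} - {p, r}. i * coef \<kappa> (transpose p r i)) = (\<Sum>i\<in>{1..n} - {p, r}. i * coef \<kappa> i)"
    by (intro sum.cong) (auto simp: transpose_def)
  moreover have "0 < (r - p) * (coef \<kappa> r - coef \<kappa> p)" using assms by simp
  ultimately show ?thesis by (simp add: algebra_simps)
qed

lemma sqn_root_string:
  assumes "i \<in> {1..n - 1}" "0 < k" "k < coef \<nu> i - coef \<nu> (i + 1)"
  shows "sqn n (\<nu> - frag_cmul k (root i)) < sqn n \<nu>"
proof -
  let ?\<kappa> = "\<nu> - frag_cmul k (root i)"
  have c: "coef ?\<kappa> i = coef \<nu> i - k" "coef ?\<kappa> (i + 1) = coef \<nu> (i + 1) + k"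
    "j \<noteq> i \<Longrightarrow> j \<noteq> i + 1 \<Longrightarrow> coef ?\<kappa> j = coef \<nu> j" for j
    by (simp_all add: lookup_minus lookup_single when_def)
  have "sqn n ?\<kappa> = (coef \<nu> i - k)\<^sup>2 + (coef \<nu> (i + 1) + k)\<^sup>2 + (\<Sum>j\<in>{1..n} - {i, i + 1}. (coef ?\<kappa> j)\<^sup>2)"
    unfolding sqn_def using assms(1) by (subst sum_two_off[of _ i "i + 1"]) (auto simp: c)
  moreover have "sqn n \<nu> = (coef \<nu> i)\<^sup>2 + (coef \<nu> (i + 1))\<^sup>2 + (\<Sum>j\<in>{1..n} - {i, i + 1}. (coef \<nu> j)\<^sup>2)"
    unfolding sqn_def using assms(1) by (subst sum_two_off[of _ i "i + 1"]) auto
  moreover have "(\<Sum>j\<in>{1..n} - {i, i + 1}. (coef ?\<kappa> j)\<^sup>2) = (\<Sum>j\<in>{1..n} - {i, i + 1}. (coef \<nu> j)\<^sup>2)"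
    by (intro sum.cong refl) (use c in auto)
  moreover have "0 < k * (coef \<nu> i - coef \<nu> (i + 1) - k)" using assms by simp
  ultimately show ?thesis by (simp add: power2_eq_square algebra_simps)
qed

text \<open>
  The twist by \<open>w\<close> records how the factors of \<open>Y\<^sub>i\<close> that have been applied so far permute the exponents.
\<close>

definition low :: "int \<Rightarrow> (int \<Rightarrow> int) \<Rightarrow> expo \<Rightarrow> laurent set"
  where "low n w \<nu> = {r. \<forall>\<kappa>\<in>supp r. \<kappa> \<in> Zn n \<and> lower n (perm_expo (inv w) \<kappa>) \<nu>}"

lemma low_0 [simp]: "0 \<in> low n w \<nu>"
  by (simp add: low_def)

lemma low_add: "f \<in> low n w \<nu> \<Longrightarrow> g \<in> low n w \<nu> \<Longrightarrow> f + g \<in> low n w \<nu>"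
  unfolding low_def using keys_add[of f g] by blast

lemma low_Const: "f \<in> low n w \<nu> \<Longrightarrow> Const c * f \<in> low n w \<nu>"
  unfolding low_def by (auto simp: in_keys_iff)

lemma low_sum: "(\<And>i. i \<in> S \<Longrightarrow> f i \<in> low n w \<nu>) \<Longrightarrow> (\<Sum>i\<in>S. f i) \<in> low n w \<nu>"
  by (induction S rule: infinite_finite_induct) (simp_all add: low_add)

lemma low_xpow: "\<kappa> \<in> Zn n \<Longrightarrow> lower n (perm_expo (inv w) \<kappa>) \<nu> \<Longrightarrow> xpow \<kappa> \<in> low n w \<nu>"
  by (simp add: low_def)

lemma low_mono: "lower n \<kappa> \<nu> \<Longrightarrow> low n w \<kappa> \<subseteq> low n w \<nu>"
  unfolding low_def using lower_trans by blast

text \<open>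
  Triangularity of an operator that moves the leading exponent from \<open>v \<kappa>\<close> to \<open>w \<kappa>\<close>. The single factors of
  \<open>Y\<^sub>i\<close> move exponents by reflections and cycles, which cancel in the product.
\<close>

definition triop ::
  "int \<Rightarrow> (laurent \<Rightarrow> laurent) \<Rightarrow> (int \<Rightarrow> int) \<Rightarrow> (int \<Rightarrow> int) \<Rightarrow> (expo \<Rightarrow> complex) \<Rightarrow> bool"
  where "triop n A v w \<phi> \<longleftrightarrow> lin A \<and> v permutes {1..n} \<and>
    (\<forall>\<kappa>\<in>Zn n. \<exists>r\<in>low n w \<kappa>. A (xpow (perm_expo v \<kappa>)) = Const (\<phi> \<kappa>) * xpow (perm_expo w \<kappa>) + r)"

lemma triop_low:
  assumes "triop n A v w \<phi>" "w permutes {1..n}" "f \<in> low n v \<nu>"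
  shows "A f \<in> low n w \<nu>"
proof -
  have A: "lin A" and v: "v permutes {1..n}" using assms(1) by (simp_all add: triop_def)
  have "A (xpow \<kappa>') \<in> low n w \<nu>" if "\<kappa>' \<in> supp f" for \<kappa>'
  proof -
    define \<kappa> where "\<kappa> = perm_expo (inv v) \<kappa>'"
    have \<kappa>': "\<kappa>' = perm_expo v \<kappa>" using v by (simp add: \<kappa>_def permutes_bij)
    have \<kappa>: "\<kappa> \<in> Zn n" "lower n \<kappa> \<nu>"
      using assms(3) that Zn_perm[OF permutes_inv[OF v]] by (auto simp: low_def \<kappa>_def)
    then obtain r where r: "r \<in> low n w \<kappa>" "A (xpow \<kappa>') = Const (\<phi> \<kappa>) * xpow (perm_expo w \<kappa>) + r"
      using assms(1) \<kappa>' by (auto simp: triop_def)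
    have "xpow (perm_expo w \<kappa>) \<in> low n w \<nu>"
      using \<kappa> assms(2) by (intro low_xpow Zn_perm) (simp_all add: permutes_bij)
    then show ?thesis
      using r low_mono[OF \<kappa>(2)] by (auto intro: low_add low_Const)
  qed
  then show ?thesis
    unfolding lin_expansion[OF A, of f] by (intro low_sum low_Const)
qed

lemma triop_comp:
  assumes "triop n A v w \<phi>" "triop n B w x \<psi>" "x permutes {1..n}"
  shows "triop n (B \<circ> A) v x (\<lambda>\<kappa>. \<psi> \<kappa> * \<phi> \<kappa>)"
  unfolding triop_def
proof (intro conjI ballI)
  have A: "lin A" "v permutes {1..n}" using assms(1) by (simp_all add: triop_def)
  have B: "lin B" "w permutes {1..n}" using assms(2) by (simp_all add: triop_def)
  show "lin (B \<circ> A)" "v permutes {1..n}" using A B by (simp_all add: lin_comp)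
  fix \<kappa> assume \<kappa>: "\<kappa> \<in> Zn n"
  obtain r where r: "r \<in> low n w \<kappa>" "A (xpow (perm_expo v \<kappa>)) = Const (\<phi> \<kappa>) * xpow (perm_expo w \<kappa>) + r"
    using assms(1) \<kappa> unfolding triop_def by blast
  obtain s where s: "s \<in> low n x \<kappa>" "B (xpow (perm_expo w \<kappa>)) = Const (\<psi> \<kappa>) * xpow (perm_expo x \<kappa>) + s"
    using assms(2) \<kappa> unfolding triop_def by blast
  have "(B \<circ> A) (xpow (perm_expo v \<kappa>)) =
    Const (\<psi> \<kappa> * \<phi> \<kappa>) * xpow (perm_expo x \<kappa>) + (Const (\<phi> \<kappa>) * s + B r)"
    using r(2) s(2) B(1) by (simp add: lin_add lin_Const Const_mult algebra_simps)
  moreover have "Const (\<phi> \<kappa>) * s + B r \<in> low n x \<kappa>"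
    by (intro low_add low_Const s(1) triop_low[OF assms(2,3) r(1)])
  ultimately show "\<exists>r\<in>low n x \<kappa>. (B \<circ> A) (xpow (perm_expo v \<kappa>)) =
      Const (\<psi> \<kappa> * \<phi> \<kappa>) * xpow (perm_expo x \<kappa>) + r" by blast
qed

context hecke begin

text \<open>
  The interior of the string has smaller norm. Modulo such terms \<open>T\<^sub>i\<close> acts on the span of \<open>x\<^sup>\<nu>\<close> and its
  reflection as in the regular representation of the Hecke algebra of one reflection.
\<close>

lemma T_xpow_greater:
  assumes "i \<in> {1..n - 1}" "\<nu> \<in> Zn n" "coef \<nu> (i + 1) < coef \<nu> i"
  shows "\<exists>R. (\<forall>\<kappa>\<in>supp R. \<kappa> \<in> Zn n \<and> sqn n \<kappa> < sqn n \<nu>) \<and>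
    T i (xpow \<nu>) = u' * xpow (sact i \<nu>) + R"
proof -
  define e where "e = nat (coef \<nu> i - coef \<nu> (i + 1) - 1)"
  have e: "coef \<nu> i - coef \<nu> (i + 1) = int e + 1" using assms(3) by (simp add: e_def)
  let ?P = "\<lambda>k. xpow (\<nu> - frag_cmul k (root i))"
  define S where "S = (\<Sum>k = 1..<int e + 1. ?P k)"
  have tel: "(xvar i - xvar (i + 1)) * S = xvar (i + 1) * (xpow \<nu> - ?P (int e))"
    unfolding S_def by (rule root_string_telescope)
  have step: "xvar i * ?P (int e + 1) = xvar (i + 1) * ?P (int e)"
    by (rule root_string_step)
  have s: "sact i \<nu> = \<nu> - frag_cmul (int e + 1) (root i)" by (simp add: sact_eq e)
  have R: "T i (xpow \<nu>) = u' * xpow (sact i \<nu>) + (u' - u) * S"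
    by (rule T_eqI) (use tel step u_u' in \<open>simp only: perm_laurent_xpow s, algebra\<close>)
  have "\<kappa> \<in> Zn n \<and> sqn n \<kappa> < sqn n \<nu>" if "\<kappa> \<in> supp ((u' - u) * S)" for \<kappa>
  proof -
    have "\<kappa> \<in> supp S" using that
      by (auto simp: in_keys_iff Const_diff[symmetric])
    then have "\<kappa> \<in> (\<Union>k\<in>{1..<int e + 1}. supp (?P k))"
      using keys_sum[of ?P "{1..<int e + 1}"] unfolding S_def by blast
    then obtain k where k: "1 \<le> k" "k < int e + 1" "\<kappa> = \<nu> - frag_cmul k (root i)"
      by auto
    have "\<kappa> \<in> Zn n"
      using assms(1,2) unfolding Zn_coef k(3) by (auto simp: lookup_minus lookup_single when_def)
    then show ?thesis using sqn_root_string[OF assms(1), of k \<nu>] k e by simp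
  qed
  then show ?thesis using R by blast
qed

lemma sact_sact [simp]: "sact i (sact i \<nu>) = \<nu>"
  by (simp add: perm_expo_comp[symmetric])

lemma T_xpow_less:
  assumes "i \<in> {1..n - 1}" "\<nu> \<in> Zn n" "coef \<nu> i < coef \<nu> (i + 1)"
  shows "\<exists>R. (\<forall>\<kappa>\<in>supp R. \<kappa> \<in> Zn n \<and> sqn n \<kappa> < sqn n \<nu>) \<and>
    T i (xpow \<nu>) = u * xpow (sact i \<nu>) + (u - u') * xpow \<nu> + R"
proof -
  have "sact i \<nu> \<in> Zn n" by (intro Zn_perm sref_permutes assms)
  moreover have "coef (sact i \<nu>) (i + 1) < coef (sact i \<nu>) i"
    unfolding coef_sact using assms(3) by simp
  ultimately obtain R where R: "\<forall>\<kappa>\<in>supp R. \<kappa> \<in> Zn n \<and> sqn n \<kappa> < sqn n (sact i \<nu>)"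
    "T i (xpow (sact i \<nu>)) = u' * xpow (sact i (sact i \<nu>)) + R"
    using T_xpow_greater[OF assms(1)] by blast
  \<comment> \<open>The symmetric sum is an eigenvector, which reduces the claim to the previous case for \<open>s\<^sub>i \<nu>\<close>.\<close>
  have "T i (xpow \<nu> + xpow (sact i \<nu>)) = u * (xpow \<nu> + xpow (sact i \<nu>))"
    by (rule T_invariant) (simp add: sig_add)
  then have "T i (xpow \<nu>) = u * xpow (sact i \<nu>) + (u - u') * xpow \<nu> + (- R)"
    using R(2) by (simp add: T_add algebra_simps)
  moreover have "\<forall>\<kappa>\<in>supp (- R). \<kappa> \<in> Zn n \<and> sqn n \<kappa> < sqn n \<nu>"
    using R(1) unfolding sqn_perm[OF sref_permutes[OF assms(1)]] by (simp add: in_keys_iff)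
  ultimately show ?thesis by blast
qed

lemma T_xpow_equal:
  "coef \<nu> i = coef \<nu> (i + 1) \<Longrightarrow> T i (xpow \<nu>) = u * xpow \<nu>" "coef \<nu> i = coef \<nu> (i + 1) \<Longrightarrow> sact i \<nu> = \<nu>"
  by (simp_all add: sact_eq T_invariant)

lemma low_smaller_norm:
  assumes "\<forall>\<kappa>'\<in>supp R. \<kappa>' \<in> Zn n \<and> sqn n \<kappa>' < sqn n (perm_expo v \<kappa>)"
    "v permutes {1..n}" "w permutes {1..n}"
  shows "R \<in> low n w \<kappa>"
  using assms(1) sqn_perm[OF assms(2)] sqn_perm[OF permutes_inv[OF assms(3)]]
  by (simp add: low_def lower_def)

text \<open>
  Undoing the twist by \<open>s\<^sub>j v\<close> instead of \<open>v\<close> exchanges two entries of \<open>\<kappa>\<close>, and in both cases the larger one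
  moves to the left, which lowers the weighted sum.
\<close>

lemma low_swap:
  assumes "j \<in> {1..n - 1}" "v permutes {1..n}" "\<kappa> \<in> Zn n"
    "inv v j < inv v (j + 1) \<and> coef \<kappa> (inv v j) < coef \<kappa> (inv v (j + 1)) \<or>
     inv v (j + 1) < inv v j \<and> coef \<kappa> (inv v (j + 1)) < coef \<kappa> (inv v j)"
  shows "xpow (perm_expo v \<kappa>) \<in> low n (sref j \<circ> v) \<kappa>"
proof -
  let ?p = "inv v j" and ?r = "inv v (j + 1)"
  have pr: "?p \<in> {1..n}" "?r \<in> {1..n}"
    using assms(1) permutes_in_image[OF permutes_inv[OF assms(2)]] by auto
  define \<rho> where "\<rho> = perm_expo (transpose ?p ?r) \<kappa>"
  have b: "bij v" using assms(2) permutes_bij by blast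
  have "inv (sref j \<circ> v) \<circ> v = transpose ?p ?r"
  proof
    fix x
    show "(inv (sref j \<circ> v) \<circ> v) x = transpose ?p ?r x"
    proof -
      have vx: "v x = k \<longleftrightarrow> x = inv v k" for k
        using permutes_inverses[OF assms(2)] by metis
      have inv: "inv v (v x) = x" by (rule permutes_inverses(2)[OF assms(2)])
      have "(inv (sref j \<circ> v) \<circ> v) x = inv v (sref j (v x))"
        unfolding inv_sref_comp[OF assms(2)] by simp
      also have "\<dots> = transpose ?p ?r x"
      proof -
        consider "v x = j" | "v x = j + 1" | "v x \<noteq> j" "v x \<noteq> j + 1" by blast
        then show ?thesis
        proof cases
          case 1
          then show ?thesis using vx[of j] by simp
        next
          case 2
          then show ?thesis using vx[of "j + 1"] by simp
        next
          case 3
          then show ?thesis using vx[of j] vx[of "j + 1"] inv by (simp add: sref_other)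
        qed
      qed
      finally show ?thesis .
    qed
  qed
  then have "perm_expo (inv (sref j \<circ> v)) (perm_expo v \<kappa>) = \<rho>"
    using perm_expo_comp[OF bij_imp_bij_inv[OF bij_comp[OF b bij_sref]] b, of j \<kappa>]
    by (simp only: \<rho>_def)
  moreover have "lower n \<rho> \<kappa>"
    unfolding lower_def \<rho>_def
    using wsum_transpose[OF pr, of \<kappa>] wsum_transpose[OF pr(2,1), of \<kappa>] assms(4)
      sqn_perm[OF permutes_swap_id[OF pr], of \<kappa>] by (auto simp: transpose_commute)
  ultimately show ?thesis
    using Zn_perm[OF assms(2,3)] by (intro low_xpow) simp_all
qed

text \<open>
  The additional term \<open>x\<^sup>\<nu>\<close> of \<open>T\<^sub>j x\<^sup>\<nu>\<close> occurs for \<open>\<nu>\<^sub>j < \<nu>\<^bsub>j+1\<^esub>\<close>. It is lower by \<open>low_swap\<close> if \<open>s\<^sub>j v\<close> is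
  longer than \<open>v\<close>. For \<open>T\<^sub>j\<^sup>-\<^sup>1\<close> the additional term occurs for \<open>\<nu>\<^sub>j > \<nu>\<^bsub>j+1\<^esub>\<close>, whence the opposite
  condition on \<open>v\<close> in \<open>triop_Ti\<close>.
\<close>

lemma triop_T:
  assumes "j \<in> {1..n - 1}" "v permutes {1..n}" "inv v j < inv v (j + 1)"
  shows "triop n (T j) v (sref j \<circ> v)
    (\<lambda>\<kappa>. if coef \<kappa> (inv v (j + 1)) < coef \<kappa> (inv v j) then inverse th else th)"
  unfolding triop_def
proof (intro conjI ballI lin_T assms(2))
  fix \<kappa> assume \<kappa>: "\<kappa> \<in> Zn n"
  let ?\<nu> = "perm_expo v \<kappa>" and ?w = "sref j \<circ> v"
  let ?\<phi> = "if coef \<kappa> (inv v (j + 1)) < coef \<kappa> (inv v j) then inverse th else th"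
  have b: "bij v" using assms(2) permutes_bij by blast
  have w: "?w permutes {1..n}" by (rule permutes_compose[OF assms(2) sref_permutes[OF assms(1)]])
  have \<nu>: "?\<nu> \<in> Zn n" "coef ?\<nu> k = coef \<kappa> (inv v k)" for k
    using Zn_perm[OF assms(2) \<kappa>] b by (simp_all add: coef_perm_expo')
  have s: "sact j ?\<nu> = perm_expo ?w \<kappa>" using b by (simp add: perm_expo_comp)
  show "\<exists>r\<in>low n ?w \<kappa>. T j (xpow ?\<nu>) = Const ?\<phi> * xpow (perm_expo ?w \<kappa>) + r"
  proof (cases "coef ?\<nu> j" "coef ?\<nu> (j + 1)" rule: linorder_cases)
    case greater
    obtain R where R: "\<forall>\<kappa>'\<in>supp R. \<kappa>' \<in> Zn n \<and> sqn n \<kappa>' < sqn n ?\<nu>"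
      "T j (xpow ?\<nu>) = u' * xpow (sact j ?\<nu>) + R"
      using T_xpow_greater[OF assms(1) \<nu>(1) greater] by blast
    show ?thesis
      using greater R(2) low_smaller_norm[OF R(1) assms(2) w] unfolding s \<nu>(2) by (intro bexI[of _ R]) simp_all
  next
    case equal
    then show ?thesis
      using T_xpow_equal[OF equal] unfolding s \<nu>(2) by (intro bexI[of _ 0]) simp_all
  next
    case less
    obtain R where R: "\<forall>\<kappa>'\<in>supp R. \<kappa>' \<in> Zn n \<and> sqn n \<kappa>' < sqn n ?\<nu>"
      "T j (xpow ?\<nu>) = u * xpow (sact j ?\<nu>) + (u - u') * xpow ?\<nu> + R"
      using T_xpow_less[OF assms(1) \<nu>(1) less] by blast
    have "(u - u') * xpow ?\<nu> + R \<in> low n ?w \<kappa>"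
      unfolding Const_diff[symmetric]
      using low_smaller_norm[OF R(1) assms(2) w] low_swap[OF assms(1,2) \<kappa>] less \<nu>(2) assms(3)
      by (intro low_add low_Const) simp_all
    then show ?thesis
      using less R(2) unfolding s \<nu>(2) by (intro bexI[of _ "(u - u') * xpow ?\<nu> + R"]) simp_all
  qed
qed

lemma triop_Ti:
  assumes "j \<in> {1..n - 1}" "v permutes {1..n}" "inv v (j + 1) < inv v j"
  shows "triop n (Ti j) v (sref j \<circ> v)
    (\<lambda>\<kappa>. if coef \<kappa> (inv v (j + 1)) \<le> coef \<kappa> (inv v j) then inverse th else th)"
  unfolding triop_def
proof (intro conjI ballI lin_Ti assms(2))
  fix \<kappa> assume \<kappa>: "\<kappa> \<in> Zn n"
  let ?\<nu> = "perm_expo v \<kappa>" and ?w = "sref j \<circ> v"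
  let ?\<phi> = "if coef \<kappa> (inv v (j + 1)) \<le> coef \<kappa> (inv v j) then inverse th else th"
  have b: "bij v" using assms(2) permutes_bij by blast
  have w: "?w permutes {1..n}" by (rule permutes_compose[OF assms(2) sref_permutes[OF assms(1)]])
  have \<nu>: "?\<nu> \<in> Zn n" "coef ?\<nu> k = coef \<kappa> (inv v k)" for k
    using Zn_perm[OF assms(2) \<kappa>] b by (simp_all add: coef_perm_expo')
  have s: "sact j ?\<nu> = perm_expo ?w \<kappa>" using b by (simp add: perm_expo_comp)
  show "\<exists>r\<in>low n ?w \<kappa>. Ti j (xpow ?\<nu>) = Const ?\<phi> * xpow (perm_expo ?w \<kappa>) + r"
  proof (cases "coef ?\<nu> j" "coef ?\<nu> (j + 1)" rule: linorder_cases)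
    case greater
    obtain R where R: "\<forall>\<kappa>'\<in>supp R. \<kappa>' \<in> Zn n \<and> sqn n \<kappa>' < sqn n ?\<nu>"
      "T j (xpow ?\<nu>) = u' * xpow (sact j ?\<nu>) + R"
      using T_xpow_greater[OF assms(1) \<nu>(1) greater] by blast
    have "(u' - u) * xpow ?\<nu> + R \<in> low n ?w \<kappa>"
      unfolding Const_diff[symmetric]
      using low_smaller_norm[OF R(1) assms(2) w] low_swap[OF assms(1,2) \<kappa>] greater \<nu>(2) assms(3)
      by (intro low_add low_Const) simp_all
    then show ?thesis
      using greater R(2) unfolding s \<nu>(2)
      by (intro bexI[of _ "(u' - u) * xpow ?\<nu> + R"]) (simp_all add: Ti_def algebra_simps)
  next
    case equal
    then show ?thesis
      using T_xpow_equal[OF equal] unfolding s \<nu>(2)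
      by (intro bexI[of _ 0]) (simp_all add: Ti_def algebra_simps)
  next
    case less
    obtain R where R: "\<forall>\<kappa>'\<in>supp R. \<kappa>' \<in> Zn n \<and> sqn n \<kappa>' < sqn n ?\<nu>"
      "T j (xpow ?\<nu>) = u * xpow (sact j ?\<nu>) + (u - u') * xpow ?\<nu> + R"
      using T_xpow_less[OF assms(1) \<nu>(1) less] by blast
    show ?thesis
      using less R(2) low_smaller_norm[OF R(1) assms(2) w] unfolding s \<nu>(2)
      by (intro bexI[of _ R]) (simp_all add: Ti_def)
  qed
qed

end

section \<open>Joint eigenvectors\<close>

context macdonald begin

text \<open>
  The contribution of position \<open>k\<close> to the eigenvalue of \<open>Y\<^sub>i\<close> with leading exponent \<open>\<kappa>\<close>.
\<close>

definition fac :: "expo \<Rightarrow> int \<Rightarrow> int \<Rightarrow> complex"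
  where "fac \<kappa> i k = (if vless \<kappa> k i then inverse th else th)"

definition ev :: "int \<Rightarrow> int \<Rightarrow> complex"
  where "ev a b = q powi (- a) * th powi (- 2 * (b - 1) + (n - 1))"

text \<open>
  The generators move the \<open>i\<close>-th entry past the entries \<open>i + 1, \<dots>, m\<close>, and each passage contributes one
  factor.
\<close>

lemma triop_T_word:
  assumes "i \<in> {1..n}" "i \<le> m" "m \<le> n"
  shows "triop n (T_word th (rev [i..m - 1])) id (unrot i m) (\<lambda>\<kappa>. \<Prod>k\<in>{i + 1..m}. fac \<kappa> i k)"
  using assms(2,3)
proof (induction m rule: int_ge_induct)
  case base
  have "unrot i i = id" by (auto simp: fun_eq_iff unrot_def)
  moreover have "T_word th (rev [i..i - 1]) = (\<lambda>h. h)" by (simp add: fun_eq_iff)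
  ultimately show ?case
    unfolding triop_def by (auto simp: lin_def permutes_id intro!: bexI[of _ 0])
next
  case (step m)
  have inv: "inv (unrot i m) = rot i m"
    using step.hyps by (intro inv_unique_comp) (auto simp: fun_eq_iff)
  have p: "unrot i m permutes {1..n}"
    using step assms(1) by (intro permutes_subset[OF unrot_permutes[of i m]]) auto
  have m: "m \<in> {1..n - 1}" using step assms(1) by auto
  have w: "sref m \<circ> unrot i m = unrot i (m + 1)"
    using step.hyps by (auto simp: fun_eq_iff unrot_def sref_def transpose_def)
  have wp: "unrot i (m + 1) permutes {1..n}"
    using permutes_compose[OF p sref_permutes[OF m]] w by simp
  have rot: "rot i m m = i" "rot i m (m + 1) = m + 1" by (auto simp: rot_def)
  have "triop n (T m) (unrot i m) (unrot i (m + 1))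
    (\<lambda>\<kappa>. if coef \<kappa> (m + 1) < coef \<kappa> i then inverse th else th)"
    using triop_T[OF m p] step.hyps unfolding inv w rot by simp
  moreover have "(\<lambda>\<kappa>. if coef \<kappa> (m + 1) < coef \<kappa> i then inverse th else th) = (\<lambda>\<kappa>. fac \<kappa> i (m + 1))"
    using step.hyps by (auto simp: fun_eq_iff fac_def vless_def)
  ultimately have T: "triop n (T m) (unrot i m) (unrot i (m + 1)) (\<lambda>\<kappa>. fac \<kappa> i (m + 1))"
    by (simp only:)
  have "m \<le> n" using step.prems by simp
  from triop_comp[OF step.IH[OF this] T wp]
  have "triop n (T m \<circ> T_word th (rev [i..m - 1])) id (unrot i (m + 1))
    (\<lambda>\<kappa>. fac \<kappa> i (m + 1) * (\<Prod>k\<in>{i + 1..m}. fac \<kappa> i k))" .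
  moreover have "[i..m] = [i..m - 1] @ [m]" using step.hyps by (simp add: upto_rec2)
  then have "T m \<circ> T_word th (rev [i..m - 1]) = T_word th (rev [i..m + 1 - 1])"
    by (simp add: fun_eq_iff)
  moreover have "{i + 1..m + 1} = insert (m + 1) {i + 1..m}" using step.hyps by auto
  ultimately show ?case by (simp del: id_apply)
qed

lemma triop_Ti_word:
  assumes "i \<in> {1..n}" "1 \<le> m" "m \<le> i"
  shows "triop n (Ti_word (rev [1..m - 1])) (rot 1 i) (rot m i) (\<lambda>\<kappa>. \<Prod>k\<in>{1..m - 1}. fac \<kappa> i k)"
  using assms(2,3)
proof (induction m rule: int_ge_induct)
  case base
  have "Ti_word (rev [1..1 - 1]) = (\<lambda>h. h)" by (simp add: fun_eq_iff)
  moreover have "rot 1 i permutes {1..n}"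
    using assms(1) by (intro permutes_subset[OF rot_permutes[of 1 i]]) auto
  ultimately show ?case
    unfolding triop_def by (auto simp: lin_def intro!: bexI[of _ 0])
next
  case (step m)
  have inv: "inv (rot m i) = unrot m i" using step by (intro inv_rot) simp
  have p: "rot m i permutes {1..n}"
    using step assms(1) by (intro permutes_subset[OF rot_permutes[of m i]]) auto
  have m: "m \<in> {1..n - 1}" using step assms(1) by auto
  have w: "sref m \<circ> rot m i = rot (m + 1) i"
    using sref_rot[of m i, symmetric] step by (simp add: comp_assoc[symmetric])
  have wp: "rot (m + 1) i permutes {1..n}"
    using permutes_compose[OF p sref_permutes[OF m]] w by simp
  have unrot: "unrot m i m = i" "unrot m i (m + 1) = m" using step by (auto simp: unrot_def)
  have "triop n (Ti m) (rot m i) (rot (m + 1) i)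
    (\<lambda>\<kappa>. if coef \<kappa> m \<le> coef \<kappa> i then inverse th else th)"
    using triop_Ti[OF m p] step unfolding inv w unrot by simp
  moreover have "(\<lambda>\<kappa>. if coef \<kappa> m \<le> coef \<kappa> i then inverse th else th) = (\<lambda>\<kappa>. fac \<kappa> i m)"
    using step by (auto simp: fun_eq_iff fac_def vless_def)
  ultimately have "triop n (Ti m \<circ> Ti_word (rev [1..m - 1])) (rot 1 i) (rot (m + 1) i)
    (\<lambda>\<kappa>. fac \<kappa> i m * (\<Prod>k\<in>{1..m - 1}. fac \<kappa> i k))"
    using step by (intro triop_comp[OF _ _ wp]) auto
  moreover have "[1..m] = [1..m - 1] @ [m]" using step.hyps by (simp add: upto_rec2)
  then have "Ti m \<circ> Ti_word (rev [1..m - 1]) = Ti_word (rev [1..m + 1 - 1])"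
    by (simp add: fun_eq_iff)
  moreover have "{1..m + 1 - 1} = insert m {1..m - 1}" using step.hyps by auto
  ultimately show ?case by simp
qed

lemma triop_g:
  assumes "v permutes {1..n}"
  shows "triop n g v (c \<circ> v) (\<lambda>\<kappa>. inverse q powi coef \<kappa> (inv v n))"
  unfolding triop_def
  by (intro conjI ballI lin_g assms bexI[of _ 0])
    (simp_all add: g_xpow perm_expo_comp bij_c permutes_bij[OF assms] coef_perm_expo')

lemma prod_fac:
  assumes "i \<in> {1..n}"
  shows "(\<Prod>k\<in>{1..n} - {i}. fac \<kappa> i k) = th powi (- 2 * (vperm n \<kappa> i - 1) + (n - 1))"
proof -
  let ?S = "{k \<in> {1..n}. vless \<kappa> k i}"
  have S: "?S \<subseteq> {1..n} - {i}" "finite ?S" by (auto simp: vless_def)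
  have "(\<Prod>k\<in>{1..n} - {i}. fac \<kappa> i k) = (\<Prod>k\<in>{1..n} - {i} - ?S. fac \<kappa> i k) * (\<Prod>k\<in>?S. fac \<kappa> i k)"
    using S(1) by (intro prod.subset_diff) auto
  also have "(\<Prod>k\<in>?S. fac \<kappa> i k) = (\<Prod>k\<in>?S. inverse th)"
    by (intro prod.cong refl) (auto simp: fac_def)
  also have "(\<Prod>k\<in>{1..n} - {i} - ?S. fac \<kappa> i k) = (\<Prod>k\<in>{1..n} - {i} - ?S. th)"
    by (intro prod.cong refl) (auto simp: fac_def)
  also have "(\<Prod>k\<in>{1..n} - {i} - ?S. th) = th ^ card ({1..n} - {i} - ?S)" by (rule prod_constant)
  also have "(\<Prod>k\<in>?S. inverse th) = inverse th ^ card ?S" by (rule prod_constant)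
  also have "th ^ card ({1..n} - {i} - ?S) * inverse th ^ card ?S =
    th powi int (card ({1..n} - {i} - ?S)) * th powi (- int (card ?S))"
    by (simp only: power_int_of_nat power_int_minus power_inverse)
  also have "\<dots> = th powi (int (card ({1..n} - {i} - ?S)) + (- int (card ?S)))"
    by (rule power_int_add[symmetric]) (use th in simp)
  also have "int (card ({1..n} - {i} - ?S)) = n - 1 - int (card ?S)"
  proof -
    have "card ({1..n} - {i} - ?S) = card ({1..n} - {i}) - card ?S"
      using S by (intro card_Diff_subset) auto
    moreover have "card ?S \<le> card ({1..n} - {i})" using S by (intro card_mono) auto
    moreover have "int (card ({1..n} - {i})) = n - 1" using assms by simp arith
    ultimately show ?thesis by linarith
  qed
  also have "n - 1 - int (card ?S) + (- int (card ?S)) = - 2 * (vperm n \<kappa> i - 1) + (n - 1)"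
    using vperm_count[OF assms, of \<kappa>] by simp
  finally show ?thesis .
qed

text \<open>
  In \<open>Y_explicit\<close> the \<open>i\<close>-th entry of the exponent travels to the last position, is moved to the first one by
  \<open>g\<close>, which contributes the power of \<open>q\<close>, and travels back. It passes every other entry once, so the
  product of the factors is the power of \<open>t\<^bsup>1/2\<^esup>\<close> that counts the entries sorted before it.
\<close>

lemma Y_xpow:
  assumes "i \<in> {1..n}" "\<kappa> \<in> Zn n"
  obtains r where "r \<in> low n id \<kappa>"
    "Y i (xpow \<kappa>) = Const (ev (coef \<kappa> i) (vperm n \<kappa> i)) * xpow \<kappa> + r"
proof -
  have un: "unrot i n permutes {1..n}" using assms(1) by (intro unrot_permutes) auto
  have inv: "inv (unrot i n) n = i"
    using assms(1) inv_inv_eq[OF bij_rot[of i n]] by (simp add: inv_rot[symmetric]) (simp add: rot_def)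
  have comp: "c \<circ> unrot i n = rot 1 i"
    using assms(1) by (auto simp: fun_eq_iff rot_def unrot_def)
  have r1: "rot 1 i permutes {1..n}"
    using assms(1) by (intro permutes_subset[OF rot_permutes[of 1 i]]) auto
  have "triop n (g \<circ> T_word th (rev [i..n - 1])) id (rot 1 i)
    (\<lambda>\<kappa>. inverse q powi coef \<kappa> i * (\<Prod>k\<in>{i + 1..n}. fac \<kappa> i k))"
    using triop_comp[OF triop_T_word[OF assms(1), of n] triop_g[OF un]] assms(1) r1
    unfolding inv comp by auto
  from triop_comp[OF this triop_Ti_word[OF assms(1), of i]]
  have "triop n (Ti_word (rev [1..i - 1]) \<circ> (g \<circ> T_word th (rev [i..n - 1]))) id id
    (\<lambda>\<kappa>. (\<Prod>k\<in>{1..i - 1}. fac \<kappa> i k) * (inverse q powi coef \<kappa> i * (\<Prod>k\<in>{i + 1..n}. fac \<kappa> i k)))"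
    using assms(1) permutes_id by (simp add: rot_n)
  moreover have "Ti_word (rev [1..i - 1]) \<circ> (g \<circ> T_word th (rev [i..n - 1])) = Y i"
    using Y_explicit[OF assms(1)] by (simp add: fun_eq_iff)
  moreover have "(\<Prod>k\<in>{1..i - 1}. fac \<kappa> i k) * (inverse q powi coef \<kappa> i * (\<Prod>k\<in>{i + 1..n}. fac \<kappa> i k)) =
    ev (coef \<kappa> i) (vperm n \<kappa> i)"
  proof -
    have "{1..n} - {i} = {1..i - 1} \<union> {i + 1..n}" using assms(1) by auto
    then have "(\<Prod>k\<in>{1..n} - {i}. fac \<kappa> i k) =
      (\<Prod>k\<in>{1..i - 1}. fac \<kappa> i k) * (\<Prod>k\<in>{i + 1..n}. fac \<kappa> i k)"
      by (simp add: prod.union_disjoint)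
    then show ?thesis
      unfolding ev_def prod_fac[OF assms(1), symmetric] by (simp add: power_int_minus power_int_inverse)
  qed
  ultimately show ?thesis
    using that assms(2) unfolding triop_def by (metis perm_expo_id)
qed

text \<open>
  The quotient of two eigenvalues has the form \<open>q\<^sup>a t\<^sup>b\<close>, so this is genericity of the parameters.
\<close>

lemma ev_inject: "ev a b = ev a' b' \<longleftrightarrow> a = a' \<and> b = b'"
proof
  assume eq: "ev a b = ev a' b'"
  have "q powi (a' - a) * (th ^ 2) powi (b' - b) = ev a b * inverse (ev a' b')"
  proof -
    have "(th ^ 2) powi (b' - b) = th powi (2 * (b' - b))"
      using power_int_mult[of th 2 "b' - b"] by simp
    also have "2 * (b' - b) = (- 2 * (b - 1) + (n - 1)) + - (- 2 * (b' - 1) + (n - 1))" by simp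
    finally have 1: "(th ^ 2) powi (b' - b) =
      th powi (- 2 * (b - 1) + (n - 1)) * inverse (th powi (- 2 * (b' - 1) + (n - 1)))"
      using th by (subst (asm) power_int_add) (simp_all only: power_int_minus simp_thms)
    have "a' - a = - a + - (- a')" by simp
    then have 2: "q powi (a' - a) = q powi (- a) * inverse (q powi (- a'))"
      using q by (simp only: power_int_add power_int_minus simp_thms)
    show ?thesis unfolding 1 2 ev_def by simp
  qed
  also have "\<dots> = 1"
  proof -
    have "ev a' b' \<noteq> 0" using th q by (simp add: ev_def)
    then show ?thesis using eq by simp
  qed
  finally have "q powi (a' - a) * (th ^ 2) powi (b' - b) = 1" .
  then have "(a' - a, b' - b) = (0, 0)" using generic unfolding generic_def by blast
  then show "a = a' \<and> b = b'" by simp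
qed simp

lemma coef_Y_top:
  assumes "i \<in> {1..n}" "h \<in> Laurent n" "\<kappa> \<in> Zn n" "\<And>\<kappa>'. \<kappa>' \<in> supp h \<Longrightarrow> \<not> lower n \<kappa> \<kappa>'"
  shows "coef (Y i h) \<kappa> = ev (coef \<kappa> i) (vperm n \<kappa> i) * coef h \<kappa>"
proof -
  let ?e = "ev (coef \<kappa> i) (vperm n \<kappa> i)"
  have 1: "coef (Y i (xpow \<kappa>')) \<kappa> = (if \<kappa>' = \<kappa> then ?e else 0)" if "\<kappa>' \<in> supp h" for \<kappa>'
  proof -
    have "\<kappa>' \<in> Zn n" using assms(2) that by (auto simp: Laurent_def)
    from Y_xpow[OF assms(1) this] obtain r where r: "r \<in> low n id \<kappa>'"
      "Y i (xpow \<kappa>') = Const (ev (coef \<kappa>' i) (vperm n \<kappa>' i)) * xpow \<kappa>' + r" .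
    have "coef r \<kappa> = 0"
      using r(1) assms(4)[OF that] by (auto simp: low_def in_keys_iff)
    then show ?thesis unfolding r(2) by (simp add: lookup_add coef_xpow)
  qed
  have "coef (Y i h) \<kappa> = (\<Sum>\<nu>\<in>supp h. coef h \<nu> * coef (Y i (xpow \<nu>)) \<kappa>)"
    unfolding lin_expansion[OF lin_Y[OF assms(1)], of h] by (simp add: lookup_sum)
  also have "\<dots> = (\<Sum>\<nu>\<in>supp h. coef h \<nu> * (if \<nu> = \<kappa> then ?e else 0))"
    by (intro sum.cong refl) (simp add: 1)
  also have "\<dots> = ?e * coef h \<kappa>"
    by (simp add: if_distrib[of "(*) _"] in_keys_iff cong: if_cong)
  finally show ?thesis .
qed

lemma finite_maximal_lower:
  assumes "finite S" "S \<noteq> {}"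
  obtains \<kappa> where "\<kappa> \<in> S" "\<And>\<kappa>'. \<kappa>' \<in> S \<Longrightarrow> \<not> lower n \<kappa> \<kappa>'"
proof -
  have "\<exists>\<kappa>\<in>S. \<forall>\<kappa>'\<in>S. \<not> lower n \<kappa> \<kappa>'"
    using assms
  proof (induction S rule: finite_ne_induct)
    case (insert x S)
    then obtain \<kappa> where \<kappa>: "\<kappa> \<in> S" "\<forall>\<kappa>'\<in>S. \<not> lower n \<kappa> \<kappa>'" by blast
    show ?case
    proof (cases "lower n \<kappa> x")
      case True
      then have "\<forall>\<kappa>'\<in>insert x S. \<not> lower n x \<kappa>'"
        using \<kappa>(2) lower_trans[OF True] lower_irrefl by blast
      then show ?thesis by blast
    next
      case False
      then show ?thesis using \<kappa> by blast
    qed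
  qed simp
  then show ?thesis using that by blast
qed

text \<open>
  By triangularity the eigenvalues can be read off at every maximal exponent of the support. Maximal
  exponents with the same eigenvalues coincide by \<open>ev_inject\<close>, so there is only one, and all other exponents
  lie below it.
\<close>

lemma joint_eigenvector_top:
  assumes "f \<in> Laurent n" "f \<noteq> 0" "\<And>i. i \<in> {1..n} \<Longrightarrow> Y i f = Const (y i) * f"
  obtains \<kappa> where "\<kappa> \<in> Zn n" "\<And>i. i \<in> {1..n} \<Longrightarrow> y i = ev (coef \<kappa> i) (vperm n \<kappa> i)"
    "\<And>\<kappa>'. \<kappa>' \<in> supp f \<Longrightarrow> \<kappa>' = \<kappa> \<or> lower n \<kappa>' \<kappa>" "\<kappa> \<in> supp f"
proof -
  have top: "y i = ev (coef \<kappa> i) (vperm n \<kappa> i)"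
    if "i \<in> {1..n}" "\<kappa> \<in> supp f" "\<And>\<kappa>'. \<kappa>' \<in> supp f \<Longrightarrow> \<not> lower n \<kappa> \<kappa>'" for \<kappa> i
  proof -
    have "\<kappa> \<in> Zn n" using assms(1) that(2) by (auto simp: Laurent_def)
    then have "y i * coef f \<kappa> = ev (coef \<kappa> i) (vperm n \<kappa> i) * coef f \<kappa>"
      using coef_Y_top[OF that(1) assms(1) _ that(3)] assms(3)[OF that(1)] by simp
    then show ?thesis using that(2) by (simp add: in_keys_iff)
  qed
  have "supp f \<noteq> {}" using assms(2) by simp
  then obtain \<kappa> where \<kappa>: "\<kappa> \<in> supp f" "\<And>\<kappa>'. \<kappa>' \<in> supp f \<Longrightarrow> \<not> lower n \<kappa> \<kappa>'"
    using finite_maximal_lower[OF finite_keys] by blast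
  have "\<kappa>' = \<kappa> \<or> lower n \<kappa>' \<kappa>" if k: "\<kappa>' \<in> supp f" for \<kappa>'
  proof (rule ccontr)
    assume "\<not> (\<kappa>' = \<kappa> \<or> lower n \<kappa>' \<kappa>)"
    then have ne: "\<kappa>' \<noteq> \<kappa>" "\<not> lower n \<kappa>' \<kappa>" "\<not> lower n \<kappa> \<kappa>'" using \<kappa>(2)[OF k] by auto
    then have "\<And>\<kappa>''. \<kappa>'' \<in> supp f \<Longrightarrow> \<not> lower n \<kappa>' \<kappa>''"
      using \<kappa>(2) unfolding lower_def by (metis linorder_neqE order_less_trans)
    then have "ev (coef \<kappa>' i) (vperm n \<kappa>' i) = ev (coef \<kappa> i) (vperm n \<kappa> i)" if "i \<in> {1..n}" for i
      using top[OF that k] top[OF that \<kappa>] by simp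
    then have "coef \<kappa>' i = coef \<kappa> i" if "i \<in> {1..n}" for i
      using that by (simp add: ev_inject)
    moreover have "\<kappa>' \<in> Zn n" "\<kappa> \<in> Zn n" using assms(1) k \<kappa>(1) by (auto simp: Laurent_def)
    ultimately have "\<kappa>' = \<kappa>" by (intro poly_mapping_eqI) (metis Zn_coef)
    then show False using ne by simp
  qed
  moreover have "\<kappa> \<in> Zn n" using assms(1) \<kappa>(1) by (auto simp: Laurent_def)
  ultimately show ?thesis using that top \<kappa> by blast
qed

definition is_E :: "expo \<Rightarrow> laurent \<Rightarrow> bool"
  where "is_E \<nu> f \<longleftrightarrow> f \<in> Laurent n \<and>
    (\<forall>i\<in>{1..n}. Y i f = Const (ev (coef \<nu> i) (vperm n \<nu> i)) * f) \<and> coef f \<nu> = 1"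

lemma Zn_eqI: "\<kappa> \<in> Zn n \<Longrightarrow> \<nu> \<in> Zn n \<Longrightarrow> (\<And>i. i \<in> {1..n} \<Longrightarrow> coef \<kappa> i = coef \<nu> i) \<Longrightarrow> \<kappa> = \<nu>"
  by (intro poly_mapping_eqI) (metis Zn_coef)

lemma is_E_Zn: "is_E \<nu> f \<Longrightarrow> \<nu> \<in> Zn n"
  by (auto simp: is_E_def Laurent_def in_keys_iff subset_iff)

lemma is_E_unique: assumes "is_E \<nu> f" "is_E \<nu> f'" shows "f = f'"
proof (rule ccontr)
  assume "f \<noteq> f'"
  then have "f - f' \<noteq> 0" by simp
  moreover have "Y i (f - f') = Const (ev (coef \<nu> i) (vperm n \<nu> i)) * (f - f')" if "i \<in> {1..n}" for i
    using assms that by (simp add: is_E_def lin_diff[OF lin_Y] right_diff_distrib)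
  moreover have "f - f' \<in> Laurent n" using assms by (simp add: is_E_def Laurent_diff)
  ultimately obtain \<kappa> where \<kappa>: "\<kappa> \<in> Zn n" "\<kappa> \<in> supp (f - f')"
    "\<And>i. i \<in> {1..n} \<Longrightarrow> ev (coef \<nu> i) (vperm n \<nu> i) = ev (coef \<kappa> i) (vperm n \<kappa> i)"
    using joint_eigenvector_top[of "f - f'" "\<lambda>i. ev (coef \<nu> i) (vperm n \<nu> i)"] by metis
  have "\<kappa> = \<nu>"
    by (rule Zn_eqI[OF \<kappa>(1) is_E_Zn[OF assms(1)]]) (use \<kappa>(3) in \<open>simp add: ev_inject\<close>)
  then show False using \<kappa>(2) assms by (simp add: is_E_def in_keys_iff lookup_minus)
qed

lemma E_mac_eqI: "is_E \<nu> f \<Longrightarrow> E_mac n q th \<nu> = f"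
  unfolding E_mac_def
  by (rule the_equality) (auto simp: is_E_def[symmetric] ev_def[symmetric] is_E_unique simp del: mult_minus_left)

lemma is_E_low:
  assumes "is_E \<nu> f" shows "f - xpow \<nu> \<in> low n id \<nu>"
proof -
  have "f \<noteq> 0" using assms by (auto simp: is_E_def)
  then obtain \<kappa> where \<kappa>: "\<kappa> \<in> Zn n" "\<And>\<kappa>'. \<kappa>' \<in> supp f \<Longrightarrow> \<kappa>' = \<kappa> \<or> lower n \<kappa>' \<kappa>"
    "\<And>i. i \<in> {1..n} \<Longrightarrow> ev (coef \<nu> i) (vperm n \<nu> i) = ev (coef \<kappa> i) (vperm n \<kappa> i)"
    using joint_eigenvector_top[of f "\<lambda>i. ev (coef \<nu> i) (vperm n \<nu> i)"] assms
    unfolding is_E_def by metis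
  have "\<kappa> = \<nu>"
    by (rule Zn_eqI[OF \<kappa>(1) is_E_Zn[OF assms(1)]]) (use \<kappa>(3) in \<open>simp add: ev_inject\<close>)
  then have "\<forall>\<kappa>'\<in>supp f. \<kappa>' = \<nu> \<or> lower n \<kappa>' \<nu>" using \<kappa>(2) by blast
  then show ?thesis
    using assms by (auto simp: low_def is_E_def Laurent_def in_keys_iff lookup_minus coef_xpow
        inv_id split: if_splits)
qed

end

section \<open>Intertwiners and the recursion for Macdonald polynomials\<close>

context macdonald begin

lemma low_Laurent: "r \<in> low n w \<kappa> \<Longrightarrow> r \<in> Laurent n"
  by (auto simp: low_def Laurent_def)

lemma Laurent_T:
  assumes "i \<in> {1..n - 1}" "f \<in> Laurent n" shows "T i f \<in> Laurent n"
proof (rule Laurent_expansion_closed[OF assms(2) lin_T])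
  fix \<nu> assume \<nu>: "\<nu> \<in> Zn n"
  have "triop n (T i) id (sref i \<circ> id) (\<lambda>\<kappa>. if coef \<kappa> (inv id (i + 1)) < coef \<kappa> (inv id i) then inverse th else th)"
    by (rule triop_T[OF assms(1) permutes_id]) (simp add: inv_id)
  then obtain a r where "r \<in> low n (sref i \<circ> id) \<nu>"
    "T i (xpow (perm_expo id \<nu>)) = Const a * xpow (perm_expo (sref i \<circ> id) \<nu>) + r"
    using \<nu> unfolding triop_def by blast
  then show "T i (xpow \<nu>) \<in> Laurent n"
    using Zn_perm[OF sref_permutes[OF assms(1)] \<nu>] low_Laurent
    by (auto intro!: Laurent_add Laurent_Const_mult simp del: id_apply)
qed

lemma Laurent_raise_monomials:
  assumes "f \<in> Laurent n" shows "xvar 1 * g f \<in> Laurent n"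
proof (rule Laurent_expansion_closed[OF assms, of "(*) (xvar 1) \<circ> g", simplified])
  show "lin ((*) (xvar 1) \<circ> g)" by (intro lin_comp lin_mult lin_g)
  fix \<nu> assume "\<nu> \<in> Zn n"
  then have "Poly_Mapping.single 1 1 + perm_expo c \<nu> \<in> Zn n"
    using Zn_perm[OF c_permutes] n by (auto simp: Zn_coef lookup_add lookup_single when_def)
  moreover have "xvar 1 * g (xpow \<nu>) =
      Const (inverse q powi coef \<nu> n) * xpow (Poly_Mapping.single 1 1 + perm_expo c \<nu>)"
    unfolding g_xpow xvar_eq_xpow xpow_add by (rule mult.left_commute)
  ultimately show "xvar 1 * g (xpow \<nu>) \<in> Laurent n"
    by (simp only: Laurent_Const_mult Laurent_xpow)
qed

text \<open>
  The operators \<open>Y\<^sub>i\<close> and \<open>Y\<^bsub>i+1\<^esub> = T\<^sub>i\<^sup>-\<^sup>1 Y\<^sub>i T\<^sub>i\<^sup>-\<^sup>1\<close> preserve the span of \<open>f\<close> and \<open>T\<^sub>i f\<close> and are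
  triangular there, so besides \<open>f\<close> there is an eigenvector with the two eigenvalues swapped. The condition on
  \<open>a\<close> describes it.
\<close>

lemma intertwiner:
  assumes i: "i \<in> {1..n - 1}" and f: "\<And>j. j \<in> {1..n} \<Longrightarrow> Y j f = Const (y j) * f"
    and a: "a * (y (i + 1) - y i) = (th - inverse th) * y i" and j: "j \<in> {1..n}"
  shows "Y j (T i f + Const a * f) = Const (y (sref i j)) * (T i f + Const a * f)"
proof -
  note linY = lin_add[OF lin_Y[OF j]] lin_Const[OF lin_Y[OF j]]
  have a': "Const a * (Const (y (i + 1)) - Const (y i)) = (u - u') * Const (y i)"
    using a by (simp only: Const_diff[symmetric] Const_mult[symmetric])
  consider "j = i" | "j = i + 1" | "j \<noteq> i" "j \<noteq> i + 1" by blast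
  then show ?thesis
  proof cases
    case 1
    have "Y i (Ti i f) = T i (Y (i + 1) f)" using i by (simp add: T_Y)
    also have "\<dots> = Const (y (i + 1)) * T i f" using f[of "i + 1"] i by (simp add: T_Const)
    finally have "Y i (T i f) - (u - u') * Y i f = Const (y (i + 1)) * T i f"
      using lin_Y[OF j] 1 unfolding Ti_def Const_diff[symmetric] by (simp add: lin_diff lin_Const)
    then have "Y i (T i f) = Const (y (i + 1)) * T i f + (u - u') * (Const (y i) * f)"
      using f[of i] j 1 by (simp add: algebra_simps)
    moreover have "Y i (T i f + Const a * f) = Y i (T i f) + Const a * (Const (y i) * f)"
      using linY f[OF j] unfolding 1 by simp
    ultimately have "Y i (T i f + Const a * f) = Const (y (i + 1)) * (T i f + Const a * f)"
      using a' by algebra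
    then show ?thesis by (simp add: 1)
  next
    case 2
    have "Y (i + 1) (T i f) = Ti i (Y i f)" using i by (simp add: Y_Suc)
    also have "\<dots> = Const (y i) * (T i f - (u - u') * f)"
      using f[of i] i by (simp add: lin_Const[OF lin_Ti]) (simp add: Ti_def)
    finally have "Y (i + 1) (T i f) = Const (y i) * (T i f - (u - u') * f)" .
    moreover have "Y (i + 1) (T i f + Const a * f) = Y (i + 1) (T i f) + Const a * (Const (y (i + 1)) * f)"
      using linY f[OF j] unfolding 2 by simp
    ultimately have "Y (i + 1) (T i f + Const a * f) = Const (y i) * (T i f + Const a * f)"
      using a' by algebra
    then show ?thesis by (simp add: 2)
  next
    case 3
    then have "Y j (T i f) = Const (y j) * T i f"
      using T_Y_commute[OF j i 3, of f] f[OF j] by (simp add: T_Const)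
    then have "Y j (T i f + Const a * f) = Const (y j) * (T i f + Const a * f)"
      using linY f[OF j] by (simp add: algebra_simps)
    then show ?thesis using 3 by (simp add: sref_other)
  qed
qed

text \<open>
  The quotient of the eigenvalues of \<open>Y\<^bsub>i+1\<^esub>\<close> and \<open>Y\<^sub>i\<close> at \<open>E\<^sub>\<nu>\<close>. In the weights of alcove walks it appears
  as \<open>d\<^sub>k\<close>.
\<close>

definition dval :: "expo \<Rightarrow> int \<Rightarrow> complex"
  where "dval \<nu> i = q powi (coef \<nu> i - coef \<nu> (i + 1)) * (th ^ 2) powi (vperm n \<nu> i - vperm n \<nu> (i + 1))"

lemma dval_neq_1:
  assumes "i \<in> {1..n - 1}" shows "dval \<nu> i \<noteq> 1"
proof -
  have "vperm n \<nu> i \<noteq> vperm n \<nu> (i + 1)"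
    using permutes_inj[OF vperm_permutes[of n \<nu>]] by (simp add: inj_eq)
  then show ?thesis using generic unfolding generic_def dval_def by (metis eq_iff_diff_eq_0 prod.inject)
qed

lemma ev_ratio:
  "ev (coef \<nu> (i + 1)) (vperm n \<nu> (i + 1)) = dval \<nu> i * ev (coef \<nu> i) (vperm n \<nu> i)"
proof -
  let ?v = "vperm n \<nu>"
  have "- coef \<nu> (i + 1) = (coef \<nu> i - coef \<nu> (i + 1)) + - coef \<nu> i" by simp
  then have 1: "q powi (- coef \<nu> (i + 1)) = q powi (coef \<nu> i - coef \<nu> (i + 1)) * q powi (- coef \<nu> i)"
    using q by (metis power_int_add)
  have "- 2 * (?v (i + 1) - 1) + (n - 1) = 2 * (?v i - ?v (i + 1)) + (- 2 * (?v i - 1) + (n - 1))" by simp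
  then have "th powi (- 2 * (?v (i + 1) - 1) + (n - 1)) =
    th powi (2 * (?v i - ?v (i + 1))) * th powi (- 2 * (?v i - 1) + (n - 1))"
    using th by (metis power_int_add)
  moreover have "th powi (2 * (?v i - ?v (i + 1))) = (th ^ 2) powi (?v i - ?v (i + 1))"
    using power_int_mult[of th 2 "?v i - ?v (i + 1)"] by simp
  ultimately show ?thesis unfolding ev_def dval_def 1 by simp
qed

text \<open>
  The constant \<open>a\<close> that \<open>intertwiner\<close> requires for \<open>f = E\<^sub>\<nu>\<close>.
\<close>

definition acoef :: "expo \<Rightarrow> int \<Rightarrow> complex"
  where "acoef \<nu> i = inverse th * (1 - th ^ 2) / (1 - dval \<nu> i)"

lemma acoef_eq:
  assumes "i \<in> {1..n - 1}"
  shows "acoef \<nu> i * (ev (coef \<nu> (i + 1)) (vperm n \<nu> (i + 1)) - ev (coef \<nu> i) (vperm n \<nu> i)) =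
    (th - inverse th) * ev (coef \<nu> i) (vperm n \<nu> i)"
proof -
  have "1 - dval \<nu> i \<noteq> 0" using dval_neq_1[OF assms] by simp
  moreover have "b / e * (- e) = - b" if "e \<noteq> 0" for b e :: complex using that by simp
  ultimately have "acoef \<nu> i * (- (1 - dval \<nu> i)) = - (inverse th * (1 - th ^ 2))"
    unfolding acoef_def by blast
  then have "acoef \<nu> i * (dval \<nu> i - 1) = - (inverse th * (1 - th ^ 2))" by simp
  also have "\<dots> = th - inverse th" using th by (simp add: field_simps power2_eq_square)
  finally have "acoef \<nu> i * (dval \<nu> i - 1) = th - inverse th" .
  moreover have "acoef \<nu> i * (dval \<nu> i * e - e) = (acoef \<nu> i * (dval \<nu> i - 1)) * e" for e
    by (simp add: algebra_simps)
  ultimately show ?thesis unfolding ev_ratio by simp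
qed

text \<open>
  For distinct entries the eigenvalues of \<open>E\<close> at \<open>s\<^sub>i \<nu>\<close> are those at \<open>\<nu>\<close> with two of them swapped, as
  in \<open>intertwiner\<close>. Since \<open>\<nu>\<close> is lower than \<open>s\<^sub>i \<nu>\<close>, the monomial with exponent \<open>s\<^sub>i \<nu>\<close> only arises from the
  leading term of \<open>T\<^sub>i x\<^sup>\<nu>\<close>, with coefficient \<open>t\<^bsup>-1/2\<^esup>\<close>.
\<close>

lemma is_E_T:
  assumes f: "is_E \<nu> f" and i: "i \<in> {1..n - 1}" and gt: "coef \<nu> (i + 1) < coef \<nu> i"
  shows "is_E (sact i \<nu>) (u * (T i f + Const (acoef \<nu> i) * f))"
proof -
  let ?h = "T i f + Const (acoef \<nu> i) * f" and ?\<mu> = "sact i \<nu>"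
  have \<nu>: "\<nu> \<in> Zn n" using is_E_Zn[OF f] .
  have in_n: "i \<in> {1..n}" "i + 1 \<in> {1..n}" using i by auto
  have v: "vperm n ?\<mu> = vperm n \<nu> \<circ> sref i" using gt by (intro vperm_sact[OF i]) simp
  have Yf: "Y j f = Const (ev (coef \<nu> j) (vperm n \<nu> j)) * f" if "j \<in> {1..n}" for j
    using f that by (simp add: is_E_def)
  have "Y j (u * ?h) = Const (ev (coef ?\<mu> j) (vperm n ?\<mu> j)) * (u * ?h)" if j: "j \<in> {1..n}" for j
    using intertwiner[OF i Yf acoef_eq[OF i] j]
    by (simp add: lin_Const[OF lin_Y[OF j]] v coef_sact)
  moreover have "u * ?h \<in> Laurent n"
    using f i by (intro Laurent_Const_mult Laurent_add Laurent_T) (auto simp: is_E_def)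
  moreover have "coef (u * ?h) ?\<mu> = 1"
  proof -
    have low: "lower n \<nu> ?\<mu>"
    proof -
      have "wsum n (perm_expo (transpose i (i + 1)) ?\<mu>) < wsum n ?\<mu>"
        using gt in_n by (intro wsum_transpose) (simp_all add: coef_sact)
      then show ?thesis
        using sqn_perm[OF sref_permutes[OF i], of \<nu>] sact_sact[of i \<nu>] by (simp add: lower_def sref_def)
    qed
    have ne: "?\<mu> \<noteq> \<nu>" using low lower_irrefl by metis
    have rlow: "f - xpow \<nu> \<in> low n id \<nu>" by (rule is_E_low[OF f])
    have f\<mu>: "coef f ?\<mu> = 0"
    proof -
      have "\<not> lower n ?\<mu> \<nu>" using lower_trans[OF low] lower_irrefl by blast
      then have "?\<mu> \<notin> supp (f - xpow \<nu>)"
        using rlow unfolding low_def inv_id perm_expo_id by blast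
      then have "coef (f - xpow \<nu>) ?\<mu> = 0" by (simp only: in_keys_iff simp_thms)
      then show ?thesis using ne by (simp add: lookup_minus coef_xpow)
    qed
    have tri: "triop n (T i) id (sref i \<circ> id)
      (\<lambda>\<kappa>. if coef \<kappa> (inv id (i + 1)) < coef \<kappa> (inv id i) then inverse th else th)"
      by (rule triop_T[OF i permutes_id]) (simp add: inv_id)
    obtain r where r: "r \<in> low n (sref i) \<nu>" "T i (xpow \<nu>) = u' * xpow ?\<mu> + r"
      using tri \<nu> gt unfolding triop_def by (auto simp: inv_id)
    have "T i (f - xpow \<nu>) \<in> low n (sref i) \<nu>"
      using triop_low[OF tri _ rlow] sref_permutes[OF i] by simp
    then have "r + T i (f - xpow \<nu>) \<in> low n (sref i) \<nu>" using r(1) by (intro low_add)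
    moreover have "\<not> lower n (perm_expo (inv (sref i)) ?\<mu>) \<nu>" by simp
    ultimately have "?\<mu> \<notin> supp (r + T i (f - xpow \<nu>))"
      unfolding low_def by blast
    then have "coef (r + T i (f - xpow \<nu>)) ?\<mu> = 0" by (simp only: in_keys_iff simp_thms)
    moreover have "T i f = u' * xpow ?\<mu> + (r + T i (f - xpow \<nu>))"
      using r(2) by (simp add: T_diff)
    ultimately have "coef (T i f) ?\<mu> = inverse th"
      by (simp add: lookup_add[of "u' * xpow ?\<mu>" "r + T i (f - xpow \<nu>)"] coef_xpow)
    then show ?thesis using f\<mu> th by (simp add: lookup_add)
  qed
  ultimately show ?thesis by (simp add: is_E_def)
qed

text \<open>
  For equal entries \<open>a = - t\<^bsup>1/2\<^esup>\<close>. If \<open>T\<^sub>i f - t\<^bsup>1/2\<^esup> f\<close> were not zero, it would be a joint eigenvector whose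
  eigenvalues have the powers of \<open>q\<close> of \<open>\<nu>\<close>, but two powers of \<open>t\<close> swapped. Such eigenvalues belong to no
  exponent, because those powers are determined by sorting.
\<close>

lemma is_E_T_equal:
  assumes f: "is_E \<nu> f" and i: "i \<in> {1..n - 1}" and eq: "coef \<nu> i = coef \<nu> (i + 1)"
  shows "T i f = u * f"
proof (rule ccontr)
  assume ne: "T i f \<noteq> u * f"
  define y where "y j = ev (coef \<nu> j) (vperm n \<nu> j)" for j
  let ?h = "T i f + Const (acoef \<nu> i) * f"
  have Suc: "vperm n \<nu> (i + 1) = vperm n \<nu> i + 1" by (rule vperm_Suc_eq[OF i eq])
  have "dval \<nu> i = inverse (th ^ 2)" unfolding dval_def Suc eq by (simp add: power_int_minus)
  then have "acoef \<nu> i = - th"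
  proof -
    have "dval \<nu> i \<noteq> 1" by (rule dval_neq_1[OF i])
    then have "th ^ 2 \<noteq> 1" using \<open>dval \<nu> i = _\<close> by auto
    then show ?thesis
      unfolding acoef_def \<open>dval \<nu> i = _\<close> using th by (simp add: field_simps power2_eq_square)
  qed
  then have h: "?h = T i f - u * f" by (simp add: Const_minus)
  have Yf: "Y j f = Const (y j) * f" if "j \<in> {1..n}" for j
    using f that by (simp add: is_E_def y_def)
  have "Y j ?h = Const (y (sref i j)) * ?h" if "j \<in> {1..n}" for j
    by (rule intertwiner[OF i Yf _ that]) (use acoef_eq[OF i, of \<nu>] in \<open>simp_all add: y_def\<close>)
  moreover have "?h \<in> Laurent n"
    using f i by (intro Laurent_Const_mult Laurent_add Laurent_T) (auto simp: is_E_def)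
  moreover have "?h \<noteq> 0" using ne h by simp
  ultimately obtain \<kappa> where \<kappa>: "\<kappa> \<in> Zn n"
    "\<And>j. j \<in> {1..n} \<Longrightarrow> y (sref i j) = ev (coef \<kappa> j) (vperm n \<kappa> j)"
    using joint_eigenvector_top[of ?h "\<lambda>j. y (sref i j)"] by metis
  have "coef \<nu> (sref i j) = coef \<nu> j" for j
    using eq by (simp add: sref_def transpose_def)
  then have "\<kappa> = \<nu>"
    by (intro Zn_eqI[OF \<kappa>(1) is_E_Zn[OF f]]) (use \<kappa>(2) in \<open>simp add: y_def ev_inject\<close>)
  then have "vperm n \<nu> (i + 1) = vperm n \<nu> i"
    using \<kappa>(2)[of i] i by (simp add: y_def ev_inject)
  then show False using Suc by simp
qed

lemma ev_Suc: "ev (a + 1) b = inverse q * ev a b"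
proof -
  have "- (a + 1) = - 1 + - a" by simp
  then have "q powi (- (a + 1)) = q powi (- 1) * q powi (- a)"
    using q power_int_add[of q "- 1" "- a"] by (simp only: simp_thms)
  then show ?thesis by (simp add: ev_def power_int_minus)
qed

lemma lin_raise: "lin raise"
  using lin_comp[OF lin_mult[of "xvar 1"] lin_T_word[of "[1..n - 1]"]]
  by (simp add: comp_def raise_def[abs_def])

text \<open>
  The eigenvalues are shifted cyclically by \<open>Y_raise\<close>, and the one that moves to the front obtains the factor
  \<open>q\<^sup>-\<^sup>1\<close> by \<open>Y_1_raise\<close>, in accordance with the action of \<open>\<pi>\<close> on exponents.
\<close>

lemma is_E_raise:
  assumes f: "is_E \<nu> f"
  shows "is_E (piact n \<nu>) (Const (q powi coef \<nu> n) * (xvar 1 * g f))"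
proof -
  let ?e = "\<lambda>j. ev (coef \<nu> j) (vperm n \<nu> j)" and ?\<mu> = "piact n \<nu>"
  have nn: "n \<in> {1..n}" using n by simp
  have Yf: "Y j f = Const (?e j) * f" if "j \<in> {1..n}" for j
    using f that by (simp add: is_E_def)
  have r: "xvar 1 * g f = Const (?e n) * raise f"
    using raise_Y_n[of f] Yf[OF nn] by (simp add: lin_Const[OF lin_raise])
  have "Y j (raise f) = Const (ev (coef ?\<mu> j) (vperm n ?\<mu> j)) * raise f" if j: "j \<in> {1..n}" for j
  proof (cases "j = 1")
    case True
    have "Y 1 (raise f) = Const (inverse q * ?e n) * raise f"
      unfolding Y_1_raise r by (simp add: Const_mult mult.assoc)
    then show ?thesis
      unfolding True vperm_piact[OF n] coef_piact[OF n] ev_Suc[symmetric] using n by (simp add: unrot_def)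
  next
    case False
    then have "Y ((j - 1) + 1) (raise f) = raise (Y (j - 1) f)" using j by (intro Y_raise) auto
    then show ?thesis
      using j False Yf[of "j - 1"] unfolding vperm_piact[OF n] coef_piact[OF n]
      by (simp add: unrot_def lin_Const[OF lin_raise])
  qed
  then have "Y j (Const a * raise f) = Const (ev (coef ?\<mu> j) (vperm n ?\<mu> j)) * (Const a * raise f)"
    if "j \<in> {1..n}" for j a
    using that by (simp add: lin_Const[OF lin_Y] mult.left_commute)
  moreover have "coef (xvar 1 * g f) ?\<mu> = inverse q powi coef \<nu> n"
  proof -
    have "coef (xvar 1 * g f) ?\<mu> = coef (g f) (perm_expo c \<nu>)"
      by (simp add: xvar_eq_xpow coef_xpow_mult piact_def)
    also have "\<dots> = inverse q powi coef \<nu> n * coef f \<nu>"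
      unfolding g_eq_monop by (rule coef_monop[OF inj_perm_expo[OF bij_c]])
    finally show ?thesis using f by (simp add: is_E_def)
  qed
  moreover have "xvar 1 * g f \<in> Laurent n"
    using f by (intro Laurent_raise_monomials) (simp add: is_E_def)
  moreover have "Const (q powi coef \<nu> n) * (xvar 1 * g f) = Const (q powi coef \<nu> n * ?e n) * raise f"
    unfolding r by (simp only: Const_mult mult.assoc)
  moreover have "q powi coef \<nu> n * inverse q powi coef \<nu> n = 1"
    using q by (simp add: power_int_inverse)
  ultimately show ?thesis
    unfolding is_E_def by (metis Laurent_Const_mult coef_Const_mult)
qed

lemma is_E_0: "is_E 0 1"
proof -
  have Ti: "Ti i 1 = u'" for i by (simp add: Ti_def T_1)
  have "Ti_word ws 1 = Const (inverse th ^ length ws)" for ws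
    by (induction ws) (simp_all add: lin_Const[OF lin_Ti, of _ _ 1, simplified] Ti Const_mult[symmetric] mult.commute)
  then have Tiw: "Ti_word ws (Const a) = Const (a * inverse th ^ length ws)" for ws a
  proof -
    have "Ti_word ws (Const a) = Const a * Ti_word ws 1"
      by (induction ws) (simp_all add: lin_Const[OF lin_Ti])
    then show ?thesis using \<open>Ti_word ws 1 = _\<close> by (simp add: Const_mult)
  qed
  have "Y i 1 = Const (ev 0 i)" if i: "i \<in> {1..n}" for i
  proof -
    have "Y i 1 = Const (th ^ nat (n - i) * inverse th ^ nat (i - 1))"
      unfolding Y_explicit[OF i] T_word_one g_Const Tiw using i by simp
    also have "th ^ nat (n - i) * inverse th ^ nat (i - 1) = th powi (n - i) * th powi (- (i - 1))"
      using i by (simp add: power_int_def)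
    also have "\<dots> = th powi ((n - i) + (- (i - 1)))" using th by (intro power_int_add[symmetric]) simp
    also have "(n - i) + (- (i - 1)) = - 2 * (i - 1) + (n - 1)" by simp
    finally show ?thesis by (simp add: ev_def)
  qed
  moreover have "(1 :: laurent) \<in> Laurent n" using Laurent_xpow[of 0 n] by simp
  ultimately show ?thesis by (simp add: is_E_def vperm_zero lookup_one)
qed

lemma rel_exponent:
  assumes "is_E \<nu> f"
  shows "E_rel n q th z \<nu> = Const (th powi (int (perm_len n (vperm n \<nu>)) -
    int (perm_len n (z \<circ> inv (vperm n \<nu>))))) * T_perm n th z f"
  using perm_len_inv[OF vperm_permutes[of n \<nu>]] E_mac_eqI[OF assms] by (simp add: E_rel_def)

lemma E_rel_0: "z permutes {1..n} \<Longrightarrow> E_rel n q th z 0 = 1"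
  unfolding rel_exponent[OF is_E_0] vperm_zero
  using th by (simp add: inv_id T_perm_one Const_mult[symmetric] power_int_minus)

text \<open>
  The operators are rearranged by \<open>T_perm_X_rot\<close>. The power of \<open>t\<^bsup>1/2\<^esup>\<close> in the eigenvalue that relates
  \<open>x\<^sub>1 g\<close> to \<open>raise\<close> is compensated by the change of length in \<open>perm_len_unrot\<close>.
\<close>

lemma E_rel_piact:
  assumes f: "is_E \<nu> f" and z: "z permutes {1..n}"
  shows "E_rel n q th z (piact n \<nu>) = xvar (z 1) * E_rel n q th (z \<circ> c) \<nu>"
proof -
  let ?v = "vperm n \<nu>"
  have nn: "n \<in> {1..n}" using n by simp
  have c_word: "T_perm n th c h = T_word th [1..n - 1] h" for h
    using n by (intro T_perm_eq perm_reduced_word_rot) auto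
  have "Const (q powi coef \<nu> n) * (xvar 1 * g f) =
    Const (q powi coef \<nu> n * ev (coef \<nu> n) (?v n)) * raise f"
    using raise_Y_n[of f] f nn by (simp add: lin_Const[OF lin_raise] is_E_def Const_mult mult.assoc)
  also have "q powi coef \<nu> n * ev (coef \<nu> n) (?v n) = th powi (- 2 * (?v n - 1) + (n - 1))"
    using q by (simp add: ev_def power_int_minus)
  finally have F: "Const (q powi coef \<nu> n) * (xvar 1 * g f) = Const (th powi (- 2 * (?v n - 1) + (n - 1))) * raise f" .
  have Tz: "T_perm n th z (raise f) = xvar (z 1) * T_perm n th (z \<circ> c) f"
    unfolding raise_def c_word[symmetric] by (rule T_perm_X_rot[OF n z])
  have vinv: "z \<circ> inv (?v \<circ> unrot 1 n) = z \<circ> c \<circ> inv ?v"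
  proof -
    have "inv (?v \<circ> unrot 1 n) = inv (unrot 1 n) \<circ> inv ?v"
      using n permutes_bij[OF vperm_permutes[of n \<nu>]] permutes_bij[OF unrot_permutes[of 1 n]]
      by (intro o_inv_distrib) auto
    moreover have "inv (unrot 1 n) = c" using n by (intro inv_unique_comp) (auto simp: fun_eq_iff)
    ultimately show ?thesis by (simp add: comp_assoc)
  qed
  have len: "int (perm_len n (?v \<circ> unrot 1 n)) = int (perm_len n ?v) + 2 * ?v n - n - 1"
    by (rule perm_len_unrot[OF n vperm_permutes])
  let ?b = "int (perm_len n (z \<circ> c \<circ> inv ?v))"
  have "E_rel n q th z (piact n \<nu>) =
    Const (th powi (int (perm_len n ?v) + 2 * ?v n - n - 1 - ?b)) *
      (Const (th powi (- 2 * (?v n - 1) + (n - 1))) * (xvar (z 1) * T_perm n th (z \<circ> c) f))"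
    unfolding rel_exponent[OF is_E_raise[OF f]] vperm_piact[OF n] vinv len F
    by (simp add: lin_Const[OF lin_T_perm] Tz)
  also have "\<dots> = xvar (z 1) * (Const (th powi (int (perm_len n ?v) + 2 * ?v n - n - 1 - ?b) *
      th powi (- 2 * (?v n - 1) + (n - 1))) * T_perm n th (z \<circ> c) f)"
    by (simp add: Const_mult mult_ac)
  also have "th powi (int (perm_len n ?v) + 2 * ?v n - n - 1 - ?b) * th powi (- 2 * (?v n - 1) + (n - 1)) =
    th powi (int (perm_len n ?v) + 2 * ?v n - n - 1 - ?b + (- 2 * (?v n - 1) + (n - 1)))"
    using th by (intro power_int_add[symmetric]) simp
  also have "int (perm_len n ?v) + 2 * ?v n - n - 1 - ?b + (- 2 * (?v n - 1) + (n - 1)) = int (perm_len n ?v) - ?b"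
    by simp
  finally show ?thesis unfolding rel_exponent[OF f] .
qed

text \<open>
  The coefficient for a walk that does not cross the wall. The two cases correspond to \<open>T\<^sub>z T\<^sub>i\<close> and
  \<open>T\<^sub>z T\<^sub>i\<^sup>-\<^sup>1\<close> being the operator of \<open>z s\<^sub>i\<close>.
\<close>

definition fold_weight :: "(int \<Rightarrow> int) \<Rightarrow> expo \<Rightarrow> int \<Rightarrow> complex"
  where "fold_weight z \<nu> i =
    (if z i < z (i + 1) then 1 else dval \<nu> i) * (1 - th ^ 2) / (1 - dval \<nu> i) *
    th powi (int (perm_len n (z \<circ> inv (vperm n \<nu>))) - int (perm_len n (z \<circ> sref i \<circ> inv (vperm n \<nu>))) - 1)"

text \<open>
  If \<open>z s\<^sub>i\<close> is longer than \<open>z\<close>, then \<open>T\<^sub>z T\<^sub>i\<close> is the operator of \<open>z s\<^sub>i\<close>, and \<open>is_E_T\<close> is the claim. Otherwise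
  \<open>T\<^sub>i\<close> is replaced by \<open>T\<^sub>i\<^sup>-\<^sup>1 + t\<^bsup>1/2\<^esup> - t\<^bsup>-1/2\<^esup>\<close>, and adding this constant to \<open>a\<close> turns \<open>1 / (1 - d)\<close> into
  \<open>d / (1 - d)\<close>.
\<close>

lemma E_rel_sact:
  assumes f: "is_E \<nu> f" and i: "i \<in> {1..n - 1}" and gt: "coef \<nu> (i + 1) < coef \<nu> i"
    and z: "z permutes {1..n}"
  shows "E_rel n q th z (sact i \<nu>) =
    E_rel n q th (z \<circ> sref i) \<nu> + Const (fold_weight z \<nu> i) * E_rel n q th z \<nu>"
proof -
  let ?v = "vperm n \<nu>" and ?a = "acoef \<nu> i" and ?d = "dval \<nu> i"
  have in_n: "i \<in> {1..n}" "i + 1 \<in> {1..n}" using i by auto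
  have v: "vperm n (sact i \<nu>) = ?v \<circ> sref i" using gt by (intro vperm_sact[OF i]) simp
  have "\<not> vless \<nu> i (i + 1)" "vless \<nu> (i + 1) i" using gt by (auto simp: vless_def)
  then have "?v (i + 1) < ?v i" using vperm_less[OF in_n(2,1)] by simp
  then have len: "int (perm_len n (?v \<circ> sref i)) = int (perm_len n ?v) - 1"
    using perm_len_sref_less[OF i vperm_permutes] by simp
  have vinv: "inv (?v \<circ> sref i) = sref i \<circ> inv ?v"
    using permutes_bij[OF vperm_permutes[of n \<nu>]] by (simp add: o_inv_distrib)
  let ?b = "int (perm_len n (z \<circ> sref i \<circ> inv ?v))" and ?b' = "int (perm_len n (z \<circ> inv ?v))"
  let ?l = "int (perm_len n ?v)"
  have zi: "z i \<noteq> z (i + 1)" using permutes_inj[OF z] by (simp add: inj_eq)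
  have d1: "1 - ?d \<noteq> 0" using dval_neq_1[OF i] by simp
  define a' where "a' = (if z i < z (i + 1) then ?a else ?a + (th - inverse th))"
  have Tz: "T_perm n th z (T i f + Const ?a * f) = T_perm n th (z \<circ> sref i) f + Const a' * T_perm n th z f"
  proof (cases "z i < z (i + 1)")
    case True
    then show ?thesis
      by (simp add: lin_add[OF lin_T_perm] lin_Const[OF lin_T_perm] T_perm_right[OF i z True] a'_def)
  next
    case False
    then have lt: "z (i + 1) < z i" using zi by simp
    have "T i f + Const ?a * f = Ti i f + Const (?a + (th - inverse th)) * f"
      by (simp add: T_eq_Ti Const_add Const_diff algebra_simps)
    then show ?thesis using False
      by (simp add: lin_add[OF lin_T_perm] lin_Const[OF lin_T_perm] T_perm_right_less[OF i z lt] a'_def)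
  qed
  have fw: "fold_weight z \<nu> i = th * a' * th powi (?b' - ?b - 1)"
  proof -
    have 1: "th * ?a = (1 - th ^ 2) / (1 - ?d)" using th by (simp add: acoef_def)
    have "th * (?a + (th - inverse th)) = th * ?a - (1 - th ^ 2)"
      using th by (simp add: field_simps power2_eq_square)
    also have "\<dots> = ?d * (1 - th ^ 2) / (1 - ?d)" unfolding 1 using d1 by (simp add: field_simps)
    finally have "th * (?a + (th - inverse th)) = ?d * (1 - th ^ 2) / (1 - ?d)" .
    then show ?thesis unfolding fold_weight_def a'_def using 1 by auto
  qed
  have "E_rel n q th z (sact i \<nu>) = Const (th powi (?l - 1 - ?b)) * (u * T_perm n th z (T i f + Const ?a * f))"
    unfolding rel_exponent[OF is_E_T[OF f i gt]] v vinv len comp_assoc[symmetric]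
    by (simp only: lin_Const[OF lin_T_perm])
  also have "\<dots> = Const (th powi (?l - 1 - ?b) * th) * T_perm n th (z \<circ> sref i) f +
      Const (th powi (?l - 1 - ?b) * th * a') * T_perm n th z f"
    unfolding Tz Const_mult by (simp add: algebra_simps)
  also have "th powi (?l - 1 - ?b) * th = th powi (?l - ?b)"
    using power_int_add_1[of th "?l - 1 - ?b"] th by (simp add: algebra_simps)
  also have "th powi (?l - ?b) * a' = fold_weight z \<nu> i * th powi (?l - ?b')"
  proof -
    have "?l - ?b = (?b' - ?b - 1) + (1 + (?l - ?b'))" by simp
    then have "th powi (?l - ?b) = th powi (?b' - ?b - 1) * (th powi 1 * th powi (?l - ?b'))"
      using th by (metis power_int_add)
    then show ?thesis unfolding fw by simp
  qed
  finally show ?thesis unfolding rel_exponent[OF f] by (simp only: Const_mult mult.assoc)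
qed

text \<open>
  The factor \<open>t\<^bsup>1/2\<^esup>\<close> by which \<open>T\<^sub>i\<close> acts on \<open>E\<^sub>\<nu>\<close> is compensated by the change of length in the
  normalisation, since \<open>v\<^sub>\<nu>\<close> maps \<open>i\<close> and \<open>i + 1\<close> to neighbours.
\<close>

lemma E_rel_equal:
  assumes f: "is_E \<nu> f" and i: "i \<in> {1..n - 1}" and eq: "coef \<nu> i = coef \<nu> (i + 1)"
    and z: "z permutes {1..n}"
  shows "E_rel n q th (z \<circ> sref i) \<nu> = E_rel n q th z \<nu>"
proof -
  have less: "E_rel n q th (z \<circ> sref i) \<nu> = E_rel n q th z \<nu>"
    if z: "z permutes {1..n}" and lt: "z i < z (i + 1)" for z
  proof -
    let ?v = "vperm n \<nu>"
    define P where "P = ?v i"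
    have in_n: "i \<in> {1..n}" "i + 1 \<in> {1..n}" using i by auto
    have P1: "?v (i + 1) = P + 1" unfolding P_def by (rule vperm_Suc_eq[OF i eq])
    have P: "P \<in> {1..n - 1}"
      using permutes_in_image[OF vperm_permutes[of n \<nu>], of i] permutes_in_image[OF vperm_permutes[of n \<nu>], of "i + 1"]
        in_n P1 unfolding P_def by auto
    have iv: "inv ?v P = i" "inv ?v (P + 1) = i + 1"
      using permutes_inverses(2)[OF vperm_permutes[of n \<nu>]] P1[symmetric] by (simp_all add: P_def)
    have comm: "sref i \<circ> inv ?v = inv ?v \<circ> sref P"
    proof
      fix x
      have "inv ?v x = i \<longleftrightarrow> x = P" "inv ?v x = i + 1 \<longleftrightarrow> x = P + 1"
        using permutes_inj[OF permutes_inv[OF vperm_permutes[of n \<nu>]]] iv by (metis injD)+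
      then show "(sref i \<circ> inv ?v) x = (inv ?v \<circ> sref P) x"
        using iv by (cases "x = P"; cases "x = P + 1") (auto simp: sref_other)
    qed
    have zv: "z \<circ> inv ?v permutes {1..n}"
      by (rule permutes_compose[OF permutes_inv[OF vperm_permutes] z])
    have "perm_len n (z \<circ> inv ?v \<circ> sref P) = perm_len n (z \<circ> inv ?v) + 1"
      using lt iv by (intro perm_len_sref[OF P zv]) simp
    then have len: "int (perm_len n (z \<circ> sref i \<circ> inv ?v)) = int (perm_len n (z \<circ> inv ?v)) + 1"
      by (simp add: comp_assoc comm)
    have "T_perm n th (z \<circ> sref i) f = u * T_perm n th z f"
      unfolding T_perm_right[OF i z lt] is_E_T_equal[OF f i eq] by (rule lin_Const[OF lin_T_perm])
    then have "E_rel n q th (z \<circ> sref i) \<nu> =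
      Const (th powi (int (perm_len n ?v) - int (perm_len n (z \<circ> inv ?v)) - 1) * th) * T_perm n th z f"
      unfolding rel_exponent[OF f] len by (simp add: Const_mult algebra_simps)
    also have "th powi (int (perm_len n ?v) - int (perm_len n (z \<circ> inv ?v)) - 1) * th =
      th powi (int (perm_len n ?v) - int (perm_len n (z \<circ> inv ?v)))"
      using power_int_add_1[of th "int (perm_len n ?v) - int (perm_len n (z \<circ> inv ?v)) - 1"] th by simp
    finally show ?thesis unfolding rel_exponent[OF f] .
  qed
  show ?thesis
  proof (cases "z i < z (i + 1)")
    case True
    then show ?thesis by (rule less[OF z])
  next
    case False
    then have "z (i + 1) < z i" using permutes_inj[OF z] by (metis injD linorder_neqE less_add_one order_less_irrefl)
    then have "E_rel n q th (z \<circ> sref i \<circ> sref i) \<nu> = E_rel n q th (z \<circ> sref i) \<nu>"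
      by (intro less permutes_compose[OF sref_permutes[OF i] z]) simp
    then show ?thesis by (simp add: comp_assoc)
  qed
qed

end

section \<open>The affine Weyl group\<close>

definition good_letters :: "int \<Rightarrow> letter list \<Rightarrow> bool"
  where "good_letters n ws \<longleftrightarrow> set ws \<subseteq> insert Rot (Ref ` {1..n - 1})"

lemma good_letters_simps [simp]:
  "good_letters n []"
  "good_letters n (Rot # ws) \<longleftrightarrow> good_letters n ws"
  "good_letters n (Ref i # ws) \<longleftrightarrow> i \<in> {1..n - 1} \<and> good_letters n ws"
  by (auto simp: good_letters_def)

lemma aff_word_simps [simp]:
  "aff_word n [] = id" "aff_word n (a # ws) = gen n a \<circ> aff_word n ws"
  by (simp_all add: aff_word_def)

lemma rep_add: "0 < n \<Longrightarrow> rep n (k + m * n) = rep n k"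
proof -
  have "k + m * n - 1 = (k - 1) + m * n" by simp
  then show ?thesis unfolding rep_def by (metis mod_mult_self1)
qed

lemma div_add: "0 < n \<Longrightarrow> (k + m * n - 1) div n = (k - 1) div n + (m :: int)"
proof -
  assume n: "0 < n"
  have "k + m * n - 1 = (k - 1) + m * n" by simp
  then show ?thesis using n by (metis add.commute div_mult_self1 less_irrefl)
qed

lemma gen_Ref_diff: "gen n (Ref i) k - k = sref i (rep n k) - rep n k"
  using rep_decomp[of k n] by (simp add: periodic_def mult.commute)

lemma gen_Ref_in: "k \<in> {1..n} \<Longrightarrow> gen n (Ref i) k = sref i k"
  using gen_Ref_diff[of n i k] by (simp add: rep_eq)

lemma gen_Ref_gen_Ref: "i \<in> {1..n - 1} \<Longrightarrow> gen n (Ref i) (gen n (Ref i) k) = k"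
  by (simp add: periodic_s_involution)

lemma gen_Ref_affW: "i \<in> {1..n - 1} \<Longrightarrow> gen n (Ref i) \<in> affW n"
proof -
  assume i: "i \<in> {1..n - 1}"
  then have n: "0 < n" by simp
  have "bij (gen n (Ref i))"
    by (rule o_bij[of "gen n (Ref i)"]) (simp_all only: fun_eq_iff comp_apply gen_Ref_gen_Ref[OF i] id_apply simp_thms)
  moreover have "gen n (Ref i) (k + n) = gen n (Ref i) k + n" for k
    using gen_Ref_diff[of n i "k + n"] gen_Ref_diff[of n i k] rep_add[OF n, of k 1] by simp
  ultimately show ?thesis by (simp only: affW_def mem_Collect_eq simp_thms)
qed

lemma gen_Rot_affW: "gen n Rot \<in> affW n"
proof -
  have "bij (gen n Rot)"
    by (rule o_bij[of "\<lambda>k. k - 1"]) (auto simp: fun_eq_iff)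
  then show ?thesis by (simp add: affW_def)
qed

lemma affW_comp: "v \<in> affW n \<Longrightarrow> w \<in> affW n \<Longrightarrow> v \<circ> w \<in> affW n"
  by (simp add: affW_def bij_comp)

lemma affW_id: "id \<in> affW n"
  by (simp add: affW_def)

lemma affW_bij: "w \<in> affW n \<Longrightarrow> bij w"
  by (simp add: affW_def)

lemma aff_word_affW: "good_letters n ws \<Longrightarrow> aff_word n ws \<in> affW n"
proof (induction ws)
  case Nil
  show ?case unfolding aff_word_simps by (rule affW_id)
next
  case (Cons a ws)
  have "gen n a \<in> affW n"
    using Cons.prems by (cases a) (auto simp: gen_Ref_affW gen_Rot_affW simp del: gen.simps)
  moreover have "aff_word n ws \<in> affW n" using Cons by (cases a) auto
  ultimately show ?case unfolding aff_word_simps by (rule affW_comp)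
qed

abbreviation start :: "int \<Rightarrow> letter list \<Rightarrow> expo"
  where "start n ws \<equiv> aff_act n (aff_word n ws) 0"

lemma aff_act_Zn: "aff_act n w \<mu> \<in> Zn n"
  by (simp add: Zn_coef coef_aff_act)

lemma coef_start:
  assumes "i \<in> {1..n}" shows "coef (aff_act n w 0) i = - ((inv w i - 1) div n)"
  using assms by (simp add: coef_aff_act expo_ext_def)

lemma aff_act_Ref_eq: "i \<in> {1..n - 1} \<Longrightarrow> \<mu> \<in> Zn n \<Longrightarrow> aff_act n (gen n (Ref i)) \<mu> = sact i \<mu>"
proof (rule poly_mapping_eqI)
  fix j assume i: "i \<in> {1..n - 1}" and \<mu>: "\<mu> \<in> Zn n"
  show "coef (aff_act n (gen n (Ref i)) \<mu>) j = coef (sact i \<mu>) j"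
  proof (cases "j \<in> {1..n}")
    case True
    then show ?thesis using aff_act_Ref[OF i True] by (simp only: coef_sact)
  next
    case False
    then have "sref i j = j" using i by (intro sref_other) auto
    moreover have "coef \<mu> j = 0" using False \<mu> by (simp add: Zn_coef)
    moreover have "coef (aff_act n (gen n (Ref i)) \<mu>) j = 0"
      using False by (simp only: coef_aff_act if_False)
    ultimately show ?thesis by (simp only: coef_sact)
  qed
qed

lemma aff_act_Rot_eq: "0 < n \<Longrightarrow> \<mu> \<in> Zn n \<Longrightarrow> aff_act n (gen n Rot) \<mu> = piact n \<mu>"
proof (rule poly_mapping_eqI)
  fix j assume n: "0 < n" and \<mu>: "\<mu> \<in> Zn n"
  show "coef (aff_act n (gen n Rot) \<mu>) j = coef (piact n \<mu>) j"
  proof (cases "j \<in> {1..n}")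
    case True
    then show ?thesis unfolding aff_act_Rot[OF n True] coef_piact[OF n] by (auto simp: unrot_def)
  next
    case False
    then have "unrot 1 n j = j" "j \<noteq> 1" using n by (auto simp: unrot_def)
    moreover have "coef \<mu> j = 0" using False \<mu> by (simp add: Zn_coef)
    moreover have "coef (aff_act n (gen n Rot) \<mu>) j = 0"
      using False by (simp only: coef_aff_act if_False)
    ultimately show ?thesis unfolding coef_piact[OF n] by simp
  qed
qed

lemma start_Nil: "start n [] = 0"
  unfolding aff_word_simps by (rule aff_act_id) simp

lemma start_Ref:
  assumes "good_letters n (Ref i # ws)"
  shows "start n (Ref i # ws) = sact i (start n ws)"
proof -
  have i: "i \<in> {1..n - 1}" and ws: "good_letters n ws" using assms by simp_all
  then show ?thesis
    unfolding aff_word_simps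
    by (subst aff_act_comp) (auto simp: gen_Ref_affW aff_word_affW aff_act_Ref_eq aff_act_Zn simp del: gen.simps)
qed

lemma start_Rot: "0 < n \<Longrightarrow> good_letters n ws \<Longrightarrow> start n (Rot # ws) = piact n (start n ws)"
  unfolding aff_word_simps
  by (subst aff_act_comp) (auto simp: gen_Rot_affW aff_word_affW aff_act_Rot_eq aff_act_Zn simp del: gen.simps)

definition aff_invs :: "int \<Rightarrow> (int \<Rightarrow> int) \<Rightarrow> (int \<times> int) set"
  where "aff_invs n w = {(j, k). 1 \<le> j \<and> j \<le> n \<and> j < k \<and> w k < w j}"

lemma aff_len_eq: "aff_len n w = card (aff_invs n w)"
  by (simp add: aff_len_def aff_invs_def)

lemma finite_aff_invs:
  assumes "0 < n" "w \<in> affW n" shows "finite (aff_invs n w)"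
proof -
  define B where "B = (\<Sum>r\<in>{1..n}. \<bar>w r - r\<bar>)"
  have B: "\<bar>w k - k\<bar> \<le> B" for k
  proof -
    have "w k = w (rep n k) + ((k - 1) div n) * n"
      using affW_add[OF assms(2), of "rep n k" "(k - 1) div n"] rep_decomp[of k n] by simp
    then have "w k - k = w (rep n k) - rep n k" using rep_decomp[of k n] by linarith
    moreover have "\<bar>w (rep n k) - rep n k\<bar> \<le> B"
      unfolding B_def using rep_in[OF assms(1), of k] by (intro member_le_sum) auto
    ultimately show ?thesis by simp
  qed
  have "aff_invs n w \<subseteq> {1..n} \<times> {1..n + 2 * B}"
  proof (clarsimp simp: aff_invs_def)
    fix j k assume "1 \<le> j" "j \<le> n" "j < k" "w k < w j"
    then show "k \<le> n + 2 * B" using B[of j] B[of k] by linarith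
  qed
  then show ?thesis by (rule finite_subset) auto
qed

lemma gen_Ref_swaps:
  assumes "i \<in> {1..n - 1}" "a < b" "gen n (Ref i) b < gen n (Ref i) a"
  obtains m where "a = i + m * n" "b = i + 1 + m * n"
proof -
  have d: "gen n (Ref i) k - k = (if rep n k = i then 1 else if rep n k = i + 1 then -1 else 0)" for k
    unfolding gen_Ref_diff by (simp add: sref_def transpose_def)
  have "b = a + 1" "rep n a = i"
    using assms(2,3) d[of a] d[of b] by (auto split: if_splits)
  then have "a = i + (a - 1) div n * n" using rep_decomp[of a n] by simp
  then show ?thesis using that[of "(a - 1) div n"] \<open>b = a + 1\<close> by linarith
qed

text \<open>
  Left multiplication by \<open>s\<^sub>i\<close> only exchanges the values \<open>i + m n\<close> and \<open>i + 1 + m n\<close>. Up to translation by \<open>n\<close>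
  this is a single pair of values, so at most one inversion is new.
\<close>

lemma aff_invs_Ref:
  assumes "i \<in> {1..n - 1}" "w \<in> affW n" "(j, k) \<in> aff_invs n (gen n (Ref i) \<circ> w)" "(j, k) \<notin> aff_invs n w"
  shows "inv w i < inv w (i + 1) \<and>
    (j, k) = (rep n (inv w i), inv w (i + 1) - (inv w i - 1) div n * n)"
proof -
  have n: "0 < n" using assms(1) by simp
  have b: "bij w" using assms(2) by (rule affW_bij)
  have jk: "1 \<le> j" "j \<le> n" "j < k" "gen n (Ref i) (w k) < gen n (Ref i) (w j)" "w j < w k"
    using assms(3,4) inj_eq[OF bij_is_inj[OF b], of j k] by (auto simp: aff_invs_def simp del: gen.simps)
  obtain m where m: "w j = i + m * n" "w k = i + 1 + m * n"
    by (rule gen_Ref_swaps[OF assms(1) jk(5,4)])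
  have "j = inv w (i + m * n)" "k = inv w (i + 1 + m * n)"
    using m b by (metis bij_inv_eq_iff)+
  then have jk': "j = inv w i + m * n" "k = inv w (i + 1) + m * n"
    using affW_add[OF affW_inv[OF assms(2)]] by metis+
  have "j = rep n (inv w i)" using jk(1,2) rep_add[OF n, of "inv w i" m] rep_eq[of j n] jk' by simp
  moreover from this have "m = - ((inv w i - 1) div n)"
    using rep_decomp[of "inv w i" n] jk'(1) n by (smt (verit) mult_cancel_right mult_minus_left)
  ultimately show ?thesis using jk(3) jk' by simp
qed

lemma aff_len_Ref_le:
  assumes "i \<in> {1..n - 1}" "w \<in> affW n"
  shows "aff_len n (gen n (Ref i) \<circ> w) \<le> aff_len n w + 1"
proof -
  have n: "0 < n" using assms(1) by simp
  have "aff_invs n (gen n (Ref i) \<circ> w) \<subseteq>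
    insert (rep n (inv w i), inv w (i + 1) - (inv w i - 1) div n * n) (aff_invs n w)"
    using aff_invs_Ref[OF assms] by (auto simp del: gen.simps)
  then have "card (aff_invs n (gen n (Ref i) \<circ> w)) \<le>
    card (insert (rep n (inv w i), inv w (i + 1) - (inv w i - 1) div n * n) (aff_invs n w))"
    using finite_aff_invs[OF n assms(2)] by (intro card_mono) auto
  also have "\<dots> \<le> card (aff_invs n w) + 1" using finite_aff_invs[OF n assms(2)] by (simp add: card_insert_if)
  finally show ?thesis by (simp only: aff_len_eq)
qed

lemma aff_len_Ref_le_descent:
  assumes "i \<in> {1..n - 1}" "w \<in> affW n" "inv w (i + 1) < inv w i"
  shows "aff_len n (gen n (Ref i) \<circ> w) \<le> aff_len n w"
proof -
  have n: "0 < n" using assms(1) by simp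
  have "aff_invs n (gen n (Ref i) \<circ> w) \<subseteq> aff_invs n w"
    using aff_invs_Ref[OF assms(1,2)] assms(3) by force
  then show ?thesis
    unfolding aff_len_eq using finite_aff_invs[OF n assms(2)] by (intro card_mono)
qed

lemma aff_len_Rot: "aff_len n (gen n Rot \<circ> w) = aff_len n w"
proof -
  have "(gen n Rot \<circ> w) k < (gen n Rot \<circ> w) j \<longleftrightarrow> w k < w j" for j k
    by (simp only: comp_apply gen.simps add_less_cancel_right)
  then show ?thesis unfolding aff_len_def by (simp only:)
qed

abbreviation refs :: "letter list \<Rightarrow> nat"
  where "refs ws \<equiv> length (filter (\<lambda>a. a \<noteq> Rot) ws)"

lemma aff_len_word_le: "good_letters n ws \<Longrightarrow> aff_len n (aff_word n ws) \<le> refs ws"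
proof (induction ws)
  case Nil
  have "aff_invs n id = {}" by (auto simp: aff_invs_def)
  then show ?case unfolding aff_word_simps aff_len_eq by simp
next
  case (Cons a ws)
  show ?case
  proof (cases a)
    case (Ref i)
    then have "i \<in> {1..n - 1}" "good_letters n ws" using Cons.prems by simp_all
    then have "aff_len n (gen n (Ref i) \<circ> aff_word n ws) \<le> refs ws + 1"
      using aff_len_Ref_le[OF _ aff_word_affW] Cons.IH by (meson add_le_mono1 order_trans)
    moreover have "refs (a # ws) = refs ws + 1" using Ref by simp
    ultimately show ?thesis by (simp only: Ref aff_word_simps)
  next
    case Rot
    then have "aff_len n (aff_word n ws) \<le> refs (a # ws)" using Cons by simp
    then show ?thesis by (simp only: Rot aff_word_simps aff_len_Rot)
  qed
qed

text \<open>
  A word is ascending if each reflection acts on an exponent whose relevant entries are strictly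
  decreasing. These are the words along which the recursion for the polynomials can be run.
\<close>

fun ascending :: "int \<Rightarrow> letter list \<Rightarrow> bool"
  where
    "ascending n [] \<longleftrightarrow> True"
  | "ascending n (Rot # ws) \<longleftrightarrow> ascending n ws"
  | "ascending n (Ref i # ws) \<longleftrightarrow> i \<in> {1..n - 1} \<and>
      coef (start n ws) (i + 1) < coef (start n ws) i \<and> ascending n ws"

lemma ascending_good_letters: "ascending n ws \<Longrightarrow> good_letters n ws"
  by (induction n ws rule: ascending.induct) auto

text \<open>
  Each tail of the word is again reduced and minimal for its exponent. A reflection of two equal entries
  could be omitted, and a reflection of increasing entries would not increase the length.
\<close>

lemma minimal_ascending:
  assumes "0 < n" "good_letters n ws" "refs ws = aff_len n (aff_word n ws)"
    "\<And>w. w \<in> affW n \<Longrightarrow> aff_act n w 0 = start n ws \<Longrightarrow> aff_len n (aff_word n ws) \<le> aff_len n w"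
  shows "ascending n ws"
  using assms(2-)
proof (induction ws)
  case (Cons a ws)
  let ?w = "aff_word n ws"
  show ?case
  proof (cases a)
    case Rot
    have ws: "good_letters n ws" using Cons.prems(1) Rot by simp
    have len: "aff_len n (aff_word n (a # ws)) = aff_len n ?w"
      unfolding Rot aff_word_simps by (rule aff_len_Rot)
    have "aff_len n ?w \<le> aff_len n w" if w: "w \<in> affW n" "aff_act n w 0 = start n ws" for w
    proof -
      have "aff_act n (gen n Rot \<circ> w) 0 = start n (a # ws)"
        unfolding Rot aff_word_simps
        using w aff_act_comp[OF assms(1) gen_Rot_affW] aff_word_affW[OF ws] by metis
      then show ?thesis
        using Cons.prems(3)[OF affW_comp[OF gen_Rot_affW w(1)]] unfolding len aff_len_Rot by blast
    qed
    moreover have "refs (a # ws) = refs ws" using Rot by simp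
    then have "refs ws = aff_len n ?w" using Cons.prems(2) len by (simp only:)
    ultimately have "ascending n ws" using Cons.IH ws by blast
    then show ?thesis using Rot by simp
  next
    case (Ref i)
    have i: "i \<in> {1..n - 1}" and ws: "good_letters n ws" using Cons.prems(1) Ref by simp_all
    have w: "?w \<in> affW n" by (rule aff_word_affW[OF ws])
    let ?s = "gen n (Ref i)"
    have len_le: "aff_len n (?s \<circ> ?w) \<le> aff_len n ?w + 1" by (rule aff_len_Ref_le[OF i w])
    have "refs (a # ws) = refs ws + 1" using Ref by simp
    then have refs: "refs ws + 1 = aff_len n (?s \<circ> ?w)"
      using Cons.prems(2) unfolding Ref aff_word_simps by (simp only:)
    then have len: "aff_len n (?s \<circ> ?w) = aff_len n ?w + 1" "refs ws = aff_len n ?w"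
      using len_le aff_len_word_le[OF ws] by linarith+
    have min: "aff_len n (?s \<circ> ?w) \<le> aff_len n v"
      if "v \<in> affW n" "aff_act n v 0 = aff_act n (?s \<circ> ?w) 0" for v
      using Cons.prems(3)[of v] that unfolding Ref aff_word_simps by blast
    have "aff_len n ?w \<le> aff_len n v" if v: "v \<in> affW n" "aff_act n v 0 = start n ws" for v
    proof -
      have "aff_act n (?s \<circ> v) 0 = aff_act n (?s \<circ> ?w) 0"
        using v w aff_act_comp[OF assms(1) gen_Ref_affW[OF i]] by metis
      then show ?thesis
        using min[OF affW_comp[OF gen_Ref_affW[OF i] v(1)]] len(1) aff_len_Ref_le[OF i v(1)] by linarith
    qed
    then have asc: "ascending n ws" using Cons.IH ws len(2) by blast
    have in_n: "i \<in> {1..n}" "i + 1 \<in> {1..n}" using i by auto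
    have "coef (start n ws) (i + 1) < coef (start n ws) i"
    proof (rule ccontr)
      assume "\<not> ?thesis"
      then consider "coef (start n ws) i = coef (start n ws) (i + 1)"
        | "coef (start n ws) i < coef (start n ws) (i + 1)" by linarith
      then show False
      proof cases
        case 1
        then have "sact i (start n ws) = start n ws" by (simp add: sact_eq)
        then have "aff_act n (?s \<circ> ?w) 0 = start n ws"
          using start_Ref[of n i ws] i ws by (simp only: aff_word_simps good_letters_simps)
        then show False using min[OF w] len(1) by simp
      next
        case 2
        then have lt: "(inv ?w (i + 1) - 1) div n < (inv ?w i - 1) div n"
          using coef_start[OF in_n(1), of ?w] coef_start[OF in_n(2), of ?w] by simp
        have "inv ?w (i + 1) < inv ?w i"
        proof (rule ccontr)
          assume "\<not> ?thesis"
          then have "(inv ?w i - 1) div n \<le> (inv ?w (i + 1) - 1) div n"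
            using assms(1) by (intro zdiv_mono1) auto
          then show False using lt by simp
        qed
        then show False using aff_len_Ref_le_descent[OF i w] len(1) by simp
      qed
    qed
    then show ?thesis using asc i Ref by simp
  qed
qed simp

text \<open>
  The inverse of the word maps \<open>i\<close> to an integer whose quotient by \<open>n\<close> is given by the \<open>i\<close>-th entry of the
  exponent (\<open>coef_start\<close>). The residue is the sorting permutation, since both change in the same way with
  each letter; for reflections this uses that the entries are different.
\<close>

lemma rep_start:
  assumes "0 < n" "ascending n ws" "i \<in> {1..n}"
  shows "rep n (inv (aff_word n ws) i) = vperm n (start n ws) i"
  using assms(2,3)
proof (induction n ws arbitrary: i rule: ascending.induct)
  case (1 n)
  show ?case unfolding start_Nil vperm_zero unfolding aff_word_simps inv_id using 1 by (simp add: rep_eq)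
next
  case (2 n ws)
  have n: "0 < n" using 2 by simp
  let ?w = "aff_word n ws"
  have ws: "good_letters n ws" using 2 ascending_good_letters by simp
  have w: "?w \<in> affW n" by (rule aff_word_affW[OF ws])
  have "inv (gen n Rot) = (\<lambda>k. k - 1)" by (rule inv_equality) auto
  then have inv: "inv (aff_word n (Rot # ws)) k = inv ?w (k - 1)" for k
    unfolding aff_word_simps using affW_bij[OF w] affW_bij[OF gen_Rot_affW] by (simp add: o_inv_distrib)
  show ?case
  proof (cases "i = 1")
    case True
    have "inv ?w (n + (- 1) * n) = inv ?w n + (- 1) * n" by (rule affW_add[OF affW_inv[OF w]])
    then have "rep n (inv ?w 0) = rep n (inv ?w n)" using rep_add[OF n, of "inv ?w n" "- 1"] by simp
    then show ?thesis
      unfolding inv start_Rot[OF n ws] vperm_piact[OF n] using 2 True n by (simp add: unrot_def)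
  next
    case False
    then show ?thesis
      unfolding inv start_Rot[OF n ws] vperm_piact[OF n] using 2 n by (simp add: unrot_def)
  qed
next
  case (3 n j ws)
  have j: "j \<in> {1..n - 1}" and ne: "coef (start n ws) j \<noteq> coef (start n ws) (j + 1)" and ws: "good_letters n ws"
    using 3 ascending_good_letters by auto
  let ?w = "aff_word n ws"
  have w: "?w \<in> affW n" by (rule aff_word_affW[OF ws])
  have "inv (gen n (Ref j)) = gen n (Ref j)" by (rule inv_equality) (rule gen_Ref_gen_Ref[OF j])+
  then have inv: "inv (aff_word n (Ref j # ws)) k = inv ?w (gen n (Ref j) k)" for k
    unfolding aff_word_simps using affW_bij[OF w] affW_bij[OF gen_Ref_affW[OF j]]
    by (simp add: o_inv_distrib del: gen.simps)
  have st: "start n (Ref j # ws) = sact j (start n ws)" using j ws by (intro start_Ref) simp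
  show ?case
    unfolding inv gen_Ref_in[OF 3(3)] st vperm_sact[OF j ne] comp_apply
    using 3 sref_in[OF j 3(3)] by simp
qed

lemma inv_gen_act_add: "inv_gen_act n a (x + y) = inv_gen_act n a x + inv_gen_act n a y"
  and inv_gen_act_diff: "inv_gen_act n a (x - y) = inv_gen_act n a x - inv_gen_act n a y"
  and inv_gen_act_Kel: "inv_gen_act n a (frag_of Kel) = frag_of Kel"
  by (simp_all add: inv_gen_act_def frag_extend_add frag_extend_diff)

lemma fold_inv_gen_act_add:
  "fold (inv_gen_act n) ws (x + y) = fold (inv_gen_act n) ws x + fold (inv_gen_act n) ws y"
  by (induction ws arbitrary: x y) (simp_all add: inv_gen_act_add)

lemma fold_inv_gen_act_diff:
  "fold (inv_gen_act n) ws (x - y) = fold (inv_gen_act n) ws x - fold (inv_gen_act n) ws y"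
  by (induction ws arbitrary: x y) (simp_all add: inv_gen_act_diff)

lemma fold_inv_gen_act_Kel: "fold (inv_gen_act n) ws (frag_of Kel) = frag_of Kel"
  by (induction ws) (simp_all add: inv_gen_act_Kel)

text \<open>
  With the convention \<open>\<epsilon>\<^bsub>i+mn\<^esub>\<^sup>\<or> = \<epsilon>\<^sub>i\<^sup>\<or> - m K\<close> the action on coroots is induced by the action on integers.
\<close>

lemma fold_inv_gen_act_Eps:
  assumes "0 < n" "good_letters n ws" "i \<in> {1..n}"
  shows "fold (inv_gen_act n) ws (frag_of (Eps i)) =
    frag_of (Eps (rep n (inv (aff_word n ws) i))) -
    frag_cmul ((inv (aff_word n ws) i - 1) div n) (frag_of Kel)"
  using assms(2,3)
proof (induction ws arbitrary: i)
  case Nil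
  then show ?case unfolding aff_word_simps by (simp add: inv_id rep_eq div_pos_pos_trivial)
next
  case (Cons a ws)
  let ?w = "aff_word n ws"
  show ?case
  proof (cases a)
    case Rot
    have ws: "good_letters n ws" using Cons.prems Rot by simp
    have w: "?w \<in> affW n" by (rule aff_word_affW[OF ws])
    have "inv (gen n Rot) = (\<lambda>k. k - 1)" by (rule inv_equality) auto
    then have inv: "inv (aff_word n (Rot # ws)) k = inv ?w (k - 1)" for k
      unfolding aff_word_simps using affW_bij[OF w] affW_bij[OF gen_Rot_affW] by (simp add: o_inv_distrib)
    show ?thesis
    proof (cases "i = 1")
      case True
      have "inv ?w (n + (- 1) * n) = inv ?w n + (- 1) * n" by (rule affW_add[OF affW_inv[OF w]])
      then have 0: "inv ?w 0 = inv ?w n + (- 1) * n" by simp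
      have "fold (inv_gen_act n) (a # ws) (frag_of (Eps i)) =
        fold (inv_gen_act n) ws (frag_of (Eps n)) + frag_of Kel"
        unfolding Rot True by (simp add: inv_gen_act_def fold_inv_gen_act_add fold_inv_gen_act_Kel)
      also have "\<dots> = frag_of (Eps (rep n (inv ?w 0))) - frag_cmul ((inv ?w 0 - 1) div n) (frag_of Kel)"
        unfolding 0 rep_add[OF assms(1)] div_add[OF assms(1)]
        using Cons.IH[OF ws, of n] assms(1) by (simp add: frag_cmul_diff_distrib)
      finally show ?thesis unfolding Rot inv True by simp
    next
      case False
      then show ?thesis
        using Cons.IH[OF ws, of "i - 1"] Cons.prems(2) unfolding Rot inv by (simp add: inv_gen_act_def)
    qed
  next
    case (Ref j)
    have j: "j \<in> {1..n - 1}" and ws: "good_letters n ws" using Cons.prems Ref by simp_all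
    have w: "?w \<in> affW n" by (rule aff_word_affW[OF ws])
    have "inv (gen n (Ref j)) = gen n (Ref j)" by (rule inv_equality) (rule gen_Ref_gen_Ref[OF j])+
    then have inv: "inv (aff_word n (Ref j # ws)) k = inv ?w (gen n (Ref j) k)" for k
      unfolding aff_word_simps using affW_bij[OF w] affW_bij[OF gen_Ref_affW[OF j]]
      by (simp add: o_inv_distrib del: gen.simps)
    show ?thesis
      unfolding Ref inv gen_Ref_in[OF Cons.prems(2)]
      using Cons.IH[OF ws sref_in[OF j Cons.prems(2)]] by (simp add: inv_gen_act_def)
  qed
qed

lemma ht_Eps:
  assumes "j \<in> {1..n}" "k \<in> {1..n}"
  shows "ht n (- (frag_of (Eps j) - frag_of (Eps k) - frag_cmul m (frag_of Kel))) = j - k"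
proof -
  have neg: "ht n (- x) = - ht n x" for x
    by (simp add: ht_def sum_negf)
  show ?thesis unfolding neg ht_coroot[OF assms] by simp
qed

lemma d_step_eq:
  assumes "0 < n" "ascending n (Ref i # ws)"
  defines "\<nu> \<equiv> start n ws"
  shows "q powi sh (- fold (inv_gen_act n) ws (alpha i)) *
    (th ^ 2) powi ht n (- fold (inv_gen_act n) ws (alpha i)) =
    q powi (coef \<nu> i - coef \<nu> (i + 1)) * (th ^ 2) powi (vperm n \<nu> i - vperm n \<nu> (i + 1))"
proof -
  have i: "i \<in> {1..n}" "i + 1 \<in> {1..n}" and asc: "ascending n ws" using assms(2) by auto
  have ws: "good_letters n ws" by (rule ascending_good_letters[OF asc])
  let ?w = "aff_word n ws" and ?v = "vperm n \<nu>"
  define m where "m = coef \<nu> (i + 1) - coef \<nu> i"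
  have cmul: "frag_cmul (- a - - b) x = frag_cmul b x - frag_cmul a x" for a b :: int and x :: coweight
    using frag_cmul_diff_distrib[of b a x] by simp
  have \<beta>: "fold (inv_gen_act n) ws (alpha i) =
    frag_of (Eps (?v i)) - frag_of (Eps (?v (i + 1))) - frag_cmul m (frag_of Kel)"
    unfolding alpha_def fold_inv_gen_act_diff fold_inv_gen_act_Eps[OF assms(1) ws i(1)]
      fold_inv_gen_act_Eps[OF assms(1) ws i(2)] rep_start[OF assms(1) asc i(1)]
      rep_start[OF assms(1) asc i(2)] m_def \<nu>_def coef_start[OF i(1)] coef_start[OF i(2)]
    unfolding cmul by simp
  have v: "?v i \<in> {1..n}" "?v (i + 1) \<in> {1..n}"
    using permutes_in_image[OF vperm_permutes[of n \<nu>]] i by blast+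
  have neg: "sh (- x) = - sh x" for x by (simp add: sh_def)
  have "sh (- fold (inv_gen_act n) ws (alpha i)) = coef \<nu> i - coef \<nu> (i + 1)"
    unfolding \<beta> neg sh_coroot m_def by simp
  moreover have "ht n (- fold (inv_gen_act n) ws (alpha i)) = ?v i - ?v (i + 1)"
    unfolding \<beta> by (rule ht_Eps[OF v])
  ultimately show ?thesis by (simp only:)
qed

section \<open>The alcove walk formula\<close>

text \<open>Induction on the word needs walks that start at an arbitrary element.\<close>

definition walks :: "int \<Rightarrow> (int \<Rightarrow> int) \<Rightarrow> letter list \<Rightarrow> (int \<Rightarrow> int) list set"
  where "walks n p0 ws = {p. length p = length ws + 1 \<and> p ! 0 = p0 \<and>
    (\<forall>k\<in>{1..length ws}.
      (case ws ! (k - 1) of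
        Rot \<Rightarrow> p ! k = p ! (k - 1) \<circ> gen n Rot
      | Ref i \<Rightarrow> p ! k \<in> {p ! (k - 1), p ! (k - 1) \<circ> gen n (Ref i)}))}"

lemma AW_eq_walks: "AW n z ws = walks n (periodic n z) ws"
  by (simp add: AW_def walks_def)

lemma walks_Nil: "walks n p0 [] = {[p0]}"
  by (auto simp: walks_def length_Suc_conv)

lemma atLeastAtMost_Suc_split: "(\<forall>k\<in>{1..Suc m}. P k) \<longleftrightarrow> P 1 \<and> (\<forall>k\<in>{1..m}. P (Suc k))"
proof -
  have eq: "{1..Suc m} = insert 1 (Suc ` {1..m})"
    by (simp add: image_Suc_atLeastAtMost atLeastAtMost_insertL)
  show ?thesis unfolding eq by (simp only: ball_simps)
qed

lemma walks_Cons: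
  "p0 # p \<in> walks n p0' (a # ws) \<longleftrightarrow> p0 = p0' \<and> p \<noteq> [] \<and>
    (case a of Rot \<Rightarrow> hd p = p0 \<circ> gen n Rot | Ref i \<Rightarrow> hd p \<in> {p0, p0 \<circ> gen n (Ref i)}) \<and>
    p \<in> walks n (hd p) ws"
proof (cases "p = []")
  case True
  then show ?thesis by (simp add: walks_def)
next
  case False
  define Q where "Q ws p k = (case ws ! (k - 1) of
        Rot \<Rightarrow> p ! k = p ! (k - 1) \<circ> gen n Rot
      | Ref i \<Rightarrow> p ! k \<in> {p ! (k - 1), p ! (k - 1) \<circ> gen n (Ref i)})" for ws k and p :: "(int \<Rightarrow> int) list"
  have walks: "p \<in> walks n p0 ws \<longleftrightarrow> length p = length ws + 1 \<and> p ! 0 = p0 \<and> (\<forall>k\<in>{1..length ws}. Q ws p k)"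
    for p p0 ws unfolding walks_def Q_def by (rule mem_Collect_eq)
  have "Q (a # ws) (p0 # p) (Suc k) \<longleftrightarrow> Q ws p k" if "k \<in> {1..length ws}" for k
  proof -
    obtain j where "k = Suc j" using \<open>k \<in> {1..length ws}\<close> by (cases k) auto
    then show ?thesis unfolding Q_def by (simp only: diff_Suc_1 nth_Cons_Suc)
  qed
  then have tail: "(\<forall>k\<in>{1..length ws}. Q (a # ws) (p0 # p) (Suc k)) \<longleftrightarrow> (\<forall>k\<in>{1..length ws}. Q ws p k)"
    by blast
  have hd: "p ! 0 = hd p" using False by (simp add: hd_conv_nth)
  have "Q (a # ws) (p0 # p) 1 \<longleftrightarrow>
    (case a of Rot \<Rightarrow> hd p = p0 \<circ> gen n Rot | Ref i \<Rightarrow> hd p \<in> {p0, p0 \<circ> gen n (Ref i)})"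
    unfolding Q_def One_nat_def diff_self_eq_0 nth_Cons_Suc nth_Cons_0 hd by (rule refl)
  moreover have "length (a # ws) = Suc (length ws)" "length (p0 # p) = length (a # ws) + 1 \<longleftrightarrow> length p = length ws + 1"
    by simp_all
  ultimately show ?thesis
    unfolding walks using False by (simp only: atLeastAtMost_Suc_split tail hd nth_Cons_0) blast
qed

lemma walks_nonempty_list: "p \<in> walks n p0 ws \<Longrightarrow> \<exists>p'. p = p0 # p'"
  by (cases p) (auto simp: walks_def)

lemma walks_Rot: "walks n p0 (Rot # ws) = (#) p0 ` walks n (p0 \<circ> gen n Rot) ws"
proof (intro equalityI subsetI)
  fix p assume p: "p \<in> walks n p0 (Rot # ws)"
  then obtain p' where p': "p = p0 # p'" using walks_nonempty_list by blast
  then have "p' \<in> walks n (p0 \<circ> gen n Rot) ws"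
    using p unfolding p' walks_Cons letter.case by metis
  then show "p \<in> (#) p0 ` walks n (p0 \<circ> gen n Rot) ws" using p' by blast
next
  fix p assume "p \<in> (#) p0 ` walks n (p0 \<circ> gen n Rot) ws"
  then obtain p' where p': "p = p0 # p'" "p' \<in> walks n (p0 \<circ> gen n Rot) ws" by blast
  obtain p'' where "p' = (p0 \<circ> gen n Rot) # p''" using walks_nonempty_list[OF p'(2)] ..
  then have hd: "p' \<noteq> []" "hd p' = p0 \<circ> gen n Rot" by (metis list.distinct(1), metis list.sel(1))
  show "p \<in> walks n p0 (Rot # ws)"
    unfolding p'(1) walks_Cons letter.case hd(2) by (intro conjI refl hd(1) p'(2))
qed

lemma walks_Ref:
  "walks n p0 (Ref i # ws) = (#) p0 ` (walks n p0 ws \<union> walks n (p0 \<circ> gen n (Ref i)) ws)"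
proof (intro equalityI subsetI)
  fix p assume p: "p \<in> walks n p0 (Ref i # ws)"
  then obtain p' where p': "p = p0 # p'" using walks_nonempty_list by blast
  then have "p' \<in> walks n p0 ws \<union> walks n (p0 \<circ> gen n (Ref i)) ws"
    using p unfolding p' walks_Cons letter.case by (metis UnI1 UnI2 insertE singletonD)
  then show "p \<in> (#) p0 ` (walks n p0 ws \<union> walks n (p0 \<circ> gen n (Ref i)) ws)" using p' by blast
next
  fix p assume "p \<in> (#) p0 ` (walks n p0 ws \<union> walks n (p0 \<circ> gen n (Ref i)) ws)"
  then obtain p' p1 where p': "p = p0 # p'" "p' \<in> walks n p1 ws" "p1 \<in> {p0, p0 \<circ> gen n (Ref i)}" by blast
  obtain p'' where "p' = p1 # p''" using walks_nonempty_list[OF p'(2)] ..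
  then have hd: "p' \<noteq> []" "hd p' = p1" by simp_all
  show "p \<in> walks n p0 (Ref i # ws)"
    unfolding p'(1) walks_Cons letter.case hd(2) by (intro conjI refl hd(1) p'(2,3))
qed

lemma finite_walks: "finite (walks n p0 ws)"
proof (induction ws arbitrary: p0)
  case (Cons a ws)
  show ?case
  proof (cases a)
    case Rot
    show ?thesis unfolding Rot walks_Rot by (intro finite_imageI Cons.IH)
  next
    case (Ref i)
    show ?thesis unfolding Ref walks_Ref by (intro finite_imageI finite_UnI Cons.IH)
  qed
qed (simp add: walks_Nil)

lemma wt_step_Cons: "wt_step n q th (a # ws) (p0 # p) (Suc (Suc k)) = wt_step n q th ws p (Suc k)"
  unfolding wt_step_def d_step_def beta_def twice_norm_def mu_at_def
  by (simp only: diff_Suc_1 nth_Cons_Suc drop_Suc_Cons)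

lemma wt_walk_Cons:
  "wt_walk n q th (a # ws) (p0 # p) = wt_step n q th (a # ws) (p0 # p) 1 * wt_walk n q th ws p"
proof -
  have "{1..length (a # ws)} = insert 1 (Suc ` {1..length ws})"
    by (simp add: image_Suc_atLeastAtMost atLeastAtMost_insertL)
  then have "wt_walk n q th (a # ws) (p0 # p) =
    (\<Prod>k\<in>insert 1 (Suc ` {1..length ws}). wt_step n q th (a # ws) (p0 # p) k)"
    by (simp only: wt_walk_def)
  also have "\<dots> = wt_step n q th (a # ws) (p0 # p) 1 *
    (\<Prod>k\<in>Suc ` {1..length ws}. wt_step n q th (a # ws) (p0 # p) k)"
    by (rule prod.insert) auto
  also have "(\<Prod>k\<in>Suc ` {1..length ws}. wt_step n q th (a # ws) (p0 # p) k) =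
    (\<Prod>k\<in>{1..length ws}. wt_step n q th (a # ws) (p0 # p) (Suc k))"
    by (subst prod.reindex) (simp_all add: comp_def)
  also have "(\<Prod>k\<in>{1..length ws}. wt_step n q th (a # ws) (p0 # p) (Suc k)) = wt_walk n q th ws p"
    unfolding wt_walk_def
  proof (intro prod.cong refl)
    fix k assume "k \<in> {1..length ws}"
    then obtain j where "k = Suc j" by (cases k) auto
    then show "wt_step n q th (a # ws) (p0 # p) (Suc k) = wt_step n q th ws p k"
      by (simp only: wt_step_Cons)
  qed
  finally show ?thesis .
qed

lemma overline_Rot:
  assumes "0 < n" "w \<in> affW n"
  shows "overline n (w \<circ> gen n Rot) = overline n w \<circ> rot 1 n"
proof
  fix i
  consider "i \<in> {1..n - 1}" | "i = n" | "i \<notin> {1..n}" using assms(1) by fastforce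
  then show "overline n (w \<circ> gen n Rot) i = (overline n w \<circ> rot 1 n) i"
  proof cases
    case 1
    then show ?thesis by (auto simp: overline_def rot_def)
  next
    case 2
    have "w (1 + 1 * n) = w 1 + 1 * n" by (rule affW_add[OF assms(2)])
    then have "rep n (w (n + 1)) = rep n (w 1)" using rep_add[OF assms(1), of "w 1" 1] by (simp add: add.commute)
    then show ?thesis using 2 assms(1) by (simp add: overline_def rot_def)
  next
    case 3
    then show ?thesis using assms(1) by (auto simp: overline_def rot_def)
  qed
qed

lemma overline_Ref:
  assumes "i \<in> {1..n - 1}"
  shows "overline n (w \<circ> gen n (Ref i)) = overline n w \<circ> sref i"
proof
  fix k
  show "overline n (w \<circ> gen n (Ref i)) k = (overline n w \<circ> sref i) k"
  proof (cases "k \<in> {1..n}")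
    case True
    then show ?thesis
      using sref_in[OF assms True] gen_Ref_in[OF True] by (simp add: overline_def del: gen.simps)
  next
    case False
    then have "sref i k = k" using assms by (intro sref_other) auto
    then show ?thesis using False by (simp only: overline_def comp_apply if_False)
  qed
qed

lemma overline_permutes:
  assumes "0 < n" "w \<in> affW n"
  shows "overline n w permutes {1..n}"
proof (rule bij_imp_permutes)
  have "inj_on (overline n w) {1..n}"
  proof (rule inj_onI)
    fix i j assume ij: "i \<in> {1..n}" "j \<in> {1..n}" "overline n w i = overline n w j"
    then have "rep n (w i) = rep n (w j)" by (simp add: overline_def)
    then have "w i = w j + ((w i - 1) div n - (w j - 1) div n) * n"
      using rep_decomp[of "w i" n] rep_decomp[of "w j" n] by (simp add: algebra_simps)
    then have "w i = w (j + ((w i - 1) div n - (w j - 1) div n) * n)"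
      using affW_add[OF assms(2)] by metis
    then have "i = j + ((w i - 1) div n - (w j - 1) div n) * n"
      using affW_bij[OF assms(2)] by (metis bij_inv_eq_iff)
    then have "rep n i = rep n j" using rep_add[OF assms(1)] by metis
    then show "i = j" using ij by (simp add: rep_eq)
  qed
  moreover have "overline n w ` {1..n} \<subseteq> {1..n}"
    using rep_in[OF assms(1)] by (auto simp: overline_def simp del: atLeastAtMost_iff)
  ultimately show "bij_betw (overline n w) {1..n} {1..n}"
    by (simp add: bij_betw_def endo_inj_surj)
qed (simp only: overline_def if_False)

lemma periodic_affW:
  assumes "0 < n" "z permutes {1..n}" shows "periodic n z \<in> affW n"
proof -
  have per: "periodic n z (k + m * n) = periodic n z k + m * n" for k m
    unfolding periodic_def rep_add[OF assms(1)] div_add[OF assms(1)] by (simp add: algebra_simps)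
  have val: "periodic n y k = y k" if "k \<in> {1..n}" for k y
    using that by (simp add: periodic_def rep_eq div_pos_pos_trivial)
  have inv: "periodic n y (periodic n z k) = k" if yz: "\<And>k. y (z k) = k" "z permutes {1..n}" for y z k
  proof -
    have "periodic n y (periodic n z k) = periodic n y (z (rep n k) + (k - 1) div n * n)"
      by (simp add: periodic_def[of n z] mult.commute)
    also have "\<dots> = periodic n y (z (rep n k)) + (k - 1) div n * n"
      unfolding periodic_def[of n y] rep_add[OF assms(1)] div_add[OF assms(1)] by (simp add: algebra_simps)
    also have "periodic n y (z (rep n k)) = y (z (rep n k))"
      using rep_in[OF assms(1), of k] permutes_in_image[OF yz(2)] by (intro val) blast
    also have "\<dots> + (k - 1) div n * n = k" using yz(1) rep_decomp[of k n] by simp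
    finally show ?thesis .
  qed
  have "bij (periodic n z)"
  proof (rule o_bij[of "periodic n (inv z)"])
    show "periodic n (inv z) \<circ> periodic n z = id"
      using inv[of "inv z" z] permutes_inverses[OF assms(2)] assms(2) by (simp add: fun_eq_iff)
    show "periodic n z \<circ> periodic n (inv z) = id"
      using inv[of z "inv z"] permutes_inverses[OF assms(2)] permutes_inv[OF assms(2)] by (simp add: fun_eq_iff)
  qed
  then show ?thesis using per[of _ 1] by (simp add: affW_def)
qed

lemma overline_periodic:
  assumes "0 < n" "z permutes {1..n}" shows "overline n (periodic n z) = z"
proof
  fix i
  show "overline n (periodic n z) i = z i"
  proof (cases "i \<in> {1..n}")
    case True
    then have "z i \<in> {1..n}" using permutes_in_image[OF assms(2)] by blast
    then show ?thesis using True by (simp add: overline_def periodic_def rep_eq div_pos_pos_trivial)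
  next
    case False
    then show ?thesis using permutes_not_in[OF assms(2) False] by (simp only: overline_def if_False)
  qed
qed

context macdonald begin

lemma is_E_exists_word: "ascending n ws \<Longrightarrow> \<exists>f. is_E (start n ws) f"
proof (induction ws)
  case Nil
  show ?case unfolding start_Nil using is_E_0 by blast
next
  case (Cons a ws)
  have ws: "ascending n ws" "good_letters n ws"
    using Cons.prems ascending_good_letters by (cases a; auto)+
  then obtain f where f: "is_E (start n ws) f" using Cons.IH by blast
  show ?case
  proof (cases a)
    case Rot
    then show ?thesis using is_E_raise[OF f] start_Rot[OF n ws(2)] by metis
  next
    case (Ref i)
    then have i: "i \<in> {1..n - 1}" "coef (start n ws) (i + 1) < coef (start n ws) i" using Cons.prems by auto
    then have "start n (Ref i # ws) = sact i (start n ws)" using ws(2) by (intro start_Ref) simp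
    then show ?thesis using is_E_T[OF f i] Ref by metis
  qed
qed

lemma wt_step_fold:
  assumes asc: "ascending n (Ref i # ws)" and p0: "p0 \<in> affW n" and p: "p \<in> walks n p0 ws"
  shows "wt_step n q th (Ref i # ws) (p0 # p) 1 = Const (fold_weight (overline n p0) (start n ws) i)"
proof -
  let ?z = "overline n p0" and ?\<nu> = "start n ws"
  have i: "i \<in> {1..n - 1}" and gt: "coef ?\<nu> (i + 1) < coef ?\<nu> i" and ws: "good_letters n ws"
    using asc ascending_good_letters by auto
  have z: "?z permutes {1..n}" by (rule overline_permutes[OF n p0])
  have zi: "?z i \<noteq> ?z (i + 1)" using permutes_inj[OF z] by (simp add: inj_eq)
  have hd: "p ! 0 = p0" using p by (simp add: walks_def)
  have up: "perm_len n (?z \<circ> sref i) > perm_len n ?z \<longleftrightarrow> ?z i < ?z (i + 1)"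
    using perm_len_sref[OF i z] perm_len_sref_less[OF i z] zi by (cases "?z i < ?z (i + 1)") auto
  have d: "d_step n q th (Ref i # ws) 1 i = dval ?\<nu> i"
    using d_step_eq[OF n asc, of q th] by (simp add: d_step_def beta_def dval_def)
  have mu: "mu_at n (Ref i # ws) 1 = sact i ?\<nu>"
    using start_Ref[of n i ws] i ws by (simp only: mu_at_def diff_self_eq_0 drop_0 good_letters_simps)
  have v: "vperm n (sact i ?\<nu>) = vperm n ?\<nu> \<circ> sref i" using gt by (intro vperm_sact[OF i]) simp
  have vinv: "inv (vperm n ?\<nu> \<circ> sref i) = sref i \<circ> inv (vperm n ?\<nu>)"
    using permutes_bij[OF vperm_permutes[of n ?\<nu>]] by (simp add: o_inv_distrib)
  have "?z \<circ> sref i \<circ> (sref i \<circ> inv (vperm n ?\<nu>)) = ?z \<circ> inv (vperm n ?\<nu>)"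
    by (simp add: fun_eq_iff)
  then have norm: "twice_norm n (Ref i # ws) (p0 # p) 1 i =
    int (perm_len n (?z \<circ> inv (vperm n ?\<nu>))) - int (perm_len n (?z \<circ> sref i \<circ> inv (vperm n ?\<nu>))) - 1"
    unfolding twice_norm_def Let_def mu v vinv by (simp add: comp_assoc)
  have nth: "(p0 # p) ! 1 = p0" "(p0 # p) ! (1 - 1) = p0" "(Ref i # ws) ! (1 - 1) = Ref i"
    using hd by simp_all
  show ?thesis
    unfolding wt_step_def Let_def nth letter.case up d norm fold_weight_def by (auto simp: mult_ac)
qed

lemma wt_step_cross:
  assumes "i \<in> {1..n - 1}" "p0 \<in> affW n" "p \<in> walks n (p0 \<circ> gen n (Ref i)) ws"
  shows "wt_step n q th (Ref i # ws) (p0 # p) 1 = 1"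
proof -
  have hd: "p ! 0 = p0 \<circ> gen n (Ref i)" using assms(3) by (simp add: walks_def del: gen.simps)
  have "p0 \<circ> gen n (Ref i) \<noteq> p0"
  proof
    assume "p0 \<circ> gen n (Ref i) = p0"
    then have "p0 (gen n (Ref i) i) = p0 i" by (metis comp_apply)
    then have "gen n (Ref i) i = i" using affW_bij[OF assms(2)] by (metis bij_inv_eq_iff)
    then show False using gen_Ref_in[of i n i] assms(1) by simp
  qed
  then show ?thesis using hd by (simp add: wt_step_def del: gen.simps)
qed

text \<open>
  Induction on the word, with one recursion step for the first letter. At a reflection the two terms of
  \<open>E_rel_sact\<close> are the walks that cross and the walks that fold.
\<close>

lemma walk_sum:
  assumes "ascending n ws" "p0 \<in> affW n"
  shows "E_rel n q th (overline n p0) (start n ws) = (\<Sum>p\<in>walks n p0 ws. wt_walk n q th ws p)"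
  using assms
proof (induction ws arbitrary: p0)
  case Nil
  show ?case
    unfolding start_Nil walks_Nil using E_rel_0[OF overline_permutes[OF n Nil(2)]]
    by (simp add: wt_walk_def)
next
  case (Cons a ws)
  have ws: "ascending n ws" "good_letters n ws"
    using Cons.prems ascending_good_letters by (cases a; auto)+
  obtain f where f: "is_E (start n ws) f" using is_E_exists_word[OF ws(1)] by blast
  have z: "overline n p0 permutes {1..n}" by (rule overline_permutes[OF n Cons.prems(2)])
  have inj: "inj_on ((#) p0) A" for A by simp
  show ?case
  proof (cases a)
    case Rot
    let ?p1 = "p0 \<circ> gen n Rot"
    have "(\<Sum>p\<in>walks n p0 (Rot # ws). wt_walk n q th (Rot # ws) p) =
      (\<Sum>p\<in>walks n ?p1 ws. xvar (overline n p0 1) * wt_walk n q th ws p)"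
      unfolding walks_Rot sum.reindex[OF inj] comp_apply[of _ "(#) p0"] wt_walk_Cons
      by (simp add: wt_step_def)
    also have "\<dots> = xvar (overline n p0 1) * E_rel n q th (overline n ?p1) (start n ws)"
      using Cons.IH[OF ws(1) affW_comp[OF Cons.prems(2) gen_Rot_affW]] by (simp only: sum_distrib_left)
    finally show ?thesis
      unfolding Rot start_Rot[OF n ws(2)] E_rel_piact[OF f z] overline_Rot[OF n Cons.prems(2)] by simp
  next
    case (Ref i)
    have i: "i \<in> {1..n - 1}" "coef (start n ws) (i + 1) < coef (start n ws) i" using Cons.prems(1) Ref by auto
    let ?p1 = "p0 \<circ> gen n (Ref i)" and ?C = "Const (fold_weight (overline n p0) (start n ws) i)"
    have p1: "?p1 \<in> affW n" by (intro affW_comp Cons.prems(2) gen_Ref_affW i(1))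
    have ne: "?p1 \<noteq> p0"
    proof
      assume "?p1 = p0"
      then have "p0 (gen n (Ref i) i) = p0 i" by (metis comp_apply)
      then have "gen n (Ref i) i = i" using affW_bij[OF Cons.prems(2)] by (metis bij_inv_eq_iff)
      then show False using gen_Ref_in[of i n i] i(1) by simp
    qed
    have "walks n p0 ws \<inter> walks n ?p1 ws = {}"
      using ne by (auto simp: walks_def simp del: gen.simps)
    then have "(\<Sum>p\<in>walks n p0 (Ref i # ws). wt_walk n q th (Ref i # ws) p) =
      (\<Sum>p\<in>walks n p0 ws. wt_walk n q th (Ref i # ws) (p0 # p)) +
      (\<Sum>p\<in>walks n ?p1 ws. wt_walk n q th (Ref i # ws) (p0 # p))"
      unfolding walks_Ref sum.reindex[OF inj] by (subst sum.union_disjoint) (simp_all add: finite_walks)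
    also have "(\<Sum>p\<in>walks n p0 ws. wt_walk n q th (Ref i # ws) (p0 # p)) =
        (\<Sum>p\<in>walks n p0 ws. ?C * wt_walk n q th ws p)"
      using Cons.prems Ref by (intro sum.cong refl) (simp only: wt_walk_Cons wt_step_fold)
    also have "\<dots> = ?C * E_rel n q th (overline n p0) (start n ws)"
      unfolding Cons.IH[OF ws(1) Cons.prems(2)] by (rule sum_distrib_left[symmetric])
    also have "(\<Sum>p\<in>walks n ?p1 ws. wt_walk n q th (Ref i # ws) (p0 # p)) =
        (\<Sum>p\<in>walks n ?p1 ws. wt_walk n q th ws p)"
      using i(1) Cons.prems(2) by (intro sum.cong refl) (simp only: wt_walk_Cons wt_step_cross mult_1)
    also have "\<dots> = E_rel n q th (overline n p0 \<circ> sref i) (start n ws)"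
      using Cons.IH[OF ws(1) p1] overline_Ref[OF i(1), of p0] by (simp only:)
    finally show ?thesis
      unfolding Ref using start_Ref[of n i ws] i ws(2) E_rel_sact[OF f i z]
      by (simp only: good_letters_simps) (simp add: add.commute)
  qed
qed

end

section \<open>Removing the first box\<close>

text \<open>
  The first box of column \<open>k\<close> is removed, and the rest of the column becomes the last column. If the columns
  before \<open>k\<close> are empty, then \<open>\<mu> = s\<^bsub>k-1\<^esub> \<cdots> s\<^sub>1 \<pi> \<nu>\<close> for the result \<open>\<nu>\<close>.
\<close>

definition shrink :: "int \<Rightarrow> int \<Rightarrow> expo \<Rightarrow> expo"
  where "shrink n k \<mu> = perm_expo (unrot k n) (\<mu> - Poly_Mapping.single k 1)"

definition first_column :: "int \<Rightarrow> int \<Rightarrow> expo \<Rightarrow> bool"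
  where "first_column n k \<mu> \<longleftrightarrow> k \<in> {1..n} \<and> \<mu> \<in> Zn n \<and> (\<forall>i. 0 \<le> coef \<mu> i) \<and>
    (\<forall>i\<in>{1..k - 1}. coef \<mu> i = 0) \<and> 0 < coef \<mu> k"

lemma bij_unrot: "k \<le> n \<Longrightarrow> bij (unrot k n)"
  by (rule bij_betw_byWitness[where f' = "rot k n"]) auto

lemma inv_unrot: "k \<le> n \<Longrightarrow> inv (unrot k n) = rot k n"
  by (rule inv_unique_comp) (auto simp: fun_eq_iff)

lemma coef_shrink:
  "k \<le> n \<Longrightarrow> coef (shrink n k \<mu>) i = coef \<mu> (rot k n i) - (if i = n then 1 else 0)"
  by (auto simp: shrink_def coef_perm_expo' bij_unrot inv_unrot lookup_minus lookup_single when_def rot_def)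

lemma shrink_Zn: "first_column n k \<mu> \<Longrightarrow> shrink n k \<mu> \<in> Zn n"
  by (auto simp: first_column_def Zn_coef coef_shrink rot_def)

lemma shrink_nonneg: "first_column n k \<mu> \<Longrightarrow> 0 \<le> coef (shrink n k \<mu>) i"
  by (auto simp: first_column_def coef_shrink rot_def)

lemma shrink_zero: "first_column n k \<mu> \<Longrightarrow> i \<in> {1..k - 1} \<Longrightarrow> coef (shrink n k \<mu>) i = 0"
  by (auto simp: first_column_def coef_shrink rot_def)

lemma piact_shrink: "first_column n 1 \<mu> \<Longrightarrow> piact n (shrink n 1 \<mu>) = \<mu>"
proof (rule poly_mapping_eqI)
  fix i assume f: "first_column n 1 \<mu>"
  then have n: "0 < n" "1 \<le> n" by (auto simp: first_column_def)
  show "coef (piact n (shrink n 1 \<mu>)) i = coef \<mu> i"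
    unfolding coef_piact[OF n(1)] coef_shrink[OF n(2)] rot_unrot[OF n(2)]
    using n by (auto simp: unrot_def)
qed

lemma first_column_sact:
  assumes "first_column n (k + 1) \<mu>" "1 \<le> k"
  shows "first_column n k (sact k \<mu>)" "shrink n k (sact k \<mu>) = shrink n (k + 1) \<mu>"
    "k \<in> {1..n - 1}" "coef (sact k \<mu>) (k + 1) = 0" "coef (sact k \<mu>) k = coef \<mu> (k + 1)"
proof -
  have f: "k + 1 \<in> {1..n}" "\<mu> \<in> Zn n" "\<And>i. 0 \<le> coef \<mu> i" "\<And>i. i \<in> {1..k} \<Longrightarrow> coef \<mu> i = 0" "0 < coef \<mu> (k + 1)"
    using assms(1) by (auto simp: first_column_def)
  show k: "k \<in> {1..n - 1}" using f(1) assms(2) by auto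
  show "coef (sact k \<mu>) (k + 1) = 0" "coef (sact k \<mu>) k = coef \<mu> (k + 1)"
    unfolding coef_sact using f(4)[of k] assms(2) by simp_all
  show "first_column n k (sact k \<mu>)"
    unfolding first_column_def
  proof (intro conjI ballI allI)
    show "sact k \<mu> \<in> Zn n" using Zn_perm[OF sref_permutes[OF k] f(2)] .
    show "k \<in> {1..n}" using k by auto
    show "0 < coef (sact k \<mu>) k" "0 \<le> coef (sact k \<mu>) i" for i
      unfolding coef_sact using f(3,5) by simp_all
    fix i assume "i \<in> {1..k - 1}"
    then show "coef (sact k \<mu>) i = 0"
      unfolding coef_sact using f(4)[of i] by (subst sref_other) auto
  qed
  have "coef \<mu> (sref k (rot k n i)) = coef \<mu> (rot (k + 1) n i)" for i
    using sref_rot[of k n, symmetric] k by simp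
  then show "shrink n k (sact k \<mu>) = shrink n (k + 1) \<mu>"
    using k by (intro poly_mapping_eqI) (simp add: coef_shrink coef_sact)
qed

lemma nonneg_induct [consumes 3, case_names zero column]:
  assumes "0 < n" "\<mu> \<in> Zn n" "\<forall>i. 0 \<le> coef \<mu> i"
    and zero: "P 0"
    and column: "\<And>k \<mu>. first_column n k \<mu> \<Longrightarrow> P (shrink n k \<mu>) \<Longrightarrow> P \<mu>"
  shows "P \<mu>"
  using assms(2,3)
proof (induction "nat (\<Sum>i\<in>{1..n}. coef \<mu> i)" arbitrary: \<mu> rule: less_induct)
  case less
  show ?case
  proof (cases "\<mu> = 0")
    case False
    then have "\<exists>i\<in>{1..n}. coef \<mu> i \<noteq> 0"
      using less.prems(1) by (metis Zn_coef lookup_zero poly_mapping_eqI)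
    define S where "S = {i \<in> {1..n}. coef \<mu> i \<noteq> 0}"
    have S: "finite S" "S \<noteq> {}" using \<open>\<exists>i\<in>{1..n}. _\<close> by (auto simp: S_def)
    define k where "k = Min S"
    have k: "k \<in> S" "\<And>i. i \<in> S \<Longrightarrow> k \<le> i" using S by (simp_all add: k_def)
    have fc: "first_column n k \<mu>"
      unfolding first_column_def
    proof (intro conjI ballI)
      show "k \<in> {1..n}" "0 < coef \<mu> k"
        using k(1) less.prems(2) by (auto simp: S_def order_le_less)
      fix i assume "i \<in> {1..k - 1}"
      then show "coef \<mu> i = 0" using k(2)[of i] k(1) by (auto simp: S_def)
    qed (use less.prems in auto)
    have kn: "k \<le> n" "k \<in> {1..n}" using fc by (auto simp: first_column_def)
    have "(\<Sum>i\<in>{1..n}. coef (shrink n k \<mu>) i) = (\<Sum>i\<in>{1..n}. coef \<mu> (rot k n i)) - (\<Sum>i\<in>{1..n}. if i = n then 1 else 0)"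
      unfolding coef_shrink[OF kn(1)] by (rule sum_subtractf)
    also have "(\<Sum>i\<in>{1..n}. coef \<mu> (rot k n i)) = (\<Sum>i\<in>{1..n}. coef \<mu> i)"
      using sum.permute[OF rot_permutes[of k n], of "coef \<mu>"] kn by (simp add: comp_def)
    also have "(\<Sum>i\<in>{1..n}. if i = n then 1 else 0 :: int) = 1" using assms(1) by simp
    finally have sum: "(\<Sum>i\<in>{1..n}. coef (shrink n k \<mu>) i) = (\<Sum>i\<in>{1..n}. coef \<mu> i) - 1" .
    have "0 \<le> (\<Sum>i\<in>{1..n}. coef (shrink n k \<mu>) i)"
      using shrink_nonneg[OF fc] by (intro sum_nonneg) auto
    then have "nat (\<Sum>i\<in>{1..n}. coef (shrink n k \<mu>) i) < nat (\<Sum>i\<in>{1..n}. coef \<mu> i)"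
      using sum by simp
    then show ?thesis
      using less.hyps[OF _ shrink_Zn[OF fc]] shrink_nonneg[OF fc] column[OF fc] by blast
  qed (simp add: zero)
qed

definition between :: "int set \<Rightarrow> (int \<Rightarrow> int) \<Rightarrow> int \<Rightarrow> int \<Rightarrow> nat"
  where "between S f x y = card {a \<in> S. x < f a \<and> f a < y \<or> y < f a \<and> f a < x}"

lemma between_commute: "between S f x y = between S f y x"
  unfolding between_def by (rule arg_cong[of _ _ card]) auto

lemma between_add:
  assumes "finite S" "x < y" "y < w" "\<And>a. a \<in> S \<Longrightarrow> f a \<noteq> y"
  shows "between S f x w = between S f x y + between S f y w"
proof -
  have "{a \<in> S. x < f a \<and> f a < w \<or> w < f a \<and> f a < x} =
    {a \<in> S. x < f a \<and> f a < y \<or> y < f a \<and> f a < x} \<union> {a \<in> S. y < f a \<and> f a < w \<or> w < f a \<and> f a < y}"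
    using assms by (auto dest: assms(4) order_less_trans)
  then show ?thesis
    unfolding between_def using assms(1-3) by (subst card_Un_disjoint[symmetric]) auto
qed

lemma between_insert:
  assumes "finite S" "k \<notin> S"
  shows "between (insert k S) f x y =
    between S f x y + (if x < f k \<and> f k < y \<or> y < f k \<and> f k < x then 1 else 0)"
proof -
  have "{a \<in> insert k S. x < f a \<and> f a < y \<or> y < f a \<and> f a < x} =
    (if x < f k \<and> f k < y \<or> y < f k \<and> f k < x then {k} else {}) \<union> {a \<in> S. x < f a \<and> f a < y \<or> y < f a \<and> f a < x}"
    by auto
  then show ?thesis using assms by (simp add: between_def)
qed

lemma between_cong: "(\<And>a. a \<in> S \<Longrightarrow> f a = g a) \<Longrightarrow> between S f x y = between S g x y"
  unfolding between_def by (rule arg_cong[of _ _ card]) auto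

text \<open>
  The rational factor in the weight of a box with entry \<open>y\<close> and entry \<open>x\<close> below it, detached from the diagram;
  \<open>b\<close> is the number of entries between \<open>x\<close> and \<open>y\<close>.
\<close>

definition wgt :: "complex \<Rightarrow> complex \<Rightarrow> nat \<Rightarrow> int \<Rightarrow> int \<Rightarrow> complex"
  where "wgt t D b x y = (if x > y then (1 - t) / (1 - D) * t ^ b
    else if x < y then (1 - t) * D / (1 - D) * t powi (- 1 - int b) else 1)"

lemma wgt_less: "x < y \<Longrightarrow> wgt t D b x y = (1 - t) * D / (1 - D) * inverse (t ^ (b + 1))"
proof -
  have "t powi (- 1 - int b) = inverse (t ^ (b + 1))"
    using power_int_minus[of t "int (b + 1)"] by (simp only: power_int_of_nat) simp
  then show "x < y \<Longrightarrow> ?thesis" by (simp add: wgt_def)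
qed

lemma wgt_greater: "y < x \<Longrightarrow> wgt t D b x y = (1 - t) / (1 - D) * t ^ b"
  by (simp add: wgt_def)

text \<open>
  The six cases of \<open>wgt_merge\<close>, where \<open>r = (1 - t) / (1 - D t)\<close> and \<open>e = (1 - t) / (1 - D)\<close>. Powers of \<open>t\<close> are
  replaced by \<open>P\<close> and \<open>Q\<close>, and \<open>Pi\<close>, \<open>Qi\<close> and \<open>ti\<close> are the inverses.
\<close>

lemma merge_algebra:
  fixes r e D t ti P Pi Q Qi :: complex
  assumes "r * (t + e) = e" "r * (1 + e * D) = e" "t * ti = 1" "P * Pi = 1" "Q * Qi = 1"
  shows "r * (P * Q * t) + e * Q * (r * P) = e * (P * Q)"
    and "r * P + e * D * (Qi * ti) * (r * (P * Q * t)) = e * P"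
    and "r * P + e * (Q * P) * (r * D * Qi) = e * P"
    and "r * D * Pi + e * D * (Pi * Qi * ti) * (r * Q) = e * D * (Pi * ti)"
    and "r * D * Pi + e * Q * (r * D * (Qi * Pi * ti)) = e * D * (Pi * ti)"
    and "r * D * (Qi * Pi * ti) + e * D * (Qi * ti) * (r * D * Pi) = e * D * (Qi * Pi * ti)"
proof -
  have "r * (P * Q * t) + e * Q * (r * P) = r * (t + e) * (P * Q)" by (simp add: algebra_simps)
  then show "r * (P * Q * t) + e * Q * (r * P) = e * (P * Q)" by (simp only: assms(1))
  have "r * P + e * D * (Qi * ti) * (r * (P * Q * t)) = r * P + e * D * r * P * (Q * Qi) * (t * ti)" by (simp only: mult_ac)
  also have "\<dots> = r * (1 + e * D) * P" unfolding assms(3,5) by (simp add: algebra_simps)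
  also have "\<dots> = e * P" by (simp only: assms(1,2))
  finally show "r * P + e * D * (Qi * ti) * (r * (P * Q * t)) = e * P" .
  have "r * P + e * (Q * P) * (r * D * Qi) = r * P + e * D * r * P * (Q * Qi)" by (simp only: mult_ac)
  also have "\<dots> = r * (1 + e * D) * P" unfolding assms(5) by (simp add: algebra_simps)
  also have "\<dots> = e * P" by (simp only: assms(1,2))
  finally show "r * P + e * (Q * P) * (r * D * Qi) = e * P" .
  have D: "r * D * Pi = r * t * (D * Pi * ti)"
    using assms(3) by (metis mult.assoc mult.commute mult_1_right)
  have "r * D * Pi + e * D * (Pi * Qi * ti) * (r * Q) = r * t * (D * Pi * ti) + r * e * (D * Pi * ti) * (Q * Qi)"
    unfolding D by (simp only: mult_ac)
  also have "\<dots> = r * (t + e) * (D * Pi * ti)" unfolding assms(5) by (simp add: algebra_simps)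
  finally show "r * D * Pi + e * D * (Pi * Qi * ti) * (r * Q) = e * D * (Pi * ti)"
    unfolding assms(1) by (simp only: mult_ac)
  have "r * D * Pi + e * Q * (r * D * (Qi * Pi * ti)) = r * t * (D * Pi * ti) + r * e * (D * Pi * ti) * (Q * Qi)"
    unfolding D by (simp only: mult_ac)
  also have "\<dots> = r * (t + e) * (D * Pi * ti)" unfolding assms(5) by (simp add: algebra_simps)
  finally show "r * D * Pi + e * Q * (r * D * (Qi * Pi * ti)) = e * D * (Pi * ti)"
    unfolding assms(1) by (simp only: mult_ac)
  have "r * D * (Qi * Pi * ti) + e * D * (Qi * ti) * (r * D * Pi) = r * (1 + e * D) * (D * Qi * Pi * ti)"
    by (simp add: algebra_simps)
  then show "r * D * (Qi * Pi * ti) + e * D * (Qi * ti) * (r * D * Pi) = e * D * (Qi * Pi * ti)"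
    unfolding assms(2) by (simp only: mult_ac)
qed

text \<open>
  This adds the two contributions to the entry \<open>v\<close> when the first column moves by one position: the first
  summand comes from crossing, the second one from folding. In each of the six relative orders of the three
  values, \<open>between_add\<close> reduces the claim to one of the two identities \<open>r (t + e) = e\<close> and \<open>r (1 + e D) = e\<close>.
\<close>

lemma wgt_merge:
  fixes A B v :: int
  assumes "t \<noteq> 0" "D \<noteq> 1" "D * t \<noteq> 1" "A \<noteq> B" "v \<noteq> A" "v \<noteq> B" "finite S"
    and S: "\<And>a. a \<in> S \<Longrightarrow> f a \<noteq> A \<and> f a \<noteq> B \<and> f a \<noteq> v"
  shows "wgt t (D * t) (between S f B v + (if B < A \<and> A < v \<or> v < A \<and> A < B then 1 else 0)) B v +
      wgt t D (between S f B A) B A *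
      wgt t (D * t) (between S f A v + (if A < B \<and> B < v \<or> v < B \<and> B < A then 1 else 0)) A v =
    wgt t D (between S f B v) B v"
proof -
  have D: "1 - D \<noteq> 0" "1 - D * t \<noteq> 0" using assms(2,3) by auto
  define r e where "r = (1 - t) / (1 - D * t)" and "e = (1 - t) / (1 - D)"
  have id: "r * (t + e) = e" "r * (1 + e * D) = e"
  proof -
    have "t + e = (1 - D * t) / (1 - D)" "1 + e * D = (1 - D * t) / (1 - D)"
      unfolding e_def using D by (simp_all add: field_simps)
    then show "r * (t + e) = e" "r * (1 + e * D) = e"
      unfolding r_def using D by (simp_all add: e_def)
  qed
  have tinv: "t * inverse t = 1" "t ^ m * inverse (t ^ m) = 1" for m using assms(1) by simp_all
  have w: "wgt t D b x y = e * t ^ b" "wgt t (D * t) b x y = r * t ^ b" if "y < x" for b x y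
    using that by (simp_all add: wgt_greater r_def e_def)
  have w': "wgt t D b x y = e * D * (inverse (t ^ b) * inverse t)"
    "wgt t (D * t) b x y = r * D * inverse (t ^ b)" if "x < y" for b x y
    using that assms(1) by (simp_all add: wgt_less r_def e_def)
  let ?b = "between S f"
  have add: "?b x w = ?b x y + ?b y w" if "x < y" "y < w" "y \<in> {A, B, v}" for x y w
    using that S by (intro between_add assms(7)) auto
  note comm = between_commute[of S f v A] between_commute[of S f v B] between_commute[of S f A B]
  note expand = power_add power_one_right inverse_mult_distrib
  consider "v < A" "A < B" "v < B" | "v < B" "B < A" "v < A" | "A < v" "v < B" "A < B"
    | "B < v" "v < A" "B < A" | "A < B" "B < v" "A < v" | "B < A" "A < v" "B < v"
    using assms(4-6) by linarith
  then show ?thesis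
  proof cases
    case 1
    have b: "?b B v = ?b A v + ?b B A" using add[of v A B] 1 by (simp add: comm)
    have i: "(if B < A \<and> A < v \<or> v < A \<and> A < B then 1 else 0) = (1 :: nat)"
      "?b A v + (if A < B \<and> B < v \<or> v < B \<and> B < A then 1 else 0) = ?b A v" using 1 by auto
    show ?thesis
      unfolding i w[OF 1(1)] w[OF 1(2)] w[OF 1(3)] unfolding b expand
      using merge_algebra(1)[OF id tinv(1) tinv(2)[of "?b A v"] tinv(2)[of "?b B A"]] by (simp only: mult_ac)
  next
    case 2
    have b: "?b A v = ?b B v + ?b B A" using add[of v B A] 2 by (simp add: comm)
    have i: "?b B v + (if B < A \<and> A < v \<or> v < A \<and> A < B then 1 else 0) = ?b B v"
      "(if A < B \<and> B < v \<or> v < B \<and> B < A then 1 else 0) = (1 :: nat)" using 2 by auto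
    show ?thesis
      unfolding i w[OF 2(1)] w'[OF 2(2)] w[OF 2(3)] unfolding b expand
      using merge_algebra(2)[OF id tinv(1) tinv(2)[of "?b B v"] tinv(2)[of "?b B A"]] by (simp only: mult_ac)
  next
    case 3
    have b: "?b B A = ?b A v + ?b B v" using add[of A v B] 3 by (simp add: comm)
    have i: "?b B v + (if B < A \<and> A < v \<or> v < A \<and> A < B then 1 else 0) = ?b B v"
      "?b A v + (if A < B \<and> B < v \<or> v < B \<and> B < A then 1 else 0) = ?b A v" using 3 by auto
    show ?thesis
      unfolding i w'[OF 3(1)] w[OF 3(2)] w[OF 3(3)] unfolding b expand
      using merge_algebra(3)[OF id tinv(1) tinv(2)[of "?b B v"] tinv(2)[of "?b A v"]] by (simp only: mult_ac)
  next
    case 4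
    have b: "?b B A = ?b B v + ?b A v" using add[of B v A] 4 by (simp add: comm)
    have i: "?b B v + (if B < A \<and> A < v \<or> v < A \<and> A < B then 1 else 0) = ?b B v"
      "?b A v + (if A < B \<and> B < v \<or> v < B \<and> B < A then 1 else 0) = ?b A v" using 4 by auto
    show ?thesis
      unfolding i w'[OF 4(1)] w[OF 4(2)] w'[OF 4(3)] unfolding b expand
      using merge_algebra(4)[OF id tinv(1) tinv(2)[of "?b B v"] tinv(2)[of "?b A v"]] by (simp only: mult_ac)
  next
    case 5
    have b: "?b A v = ?b B A + ?b B v" using add[of A B v] 5 by (simp add: comm)
    have i: "?b B v + (if B < A \<and> A < v \<or> v < A \<and> A < B then 1 else 0) = ?b B v"
      "(if A < B \<and> B < v \<or> v < B \<and> B < A then 1 else 0) = (1 :: nat)" using 5 by auto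
    show ?thesis
      unfolding i w[OF 5(1)] w'[OF 5(2)] w'[OF 5(3)] unfolding b expand
      using merge_algebra(5)[OF id tinv(1) tinv(2)[of "?b B v"] tinv(2)[of "?b B A"]] by (simp only: mult_ac)
  next
    case 6
    have b: "?b B v = ?b B A + ?b A v" using add[of B A v] 6 by (simp add: comm)
    have i: "(if B < A \<and> A < v \<or> v < A \<and> A < B then 1 else 0) = (1 :: nat)"
      "?b A v + (if A < B \<and> B < v \<or> v < B \<and> B < A then 1 else 0) = ?b A v" using 6 by auto
    show ?thesis
      unfolding i w'[OF 6(1)] w'[OF 6(2)] w'[OF 6(3)] unfolding b expand
      using merge_algebra(6)[OF id tinv(1) tinv(2)[of "?b A v"] tinv(2)[of "?b B A"]] by (simp only: mult_ac)
  qed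
qed

context macdonald begin

text \<open>
  The permutations differ by a permutation of positions at which \<open>\<nu>\<close> is constant.
\<close>

lemma E_rel_agree:
  assumes f: "is_E \<nu> f" and y: "y permutes {1..n}" "y' permutes {1..n}"
    and k: "k \<le> n" "\<And>m. m \<in> {k + 1..n} \<Longrightarrow> y m = y' m" "\<And>i. i \<in> {1..k} \<Longrightarrow> coef \<nu> i = 0"
  shows "E_rel n q th y \<nu> = E_rel n q th y' \<nu>"
proof -
  have word: "set ws \<subseteq> {1..k - 1} \<Longrightarrow> y permutes {1..n} \<Longrightarrow> E_rel n q th (y \<circ> perm_word ws) \<nu> = E_rel n q th y \<nu>" for ws y
  proof (induction ws arbitrary: y)
    case Nil
    then show ?case by (simp only: perm_word_Nil comp_id)
  next
    case (Cons i ws)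
    then have i: "i \<in> {1..n - 1}" "i \<in> {1..k}" "i + 1 \<in> {1..k}" using k(1) by auto
    have "E_rel n q th (y \<circ> sref i \<circ> perm_word ws) \<nu> = E_rel n q th (y \<circ> sref i) \<nu>"
      using Cons by (intro Cons.IH permutes_compose[OF sref_permutes[OF i(1)]]) auto
    also have "\<dots> = E_rel n q th y \<nu>"
      using k(3)[OF i(2)] k(3)[OF i(3)] Cons.prems(2) by (intro E_rel_equal[OF f i(1)]) auto
    finally show ?case by (simp only: perm_word_Cons comp_assoc)
  qed
  define x where "x = inv y \<circ> y'"
  have "x permutes {1..n}" unfolding x_def by (rule permutes_compose[OF y(2) permutes_inv[OF y(1)]])
  moreover have "x m = m" if "m \<in> {1..n} - {1..k}" for m
  proof -
    have "y m = y' m" using that by (intro k(2)) auto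
    then show ?thesis using permutes_inverses(2)[OF y(1), of m] by (simp add: x_def)
  qed
  ultimately have "x permutes {1..k}" by (rule permutes_superset)
  then obtain ws where "perm_reduced_word k ws x" using perm_reduced_word_exists by blast
  then have ws: "set ws \<subseteq> {1..k - 1}" "perm_word ws = x" by (simp_all add: perm_reduced_word_def)
  have "y \<circ> x = y'"
    unfolding x_def by (simp add: comp_assoc[symmetric] permutes_inv_o[OF y(1)])
  then show ?thesis using word[OF ws(1) y(1)] ws(2) by simp
qed

text \<open>
  The set \<open>Narm\<close> of the first box of column \<open>k\<close>, described by columns. Accordingly \<open>Dcol\<close> is \<open>D\<close> of this
  box, and \<open>colw k \<mu> z l\<close> is the rational factor in its weight if its entry is \<open>z l\<close>.
\<close>

definition arm :: "int \<Rightarrow> expo \<Rightarrow> int set"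
  where "arm k \<mu> = {a \<in> {k + 1..n}. coef \<mu> a < coef \<mu> k}"

definition Dcol :: "int \<Rightarrow> expo \<Rightarrow> complex"
  where "Dcol k \<mu> = q powi coef \<mu> k * (th ^ 2) powi (int (card (arm k \<mu>)) + 1)"

definition colw :: "int \<Rightarrow> expo \<Rightarrow> (int \<Rightarrow> int) \<Rightarrow> int \<Rightarrow> complex"
  where "colw k \<mu> z l = wgt (th ^ 2) (Dcol k \<mu>) (between (arm k \<mu>) z (z k) (z l)) (z k) (z l)"

lemma finite_arm [simp]: "finite (arm k \<mu>)"
  by (rule finite_subset[of _ "{k + 1..n}"]) (auto simp: arm_def)

lemma Dcol_neq_1: "0 < coef \<mu> k \<Longrightarrow> Dcol k \<mu> \<noteq> 1"
  using generic unfolding Dcol_def generic_def by (metis order_less_irrefl prod.inject)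

lemma arm_sact:
  assumes "first_column n (k + 1) \<mu>" "1 \<le> k"
  shows "arm k (sact k \<mu>) = insert (k + 1) (arm (k + 1) \<mu>)" "k + 1 \<notin> arm (k + 1) \<mu>"
proof -
  have *: "coef (sact k \<mu>) a = coef \<mu> a" if "k + 1 < a" for a
    unfolding coef_sact using that by (subst sref_other) auto
  note fc = first_column_sact[OF assms]
  show "arm k (sact k \<mu>) = insert (k + 1) (arm (k + 1) \<mu>)"
  proof (intro set_eqI)
    fix a
    consider "a \<le> k" | "a = k + 1" | "k + 1 < a" by linarith
    then show "a \<in> arm k (sact k \<mu>) \<longleftrightarrow> a \<in> insert (k + 1) (arm (k + 1) \<mu>)"
    proof cases
      case 2
      then show ?thesis using fc(3-5) assms(1) by (simp add: arm_def first_column_def)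
    next
      case 3
      then show ?thesis using *[OF 3] fc(5) by (simp add: arm_def)
    qed (simp add: arm_def)
  qed
  show "k + 1 \<notin> arm (k + 1) \<mu>" by (simp add: arm_def)
qed

lemma Dcol_sact:
  assumes "first_column n (k + 1) \<mu>" "1 \<le> k"
  shows "Dcol k (sact k \<mu>) = Dcol (k + 1) \<mu> * th ^ 2"
proof -
  have c: "int (card (arm k (sact k \<mu>))) + 1 = (int (card (arm (k + 1) \<mu>)) + 1) + 1"
    using arm_sact[OF assms] by simp
  have "(th ^ 2) powi ((int (card (arm (k + 1) \<mu>)) + 1) + 1) =
    (th ^ 2) powi (int (card (arm (k + 1) \<mu>)) + 1) * th ^ 2"
    using th by (intro power_int_add_1) simp
  then show ?thesis unfolding Dcol_def c first_column_sact(5)[OF assms] by simp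
qed

text \<open>
  Sorting places exactly the columns of the arm between the two columns that \<open>s\<^sub>k\<close> exchanges. This is how the
  arm enters the weight of a fold.
\<close>

lemma vperm_between_column:
  assumes "first_column n (k + 1) \<mu>" "1 \<le> k" "a \<in> {1..n}"
  shows "vless (sact k \<mu>) (k + 1) a \<and> vless (sact k \<mu>) a k \<longleftrightarrow> a \<in> arm (k + 1) \<mu>"
proof -
  note fc = first_column_sact[OF assms(1,2)]
  have *: "coef (sact k \<mu>) a = coef \<mu> a" if "k + 1 < a" for a
    unfolding coef_sact using that by (subst sref_other) auto
  have nn: "0 \<le> coef \<mu> a" and p: "0 < coef \<mu> (k + 1)" using assms(1) by (auto simp: first_column_def)
  have low: "coef (sact k \<mu>) a = 0" if "a < k"
    using fc(1) that assms(3) by (auto simp: first_column_def)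
  consider "a < k" | "a = k" | "a = k + 1" | "k + 1 < a" by linarith
  then show ?thesis
  proof cases
    case 1
    then show ?thesis using low fc(4) by (simp add: vless_def arm_def)
  next
    case 4
    then show ?thesis using *[OF 4] fc(4,5) nn assms(3) by (auto simp: vless_def arm_def)
  qed (auto simp: vless_def arm_def)
qed

lemma vperm_diff_column:
  assumes "first_column n (k + 1) \<mu>" "1 \<le> k"
  shows "vperm n (sact k \<mu>) k - vperm n (sact k \<mu>) (k + 1) = int (card (arm (k + 1) \<mu>)) + 1"
proof -
  let ?\<kappa> = "sact k \<mu>"
  note fc = first_column_sact[OF assms]
  have k: "k \<in> {1..n}" "k + 1 \<in> {1..n}" using fc(3) by auto
  have less: "vless ?\<kappa> (k + 1) k" using fc(4,5) assms(1) by (simp add: vless_def first_column_def)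
  let ?S = "\<lambda>i. {m \<in> {1..n}. vless ?\<kappa> m i}"
  have "?S k = ?S (k + 1) \<union> insert (k + 1) (arm (k + 1) \<mu>)"
  proof (intro set_eqI)
    fix m
    show "m \<in> ?S k \<longleftrightarrow> m \<in> ?S (k + 1) \<union> insert (k + 1) (arm (k + 1) \<mu>)"
    proof (cases "m \<in> {1..n}")
      case True
      then show ?thesis
        using vperm_between_column[OF assms True] less vless_trans[of ?\<kappa> m "k + 1" k]
          vless_linear[of m "k + 1" ?\<kappa>] by blast
    next
      case False
      then show ?thesis using k by (auto simp: arm_def)
    qed
  qed
  moreover have "?S (k + 1) \<inter> insert (k + 1) (arm (k + 1) \<mu>) = {}"
    using vperm_between_column[OF assms] vless_asym vless_irrefl by (auto simp: arm_def)
  moreover have "finite (?S (k + 1))" by simp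
  ultimately have "card (?S k) = card (?S (k + 1)) + card (insert (k + 1) (arm (k + 1) \<mu>))"
    by (metis card_Un_disjoint finite_arm finite_insert)
  moreover have "card (insert (k + 1) (arm (k + 1) \<mu>)) = card (arm (k + 1) \<mu>) + 1"
    using arm_sact(2)[OF assms] by simp
  ultimately show ?thesis
    unfolding vperm_count[OF k(1)] vperm_count[OF k(2)] by linarith
qed

text \<open>
  The two permutations in \<open>fold_weight\<close> differ by the transposition of the places to which sorting moves the
  columns \<open>k\<close> and \<open>k + 1\<close>. By \<open>perm_len_transpose\<close> their lengths differ by one plus twice the number of
  places in between with values in between, and these places are those of the arm.
\<close>

lemma fold_weight_column:
  assumes "first_column n (k + 1) \<mu>" "1 \<le> k" "z permutes {1..n}"
  shows "fold_weight z (sact k \<mu>) k = colw (k + 1) \<mu> z k"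
proof -
  let ?\<kappa> = "sact k \<mu>"
  define v where "v = vperm n ?\<kappa>"
  define P where "P = v k"
  define Q where "Q = v (k + 1)"
  note fc = first_column_sact[OF assms(1,2)]
  have k: "k \<in> {1..n}" "k + 1 \<in> {1..n}" using fc(3) by auto
  have v: "v permutes {1..n}" unfolding v_def by (rule vperm_permutes)
  have iv: "inv v P = k" "inv v Q = k + 1" by (simp_all add: P_def Q_def permutes_inverses[OF v])
  have PQ: "P \<in> {1..n}" "Q \<in> {1..n}" using k permutes_in_image[OF v] by (auto simp: P_def Q_def simp del: atLeastAtMost_iff)
  have QP: "Q < P" using vperm_diff_column[OF assms(1,2)] unfolding P_def Q_def v_def by linarith
  have d: "dval ?\<kappa> k = Dcol (k + 1) \<mu>"
    unfolding dval_def Dcol_def vperm_diff_column[OF assms(1,2)] fc(4,5) by simp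
  let ?w = "z \<circ> inv v"
  have w: "?w permutes {1..n}" by (rule permutes_compose[OF permutes_inv[OF v] assms(3)])
  have wv: "?w Q = z (k + 1)" "?w P = z k" using iv by simp_all
  have comm: "z \<circ> sref k \<circ> inv v = ?w \<circ> transpose Q P"
  proof
    fix x
    have "inv v x = k \<longleftrightarrow> x = P" "inv v x = k + 1 \<longleftrightarrow> x = Q"
      using permutes_inj[OF permutes_inv[OF v]] iv by (metis injD)+
    then show "(z \<circ> sref k \<circ> inv v) x = (?w \<circ> transpose Q P) x"
      using iv by (cases "x = P"; cases "x = Q") (auto simp: sref_other)
  qed
  have zk: "z k \<noteq> z (k + 1)" using permutes_inj[OF assms(3)] by (simp add: inj_eq)
  define \<beta> where "\<beta> = between (arm (k + 1) \<mu>) z (z (k + 1)) (z k)"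
  have count: "card {m. Q < m \<and> m < P \<and> x < ?w m \<and> ?w m < y} = card {a \<in> arm (k + 1) \<mu>. x < z a \<and> z a < y}" for x y
  proof -
    have "bij_betw v {a \<in> arm (k + 1) \<mu>. x < z a \<and> z a < y} {m. Q < m \<and> m < P \<and> x < ?w m \<and> ?w m < y}"
    proof (rule bij_betw_byWitness[where f' = "inv v"])
      have arm: "a \<in> arm (k + 1) \<mu> \<longleftrightarrow> Q < v a \<and> v a < P" if "a \<in> {1..n}" for a
        using vperm_between_column[OF assms(1,2) that] vperm_less[OF k(2) that, of ?\<kappa>]
          vperm_less[OF that k(1), of ?\<kappa>] by (simp add: P_def Q_def v_def)
      show "v ` {a \<in> arm (k + 1) \<mu>. x < z a \<and> z a < y} \<subseteq> {m. Q < m \<and> m < P \<and> x < ?w m \<and> ?w m < y}"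
      proof (intro image_subsetI, clarify)
        fix a assume a: "a \<in> arm (k + 1) \<mu>" "x < z a" "z a < y"
        then have "a \<in> {1..n}" using k by (auto simp: arm_def)
        then show "Q < v a \<and> v a < P \<and> x < ?w (v a) \<and> ?w (v a) < y"
          using arm a by (simp add: permutes_inverses[OF v])
      qed
      show "inv v ` {m. Q < m \<and> m < P \<and> x < ?w m \<and> ?w m < y} \<subseteq> {a \<in> arm (k + 1) \<mu>. x < z a \<and> z a < y}"
      proof (intro image_subsetI, clarify)
        fix m assume m: "Q < m" "m < P" "x < ?w m" "?w m < y"
        then have "m \<in> {1..n}" using PQ by auto
        then have "inv v m \<in> {1..n}" using permutes_in_image[OF permutes_inv[OF v]] by blast
        then show "inv v m \<in> arm (k + 1) \<mu> \<and> x < z (inv v m) \<and> z (inv v m) < y"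
          using arm m by (simp add: permutes_inverses[OF v])
      qed
    qed (simp_all add: permutes_inverses[OF v])
    then show ?thesis by (simp add: bij_betw_same_card)
  qed
  have pow: "th powi (2 * int b) = (th ^ 2) ^ b" "th powi (- 2 - 2 * int b) = (th ^ 2) powi (- 1 - int b)" for b
  proof -
    show "th powi (2 * int b) = (th ^ 2) ^ b"
      using power_int_mult[of th 2 "int b"] by simp
    have "- 2 - 2 * int b = 2 * (- 1 - int b)" by simp
    then show "th powi (- 2 - 2 * int b) = (th ^ 2) powi (- 1 - int b)"
      using power_int_mult[of th 2 "- 1 - int b"] by (simp only: power_int_numeral)
  qed
  have fw: "fold_weight z ?\<kappa> k = (if z k < z (k + 1) then 1 else Dcol (k + 1) \<mu>) * (1 - th ^ 2) / (1 - Dcol (k + 1) \<mu>) *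
    th powi (int (perm_len n ?w) - int (perm_len n (?w \<circ> transpose Q P)) - 1)"
    unfolding fold_weight_def d v_def[symmetric] comm ..
  show ?thesis
  proof (cases "z k < z (k + 1)")
    case True
    let ?w' = "?w \<circ> transpose Q P"
    have inj: "inj_on ?w' {1..n}"
      by (rule permutes_inj_on[OF permutes_compose[OF permutes_swap_id[OF PQ(2,1)] w]])
    have "perm_len n (?w' \<circ> transpose Q P) = perm_len n ?w' + 1 +
      2 * card {m. Q < m \<and> m < P \<and> ?w' Q < ?w' m \<and> ?w' m < ?w' P}"
      using wv True by (intro perm_len_transpose[OF PQ(2,1) QP _ inj]) simp
    also have "?w' \<circ> transpose Q P = ?w" by (simp add: comp_assoc)
    also have "{m. Q < m \<and> m < P \<and> ?w' Q < ?w' m \<and> ?w' m < ?w' P} =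
        {m. Q < m \<and> m < P \<and> z k < ?w m \<and> ?w m < z (k + 1)}"
    proof -
      have "?w' Q = z k" "?w' P = z (k + 1)" using wv by simp_all
      moreover have "?w' m = ?w m" if "Q < m" "m < P" for m using that by simp
      ultimately show ?thesis by auto
    qed
    also have "card \<dots> = \<beta>"
      unfolding count \<beta>_def between_def using True by (intro arg_cong[of _ _ card]) auto
    finally have "int (perm_len n ?w) - int (perm_len n ?w') - 1 = 2 * int \<beta>" by linarith
    then show ?thesis
      unfolding fw colw_def wgt_def \<beta>_def[symmetric] using True by (simp only: pow) simp
  next
    case False
    then have lt: "z (k + 1) < z k" using zk by simp
    have "perm_len n (?w \<circ> transpose Q P) = perm_len n ?w + 1 +
      2 * card {m. Q < m \<and> m < P \<and> ?w Q < ?w m \<and> ?w m < ?w P}"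
      using wv lt by (intro perm_len_transpose[OF PQ(2,1) QP _ permutes_inj_on[OF w]]) simp
    also have "card {m. Q < m \<and> m < P \<and> ?w Q < ?w m \<and> ?w m < ?w P} = \<beta>"
      unfolding wv count \<beta>_def between_def using lt by (intro arg_cong[of _ _ card]) auto
    finally have "int (perm_len n ?w) - int (perm_len n (?w \<circ> transpose Q P)) - 1 = - 2 - 2 * int \<beta>" by linarith
    then show ?thesis
      unfolding fw colw_def wgt_def \<beta>_def[symmetric] using lt by (simp only: pow) simp
  qed
qed

text \<open>
  The basement after removal of the first box: the entry \<open>z l\<close> of this box becomes the last entry, and the
  entries to the right of column \<open>k\<close> move to the left. The transposition completes this to a permutation by
  values at columns without boxes.
\<close>

abbreviation basement :: "int \<Rightarrow> (int \<Rightarrow> int) \<Rightarrow> int \<Rightarrow> int \<Rightarrow> int"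
  where "basement k z l \<equiv> z \<circ> transpose l k \<circ> rot k n"

lemma basement_permutes:
  "l \<in> {1..k} \<Longrightarrow> k \<in> {1..n} \<Longrightarrow> z permutes {1..n} \<Longrightarrow> basement k z l permutes {1..n}"
  by (rule permutes_compose[OF rot_permutes permutes_compose[OF permutes_swap_id]]) auto

lemma is_E_exists_shrink:
  assumes "first_column n k \<mu>" "\<exists>f. is_E (shrink n k \<mu>) f"
  shows "\<exists>f. is_E \<mu> f"
proof -
  have "1 \<le> k" using assms(1) by (simp add: first_column_def)
  then show ?thesis
    using assms
  proof (induction k arbitrary: \<mu> rule: int_ge_induct)
    case base
    then show ?case using is_E_raise piact_shrink by metis
  next
    case (step k)
    note fc = first_column_sact[OF step.prems(1) step.hyps]
    have "\<exists>f. is_E (sact k \<mu>) f" using step.IH[OF fc(1)] step.prems(2) fc(2) by simp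
    moreover have "coef (sact k \<mu>) (k + 1) < coef (sact k \<mu>) k"
      using fc(4,5) step.prems(1) by (simp add: first_column_def)
    ultimately show ?case using is_E_T[OF _ fc(3), of "sact k \<mu>"] by auto
  qed
qed

lemma merge_sums:
  "(\<Sum>l\<in>S. Const (p l) * X l * H l) + Const C * (a + (\<Sum>l\<in>S. Const (r l) * X l * H l)) =
    Const C * a + (\<Sum>l\<in>S. Const (p l + C * r l) * X l * H l)"
  by (simp add: Const_add Const_mult sum.distrib sum_distrib_left distrib_left distrib_right mult.assoc)

text \<open>
  Induction on \<open>k\<close>, where \<open>E_rel_sact\<close> moves the first column by one position. The crossing and the folding
  term contribute the same polynomials by \<open>E_rel_agree\<close>, and \<open>wgt_merge\<close> adds their coefficients.
\<close>

lemma remove_first_box: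
  assumes "first_column n k \<mu>" "is_E (shrink n k \<mu>) f" "z permutes {1..n}"
  shows "E_rel n q th z \<mu> = (\<Sum>l\<in>{1..k}. Const (colw k \<mu> z l) * xvar (z l) *
    E_rel n q th (basement k z l) (shrink n k \<mu>))"
proof -
  have "1 \<le> k" using assms(1) by (simp add: first_column_def)
  then show ?thesis
    using assms
  proof (induction k arbitrary: \<mu> z rule: int_ge_induct)
    case base
    have "E_rel n q th z (piact n (shrink n 1 \<mu>)) = xvar (z 1) * E_rel n q th (z \<circ> c) (shrink n 1 \<mu>)"
      by (rule E_rel_piact[OF base.prems(2,3)])
    moreover have "basement 1 z 1 = z \<circ> c" by (simp only: transpose_same comp_id)
    moreover have "colw 1 \<mu> z 1 = 1" by (simp add: colw_def wgt_def)
    moreover have "(\<Sum>l\<in>{1..1}. F l) = F 1" for F :: "int \<Rightarrow> laurent" by simp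
    ultimately show ?case by (simp only: piact_shrink[OF base.prems(1)] Const_1 mult_1)
  next
    case (step k)
    let ?\<kappa> = "sact k \<mu>" and ?\<nu> = "shrink n (k + 1) \<mu>"
    note fc = first_column_sact[OF step.prems(1) step.hyps]
    have z: "z permutes {1..n}" by (rule step.prems(3))
    have zs: "z \<circ> sref k permutes {1..n}" by (rule permutes_compose[OF sref_permutes[OF fc(3)] z])
    have k: "k \<in> {1..n}" "k + 1 \<in> {1..n}" "k + 1 \<le> n" using fc(3) by auto
    have f: "is_E ?\<nu> f" by (rule step.prems(2))
    obtain h where h: "is_E ?\<kappa> h" using is_E_exists_shrink[OF fc(1)] f fc(2) by auto
    have pos: "0 < coef \<mu> (k + 1)" using step.prems(1) by (simp add: first_column_def)
    have IH: "E_rel n q th y ?\<kappa> = (\<Sum>l\<in>{1..k}. Const (colw k ?\<kappa> y l) * xvar (y l) * E_rel n q th (basement k y l) ?\<nu>)"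
      if "y permutes {1..n}" for y
    proof -
      have "is_E (shrink n k ?\<kappa>) f" using f by (simp only: fc(2))
      from step.IH[OF fc(1) this that] show ?thesis by (simp only: fc(2))
    qed
    define G where "G l = E_rel n q th (basement (k + 1) z l) ?\<nu>" for l
    have agree: "E_rel n q th y ?\<nu> = E_rel n q th y' ?\<nu>"
      if "y permutes {1..n}" "y' permutes {1..n}" "\<And>m. m \<in> {k + 1..n} \<Longrightarrow> y m = y' m" for y y'
      by (rule E_rel_agree[OF f that(1,2) _ that(3)]) (use k shrink_zero[OF step.prems(1)] in simp_all)
    have G1: "E_rel n q th (basement k z l) ?\<nu> = G l" if l: "l \<in> {1..k}" for l
      unfolding G_def
    proof (rule agree)
      show "basement k z l permutes {1..n}" by (rule basement_permutes[OF l k(1) z])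
      show "basement (k + 1) z l permutes {1..n}" by (rule basement_permutes[OF _ k(2) z]) (use l in auto)
      fix m assume "m \<in> {k + 1..n}"
      then show "basement k z l m = basement (k + 1) z l m"
        using l by (auto simp: rot_def transpose_def)
    qed
    have G2: "E_rel n q th (basement k (z \<circ> sref k) l) ?\<nu> = G (sref k l)" if l: "l \<in> {1..k}" for l
      unfolding G_def
    proof (rule agree)
      have "sref k l \<in> {1..k + 1}" using l by (auto simp: sref_def transpose_def)
      then show "basement (k + 1) z (sref k l) permutes {1..n}" by (rule basement_permutes[OF _ k(2) z])
      show "basement k (z \<circ> sref k) l permutes {1..n}" by (rule basement_permutes[OF l k(1) zs])
      fix m assume "m \<in> {k + 1..n}"
      then show "basement k (z \<circ> sref k) l m = basement (k + 1) z (sref k l) m"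
        using l by (auto simp: rot_def transpose_def sref_def)
    qed
    let ?D = "Dcol (k + 1) \<mu>" and ?t = "th ^ 2" and ?S = "arm (k + 1) \<mu>"
    have D: "?D \<noteq> 1" "?D * ?t \<noteq> 1"
      using Dcol_neq_1[of \<mu> "k + 1"] Dcol_neq_1[of ?\<kappa> k] pos Dcol_sact[OF step.prems(1) step.hyps] fc(5) by auto
    have S_far: "a \<in> ?S \<Longrightarrow> sref k a = a \<and> a \<in> {1..n} \<and> k + 1 < a" for a
      using k by (auto simp: arm_def sref_other)
    have zneq: "a \<noteq> b \<Longrightarrow> z a \<noteq> z b" for a b using permutes_inj[OF z] by (simp add: inj_eq)
    have w1: "colw k ?\<kappa> z l = wgt ?t (?D * ?t) (between ?S z (z k) (z l) +
        (if z k < z (k + 1) \<and> z (k + 1) < z l \<or> z l < z (k + 1) \<and> z (k + 1) < z k then 1 else 0)) (z k) (z l)" for l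
      unfolding colw_def arm_sact[OF step.prems(1) step.hyps] Dcol_sact[OF step.prems(1) step.hyps]
        between_insert[OF finite_arm arm_sact(2)[OF step.prems(1) step.hyps]] ..
    have w2: "colw k ?\<kappa> (z \<circ> sref k) l = wgt ?t (?D * ?t) (between ?S z (z (k + 1)) (z (sref k l)) +
        (if z (k + 1) < z k \<and> z k < z (sref k l) \<or> z (sref k l) < z k \<and> z k < z (k + 1) then 1 else 0))
        (z (k + 1)) (z (sref k l))" for l
    proof -
      have "between ?S (z \<circ> sref k) x y = between ?S z x y" for x y
        using S_far by (intro between_cong) simp
      then show ?thesis
        unfolding colw_def arm_sact[OF step.prems(1) step.hyps] Dcol_sact[OF step.prems(1) step.hyps]
          between_insert[OF finite_arm arm_sact(2)[OF step.prems(1) step.hyps]] by simp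
    qed
    have sum_split: "(\<Sum>l\<in>{1..k}. F l) = F k + (\<Sum>l\<in>{1..k - 1}. F l)" for F :: "int \<Rightarrow> laurent"
    proof -
      have "{1..k} = insert k {1..k - 1}" using step.hyps by auto
      then show ?thesis by simp
    qed
    have sum_split': "(\<Sum>l\<in>{1..k + 1}. F l) = F (k + 1) + (F k + (\<Sum>l\<in>{1..k - 1}. F l))" for F :: "int \<Rightarrow> laurent"
    proof -
      have "{1..k + 1} = insert (k + 1) {1..k}" using step.hyps by auto
      then show ?thesis using sum_split[of F] by simp
    qed
    have below: "sref k l = l" if "l \<in> {1..k - 1}" for l using that by (intro sref_other) auto
    have merge: "colw k ?\<kappa> (z \<circ> sref k) l + colw (k + 1) \<mu> z k * colw k ?\<kappa> z l = colw (k + 1) \<mu> z l"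
      if l: "l \<in> {1..k - 1}" for l
      unfolding w1 w2 below[OF l] unfolding colw_def
      by (rule wgt_merge) (use th D l in \<open>auto intro!: zneq dest!: S_far\<close>)
    have top: "colw k ?\<kappa> (z \<circ> sref k) k = 1" "colw k ?\<kappa> z k = 1" "colw (k + 1) \<mu> z (k + 1) = 1"
      by (simp_all add: colw_def wgt_def)
    have gt: "coef ?\<kappa> (k + 1) < coef ?\<kappa> k" using fc(4,5) pos by simp
    have "E_rel n q th z (sact k ?\<kappa>) =
      E_rel n q th (z \<circ> sref k) ?\<kappa> + Const (colw (k + 1) \<mu> z k) * E_rel n q th z ?\<kappa>"
      using E_rel_sact[OF h fc(3) gt z] fold_weight_column[OF step.prems(1) step.hyps z] by simp
    also have "E_rel n q th (z \<circ> sref k) ?\<kappa> =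
      (\<Sum>l\<in>{1..k}. Const (colw k ?\<kappa> (z \<circ> sref k) l) * xvar (z (sref k l)) * G (sref k l))"
      unfolding IH[OF zs]
    proof (rule sum.cong[OF refl])
      fix l assume l: "l \<in> {1..k}"
      have "(z \<circ> sref k) l = z (sref k l)" by simp
      then show "Const (colw k ?\<kappa> (z \<circ> sref k) l) * xvar ((z \<circ> sref k) l) * E_rel n q th (basement k (z \<circ> sref k) l) ?\<nu> =
          Const (colw k ?\<kappa> (z \<circ> sref k) l) * xvar (z (sref k l)) * G (sref k l)"
        by (simp only: G2[OF l])
    qed
    also have "\<dots> = xvar (z (k + 1)) * G (k + 1) +
      (\<Sum>l\<in>{1..k - 1}. Const (colw k ?\<kappa> (z \<circ> sref k) l) * xvar (z (sref k l)) * G (sref k l))"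
      unfolding sum_split top sref_simps Const_1 mult_1 ..
    also have "(\<Sum>l\<in>{1..k - 1}. Const (colw k ?\<kappa> (z \<circ> sref k) l) * xvar (z (sref k l)) * G (sref k l)) =
      (\<Sum>l\<in>{1..k - 1}. Const (colw k ?\<kappa> (z \<circ> sref k) l) * xvar (z l) * G l)"
      by (rule sum.cong[OF refl]) (simp only: below)
    also have "E_rel n q th z ?\<kappa> = (\<Sum>l\<in>{1..k}. Const (colw k ?\<kappa> z l) * xvar (z l) * G l)"
      unfolding IH[OF z] by (rule sum.cong[OF refl]) (simp only: G1)
    also have "\<dots> = xvar (z k) * G k + (\<Sum>l\<in>{1..k - 1}. Const (colw k ?\<kappa> z l) * xvar (z l) * G l)"
      unfolding sum_split top Const_1 mult_1 ..
    also have "xvar (z (k + 1)) * G (k + 1) + (\<Sum>l\<in>{1..k - 1}. Const (colw k ?\<kappa> (z \<circ> sref k) l) * xvar (z l) * G l) +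
      Const (colw (k + 1) \<mu> z k) * (xvar (z k) * G k + (\<Sum>l\<in>{1..k - 1}. Const (colw k ?\<kappa> z l) * xvar (z l) * G l)) =
      xvar (z (k + 1)) * G (k + 1) + (Const (colw (k + 1) \<mu> z k) * xvar (z k) * G k +
      (\<Sum>l\<in>{1..k - 1}. Const (colw k ?\<kappa> (z \<circ> sref k) l + colw (k + 1) \<mu> z k * colw k ?\<kappa> z l) * xvar (z l) * G l))"
      by (simp only: add.assoc mult.assoc merge_sums[unfolded mult.assoc])
    also have "(\<Sum>l\<in>{1..k - 1}. Const (colw k ?\<kappa> (z \<circ> sref k) l + colw (k + 1) \<mu> z k * colw k ?\<kappa> z l) * xvar (z l) * G l) =
      (\<Sum>l\<in>{1..k - 1}. Const (colw (k + 1) \<mu> z l) * xvar (z l) * G l)"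
      by (intro sum.cong refl) (simp only: merge)
    finally have "E_rel n q th z (sact k ?\<kappa>) = (\<Sum>l\<in>{1..k + 1}. Const (colw (k + 1) \<mu> z l) * xvar (z l) * G l)"
      unfolding sum_split' top Const_1 mult_1 .
    then show ?case unfolding sact_sact G_def .
  qed
qed

end

section \<open>Nonattacking fillings\<close>

lemma box_split:
  fixes i j n :: int
  assumes "i \<in> {1..n}"
  shows "rep n (i + n * j) = i" "(i + n * j - 1) div n = j"
proof -
  have n: "0 < n" using assms by simp
  have "rep n (i + j * n) = rep n i" by (rule rep_add[OF n])
  then show "rep n (i + n * j) = i" using rep_eq[OF assms] by (simp add: mult.commute)
  have "(i + j * n - 1) div n = (i - 1) div n + j" by (rule div_add[OF n])
  then show "(i + n * j - 1) div n = j" using assms by (simp add: mult.commute div_pos_pos_trivial)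
qed

text \<open>
  Adding \<open>n\<close> to a coordinate lowers the extended exponent by one, so that membership in the diagram is a sign
  condition and the leg is a value of the extended exponent.
\<close>

lemma mem_dg:
  assumes "0 < n" shows "b \<in> dg n \<mu> \<longleftrightarrow> n < b \<and> 0 \<le> expo_ext n \<mu> b"
proof -
  have b: "b = rep n b + n * ((b - 1) div n)" using rep_decomp[of b n] by (simp add: mult.commute)
  have row: "1 \<le> (b - 1) div n \<longleftrightarrow> n < b"
    using assms by (simp add: pos_imp_zdiv_pos_iff int_one_le_iff_zero_less add1_zle_eq le_diff_eq)
  have "b \<in> dg n \<mu> \<longleftrightarrow> 1 \<le> (b - 1) div n \<and> (b - 1) div n \<le> coef \<mu> (rep n b)"
  proof
    assume "b \<in> dg n \<mu>"
    then obtain i j where "b = i + n * j" "i \<in> {1..n}" "1 \<le> j" "j \<le> coef \<mu> i" unfolding dg_def by blast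
    then show "1 \<le> (b - 1) div n \<and> (b - 1) div n \<le> coef \<mu> (rep n b)" using box_split[of i n j] by simp
  next
    assume "1 \<le> (b - 1) div n \<and> (b - 1) div n \<le> coef \<mu> (rep n b)"
    then show "b \<in> dg n \<mu>" unfolding dg_def using b rep_in[OF assms, of b] by blast
  qed
  then show ?thesis using row by (simp add: expo_ext_def)
qed

lemma mem_dg_hat:
  assumes "0 < n" shows "b \<in> dg_hat n \<mu> \<longleftrightarrow> 0 < b \<and> 0 \<le> expo_ext n \<mu> b"
proof -
  have b: "b = rep n b + n * ((b - 1) div n)" using rep_decomp[of b n] by (simp add: mult.commute)
  have row: "0 \<le> (b - 1) div n \<longleftrightarrow> 0 < b"
    using assms by (simp add: pos_imp_zdiv_nonneg_iff)
  have "b \<in> dg_hat n \<mu> \<longleftrightarrow> 0 \<le> (b - 1) div n \<and> (b - 1) div n \<le> coef \<mu> (rep n b)"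
  proof
    assume "b \<in> dg_hat n \<mu>"
    then obtain i j where "b = i + n * j" "i \<in> {1..n}" "0 \<le> j" "j \<le> coef \<mu> i" unfolding dg_hat_def by blast
    then show "0 \<le> (b - 1) div n \<and> (b - 1) div n \<le> coef \<mu> (rep n b)" using box_split[of i n j] by simp
  next
    assume "0 \<le> (b - 1) div n \<and> (b - 1) div n \<le> coef \<mu> (rep n b)"
    then show "b \<in> dg_hat n \<mu>" unfolding dg_hat_def using b rep_in[OF assms, of b] by blast
  qed
  then show ?thesis using row by (simp add: expo_ext_def)
qed

lemma card_Nleg:
  assumes "0 < n" "b \<in> dg_hat n \<mu>"
  shows "card (Nleg n \<mu> b) = nat (expo_ext n \<mu> b)"
proof -
  have b: "0 < b" "0 \<le> expo_ext n \<mu> b" using assms mem_dg_hat by auto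
  have "Nleg n \<mu> b = (\<lambda>m. b + n * m) ` {1..expo_ext n \<mu> b}"
  proof (intro equalityI subsetI)
    fix x assume "x \<in> Nleg n \<mu> b"
    then obtain m where m: "x = b + n * m" "0 < m" "x \<in> dg n \<mu>" unfolding Nleg_def by blast
    then have "m \<le> expo_ext n \<mu> b"
      using expo_ext_add[OF assms(1), of \<mu> b m] mem_dg[OF assms(1), of x \<mu>] by (simp add: mult.commute)
    then show "x \<in> (\<lambda>m. b + n * m) ` {1..expo_ext n \<mu> b}" using m by auto
  next
    fix x assume "x \<in> (\<lambda>m. b + n * m) ` {1..expo_ext n \<mu> b}"
    then obtain m where "m \<in> {1..expo_ext n \<mu> b}" "x = b + n * m" by blast
    then have m: "x = b + n * m" "1 \<le> m" "m \<le> expo_ext n \<mu> b" by simp_all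
    have "n * 1 \<le> n * m" using assms(1) m(2) by (intro mult_left_mono) auto
    then have "x \<in> dg n \<mu>"
      using m b expo_ext_add[OF assms(1), of \<mu> b m] mem_dg[OF assms(1), of x \<mu>] by (simp add: mult.commute)
    then show "x \<in> Nleg n \<mu> b" unfolding Nleg_def using m by auto
  qed
  moreover have "inj_on (\<lambda>m. b + n * m) {1..expo_ext n \<mu> b}" using assms(1) by (auto simp: inj_on_def)
  ultimately show ?thesis by (simp add: card_image)
qed

lemma expo_ext_in: "i \<in> {1..n} \<Longrightarrow> expo_ext n \<mu> i = coef \<mu> i"
  by (simp add: expo_ext_def rep_eq div_pos_pos_trivial)

lemma finite_dg_hat: assumes "0 < n" shows "finite (dg_hat n \<mu>)"
proof -
  have "dg_hat n \<mu> \<subseteq> (\<Union>i\<in>{1..n}. (\<lambda>j. i + n * j) ` {0..coef \<mu> i})"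
    unfolding dg_hat_def by auto
  then show ?thesis by (rule finite_subset) auto
qed

lemma dg_subset_dg_hat: "0 < n \<Longrightarrow> dg n \<mu> \<subseteq> dg_hat n \<mu>"
  by (auto simp: mem_dg mem_dg_hat)

lemma finite_NAF: "0 < n \<Longrightarrow> finite (NAF n z \<mu>)"
  unfolding NAF_def
  by (rule finite_subset[of _ "dg_hat n \<mu> \<rightarrow>\<^sub>E {1..n}"]) (auto intro!: finite_PiE finite_dg_hat)

text \<open>
  The boxes of \<open>shrink n k \<mu>\<close> in the columns \<open>\<ge> k\<close> correspond to those of \<open>\<mu>\<close>, except for the basement box
  \<open>k\<close>, by moving to the next position of these columns in cylindrical order. This map is monotone and
  commutes with addition of \<open>n\<close>, and so it preserves attack sets, legs and arms.
\<close>

definition next_box :: "int \<Rightarrow> int \<Rightarrow> int \<Rightarrow> int"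
  where "next_box n k b = (if rep n b = n then b + k else b + 1)"

definition prev_box :: "int \<Rightarrow> int \<Rightarrow> int \<Rightarrow> int"
  where "prev_box n k b = (if rep n b = k then b - k else b - 1)"

abbreviation cols :: "int \<Rightarrow> int \<Rightarrow> int set"
  where "cols n k \<equiv> {b. k \<le> rep n b}"

context
  fixes n k :: int
  assumes k: "1 \<le> k" "k \<le> n"
begin

lemma n_pos: "0 < n" using k by simp

lemma box_cases:
  obtains i j where "b = i + n * j" "i \<in> {1..n}" "rep n b = i" "(b - 1) div n = j"
proof -
  have "b = rep n b + n * ((b - 1) div n)" using rep_decomp[of b n] by (simp add: mult.commute)
  then show ?thesis using that rep_in[OF n_pos, of b] by blast
qed

lemma next_box_rep:
  assumes "b \<in> cols n k"
  shows "rep n (next_box n k b) = (if rep n b = n then k else rep n b + 1)"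
    "(next_box n k b - 1) div n = (if rep n b = n then (b - 1) div n + 1 else (b - 1) div n)"
proof -
  obtain i j where b: "b = i + n * j" "i \<in> {1..n}" "rep n b = i" "(b - 1) div n = j" by (rule box_cases)
  have 1: "next_box n k b = k + n * (j + 1)" if "i = n" using that b by (simp add: next_box_def algebra_simps)
  have 2: "next_box n k b = (i + 1) + n * j" if "i \<noteq> n" using that b by (simp add: next_box_def)
  have "rep n (next_box n k b) = (if i = n then k else i + 1) \<and>
    (next_box n k b - 1) div n = (if i = n then j + 1 else j)"
    using 1 2 box_split[of k n "j + 1"] box_split[of "i + 1" n j] b(2) k by (cases "i = n") auto
  then show "rep n (next_box n k b) = (if rep n b = n then k else rep n b + 1)"
    "(next_box n k b - 1) div n = (if rep n b = n then (b - 1) div n + 1 else (b - 1) div n)"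
    unfolding b(3,4) by blast+
qed

lemma next_box_cols: "b \<in> cols n k \<Longrightarrow> next_box n k b \<in> cols n k"
  by (simp add: next_box_rep k(2))

lemma prev_next [simp]: "b \<in> cols n k \<Longrightarrow> prev_box n k (next_box n k b) = b"
  using next_box_rep(1)[of b] rep_in[OF n_pos, of b]
  by (auto simp: prev_box_def) (auto simp: next_box_def)

lemma prev_box_cols: "b \<in> cols n k \<Longrightarrow> prev_box n k b \<in> cols n k \<and> next_box n k (prev_box n k b) = b"
proof -
  assume bk: "b \<in> cols n k"
  obtain i j where b: "b = i + n * j" "i \<in> {1..n}" "rep n b = i" "(b - 1) div n = j" by (rule box_cases)
  show ?thesis
  proof (cases "i = k")
    case True
    then have p: "prev_box n k b = n + n * (j - 1)" using b by (simp add: prev_box_def algebra_simps)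
    have "rep n (prev_box n k b) = n" unfolding p using k by (intro box_split) auto
    then show ?thesis using p b True k by (simp add: next_box_def algebra_simps)
  next
    case False
    then have p: "prev_box n k b = (i - 1) + n * j" using b by (simp add: prev_box_def)
    have "rep n (prev_box n k b) = i - 1" unfolding p using k b bk False by (intro box_split) auto
    then show ?thesis using p b False k bk by (simp add: next_box_def)
  qed
qed

lemma rep_add_n: "rep n (b + n) = rep n b" "rep n (b - n) = rep n b"
  using rep_add[OF n_pos, of b 1] rep_add[OF n_pos, of b "- 1"] by simp_all

lemma next_box_add_n: "next_box n k (b + n) = next_box n k b + n" "next_box n k (b - n) = next_box n k b - n"
  by (simp_all add: next_box_def rep_add_n)

lemma next_box_mono:
  assumes "a \<in> cols n k" "b \<in> cols n k" "a < b"
  shows "next_box n k a < next_box n k b"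
proof -
  obtain i j where a: "a = i + n * j" "i \<in> {1..n}" "rep n a = i" "(a - 1) div n = j" by (rule box_cases)
  obtain i' j' where b: "b = i' + n * j'" "i' \<in> {1..n}" "rep n b = i'" "(b - 1) div n = j'" by (rule box_cases)
  have "j \<le> j'" using assms(3) a(4) b(4) zdiv_mono1[of "a - 1" "b - 1" n] n_pos by simp
  show ?thesis
  proof (cases "i = n")
    case True
    have "j < j'"
    proof (rule ccontr)
      assume "\<not> j < j'"
      then have "j = j'" using \<open>j \<le> j'\<close> by simp
      then show False using assms(3) a b True by simp
    qed
    then have "n * (j + 1) \<le> n * j'" using n_pos by (intro mult_left_mono) auto
    then have "a + k \<le> k + n * j'" using a True by (simp add: algebra_simps)
    also have "\<dots> \<le> b" using b assms(2) by simp
    also have "b < next_box n k b" using k by (simp add: next_box_def)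
    finally show ?thesis using True a by (simp add: next_box_def)
  next
    case False
    then show ?thesis using assms(3) a k by (auto simp: next_box_def)
  qed
qed

lemma next_box_less_iff:
  "a \<in> cols n k \<Longrightarrow> b \<in> cols n k \<Longrightarrow> next_box n k a < next_box n k b \<longleftrightarrow> a < b"
  using next_box_mono[of a b] next_box_mono[of b a] by (cases a b rule: linorder_cases) auto

lemma rep_0: "rep n 0 = n" "rep n n = n"
  using box_split[of n n "- 1"] rep_eq[of n n] k by simp_all

lemma next_box_pos: "b \<in> cols n k \<Longrightarrow> k < next_box n k b \<longleftrightarrow> 0 < b"
  using next_box_less_iff[of 0 b] k by (simp add: rep_0 next_box_def[of n k 0])

lemma next_box_row: "b \<in> cols n k \<Longrightarrow> k + n < next_box n k b \<longleftrightarrow> n < b"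
  using next_box_less_iff[of n b] k by (simp add: rep_0 next_box_def[of n k n] add.commute)

end

context
  fixes n k :: int and \<mu> \<nu> :: expo
  assumes fc: "first_column n k \<mu>"
  defines "\<nu> \<equiv> shrink n k \<mu>"
begin

lemma kn: "1 \<le> k" "k \<le> n"
  using fc by (auto simp: first_column_def)

lemma n0: "0 < n" using kn by simp

lemma expo_ext_next: "b \<in> cols n k \<Longrightarrow> expo_ext n \<mu> (next_box n k b) = expo_ext n \<nu> b"
  using rep_in[OF n0, of b] unfolding \<nu>_def expo_ext_def coef_shrink[OF kn(2)] rot_def
  by (auto simp: next_box_rep[OF kn])

lemma zero_columns: "rep n b < k \<Longrightarrow> expo_ext n \<mu> b = - ((b - 1) div n)"
  "rep n b < k \<Longrightarrow> expo_ext n \<nu> b = - ((b - 1) div n)"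
  using rep_in[OF n0, of b] fc shrink_zero[OF fc, of "rep n b"]
  by (auto simp: expo_ext_def \<nu>_def first_column_def)

lemma dg_cols: "b \<in> dg n \<mu> \<Longrightarrow> b \<in> cols n k" "b \<in> dg n \<nu> \<Longrightarrow> b \<in> cols n k"
proof -
  have "\<not> rep n b < k" if "n < b" "0 \<le> expo_ext n \<kappa> b" "\<kappa> \<in> {\<mu>, \<nu>}" for \<kappa>
  proof
    assume r: "rep n b < k"
    have "n div n \<le> (b - 1) div n" using that(1) n0 by (intro zdiv_mono1) auto
    then show False using zero_columns[OF r] that(2,3) n0 by auto
  qed
  then show "b \<in> dg n \<mu> \<Longrightarrow> b \<in> cols n k" "b \<in> dg n \<nu> \<Longrightarrow> b \<in> cols n k"
    using mem_dg[OF n0] by force+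
qed

lemma dg_hat_low_columns: "\<kappa> \<in> {\<mu>, \<nu>} \<Longrightarrow> b \<in> dg_hat n \<kappa> \<Longrightarrow> rep n b < k \<Longrightarrow> b \<in> {1..k - 1}"
proof -
  assume \<kappa>: "\<kappa> \<in> {\<mu>, \<nu>}" and b: "b \<in> dg_hat n \<kappa>" and r: "rep n b < k"
  have "0 < b" "0 \<le> expo_ext n \<kappa> b" using b mem_dg_hat[OF n0] by auto
  then have "0 \<le> (b - 1) div n" "(b - 1) div n \<le> 0"
    using zero_columns[OF r] \<kappa> n0 by (auto simp: pos_imp_zdiv_nonneg_iff)
  then have "b = rep n b" using rep_decomp[of b n] by simp
  then show ?thesis using r \<open>0 < b\<close> by simp
qed

lemma next_box_dg_hat:
  assumes "b \<in> cols n k" shows "next_box n k b \<in> dg_hat n \<mu> \<and> next_box n k b \<noteq> k \<longleftrightarrow> b \<in> dg_hat n \<nu>"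
proof -
  have "0 < next_box n k b \<and> next_box n k b \<noteq> k \<longleftrightarrow> k < next_box n k b"
  proof
    assume h: "0 < next_box n k b \<and> next_box n k b \<noteq> k"
    show "k < next_box n k b"
    proof (rule ccontr)
      assume "\<not> ?thesis"
      then have "next_box n k b \<in> {1..n}" "next_box n k b < k" using h kn by auto
      then show False using next_box_cols[OF kn assms] rep_eq[of "next_box n k b" n] by simp
    qed
  qed (use kn in auto)
  then show ?thesis
    unfolding mem_dg_hat[OF n0] expo_ext_next[OF assms] next_box_pos[OF kn assms, symmetric] by blast
qed

lemma next_box_dg:
  assumes "b \<in> cols n k" shows "next_box n k b \<in> dg n \<mu> \<and> next_box n k b \<noteq> k + n \<longleftrightarrow> b \<in> dg n \<nu>"
proof -
  have "n < next_box n k b \<and> next_box n k b \<noteq> k + n \<longleftrightarrow> k + n < next_box n k b"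
  proof
    assume h: "n < next_box n k b \<and> next_box n k b \<noteq> k + n"
    show "k + n < next_box n k b"
    proof (rule ccontr)
      assume "\<not> ?thesis"
      then have "next_box n k b - n \<in> {1..n}" "next_box n k b - n < k" using h kn by auto
      then show False
        using next_box_cols[OF kn assms] rep_eq[of "next_box n k b - n" n] rep_add_n(2)[OF kn, of "next_box n k b"] by simp
    qed
  qed (use kn in auto)
  then show ?thesis
    unfolding mem_dg[OF n0] expo_ext_next[OF assms] next_box_row[OF kn assms, symmetric] by blast
qed

lemma first_box: "k + n \<in> dg n \<mu>"
proof -
  have "expo_ext n \<mu> (k + 1 * n) = expo_ext n \<mu> k - 1" by (rule expo_ext_add[OF n0])
  moreover have "expo_ext n \<mu> k = coef \<mu> k" using kn by (intro expo_ext_in) auto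
  ultimately show ?thesis using fc kn by (simp add: mem_dg[OF n0] first_column_def)
qed

lemma dg_eq: "dg n \<mu> = insert (k + n) (next_box n k ` dg n \<nu>)"
proof (intro equalityI subsetI)
  fix b assume b: "b \<in> dg n \<mu>"
  show "b \<in> insert (k + n) (next_box n k ` dg n \<nu>)"
  proof (cases "b = k + n")
    case False
    have c: "prev_box n k b \<in> cols n k" "next_box n k (prev_box n k b) = b"
      using prev_box_cols[OF kn dg_cols(1)[OF b]] by auto
    then have "prev_box n k b \<in> dg n \<nu>" using next_box_dg[OF c(1)] b False by simp
    then show ?thesis using c(2) by (metis imageI insertCI)
  qed simp
next
  fix b assume "b \<in> insert (k + n) (next_box n k ` dg n \<nu>)"
  then show "b \<in> dg n \<mu>" using first_box next_box_dg dg_cols(2) by auto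
qed

lemma attack_next:
  assumes b: "b \<in> dg n \<nu>"
  shows "attack n \<mu> (next_box n k b) = next_box n k ` attack n \<nu> b" "attack n \<nu> b \<subseteq> cols n k"
proof -
  have bc: "b \<in> cols n k" by (rule dg_cols(2)[OF b])
  have bn: "b - n \<in> cols n k" using bc by (simp add: rep_add_n[OF kn])
  have n_b: "n < b" using b mem_dg[OF n0] by simp
  have kb: "k \<le> b - n"
  proof (rule ccontr)
    assume "\<not> k \<le> b - n"
    then have "b - n \<in> {1..n}" "b - n < k" using n_b kn by auto
    then show False using bn rep_eq[of "b - n" n] by simp
  qed
  have nb: "k < next_box n k b - n"
    using next_box_row[OF kn bc] n_b by simp
  show sub: "attack n \<nu> b \<subseteq> cols n k"
  proof
    fix a assume a: "a \<in> attack n \<nu> b"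
    have "\<not> rep n a < k"
    proof
      assume "rep n a < k"
      then have "a \<in> {1..k - 1}" using a dg_hat_low_columns[of \<nu> a] by (auto simp: attack_def)
      then show False using a kb by (auto simp: attack_def)
    qed
    then show "a \<in> cols n k" by simp
  qed
  have iff: "next_box n k a \<in> attack n \<mu> (next_box n k b) \<longleftrightarrow> a \<in> attack n \<nu> b" if a: "a \<in> cols n k" for a
  proof -
    have "next_box n k b - n < next_box n k a \<longleftrightarrow> b - n < a"
      using next_box_less_iff[OF kn bn a] by (simp add: next_box_add_n[OF kn])
    moreover have "next_box n k a < next_box n k b \<longleftrightarrow> a < b" by (rule next_box_less_iff[OF kn a bc])
    moreover have "next_box n k a \<in> {next_box n k b - n + 1..next_box n k b - 1} \<longleftrightarrow>
      next_box n k b - n < next_box n k a \<and> next_box n k a < next_box n k b" by auto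
    moreover have "a \<in> {b - n + 1..b - 1} \<longleftrightarrow> b - n < a \<and> a < b" by auto
    moreover have "next_box n k a \<noteq> k" if "next_box n k b - n < next_box n k a" using that nb by auto
    ultimately show ?thesis
      unfolding attack_def using next_box_dg_hat[OF a] by blast
  qed
  show "attack n \<mu> (next_box n k b) = next_box n k ` attack n \<nu> b"
  proof (intro equalityI subsetI)
    fix a assume a: "a \<in> attack n \<mu> (next_box n k b)"
    have "\<not> rep n a < k"
    proof
      assume "rep n a < k"
      then have "a \<in> {1..k - 1}" using a dg_hat_low_columns[of \<mu> a] by (auto simp: attack_def)
      then show False using a nb by (auto simp: attack_def)
    qed
    then have "prev_box n k a \<in> cols n k" "next_box n k (prev_box n k a) = a"
      using prev_box_cols[OF kn, of a] by auto
    then show "a \<in> next_box n k ` attack n \<nu> b" using iff a by (metis imageI)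
  next
    fix a assume "a \<in> next_box n k ` attack n \<nu> b"
    then show "a \<in> attack n \<mu> (next_box n k b)" using iff sub by auto
  qed
qed

lemma inj_next: "inj_on (next_box n k) (cols n k)"
  by (rule inj_on_inverseI[of _ "prev_box n k"]) (rule prev_next[OF kn])

lemma card_Nleg_next:
  assumes "b \<in> dg_hat n \<nu>" "b \<in> cols n k"
  shows "card (Nleg n \<mu> (next_box n k b)) = card (Nleg n \<nu> b)"
  using next_box_dg_hat[OF assms(2)] assms
  by (simp add: card_Nleg[OF n0] expo_ext_next)

lemma Narm_next:
  assumes b: "b \<in> dg n \<nu>"
  shows "Narm n \<mu> (next_box n k b) = next_box n k ` Narm n \<nu> b" "Narm n \<nu> b \<subseteq> cols n k"
proof -
  have bc: "b \<in> cols n k" "b \<in> dg_hat n \<nu>" using dg_cols(2)[OF b] b dg_subset_dg_hat[OF n0] by auto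
  show "Narm n \<nu> b \<subseteq> cols n k" using attack_next(2)[OF b] by (auto simp: Narm_def)
  have "card (Nleg n \<mu> (next_box n k a)) = card (Nleg n \<nu> a)" if "a \<in> attack n \<nu> b" for a
    using that attack_next(2)[OF b] by (intro card_Nleg_next) (auto simp: attack_def)
  then show "Narm n \<mu> (next_box n k b) = next_box n k ` Narm n \<nu> b"
    unfolding Narm_def attack_next(1)[OF b] card_Nleg_next[OF bc(2,1)] by auto
qed

context
  fixes F G :: "int \<Rightarrow> int"
  assumes FG: "\<And>b. b \<in> dg_hat n \<nu> \<Longrightarrow> b \<in> cols n k \<Longrightarrow> F (next_box n k b) = G b"
begin

lemma wt_box_next:
  assumes b: "b \<in> dg n \<nu>"
  shows "wt_box n q th \<mu> F (next_box n k b) = wt_box n q th \<nu> G b"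
proof -
  have bc: "b \<in> cols n k" "b \<in> dg_hat n \<nu>" using dg_cols(2)[OF b] b dg_subset_dg_hat[OF n0] by auto
  have bn: "b - n \<in> cols n k" "b - n \<in> dg_hat n \<nu>"
  proof -
    show "b - n \<in> cols n k" using bc by (simp add: rep_add_n[OF kn])
    have "expo_ext n \<nu> (b + (- 1) * n) = expo_ext n \<nu> b - (- 1)" by (rule expo_ext_add[OF n0])
    then show "b - n \<in> dg_hat n \<nu>" using b by (simp add: mem_dg[OF n0] mem_dg_hat[OF n0])
  qed
  have vals: "F (next_box n k b) = G b" "F (next_box n k b - n) = G (b - n)"
    using FG[OF bc(2,1)] FG[OF bn(2,1)] by (simp_all add: next_box_add_n[OF kn])
  have arm: "F (next_box n k a) = G a" if "a \<in> Narm n \<nu> b" for a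
    using that Narm_next(2)[OF b] by (intro FG) (auto simp: Narm_def attack_def)
  have "card (Narm n \<mu> (next_box n k b)) = card (Narm n \<nu> b)"
    unfolding Narm_next(1)[OF b] by (rule card_image[OF inj_on_subset[OF inj_next Narm_next(2)[OF b]]])
  then have D: "D_box n q th \<mu> (next_box n k b) = D_box n q th \<nu> b"
    by (simp only: D_box_def card_Nleg_next[OF bc(2,1)])
  have "bwn n \<mu> F (next_box n k b) = next_box n k ` bwn n \<nu> G b"
    unfolding bwn_def vals Narm_next(1)[OF b] using arm by auto
  moreover have "bwn n \<nu> G b \<subseteq> cols n k" using Narm_next(2)[OF b] by (auto simp: bwn_def)
  ultimately have "card (bwn n \<mu> F (next_box n k b)) = card (bwn n \<nu> G b)"
    by (simp only: card_image[OF inj_on_subset[OF inj_next]])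
  then show ?thesis by (simp only: wt_box_def vals D)
qed

lemma wt_filling_next: "wt_filling n q th \<mu> F = wt_box n q th \<mu> F (k + n) * wt_filling n q th \<nu> G"
proof -
  have fin: "finite (dg n \<nu>)" using finite_subset[OF dg_subset_dg_hat[OF n0] finite_dg_hat[OF n0]] .
  have ni: "k + n \<notin> next_box n k ` dg n \<nu>"
  proof
    assume "k + n \<in> next_box n k ` dg n \<nu>"
    then obtain x where "k + n = next_box n k x" "x \<in> dg n \<nu>" by blast
    then show False using next_box_dg[OF dg_cols(2), of x] by simp
  qed
  have inj: "inj_on (next_box n k) (dg n \<nu>)"
    by (rule inj_on_subset[OF inj_next]) (use dg_cols(2) in blast)
  have "wt_filling n q th \<mu> F = wt_box n q th \<mu> F (k + n) * (\<Prod>b\<in>next_box n k ` dg n \<nu>. wt_box n q th \<mu> F b)"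
    unfolding wt_filling_def dg_eq using fin ni by (intro prod.insert) auto
  also have "(\<Prod>b\<in>next_box n k ` dg n \<nu>. wt_box n q th \<mu> F b) = wt_filling n q th \<nu> G"
    unfolding wt_filling_def prod.reindex[OF inj] comp_apply by (intro prod.cong refl wt_box_next)
  finally show ?thesis .
qed

end

lemma first_box_attack: "attack n \<mu> (k + n) = {k + 1..n}"
proof (intro equalityI subsetI)
  fix a assume a: "a \<in> attack n \<mu> (k + n)"
  then have ran: "k + 1 \<le> a" "a \<le> k + n - 1" "a \<in> dg_hat n \<mu>" by (auto simp: attack_def)
  have "a \<le> n"
  proof (rule ccontr)
    assume "\<not> a \<le> n"
    then have "a \<in> dg n \<mu>" using ran by (simp add: mem_dg[OF n0] mem_dg_hat[OF n0])
    then have "k \<le> rep n a" using dg_cols(1) by blast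
    moreover have "a - n \<in> {1..n}" using ran \<open>\<not> a \<le> n\<close> kn by auto
    ultimately show False using rep_eq[of "a - n" n] rep_add_n(2)[OF kn, of a] ran by simp
  qed
  then show "a \<in> {k + 1..n}" using ran by simp
next
  fix a assume a: "a \<in> {k + 1..n}"
  then have "a \<in> {1..n}" using kn by auto
  then have "a \<in> dg_hat n \<mu>"
    using fc by (simp add: mem_dg_hat[OF n0] expo_ext_in first_column_def)
  then show "a \<in> attack n \<mu> (k + n)" using a kn by (auto simp: attack_def)
qed

lemma first_box_Nleg: "card (Nleg n \<mu> (k + n)) = nat (coef \<mu> k - 1)"
proof -
  have "k + n \<in> dg_hat n \<mu>" using first_box dg_subset_dg_hat[OF n0] by blast
  moreover have "expo_ext n \<mu> (k + 1 * n) = expo_ext n \<mu> k - 1" by (rule expo_ext_add[OF n0])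
  moreover have "expo_ext n \<mu> k = coef \<mu> k" using kn by (intro expo_ext_in) auto
  ultimately show ?thesis by (simp add: card_Nleg[OF n0])
qed

lemma first_box_Narm: "Narm n \<mu> (k + n) = {a \<in> {k + 1..n}. coef \<mu> a < coef \<mu> k}"
proof -
  have pos: "0 < coef \<mu> k" "\<And>i. 0 \<le> coef \<mu> i" using fc by (auto simp: first_column_def)
  have "card (Nleg n \<mu> a) = nat (coef \<mu> a)" if "a \<in> {k + 1..n}" for a
  proof -
    have a: "a \<in> {1..n}" using that kn by auto
    then have "a \<in> dg_hat n \<mu>" using pos by (simp add: mem_dg_hat[OF n0] expo_ext_in)
    then show ?thesis using a by (simp add: card_Nleg[OF n0] expo_ext_in)
  qed
  moreover have "nat (coef \<mu> a) \<le> nat (coef \<mu> k - 1) \<longleftrightarrow> coef \<mu> a < coef \<mu> k" for a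
    using pos(1) pos(2)[of a] by linarith
  ultimately show ?thesis
    unfolding Narm_def first_box_attack first_box_Nleg by auto
qed

end

section \<open>The recursion for nonattacking fillings\<close>

context
  fixes n k :: int and \<mu> \<nu> :: expo and z :: "int \<Rightarrow> int"
  assumes fc: "first_column n k \<mu>" and z: "z permutes {1..n}"
  defines "\<nu> \<equiv> shrink n k \<mu>"
begin

text \<open>
  The first box \<open>k + n\<close> obtains the entry of the basement box \<open>n\<close> of \<open>G\<close>, which precedes it.
\<close>

definition add_box :: "(int \<Rightarrow> int) \<Rightarrow> int \<Rightarrow> int"
  where "add_box G = (\<lambda>b\<in>dg_hat n \<mu>. if b \<in> {1..n} then z b else G (prev_box n k b))"

definition removed_basement :: "int \<Rightarrow> int \<Rightarrow> int"
  where "removed_basement l = z \<circ> transpose l k \<circ> rot k n"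

definition remove_box :: "(int \<Rightarrow> int) \<Rightarrow> int \<Rightarrow> int"
  where "remove_box F = (\<lambda>b\<in>dg_hat n \<nu>. if b \<in> {1..n}
    then removed_basement (inv z (F (k + n))) b else F (next_box n k b))"

lemmas k_bounds = kn[OF fc]
lemmas n_gt_0 = n0[OF fc]

lemma basement_boxes: "i \<in> {1..n} \<Longrightarrow> i \<in> dg_hat n \<mu>" "i \<in> {1..n} \<Longrightarrow> i \<in> dg_hat n \<nu>"
  using fc shrink_nonneg[OF fc]
  by (auto simp: mem_dg_hat[OF n_gt_0] expo_ext_in \<nu>_def first_column_def)

lemma box_above: "b \<in> dg_hat n \<kappa> \<Longrightarrow> b \<notin> {1..n} \<Longrightarrow> b \<in> dg n \<kappa>"
  by (auto simp: mem_dg_hat[OF n_gt_0] mem_dg[OF n_gt_0])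

lemma removed_basement_values:
  assumes "l \<in> {1..k}"
  shows "removed_basement l n = z l" "b \<in> {k..n - 1} \<Longrightarrow> removed_basement l b = z (b + 1)"
  using assms by (auto simp: removed_basement_def rot_def transpose_def)

lemma removed_basement_permutes: "l \<in> {1..k} \<Longrightarrow> removed_basement l permutes {1..n}"
  unfolding removed_basement_def using k_bounds z
  by (intro permutes_compose[OF rot_permutes permutes_compose[OF permutes_swap_id]]) auto

lemma NAF_cases: "F \<in> NAF n y \<kappa> \<Longrightarrow> F \<in> dg_hat n \<kappa> \<rightarrow>\<^sub>E {1..n}"
  "F \<in> NAF n y \<kappa> \<Longrightarrow> i \<in> {1..n} \<Longrightarrow> F i = y i"
  "F \<in> NAF n y \<kappa> \<Longrightarrow> b \<in> dg n \<kappa> \<Longrightarrow> a \<in> attack n \<kappa> b \<Longrightarrow> F a \<noteq> F b"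
  unfolding NAF_def by blast+

lemma cols_ge: "b \<in> cols n k \<Longrightarrow> b \<in> {1..n} \<Longrightarrow> k \<le> b"
  by (simp add: rep_eq)

lemma next_box_basement:
  assumes "b \<in> cols n k" "0 < b"
  shows "b < n \<Longrightarrow> next_box n k b = b + 1" "n \<le> b \<Longrightarrow> n < next_box n k b"
proof -
  show "b < n \<Longrightarrow> next_box n k b = b + 1"
    using assms(2) rep_eq[of b n] by (simp add: next_box_def)
  show "n \<le> b \<Longrightarrow> n < next_box n k b" using k_bounds by (auto simp: next_box_def)
qed

lemma add_box_next:
  assumes "l \<in> {1..k}" "G \<in> NAF n (removed_basement l) \<nu>" "b \<in> dg_hat n \<nu>" "b \<in> cols n k"
  shows "add_box G (next_box n k b) = G b"
proof -
  have b0: "0 < b" using assms(3) by (simp add: mem_dg_hat[OF n_gt_0])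
  have hat: "next_box n k b \<in> dg_hat n \<mu>"
    using next_box_dg_hat[OF fc assms(4)] assms(3) unfolding \<nu>_def by blast
  show ?thesis
  proof (cases "b < n")
    case True
    then have nb: "next_box n k b = b + 1" using next_box_basement(1)[OF assms(4) b0] by simp
    have "k \<le> b" using cols_ge[OF assms(4)] b0 True by simp
    then have "G b = z (b + 1)"
      using NAF_cases(2)[OF assms(2), of b] removed_basement_values(2)[OF assms(1), of b] b0 True by simp
    then show ?thesis using hat nb b0 True by (simp add: add_box_def)
  next
    case False
    then have "n < next_box n k b" using next_box_basement(2)[OF assms(4) b0] by simp
    then show ?thesis using hat prev_next[OF k_bounds assms(4)] by (simp add: add_box_def)
  qed
qed

lemma rep_first_box: "rep n (k + n) = k" "prev_box n k (k + n) = n"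
proof -
  show "rep n (k + n) = k" using rep_add[OF n_gt_0, of k 1] rep_eq[of k n] k_bounds by simp
  then show "prev_box n k (k + n) = n" by (simp add: prev_box_def)
qed

lemma add_box_first:
  assumes "l \<in> {1..k}" "G \<in> NAF n (removed_basement l) \<nu>"
  shows "add_box G (k + n) = z l"
proof -
  have "k + n \<in> dg_hat n \<mu>" using first_box[OF fc] dg_subset_dg_hat[OF n_gt_0] by blast
  moreover have "k + n \<notin> {1..n}" using k_bounds by simp
  moreover have "G n = z l"
    using NAF_cases(2)[OF assms(2), of n] n_gt_0 removed_basement_values(1)[OF assms(1)] by simp
  ultimately show ?thesis by (simp only: add_box_def restrict_apply if_True if_False rep_first_box)
qed

lemma add_box_basement: "i \<in> {1..n} \<Longrightarrow> add_box G i = z i"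
  using basement_boxes(1) by (simp add: add_box_def)

lemma add_box_NAF:
  assumes "l \<in> {1..k}" "G \<in> NAF n (removed_basement l) \<nu>"
  shows "add_box G \<in> NAF n z \<mu>"
  unfolding NAF_def mem_Collect_eq
proof (intro conjI ballI)
  have zin: "z i \<in> {1..n}" if "i \<in> {1..n}" for i using that permutes_in_image[OF z] by blast
  show "add_box G \<in> dg_hat n \<mu> \<rightarrow>\<^sub>E {1..n}"
  proof (rule PiE_I)
    fix b assume b: "b \<in> dg_hat n \<mu>"
    show "add_box G b \<in> {1..n}"
    proof (cases "b \<in> {1..n}")
      case True
      then show ?thesis using zin add_box_basement by metis
    next
      case False
      then consider "b = k + n" | a where "b = next_box n k a" "a \<in> dg n \<nu>"
        using box_above[OF b] dg_eq[OF fc] unfolding \<nu>_def by blast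
      then show ?thesis
      proof cases
        case 1
        have "l \<in> {1..n}" using assms(1) k_bounds by simp
        then show ?thesis unfolding 1 add_box_first[OF assms] by (rule zin)
      next
        case 2
        have a: "a \<in> dg_hat n \<nu>" "a \<in> cols n k"
          using 2(2) dg_subset_dg_hat[OF n_gt_0] dg_cols(2)[OF fc] unfolding \<nu>_def by auto
        show ?thesis unfolding 2(1) add_box_next[OF assms a] using NAF_cases(1)[OF assms(2)] a(1) by blast
      qed
    qed
  qed (simp add: add_box_def)
  fix i assume "i \<in> {1..n}"
  then show "add_box G i = z i" by (rule add_box_basement)
next
  fix b a assume b: "b \<in> dg n \<mu>" and a: "a \<in> attack n \<mu> b"
  from b consider "b = k + n" | b' where "b = next_box n k b'" "b' \<in> dg n \<nu>"
    using dg_eq[OF fc] unfolding \<nu>_def by blast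
  then show "add_box G a \<noteq> add_box G b"
  proof cases
    case 1
    then have "a \<in> {k + 1..n}" using a first_box_attack[OF fc] by simp
    then have "a \<in> {1..n}" "a \<noteq> l" using k_bounds assms(1) by auto
    then show ?thesis
      unfolding 1 add_box_first[OF assms] add_box_basement[OF \<open>a \<in> {1..n}\<close>]
      using permutes_inj[OF z] by (simp add: inj_eq)
  next
    case 2
    note att = attack_next[OF fc 2(2)[unfolded \<nu>_def], folded \<nu>_def]
    obtain a' where a': "a = next_box n k a'" "a' \<in> attack n \<nu> b'" using a att(1) 2(1) by auto
    have a'': "a' \<in> dg_hat n \<nu>" "a' \<in> cols n k" using a'(2) att(2) by (auto simp: attack_def)
    have b'': "b' \<in> dg_hat n \<nu>" "b' \<in> cols n k"
      using 2(2) dg_subset_dg_hat[OF n_gt_0] dg_cols(2)[OF fc] unfolding \<nu>_def by auto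
    show ?thesis
      unfolding a'(1) 2(1) add_box_next[OF assms a''] add_box_next[OF assms b'']
      by (rule NAF_cases(3)[OF assms(2) 2(2) a'(2)])
  qed
qed

text \<open>
  The first box is attacked by all basement boxes to the right of column \<open>k\<close>.
\<close>

lemma removed_index:
  assumes "F \<in> NAF n z \<mu>"
  shows "inv z (F (k + n)) \<in> {1..k}" "z (inv z (F (k + n))) = F (k + n)"
proof -
  let ?l = "inv z (F (k + n))"
  have "k + n \<in> dg_hat n \<mu>" using first_box[OF fc] dg_subset_dg_hat[OF n_gt_0] by blast
  then have "F (k + n) \<in> {1..n}" using NAF_cases(1)[OF assms] by blast
  then have l: "?l \<in> {1..n}" using permutes_in_image[OF permutes_inv[OF z]] by blast
  show zl: "z ?l = F (k + n)" by (rule permutes_inverses(1)[OF z])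
  have "\<not> k < ?l"
  proof
    assume "k < ?l"
    then have "?l \<in> attack n \<mu> (k + n)" using l first_box_attack[OF fc] by simp
    then show False
      using NAF_cases(3)[OF assms first_box[OF fc]] NAF_cases(2)[OF assms l] zl by metis
  qed
  then show "?l \<in> {1..k}" using l by simp
qed

lemma remove_box_basement:
  "i \<in> {1..n} \<Longrightarrow> remove_box F i = removed_basement (inv z (F (k + n))) i"
  using basement_boxes(2) by (simp add: remove_box_def)

lemma remove_box_next:
  assumes "F \<in> NAF n z \<mu>" "b \<in> dg_hat n \<nu>" "b \<in> cols n k"
  shows "F (next_box n k b) = remove_box F b"
proof (cases "b \<in> {1..n}")
  case True
  note l = removed_index[OF assms(1)]
  show ?thesis
  proof (cases "b < n")
    case True
    have b0: "0 < b" using \<open>b \<in> {1..n}\<close> by simp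
    have "k \<le> b" using cols_ge[OF assms(3) \<open>b \<in> {1..n}\<close>] .
    then have "remove_box F b = z (b + 1)"
      unfolding remove_box_basement[OF \<open>b \<in> {1..n}\<close>] using removed_basement_values(2)[OF l(1)] True by simp
    moreover have "F (b + 1) = z (b + 1)" using NAF_cases(2)[OF assms(1)] b0 True by simp
    ultimately show ?thesis using next_box_basement(1)[OF assms(3) b0 True] by simp
  next
    case False
    then have b: "b = n" using \<open>b \<in> {1..n}\<close> by simp
    have "next_box n k n = k + n" using rep_eq[of n n] n_gt_0 by (simp add: next_box_def)
    then show ?thesis
      unfolding remove_box_basement[OF \<open>b \<in> {1..n}\<close>] unfolding b removed_basement_values(1)[OF l(1)] l(2) by simp
  qed
next
  case False
  then show ?thesis using assms(2) by (simp only: remove_box_def restrict_apply if_True if_False)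
qed

lemma remove_box_NAF:
  assumes "F \<in> NAF n z \<mu>"
  shows "remove_box F \<in> NAF n (removed_basement (inv z (F (k + n)))) \<nu>"
  unfolding NAF_def mem_Collect_eq
proof (intro conjI ballI)
  note l = removed_index[OF assms]
  show "remove_box F \<in> dg_hat n \<nu> \<rightarrow>\<^sub>E {1..n}"
  proof (rule PiE_I)
    fix b assume b: "b \<in> dg_hat n \<nu>"
    show "remove_box F b \<in> {1..n}"
    proof (cases "b \<in> {1..n}")
      case True
      then show ?thesis
        unfolding remove_box_basement[OF True] using permutes_in_image[OF removed_basement_permutes[OF l(1)]] by blast
    next
      case False
      then have c: "b \<in> cols n k" using box_above[OF b] dg_cols(2)[OF fc] unfolding \<nu>_def by blast
      have "next_box n k b \<in> dg_hat n \<mu>" using next_box_dg_hat[OF fc c] b unfolding \<nu>_def by blast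
      then show ?thesis unfolding remove_box_next[OF assms b c, symmetric] using NAF_cases(1)[OF assms] by blast
    qed
  qed (simp add: remove_box_def)
  fix i assume "i \<in> {1..n}"
  then show "remove_box F i = removed_basement (inv z (F (k + n))) i" by (rule remove_box_basement)
next
  fix b a assume b: "b \<in> dg n \<nu>" and a: "a \<in> attack n \<nu> b"
  note att = attack_next[OF fc b[unfolded \<nu>_def], folded \<nu>_def]
  have a': "a \<in> dg_hat n \<nu>" "a \<in> cols n k" using a att(2) by (auto simp: attack_def)
  have b': "b \<in> dg_hat n \<nu>" "b \<in> cols n k"
    using b dg_subset_dg_hat[OF n_gt_0] dg_cols(2)[OF fc] unfolding \<nu>_def by auto
  have "next_box n k b \<in> dg n \<mu>" using next_box_dg[OF fc b'(2)] b unfolding \<nu>_def by blast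
  moreover have "next_box n k a \<in> attack n \<mu> (next_box n k b)" unfolding att(1) using a by blast
  ultimately show "remove_box F a \<noteq> remove_box F b"
    unfolding remove_box_next[OF assms a', symmetric] remove_box_next[OF assms b', symmetric]
    by (rule NAF_cases(3)[OF assms])
qed

lemma add_remove_box:
  assumes "F \<in> NAF n z \<mu>" shows "add_box (remove_box F) = F"
proof (rule PiE_ext[OF NAF_cases(1)[OF add_box_NAF] NAF_cases(1)[OF assms]])
  note l = removed_index[OF assms] and G = remove_box_NAF[OF assms]
  show "inv z (F (k + n)) \<in> {1..k}" by (rule l(1))
  show "remove_box F \<in> NAF n (removed_basement (inv z (F (k + n)))) \<nu>" by (rule G)
  fix b assume b: "b \<in> dg_hat n \<mu>"
  show "add_box (remove_box F) b = F b"
  proof (cases "b \<in> {1..n}")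
    case True
    then show ?thesis using add_box_basement[OF True] NAF_cases(2)[OF assms True] by simp
  next
    case False
    then consider "b = k + n" | a where "b = next_box n k a" "a \<in> dg n \<nu>"
      using box_above[OF b] dg_eq[OF fc] unfolding \<nu>_def by blast
    then show ?thesis
    proof cases
      case 1
      then show ?thesis using add_box_first[OF l(1) G] l(2) by simp
    next
      case 2
      have a: "a \<in> dg_hat n \<nu>" "a \<in> cols n k"
        using 2(2) dg_subset_dg_hat[OF n_gt_0] dg_cols(2)[OF fc] unfolding \<nu>_def by auto
      show ?thesis unfolding 2(1) add_box_next[OF l(1) G a] remove_box_next[OF assms a] ..
    qed
  qed
qed

lemma remove_add_box:
  assumes "l \<in> {1..k}" "G \<in> NAF n (removed_basement l) \<nu>"
  shows "inv z (add_box G (k + n)) = l" "remove_box (add_box G) = G"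
proof -
  show l: "inv z (add_box G (k + n)) = l"
    unfolding add_box_first[OF assms] by (rule permutes_inverses(2)[OF z])
  note F = add_box_NAF[OF assms]
  show "remove_box (add_box G) = G"
  proof (rule PiE_ext[OF NAF_cases(1)[OF remove_box_NAF[OF F]] NAF_cases(1)[OF assms(2)]])
    fix b assume b: "b \<in> dg_hat n \<nu>"
    show "remove_box (add_box G) b = G b"
    proof (cases "b \<in> {1..n}")
      case True
      then show ?thesis using remove_box_basement[OF True] NAF_cases(2)[OF assms(2) True] l by simp
    next
      case False
      then have c: "b \<in> cols n k" using box_above[OF b] dg_cols(2)[OF fc] unfolding \<nu>_def by blast
      show ?thesis
        unfolding remove_box_next[OF F b c, symmetric] by (rule add_box_next[OF assms b c])
    qed
  qed
qed

end

context macdonald begin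

lemma wt_first_box:
  assumes fc: "first_column n k \<mu>" and z: "z permutes {1..n}" and F: "F \<in> NAF n z \<mu>" and l: "F (k + n) = z l"
  shows "wt_box n q th \<mu> F (k + n) = Const (colw k \<mu> z l) * xvar (z l)"
proof -
  have k: "k \<in> {1..n}" using kn[OF fc] by simp
  have Fi: "F i = z i" if "i \<in> {1..n}" for i using F that by (simp add: NAF_def)
  have Narm: "Narm n \<mu> (k + n) = arm k \<mu>" unfolding first_box_Narm[OF fc] arm_def ..
  have "bwn n \<mu> F (k + n) = {a \<in> arm k \<mu>. z k < z a \<and> z a < z l \<or> z l < z a \<and> z a < z k}"
  proof -
    have "F a = z a" if "a \<in> arm k \<mu>" for a using that k by (intro Fi) (auto simp: arm_def)
    then show ?thesis unfolding bwn_def Narm using Fi[OF k] l by auto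
  qed
  then have bwn: "card (bwn n \<mu> F (k + n)) = between (arm k \<mu>) z (z k) (z l)"
    by (simp only: between_def)
  have pos: "0 < coef \<mu> k" using fc by (simp add: first_column_def)
  have D: "D_box n q th \<mu> (k + n) = Dcol k \<mu>"
  proof -
    have "int (nat (coef \<mu> k - 1) + 1) = coef \<mu> k" using pos by simp
    then have "q ^ (nat (coef \<mu> k - 1) + 1) = q powi coef \<mu> k" by (metis power_int_of_nat)
    moreover have "(th ^ 2) ^ (card (arm k \<mu>) + 1) = (th ^ 2) powi (int (card (arm k \<mu>)) + 1)"
      using power_int_of_nat[of "th ^ 2" "card (arm k \<mu>) + 1"] by (simp only: of_nat_add of_nat_1)
    ultimately show ?thesis unfolding D_box_def first_box_Nleg[OF fc] Narm Dcol_def by simp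
  qed
  have "F (k + n - n) = z k" using Fi[OF k] by simp
  then show ?thesis
    unfolding wt_box_def D bwn l colw_def wgt_def by simp
qed

lemma filling_recursion:
  assumes fc: "first_column n k \<mu>" and z: "z permutes {1..n}"
  shows "(\<Sum>F\<in>NAF n z \<mu>. wt_filling n q th \<mu> F) = (\<Sum>l\<in>{1..k}. Const (colw k \<mu> z l) * xvar (z l) *
    (\<Sum>G\<in>NAF n (basement k z l) (shrink n k \<mu>). wt_filling n q th (shrink n k \<mu>) G))"
proof -
  let ?\<nu> = "shrink n k \<mu>" and ?y = "removed_basement n k z"
  let ?up = "add_box n k \<mu> z" and ?down = "remove_box n k \<mu> z"
  let ?T = "SIGMA l:{1..k}. NAF n (?y l) ?\<nu>"
  have "(\<Sum>F\<in>NAF n z \<mu>. wt_filling n q th \<mu> F) =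
    (\<Sum>(l, G)\<in>?T. Const (colw k \<mu> z l) * xvar (z l) * wt_filling n q th ?\<nu> G)"
  proof (rule sum.reindex_bij_witness[where i = "\<lambda>(l, G). ?up G" and j = "\<lambda>F. (inv z (F (k + n)), ?down F)"])
    fix F assume F: "F \<in> NAF n z \<mu>"
    show "(case (inv z (F (k + n)), ?down F) of (l, G) \<Rightarrow> ?up G) = F"
      using add_remove_box[OF fc z F] by simp
    show "(inv z (F (k + n)), ?down F) \<in> ?T"
      using removed_index(1)[OF fc z F] remove_box_NAF[OF fc z F] by simp
    have "wt_filling n q th \<mu> F = wt_box n q th \<mu> F (k + n) * wt_filling n q th ?\<nu> (?down F)"
      by (rule wt_filling_next[OF fc, where F = F and G = "?down F"]) (rule remove_box_next[OF fc z F])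
    also have "wt_box n q th \<mu> F (k + n) = Const (colw k \<mu> z (inv z (F (k + n)))) * xvar (z (inv z (F (k + n))))"
      by (rule wt_first_box[OF fc z F removed_index(2)[OF fc z F, symmetric]])
    finally show "(case (inv z (F (k + n)), ?down F) of (l, G) \<Rightarrow>
        Const (colw k \<mu> z l) * xvar (z l) * wt_filling n q th ?\<nu> G) = wt_filling n q th \<mu> F"
      by simp
  next
    fix p assume "p \<in> ?T"
    then obtain l G where p: "p = (l, G)" "l \<in> {1..k}" "G \<in> NAF n (?y l) ?\<nu>" by blast
    show "(inv z ((case p of (l, G) \<Rightarrow> ?up G) (k + n)), ?down (case p of (l, G) \<Rightarrow> ?up G)) = p"
      using remove_add_box[OF fc z p(2,3)] p(1) by simp
    show "(case p of (l, G) \<Rightarrow> ?up G) \<in> NAF n z \<mu>"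
      using add_box_NAF[OF fc z p(2,3)] p(1) by simp
  qed
  also have "\<dots> = (\<Sum>l\<in>{1..k}. \<Sum>G\<in>NAF n (?y l) ?\<nu>. Const (colw k \<mu> z l) * xvar (z l) * wt_filling n q th ?\<nu> G)"
    using finite_NAF[OF n] by (intro sum.Sigma[symmetric]) auto
  also have "\<dots> = (\<Sum>l\<in>{1..k}. Const (colw k \<mu> z l) * xvar (z l) * (\<Sum>G\<in>NAF n (?y l) ?\<nu>. wt_filling n q th ?\<nu> G))"
    by (simp only: sum_distrib_left)
  finally show ?thesis unfolding removed_basement_def[OF fc z] .
qed

text \<open>
  Existence of \<open>E\<^sub>\<mu>\<close> is part of the induction, because \<open>remove_first_box\<close> requires it for the smaller diagram.
\<close>

lemma filling_formula:
  assumes "\<mu> \<in> Zn n" "\<forall>i. 0 \<le> coef \<mu> i"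
  shows "(\<exists>f. is_E \<mu> f) \<and> (\<forall>z. z permutes {1..n} \<longrightarrow>
    E_rel n q th z \<mu> = (\<Sum>F\<in>NAF n z \<mu>. wt_filling n q th \<mu> F))"
  using n assms
proof (induction \<mu> rule: nonneg_induct)
  case zero
  have ext: "expo_ext n 0 b = - ((b - 1) div n)" for b by (simp add: expo_ext_def)
  have dg: "dg n 0 = {}"
  proof -
    have "\<not> (n < b \<and> 0 \<le> expo_ext n 0 b)" for b
    proof
      assume b: "n < b \<and> 0 \<le> expo_ext n 0 b"
      then have "n div n \<le> (b - 1) div n" using n by (intro zdiv_mono1) auto
      then show False using b n ext by simp
    qed
    then show ?thesis using mem_dg[OF n, of _ 0] by blast
  qed
  have hat: "dg_hat n 0 = {1..n}"
  proof (intro equalityI subsetI)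
    fix b assume b: "b \<in> dg_hat n 0"
    then have "\<not> n < b" using dg mem_dg[OF n, of b 0] mem_dg_hat[OF n, of b 0] by auto
    then show "b \<in> {1..n}" using b mem_dg_hat[OF n, of b 0] by auto
  next
    fix b assume "b \<in> {1..n}"
    then show "b \<in> dg_hat n 0" using mem_dg_hat[OF n, of b 0] expo_ext_in[of b n 0] by simp
  qed
  have "E_rel n q th z 0 = (\<Sum>F\<in>NAF n z 0. wt_filling n q th 0 F)" if z: "z permutes {1..n}" for z
  proof -
    have "NAF n z 0 = {restrict z {1..n}}"
    proof (intro equalityI subsetI)
      fix F assume F: "F \<in> NAF n z 0"
      then have F: "F \<in> {1..n} \<rightarrow>\<^sub>E {1..n}" "\<And>i. i \<in> {1..n} \<Longrightarrow> F i = z i"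
        unfolding NAF_def hat by blast+
      have "F = restrict z {1..n}"
      proof (rule PiE_ext[OF F(1)])
        show "restrict z {1..n} \<in> {1..n} \<rightarrow>\<^sub>E {1..n}"
          using permutes_in_image[OF z] by (simp only: restrict_PiE_iff) blast
      qed (simp add: F(2))
      then show "F \<in> {restrict z {1..n}}" by simp
    next
      fix F assume "F \<in> {restrict z {1..n}}"
      then show "F \<in> NAF n z 0"
        unfolding NAF_def hat dg using permutes_in_image[OF z] by auto
    qed
    then show ?thesis using E_rel_0[OF z] by (simp add: wt_filling_def dg)
  qed
  then show ?case using is_E_0 by blast
next
  case (column k \<mu>)
  then obtain f where f: "is_E (shrink n k \<mu>) f" by blast
  have "E_rel n q th z \<mu> = (\<Sum>F\<in>NAF n z \<mu>. wt_filling n q th \<mu> F)" if z: "z permutes {1..n}" for z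
    unfolding remove_first_box[OF column.hyps f z] filling_recursion[OF column.hyps z]
  proof (rule sum.cong[OF refl])
    fix l assume l: "l \<in> {1..k}"
    have "basement k z l permutes {1..n}"
      using kn[OF column.hyps] by (intro basement_permutes[OF l _ z]) auto
    then show "Const (colw k \<mu> z l) * xvar (z l) * E_rel n q th (basement k z l) (shrink n k \<mu>) =
      Const (colw k \<mu> z l) * xvar (z l) *
      (\<Sum>G\<in>NAF n (basement k z l) (shrink n k \<mu>). wt_filling n q th (shrink n k \<mu>) G)"
      using column.IH by metis
  qed
  then show ?case using is_E_exists_shrink[OF column.hyps] f by blast
qed

end

section \<open>Reduced words of the minimal element\<close>

text \<open>This ensures that the minimum in the definition of \<open>u_min\<close> is attained.\<close>

lemma translation_exists:
  assumes "0 < n" "\<mu> \<in> Zn n"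
  shows "\<exists>w\<in>affW n. aff_act n w 0 = \<mu>"
proof -
  define w where "w k = k + coef \<mu> (rep n k) * n" for k
  define w' where "w' k = k + (- coef \<mu> (rep n k)) * n" for k
  have inv: "w (w' k) = k" "w' (w k) = k" for k
    unfolding w_def w'_def rep_add[OF assms(1)] by simp_all
  have "bij w" by (rule o_bij[of w']) (simp_all add: fun_eq_iff inv)
  moreover have "w (k + n) = w k + n" for k
    using rep_add[OF assms(1), of k 1] by (simp add: w_def)
  ultimately have w: "w \<in> affW n" by (simp add: affW_def)
  have iw: "inv w = w'" by (rule inv_unique_comp) (simp_all add: fun_eq_iff inv)
  have "aff_act n w 0 = \<mu>"
  proof (rule poly_mapping_eqI)
    fix i
    show "coef (aff_act n w 0) i = coef \<mu> i"
    proof (cases "i \<in> {1..n}")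
      case True
      have "(i + (- coef \<mu> (rep n i)) * n - 1) div n = (i - 1) div n + (- coef \<mu> (rep n i))"
        by (rule div_add[OF assms(1)])
      then show ?thesis
        using True by (simp add: coef_start[OF True] iw w'_def rep_eq div_pos_pos_trivial)
    next
      case False
      then have "coef \<mu> i = 0" using assms(2) unfolding Zn_coef by blast
      then show ?thesis using False by (simp only: coef_aff_act if_False)
    qed
  qed
  then show ?thesis using w by blast
qed

lemma reduced_word_ascending:
  assumes "0 < n" "\<mu> \<in> Zn n" "reduced_word n ws (u_min n \<mu>)"
  shows "ascending n ws" "start n ws = \<mu>"
proof -
  let ?P = "\<lambda>w. w \<in> affW n \<and> aff_act n w 0 = \<mu>"
  obtain w where w: "?P w" using translation_exists[OF assms(1,2)] by blast
  have min: "?P (u_min n \<mu>)" "\<And>v. ?P v \<Longrightarrow> aff_len n (u_min n \<mu>) \<le> aff_len n v"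
    using arg_min_nat_lemma[where P = ?P and m = "aff_len n", OF w] unfolding u_min_def by blast+
  have ws: "good_letters n ws" "aff_word n ws = u_min n \<mu>" "refs ws = aff_len n (u_min n \<mu>)"
    using assms(3) by (simp_all add: reduced_word_def good_letters_def)
  show "start n ws = \<mu>" using min(1) ws(2) by simp
  show "ascending n ws"
  proof (rule minimal_ascending[OF assms(1) ws(1)])
    show "refs ws = aff_len n (aff_word n ws)" using ws by simp
    fix v assume "v \<in> affW n" "aff_act n v 0 = start n ws"
    then show "aff_len n (aff_word n ws) \<le> aff_len n v" using min ws(2) by simp
  qed
qed

theorem theorem1p1:
  fixes n :: int and q th :: complex and \<mu> :: expo and z :: "int \<Rightarrow> int"
  assumes "0 < n"
    and "generic q th"
    and "\<mu> \<in> Zn n" and "\<forall>i. 0 \<le> coef \<mu> i"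
    and "z permutes {1..n}"
  shows "(\<forall>ws. reduced_word n ws (u_min n \<mu>) \<longrightarrow>
            E_rel n q th z \<mu> = (\<Sum>p\<in>AW n z ws. wt_walk n q th ws p))
       \<and> E_rel n q th z \<mu> = (\<Sum>F\<in>NAF n z \<mu>. wt_filling n q th \<mu> F)"
proof -
  interpret macdonald th n q
    using assms(1,2) by unfold_locales (simp_all add: generic_def)
  show ?thesis
  proof (intro conjI allI impI)
    fix ws assume "reduced_word n ws (u_min n \<mu>)"
    note ws = reduced_word_ascending[OF assms(1,3) this]
    show "E_rel n q th z \<mu> = (\<Sum>p\<in>AW n z ws. wt_walk n q th ws p)"
      using walk_sum[OF ws(1) periodic_affW[OF assms(1,5)]]
      unfolding ws(2) overline_periodic[OF assms(1,5)] AW_eq_walks .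
  next
    show "E_rel n q th z \<mu> = (\<Sum>F\<in>NAF n z \<mu>. wt_filling n q th \<mu> F)"
      using filling_formula[OF assms(3,4)] assms(5) by blast
  qed
qed

end
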